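(* Let $X$ be a surface with an isolated canonical singularity at $0$ as specified in the context. Then $$\mathcal{A}^r_X\subset C^\alpha_{X,0,r},\qquad 0\le\alpha<4/p(X)-2,$$ where $\mathcal{A}_X^r$ is the sheaf of $(0,r)$-currents defined in the context and $C^\alpha_{X,0,r}$ is the sheaf of $(0,r)$-forms on $X$ of class $C^\alpha$.
   Context: Setting. $\Omega'\subset\subset\mathbb{C}^3$ is open and pseudoconvex, $f$ is holomorphic in a neighborhood of $\Omega'$, $X=\{\zeta\in\Omega' : f(\zeta)=0\}$, $0\in X$, $df\neq 0$ at every point of $\{f=0\}$ except $0$, and $X$ has an isolated canonical (i.e. du Val) singularity at $0$. The structure form $\omega_X$ is the unique meromorphic $(2,0)$-form on $X$ with $df\wedge\omega_X=2\pi i\, d\zeta_1\wedge d\zeta_2\wedge d\zeta_3$; it is holomorphic on $X\setminus\{0\}$. $L^q(X)$ is taken with respect to the metric and volume form on $X_{reg}=X\setminus\{0\}$ induced from $\mathbb{C}^3$. $q(X)$ is a fixed number with $2<q(X)\le4$ such that $\omega_X\in L^q(X)$ for all $1\le q<q(X)$ (such a number exists), and $p(X)=q(X)/(q(X)-1)$. A $(0,r)$-form $\varphi$ is of class $C^\alpha$, $0\le\alpha<1$, if locally $\varphi=\sum_{|I|=r}\varphi_I\,d\bar z_I$ (pullbacks of ambient $d\bar z_I$) with all $\varphi_I$ H\"older continuous with exponent $\alpha$ on $X$ (continuous if $\alpha=0$). Smooth forms on $X$ are pullbacks of smooth ambient forms. Koppelman operators. Given pseudoconvex domains $\Omega_{j+1}\subset\subset\Omega_j\subset\subset\mathbb{C}^3$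 around $0$ contained in $\Omega'$, and $D_j=X\cap\Omega_j$, operators $\mathcal{K}_j$ mapping forms on $D_j$ to forms on $D_{j+1}$ are defined as follows. Put $\eta=\zeta-z$, let $\delta_\eta$ be interior multiplication by $2\pi i\sum_l\eta_l\,\partial/\partial\zeta_l$, and consider forms with anti-holomorphic differentials in both $\zeta,z$ but holomorphic differentials only in $\zeta$. Let $b=\frac{1}{2\pi i}\,\frac{\sum_l\bar\eta_l\,d\zeta_l}{|\eta|^2}$ and $B=b+b\wedge\bar\partial b+b\wedge(\bar\partial b)^2$. Let $h=\sum_l h_l\,d\zeta_l$ be a holomorphic $(1,0)$-form on $\Omega_j\times\Omega_j$ with $\delta_\eta h=f(\zeta)-f(z)$. Let $\chi=\chi(\zeta)$ be a cut-off function with compact support in $\Omega_j$, equal to $1$ in a Stein neighborhood (relatively compact in $\Omega_j$) of $\overline{\Omega_{j+1}}$, let $s=\sum_l s_l(\zeta,z)\,d\zeta_l$ be defined for $\zeta\in\mathrm{supp}\,\bar\partial\chi$, $z\in\overline{\Omega_{j+1}}$, smooth in $\zeta$, holomorphic in $z$, with $\delta_\eta s=1$, and let $g=\chi-\bar\partial\chi\wedge(s+s\wedge\bar\partial s+s\wedge(\bar\partial s)^2)$. Define $\tilde K$ by $d\zeta_1\wedge d\zeta_2\wedge d\zeta_3\wedge\tilde K=h\wedge(g\wedge B)_2$ ($(\cdot)_2$: component of bidegree $(2,* )$), and $(\mathcal{K}_j\varphi)(z)=\int_{X_\zeta}\omega_X(\zeta)\wedge\tilde K(\zeta,z)\wedge\varphi(\zeta)$.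 The sheaves $\mathcal{A}^r_X$. Outside $0$, $\mathcal{A}_X^r$ coincides with the sheaf of smooth $(0,r)$-forms. The stalk at $0$ consists of the $(0,r)$-currents that are finite sums of currents of the form $$\xi_{\nu+1}\wedge\big(\mathcal{K}_\nu(\cdots\xi_3\wedge\mathcal{K}_2(\xi_2\wedge\mathcal{K}_1\xi_1))\big),$$ where $\Omega_{\nu+1}\subset\subset\Omega_\nu\subset\subset\cdots\subset\subset\Omega_1\subset\subset\mathbb{C}^3$ are pseudoconvex domains, $D_j=X\cap\Omega_j$, each $\mathcal{K}_j$ is a Koppelman operator $(\mathcal{K}_j\varphi)(z)=\int_{X_\zeta}\omega_X(\zeta)\wedge\tilde K(\zeta,z)\wedge\varphi(\zeta)$, with $\tilde K$ determined by $d\zeta_1\wedge d\zeta_2\wedge d\zeta_3\wedge\tilde K=h\wedge(g\wedge B)_2$ for some choice of $h$, $\chi$ and $s$ (and the resulting $g$) associated with the pair $\Omega_{j+1}\subset\subset\Omega_j$, mapping forms on $D_j$ to forms on $D_{j+1}$, and $\xi_j$ are smooth $(0,* )$-forms on $D_j$. *)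

theory Defs
  imports "HOL-Analysis.Analysis" "HOL-Library.Function_Algebras"
begin

section \<open>Functions on open subsets of complex space\<close>

primrec Ck_on :: "nat \<Rightarrow> 'a::real_normed_vector set \<Rightarrow> ('a \<Rightarrow> 'b::real_normed_vector) \<Rightarrow> bool" where
  "Ck_on 0 S F = continuous_on S F"
| "Ck_on (Suc k) S F =
     ((\<forall>x\<in>S. F differentiable (at x)) \<and> (\<forall>v. Ck_on k S (\<lambda>x. frechet_derivative F (at x) v)))"

definition smooth_on :: "'a::real_normed_vector set \<Rightarrow> ('a \<Rightarrow> 'b::real_normed_vector) \<Rightarrow> bool" where
  "smooth_on S F \<longleftrightarrow> (\<forall>k. Ck_on k S F)"

text \<open>\<open>Ck_bound k M F\<close>: all partial derivatives of \<open>F\<close> of order at most \<open>k\<close> are bounded by \<open>M\<close>.\<close>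

primrec Ck_bound :: "nat \<Rightarrow> real \<Rightarrow> ('a::euclidean_space \<Rightarrow> complex) \<Rightarrow> bool" where
  "Ck_bound 0 M F = (\<forall>x. cmod (F x) \<le> M)"
| "Ck_bound (Suc k) M F =
     ((\<forall>x. cmod (F x) \<le> M) \<and> (\<forall>v\<in>Basis. Ck_bound k M (\<lambda>x. frechet_derivative F (at x) v)))"

text \<open>Holomorphy on an open set: the real Frechet derivative commutes with multiplication by
  \<open>\<i>\<close>. The latter is a parameter \<open>J\<close> of the general notion because the library has no
  multiplication of elements of a product space by complex scalars.\<close>

definition cholo_on ::
    "('a \<Rightarrow> 'a) \<Rightarrow> 'a::real_normed_vector set \<Rightarrow> ('a \<Rightarrow> complex) \<Rightarrow> bool" where
  "cholo_on J S F \<longleftrightarrow>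
     (\<forall>p\<in>S. \<exists>L. (F has_derivative L) (at p) \<and> (\<forall>v. L (J v) = \<i> * L v))"

abbreviation holo_on :: "(complex^'n) set \<Rightarrow> (complex^'n \<Rightarrow> complex) \<Rightarrow> bool" where
  "holo_on \<equiv> cholo_on ((*s) \<i>)"

abbreviation holo2_on ::
    "((complex^'n) \<times> (complex^'n)) set \<Rightarrow> ((complex^'n) \<times> (complex^'n) \<Rightarrow> complex) \<Rightarrow> bool" where
  "holo2_on \<equiv> cholo_on (map_prod ((*s) \<i>) ((*s) \<i>))"

definition psh_on :: "(complex^'n) set \<Rightarrow> (complex^'n \<Rightarrow> real) \<Rightarrow> bool" where
  "psh_on S u \<longleftrightarrow> continuous_on S u \<and>
     (\<forall>z w. (\<forall>t. cmod t \<le> 1 \<longrightarrow> z + t *s w \<in> S) \<longrightarrow>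
        u z \<le> integral {0..2*pi} (\<lambda>\<theta>. u (z + cis \<theta> *s w)) / (2*pi))"

definition pseudoconvex :: "(complex^'n) set \<Rightarrow> bool" where
  "pseudoconvex S \<longleftrightarrow> open S \<and> (\<exists>u. psh_on S u \<and> (\<forall>c. compact {z\<in>S. u z \<le> c}))"

text \<open>For open subsets of complex space, Stein means holomorphically convex (the other axioms
  hold because of the coordinate functions).\<close>

definition stein_open :: "(complex^'n) set \<Rightarrow> bool" where
  "stein_open S \<longleftrightarrow> open S \<and>
     (\<forall>K. compact K \<and> K \<subseteq> S \<longrightarrow>
        compact {z\<in>S. \<forall>F M. holo_on S F \<and> (\<forall>w\<in>K. cmod (F w) \<le> M) \<longrightarrow> cmod (F z) \<le> M})"

definition relcompact :: "'a::topological_space set \<Rightarrow> 'a set \<Rightarrow> bool" where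
  "relcompact A B \<longleftrightarrow> compact (closure A) \<and> closure A \<subseteq> B"


section \<open>Exterior algebra\<close>

text \<open>An element of the exterior algebra on generators \<open>'i\<close> is the family of its coefficients
  with respect to the monomials indexed by \<open>'i set\<close>, the factors being in increasing order.\<close>

type_synonym 'i ext = "'i set \<Rightarrow> complex"

definition wedge :: "'i::linorder ext \<Rightarrow> 'i ext \<Rightarrow> 'i ext"  (infixr \<open>\<and>\<^sub>e\<close> 72) where
  "wedge a b = (\<lambda>S. \<Sum>T\<in>Pow S.
     (-1) ^ card {(i, j). i \<in> T \<and> j \<in> S - T \<and> j < i} * a T * b (S - T))"

definition escale :: "complex \<Rightarrow> 'i ext \<Rightarrow> 'i ext"  (infixr \<open>*\<^sub>e\<close> 74) where
  "escale c a = (\<lambda>S. c * a S)"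

definition eone :: "'i ext" where
  "eone = (\<lambda>S. if S = {} then 1 else 0)"

definition gen :: "'i \<Rightarrow> 'i ext" where
  "gen i = (\<lambda>S. if S = {i} then 1 else 0)"

text \<open>The algebra homomorphism sending the generator \<open>i\<close> to the 1-form \<open>A i\<close>.\<close>

definition ext_map :: "('i::linorder \<Rightarrow> 'j::linorder ext) \<Rightarrow> 'i ext \<Rightarrow> 'j ext" where
  "ext_map A a = (\<Sum>S\<in>UNIV. a S *\<^sub>e foldr (\<lambda>i. wedge (A i)) (sorted_list_of_set S) eone)"

text \<open>The differentials \<open>d\<zeta>\<^sub>j\<close>, \<open>d\<zeta>\<^sub>j\<close>-bar and \<open>dz\<^sub>j\<close>-bar. There are no holomorphic differentials
  in \<open>z\<close>.\<close>

datatype 'n covec = D\<zeta> (idx: 'n) | D\<zeta>b (idx: 'n) | Dzb (idx: 'n)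

fun tag :: "'n covec \<Rightarrow> nat" where
  "tag (D\<zeta> j) = 0" | "tag (D\<zeta>b j) = 1" | "tag (Dzb j) = 2"

instantiation covec :: (linorder) linorder
begin
definition less_eq_covec :: "'a covec \<Rightarrow> 'a covec \<Rightarrow> bool" where
  "less_eq_covec c d \<longleftrightarrow> tag c < tag d \<or> (tag c = tag d \<and> idx c \<le> idx d)"
definition less_covec :: "'a covec \<Rightarrow> 'a covec \<Rightarrow> bool" where
  "less_covec c d \<longleftrightarrow> tag c < tag d \<or> (tag c = tag d \<and> idx c < idx d)"
instance
proof
  fix c d e :: "'a covec"
  show "(c < d) = (c \<le> d \<and> \<not> d \<le> c)"
    by (auto simp: less_eq_covec_def less_covec_def)
  show "c \<le> c"
    by (auto simp: less_eq_covec_def)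
  show "c \<le> d \<Longrightarrow> d \<le> e \<Longrightarrow> c \<le> e"
    by (auto simp: less_eq_covec_def)
  show "c \<le> d \<Longrightarrow> d \<le> c \<Longrightarrow> c = d"
    by (cases c; cases d) (auto simp: less_eq_covec_def)
  show "c \<le> d \<or> d \<le> c"
    by (auto simp: less_eq_covec_def)
qed
end

instance covec :: (finite) finite
proof
  have "x \<in> range D\<zeta> \<union> range D\<zeta>b \<union> range Dzb" for x :: "'a covec"
    by (cases x) auto
  then have "(UNIV :: 'a covec set) \<subseteq> range D\<zeta> \<union> range D\<zeta>b \<union> range Dzb"
    by blast
  then show "finite (UNIV :: 'a covec set)"
    by (rule finite_subset) (intro finite_UnI finite_imageI finite_class.finite_UNIV)
qed

text \<open>\<open>pull a\<close> is the pullback of forms in \<open>\<zeta>\<close> by the complex linear map with columns \<open>a k\<close>.\<close>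

definition pull :: "('k::{finite,linorder} \<Rightarrow> complex^'n::{finite,linorder}) \<Rightarrow>
    'n covec ext \<Rightarrow> 'k covec ext" where
  "pull a = ext_map (\<lambda>i. case i of
       D\<zeta> j \<Rightarrow> (\<Sum>k\<in>UNIV. (a k $ j) *\<^sub>e gen (D\<zeta> k))
     | D\<zeta>b j \<Rightarrow> (\<Sum>k\<in>UNIV. cnj (a k $ j) *\<^sub>e gen (D\<zeta>b k))
     | Dzb j \<Rightarrow> 0)"

definition hgram :: "('k::finite \<Rightarrow> complex^'n) \<Rightarrow> complex^'k^'k" where
  "hgram a = (\<chi> k l. \<Sum>j\<in>UNIV. a k $ j * cnj (a l $ j))"

definition columns_of :: "(complex^'k::finite \<Rightarrow> complex^'n) \<Rightarrow> complex^'k \<Rightarrow> 'k \<Rightarrow> complex^'n" where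
  "columns_of \<psi> u k = frechet_derivative \<psi> (at u) (axis k 1)"

definition d\<zeta>123 :: "3 covec ext" where
  "d\<zeta>123 = gen (D\<zeta> 1) \<and>\<^sub>e gen (D\<zeta> 2) \<and>\<^sub>e gen (D\<zeta> 3)"

definition one_form :: "(3 \<Rightarrow> complex) \<Rightarrow> 3 covec ext" where
  "one_form c = (\<Sum>l\<in>UNIV. c l *\<^sub>e gen (D\<zeta> l))"

definition bidegree :: "nat \<Rightarrow> nat \<Rightarrow> 3 covec ext \<Rightarrow> bool" where
  "bidegree p q a \<longleftrightarrow>
     (\<forall>S. a S \<noteq> 0 \<longrightarrow> (\<exists>J L. S = D\<zeta> ` J \<union> D\<zeta>b ` L \<and> card J = p \<and> card L = q))"


section \<open>The surface and its structure form\<close>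

definition hypersurface :: "(complex^3) set \<Rightarrow> (complex^3 \<Rightarrow> complex) \<Rightarrow> (complex^3) set" where
  "hypersurface \<Omega> f = {\<zeta>\<in>\<Omega>. f \<zeta> = 0}"

definition df :: "(complex^3 \<Rightarrow> complex) \<Rightarrow> complex^3 \<Rightarrow> 3 \<Rightarrow> complex" where
  "df f x l = frechet_derivative f (at x) (axis l 1)"

text \<open>An orthonormal basis of the complex tangent space at \<open>x\<close>. All notions below that use it are
  independent of the choice.\<close>

definition tangent_frame :: "(complex^3 \<Rightarrow> complex) \<Rightarrow> complex^3 \<Rightarrow> 2 \<Rightarrow> complex^3" where
  "tangent_frame f x = (SOME a. (\<forall>k. frechet_derivative f (at x) (a k) = 0) \<and> hgram a = mat 1)"

text \<open>Restriction to the regular part of \<open>{f = 0}\<close>, at \<open>x\<close>, of an ambient form in \<open>\<zeta>\<close>.\<close>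

definition restr :: "(complex^3 \<Rightarrow> complex) \<Rightarrow> complex^3 \<Rightarrow> 3 covec ext \<Rightarrow> 2 covec ext" where
  "restr f x = pull (tangent_frame f x)"

definition form_norm :: "(complex^3 \<Rightarrow> complex) \<Rightarrow> complex^3 \<Rightarrow> 3 covec ext \<Rightarrow> real" where
  "form_norm f x a = sqrt (\<Sum>S\<in>UNIV. (cmod (restr f x a S))\<^sup>2)"

text \<open>\<open>\<mu>\<close> is the volume measure on the two-dimensional complex submanifold \<open>R\<close> for the metric
  induced from the ambient space, specified in local parametrizations (\<open>R\<close> is covered by countably
  many of them, so \<open>\<mu>\<close> exists and is unique). The determinant of the Hermitian Gram matrix of
  \<open>\<psi>'\<close> is the square root of that of the real one.\<close>

definition induced_volume :: "(complex^3) set \<Rightarrow> (complex^3) measure \<Rightarrow> bool" where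
  "induced_volume R \<mu> \<longleftrightarrow> sets \<mu> = sets (restrict_space borel R) \<and>
     (\<forall>V (\<psi> :: complex^2 \<Rightarrow> complex^3).
        open V \<and> (\<forall>j. holo_on V (\<lambda>u. \<psi> u $ j)) \<and> inj_on \<psi> V \<and> \<psi> ` V \<subseteq> R \<longrightarrow>
        (\<forall>A\<in>sets borel. A \<subseteq> V \<longrightarrow>
           emeasure \<mu> (\<psi> ` A) = (\<integral>\<^sup>+u\<in>A. ennreal (Re (det (hgram (columns_of \<psi> u)))) \<partial>lborel)))"

text \<open>The density of a (2,2)-form with respect to the volume form. The factor 4 comes from
  \<open>du\<^sub>1 du\<^sub>2\<close> \<open>du\<^sub>1\<close>-bar \<open>du\<^sub>2\<close>-bar = 4 \<open>dx\<^sub>1 dy\<^sub>1 dx\<^sub>2 dy\<^sub>2\<close>.\<close>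

definition density22 :: "(complex^3 \<Rightarrow> complex) \<Rightarrow> complex^3 \<Rightarrow> 3 covec ext \<Rightarrow> complex" where
  "density22 f x a = 4 * restr f x a (range D\<zeta> \<union> range D\<zeta>b)"

text \<open>The (2,0)-form \<open>\<omega>\<close> on the regular part \<open>R\<close> of \<open>{f = 0}\<close> is given by an ambient
  representative at each point. Its restriction to \<open>R\<close> is uniquely determined by the equation (hence
  holomorphic on \<open>R\<close> and meromorphic across 0), and only this restriction is used below.\<close>

definition structure_form ::
    "(complex^3 \<Rightarrow> complex) \<Rightarrow> (complex^3) set \<Rightarrow> (complex^3 \<Rightarrow> 3 covec ext) \<Rightarrow> bool" where
  "structure_form f R \<omega> \<longleftrightarrow>
     (\<forall>x\<in>R. bidegree 2 0 (\<omega> x) \<and> one_form (df f x) \<and>\<^sub>e \<omega> x = (2 * pi * \<i>) *\<^sub>e d\<zeta>123)"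

definition in_Lq :: "(complex^3 \<Rightarrow> complex) \<Rightarrow> (complex^3) measure \<Rightarrow> real \<Rightarrow>
    (complex^3 \<Rightarrow> 3 covec ext) \<Rightarrow> bool" where
  "in_Lq f \<mu> q \<omega> \<longleftrightarrow> integrable \<mu> (\<lambda>x. form_norm f x (\<omega> x) powr q)"


section \<open>Canonical singularities\<close>

text \<open>A complex surface: a Hausdorff space \<open>M\<close> with an atlas of holomorphically compatible
  parametrizations \<open>\<psi>\<close> on open sets \<open>V\<close> of the complex plane squared.\<close>

definition complex_surface ::
    "'m topology \<Rightarrow> ((complex^2) set \<times> (complex^2 \<Rightarrow> 'm)) set \<Rightarrow> bool" where
  "complex_surface M \<A> \<longleftrightarrow> Hausdorff_space M \<and>
     (\<forall>(V, \<psi>)\<in>\<A>. open V \<and> openin M (\<psi> ` V) \<and>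
        homeomorphic_map (top_of_set V) (subtopology M (\<psi> ` V)) \<psi>) \<and>
     (\<Union>(V, \<psi>)\<in>\<A>. \<psi> ` V) = topspace M \<and>
     (\<forall>(V, \<psi>)\<in>\<A>. \<forall>(V', \<psi>')\<in>\<A>. \<forall>j.
        holo_on {u\<in>V. \<psi> u \<in> \<psi>' ` V'} (\<lambda>u. inv_into V' \<psi>' (\<psi> u) $ j))"

text \<open>\<open>\<pi>\<close> is a resolution of the surface \<open>X\<close> with isolated singularity 0: a proper holomorphic map
  from a complex surface that is biholomorphic over \<open>X - {0}\<close>, whose preimage is dense.\<close>

definition resolution ::
    "(complex^3) set \<Rightarrow> 'm topology \<Rightarrow> ((complex^2) set \<times> (complex^2 \<Rightarrow> 'm)) set \<Rightarrow>
     ('m \<Rightarrow> complex^3) \<Rightarrow> bool" where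
  "resolution X M \<A> \<pi> \<longleftrightarrow> complex_surface M \<A> \<and>
     (\<forall>(V, \<psi>)\<in>\<A>. \<forall>j. holo_on V (\<lambda>u. \<pi> (\<psi> u) $ j)) \<and>
     proper_map M (top_of_set X) \<pi> \<and>
     bij_betw \<pi> {m\<in>topspace M. \<pi> m \<noteq> 0} (X - {0}) \<and>
     (\<forall>(V, \<psi>)\<in>\<A>. \<forall>u\<in>V. \<pi> (\<psi> u) \<noteq> 0 \<longrightarrow>
        inj (frechet_derivative (\<lambda>u. \<pi> (\<psi> u)) (at u))) \<and>
     M closure_of {m\<in>topspace M. \<pi> m \<noteq> 0} = topspace M"

text \<open>The discrepancies of the resolution \<open>\<pi>\<close> are nonnegative. As \<open>X\<close> is a normal hypersurface, its
  canonical sheaf is generated by the structure form \<open>\<omega>\<close>, so the discrepancies are the vanishing orders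
  of \<open>\<pi>\<^sup>*\<omega>\<close> along the exceptional curves, and the condition is that \<open>\<pi>\<^sup>*\<omega>\<close> extends holomorphically
  across the exceptional set.\<close>

definition canonical_resolution ::
    "(complex^3) set \<Rightarrow> (complex^3 \<Rightarrow> 3 covec ext) \<Rightarrow> 'm topology \<Rightarrow>
     ((complex^2) set \<times> (complex^2 \<Rightarrow> 'm)) set \<Rightarrow> ('m \<Rightarrow> complex^3) \<Rightarrow> bool" where
  "canonical_resolution X \<omega> M \<A> \<pi> \<longleftrightarrow> resolution X M \<A> \<pi> \<and>
     (\<forall>(V, \<psi>)\<in>\<A>. \<exists>c. holo_on V c \<and>
        (\<forall>u\<in>V. \<pi> (\<psi> u) \<noteq> 0 \<longrightarrow>
           pull (columns_of (\<lambda>u. \<pi> (\<psi> u)) u) (\<omega> (\<pi> (\<psi> u))) (range D\<zeta>) = c u))"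


section \<open>Forms and currents on the surface\<close>

text \<open>A \<open>(0,*)\<close>-form on (a part of) the surface is given by an ambient representative, that is, by
  the coefficient functions of the monomials \<open>dz\<^sub>I\<close>-bar.\<close>

type_synonym form0 = "complex^3 \<Rightarrow> 3 ext"

definition smooth_form :: "(complex^3) set \<Rightarrow> form0 \<Rightarrow> bool" where
  "smooth_form D \<xi> \<longleftrightarrow> (\<forall>I. smooth_on D (\<lambda>x. \<xi> x I))"

definition degree_form :: "nat \<Rightarrow> (complex^3) set \<Rightarrow> form0 \<Rightarrow> bool" where
  "degree_form r D \<phi> \<longleftrightarrow> (\<forall>x\<in>D. \<forall>I. card I \<noteq> r \<longrightarrow> \<phi> x I = 0)"

definition emb :: "3 ext \<Rightarrow> 3 covec ext" where
  "emb a = (\<lambda>S. if S \<subseteq> range D\<zeta>b then a (D\<zeta>b -` S) else 0)"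

text \<open>Test forms of bidegree \<open>(2,2-r)\<close> on the part of the surface in the open set \<open>\<Omega>\<close> (ambient
  representatives).\<close>

definition test_forms :: "nat \<Rightarrow> (complex^3) set \<Rightarrow> (complex^3 \<Rightarrow> 3 covec ext) set" where
  "test_forms r \<Omega> = {\<theta>. (\<forall>S. smooth_on UNIV (\<lambda>x. \<theta> x S)) \<and>
     (\<forall>x. \<exists>s. s + r = 2 \<and> bidegree 2 s (\<theta> x) \<or> \<theta> x = 0) \<and>
     relcompact {x. \<theta> x \<noteq> 0} \<Omega>}"

text \<open>\<open>(0,r)\<close>-currents on \<open>X \<inter> \<Omega>\<close>, where \<open>R = X - {0}\<close>: continuous linear functionals on
  test forms that depend only on the pullback of the test form to \<open>R\<close>.\<close>

definition is_current :: "(complex^3 \<Rightarrow> complex) \<Rightarrow> (complex^3) set \<Rightarrow> nat \<Rightarrow> (complex^3) set \<Rightarrow>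
    ((complex^3 \<Rightarrow> 3 covec ext) \<Rightarrow> complex) \<Rightarrow> bool" where
  "is_current f R r \<Omega> T \<longleftrightarrow>
     (\<forall>\<theta>\<^sub>1\<in>test_forms r \<Omega>. \<forall>\<theta>\<^sub>2\<in>test_forms r \<Omega>. T (\<theta>\<^sub>1 + \<theta>\<^sub>2) = T \<theta>\<^sub>1 + T \<theta>\<^sub>2) \<and>
     (\<forall>\<theta>\<in>test_forms r \<Omega>. \<forall>c. T (\<lambda>x. c *\<^sub>e \<theta> x) = c * T \<theta>) \<and>
     (\<forall>\<theta>\<^sub>1\<in>test_forms r \<Omega>. \<forall>\<theta>\<^sub>2\<in>test_forms r \<Omega>.
        (\<forall>x\<in>R. restr f x (\<theta>\<^sub>1 x) = restr f x (\<theta>\<^sub>2 x)) \<longrightarrow> T \<theta>\<^sub>1 = T \<theta>\<^sub>2) \<and>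
     (\<forall>K. compact K \<and> K \<subseteq> \<Omega> \<longrightarrow> (\<exists>k C. \<forall>\<theta>\<in>test_forms r \<Omega>. {x. \<theta> x \<noteq> 0} \<subseteq> K \<longrightarrow>
        (\<forall>M. (\<forall>S. Ck_bound k M (\<lambda>x. \<theta> x S)) \<longrightarrow> cmod (T \<theta>) \<le> C * M)))"

definition form_current :: "(complex^3 \<Rightarrow> complex) \<Rightarrow> (complex^3) measure \<Rightarrow> form0 \<Rightarrow>
    (complex^3 \<Rightarrow> 3 covec ext) \<Rightarrow> complex" where
  "form_current f \<mu> \<phi> \<theta> = (LINT x|\<mu>. density22 f x (emb (\<phi> x) \<and>\<^sub>e \<theta> x))"

definition holder_on :: "real \<Rightarrow> (complex^3) set \<Rightarrow> (complex^3 \<Rightarrow> complex) \<Rightarrow> bool" where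
  "holder_on \<alpha> V g \<longleftrightarrow>
     (if \<alpha> = 0 then continuous_on V g
      else \<exists>C. \<forall>z\<in>V. \<forall>w\<in>V. cmod (g z - g w) \<le> C * dist z w powr \<alpha>)"


section \<open>Koppelman operators\<close>

text \<open>\<open>\<partial>g/\<partial>\<zeta>\<^sub>j\<close>-bar is \<^term>\<open>wirt_bar g p (axis j 1) (axis j \<i>)\<close>.\<close>

definition wirt_bar :: "('a::real_normed_vector \<Rightarrow> complex) \<Rightarrow> 'a \<Rightarrow> 'a \<Rightarrow> 'a \<Rightarrow> complex" where
  "wirt_bar g p v iv = (frechet_derivative g (at p) v + \<i> * frechet_derivative g (at p) iv) / 2"

text \<open>Forms on the product space, in the variables \<open>(\<zeta>, z)\<close>.\<close>

type_synonym pform = "(complex^3) \<times> (complex^3) \<Rightarrow> 3 covec ext"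

definition dbar :: "pform \<Rightarrow> pform" where
  "dbar \<Phi> p =
     (\<Sum>j\<in>UNIV. gen (D\<zeta>b j) \<and>\<^sub>e (\<lambda>S. wirt_bar (\<lambda>q. \<Phi> q S) p (axis j 1, 0) (axis j \<i>, 0))) +
     (\<Sum>j\<in>UNIV. gen (Dzb j) \<and>\<^sub>e (\<lambda>S. wirt_bar (\<lambda>q. \<Phi> q S) p (0, axis j 1) (0, axis j \<i>)))"

definition \<eta> :: "(complex^3) \<times> (complex^3) \<Rightarrow> complex^3" where
  "\<eta> p = fst p - snd p"

text \<open>\<open>\<delta>\<^sub>\<eta>\<close> applied to \<open>\<Sum>\<^sub>l c\<^sub>l d\<zeta>\<^sub>l\<close>.\<close>

definition \<delta>\<eta> :: "(complex^3) \<times> (complex^3) \<Rightarrow> (3 \<Rightarrow> complex) \<Rightarrow> complex" where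
  "\<delta>\<eta> p c = 2 * pi * \<i> * (\<Sum>l\<in>UNIV. \<eta> p $ l * c l)"

definition cauchy_powers :: "pform \<Rightarrow> pform" where
  "cauchy_powers b p = b p + b p \<and>\<^sub>e dbar b p + b p \<and>\<^sub>e dbar b p \<and>\<^sub>e dbar b p"

definition bform :: pform where
  "bform p = (1 / (2 * pi * \<i>)) *\<^sub>e
     one_form (\<lambda>l. cnj (\<eta> p $ l) / complex_of_real ((norm (\<eta> p))\<^sup>2))"

definition Bform :: pform where
  "Bform = cauchy_powers bform"

definition gform :: "(complex^3 \<Rightarrow> real) \<Rightarrow> ((complex^3) \<times> (complex^3) \<Rightarrow> 3 \<Rightarrow> complex) \<Rightarrow> pform" where
  "gform chi s p =
     complex_of_real (chi (fst p)) *\<^sub>e eone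
     - dbar (\<lambda>q. complex_of_real (chi (fst q)) *\<^sub>e eone) p \<and>\<^sub>e cauchy_powers (\<lambda>q. one_form (s q)) p"

text \<open>The component of bidegree \<open>(k,*)\<close>.\<close>

definition hol_part :: "nat \<Rightarrow> 3 covec ext \<Rightarrow> 3 covec ext" where
  "hol_part k a = (\<lambda>S. if card (S \<inter> range D\<zeta>) = k then a S else 0)"

definition supp_dbar :: "(complex^3 \<Rightarrow> real) \<Rightarrow> (complex^3) set" where
  "supp_dbar chi =
     closure {\<zeta>. \<exists>j. wirt_bar (\<lambda>x. complex_of_real (chi x)) \<zeta> (axis j 1) (axis j \<i>) \<noteq> 0}"

definition admissible_h ::
    "(complex^3 \<Rightarrow> complex) \<Rightarrow> (complex^3) set \<Rightarrow> ((complex^3) \<times> (complex^3) \<Rightarrow> 3 \<Rightarrow> complex) \<Rightarrow> bool" where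
  "admissible_h f D h \<longleftrightarrow>
     (\<forall>l. holo2_on (D \<times> D) (\<lambda>p. h p l)) \<and> (\<forall>p\<in>D \<times> D. \<delta>\<eta> p (h p) = f (fst p) - f (snd p))"

definition admissible_chi ::
    "(complex^3) set \<Rightarrow> (complex^3) set \<Rightarrow> (complex^3 \<Rightarrow> real) \<Rightarrow> bool" where
  "admissible_chi D E chi \<longleftrightarrow> smooth_on UNIV chi \<and> relcompact {\<zeta>. chi \<zeta> \<noteq> 0} D \<and>
     (\<exists>S. stein_open S \<and> closure E \<subseteq> S \<and> relcompact S D \<and> (\<forall>\<zeta>\<in>S. chi \<zeta> = 1))"

text \<open>Being smooth on \<open>supp \<times> closure E\<close> means having a smooth extension to a neighbourhood \<open>W\<close>;
  the form \<open>s\<close> is jointly smooth.\<close>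

definition admissible_s :: "(complex^3) set \<Rightarrow> (complex^3 \<Rightarrow> real) \<Rightarrow>
    ((complex^3) \<times> (complex^3) \<Rightarrow> 3 \<Rightarrow> complex) \<Rightarrow> bool" where
  "admissible_s E chi s \<longleftrightarrow> (\<exists>W. open W \<and> supp_dbar chi \<times> closure E \<subseteq> W \<and>
     (\<forall>l. smooth_on W (\<lambda>p. s p l)) \<and>
     (\<forall>\<zeta>\<in>supp_dbar chi. \<forall>l. holo_on {z. (\<zeta>, z) \<in> W} (\<lambda>z. s (\<zeta>, z) l)) \<and>
     (\<forall>\<zeta>\<in>supp_dbar chi. \<forall>z\<in>closure E. \<delta>\<eta> (\<zeta>, z) (s (\<zeta>, z)) = 1))"

text \<open>\<open>\<K>\<close> is a Koppelman operator from forms on \<open>X \<inter> D\<close> to forms on \<open>X \<inter> E\<close>. In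
  \<open>\<omega> \<and> K \<and> \<phi>\<close> the factor in front of \<open>dz\<^sub>I\<close>-bar is integrated; as it is of even degree, it does not
  matter on which side the differentials of \<open>z\<close> are placed.\<close>

definition z_coeff :: "3 set \<Rightarrow> 3 covec ext \<Rightarrow> 3 covec ext" where
  "z_coeff I a = (\<lambda>S. if S \<inter> range Dzb = {} then a (S \<union> Dzb ` I) else 0)"

definition koppelman :: "(complex^3 \<Rightarrow> complex) \<Rightarrow> (complex^3 \<Rightarrow> 3 covec ext) \<Rightarrow>
    (complex^3) measure \<Rightarrow> (complex^3) set \<Rightarrow> (complex^3) set \<Rightarrow> (form0 \<Rightarrow> form0) \<Rightarrow> bool" where
  "koppelman f \<omega> \<mu> D E \<K> \<longleftrightarrow> (\<exists>h chi s. \<exists>K :: pform.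
     admissible_h f D h \<and> admissible_chi D E chi \<and> admissible_s E chi s \<and>
     (\<forall>\<zeta>\<in>D. \<forall>z\<in>E. \<zeta> \<noteq> z \<longrightarrow>
        (\<forall>S. S \<inter> range D\<zeta> \<noteq> {} \<longrightarrow> K (\<zeta>, z) S = 0) \<and>
        d\<zeta>123 \<and>\<^sub>e K (\<zeta>, z) =
          one_form (h (\<zeta>, z)) \<and>\<^sub>e hol_part 2 (gform chi s (\<zeta>, z) \<and>\<^sub>e Bform (\<zeta>, z))) \<and>
     \<K> = (\<lambda>\<phi> z I. LINT \<zeta>:D|\<mu>.
        density22 f \<zeta> (z_coeff I (\<omega> \<zeta> \<and>\<^sub>e K (\<zeta>, z) \<and>\<^sub>e emb (\<phi> \<zeta>)))))"


section \<open>The two sheaves\<close>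

definition pc_domain :: "(complex^3) set \<Rightarrow> (complex^3) set \<Rightarrow> bool" where
  "pc_domain \<Omega>' D \<longleftrightarrow> pseudoconvex D \<and> connected D \<and> bounded D \<and> 0 \<in> D \<and> D \<subseteq> \<Omega>'"

text \<open>\<open>iterated \<dots> D \<phi>\<close>: on \<open>X \<inter> D\<close> the form \<open>\<phi>\<close> is an iterated expression
  \<open>\<xi>\<^sub>\<nu>\<^sub>+\<^sub>1 \<and> \<K>\<^sub>\<nu>(\<dots>\<xi>\<^sub>2 \<and> \<K>\<^sub>1\<xi>\<^sub>1)\<close> with \<open>\<nu> \<ge> 0\<close> and \<open>D = \<Omega>\<^sub>\<nu>\<^sub>+\<^sub>1\<close>.\<close>

inductive iterated :: "(complex^3) set \<Rightarrow> (complex^3 \<Rightarrow> complex) \<Rightarrow> (complex^3 \<Rightarrow> 3 covec ext) \<Rightarrow>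
    (complex^3) measure \<Rightarrow> (complex^3) set \<Rightarrow> form0 \<Rightarrow> bool"
  for \<Omega>' f \<omega> \<mu> where
  base: "pc_domain \<Omega>' D \<Longrightarrow> smooth_form D \<xi> \<Longrightarrow> iterated \<Omega>' f \<omega> \<mu> D \<xi>"
| step: "iterated \<Omega>' f \<omega> \<mu> D \<phi> \<Longrightarrow> pc_domain \<Omega>' E \<Longrightarrow> relcompact E D \<Longrightarrow>
    koppelman f \<omega> \<mu> D E \<K> \<Longrightarrow> smooth_form E \<xi> \<Longrightarrow>
    iterated \<Omega>' f \<omega> \<mu> E (\<lambda>z. \<xi> z \<and>\<^sub>e \<K> \<phi> z)"

text \<open>Sections over the relatively open sets \<open>X \<inter> U\<close>, \<open>U\<close> open, as currents. A current is a section
  if its germ at each point belongs to the stalk.\<close>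

definition A_sections :: "(complex^3) set \<Rightarrow> (complex^3 \<Rightarrow> complex) \<Rightarrow>
    (complex^3 \<Rightarrow> 3 covec ext) \<Rightarrow> (complex^3) measure \<Rightarrow> nat \<Rightarrow> (complex^3) set \<Rightarrow>
    ((complex^3 \<Rightarrow> 3 covec ext) \<Rightarrow> complex) set" where
  "A_sections \<Omega>' f \<omega> \<mu> r U = {T. is_current f (hypersurface \<Omega>' f - {0}) r U T \<and>
     (\<forall>x\<in>hypersurface \<Omega>' f \<inter> U - {0}. \<exists>N \<xi>. open N \<and> x \<in> N \<and> N \<subseteq> U \<and>
        smooth_form N \<xi> \<and> degree_form r N \<xi> \<and> (\<forall>\<theta>\<in>test_forms r N. T \<theta> = form_current f \<mu> \<xi> \<theta>)) \<and>
     (0 \<in> U \<longrightarrow> (\<exists>N \<phi>s. open N \<and> 0 \<in> N \<and> N \<subseteq> U \<and>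
        (\<forall>\<phi>\<in>set \<phi>s. \<exists>D. iterated \<Omega>' f \<omega> \<mu> D \<phi> \<and> degree_form r (hypersurface \<Omega>' f \<inter> D) \<phi> \<and> N \<subseteq> D) \<and>
        (\<forall>\<theta>\<in>test_forms r N. T \<theta> = (\<Sum>\<phi>\<leftarrow>\<phi>s. form_current f \<mu> \<phi> \<theta>))))}"

definition C_sections :: "(complex^3) set \<Rightarrow> (complex^3 \<Rightarrow> complex) \<Rightarrow>
    (complex^3) measure \<Rightarrow> real \<Rightarrow> nat \<Rightarrow> (complex^3) set \<Rightarrow>
    ((complex^3 \<Rightarrow> 3 covec ext) \<Rightarrow> complex) set" where
  "C_sections \<Omega>' f \<mu> \<alpha> r U = {T. is_current f (hypersurface \<Omega>' f - {0}) r U T \<and>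
     (\<forall>x\<in>hypersurface \<Omega>' f \<inter> U. \<exists>N \<phi>. open N \<and> x \<in> N \<and> N \<subseteq> U \<and>
        (\<forall>I. holder_on \<alpha> (hypersurface \<Omega>' f \<inter> N) (\<lambda>z. \<phi> z I)) \<and>
        degree_form r (hypersurface \<Omega>' f \<inter> N) \<phi> \<and>
        (\<forall>\<theta>\<in>test_forms r N. T \<theta> = form_current f \<mu> \<phi> \<theta>))}"

end

theory Submission
  imports Defs "HOL-Complex_Analysis.Conformal_Mappings"
begin

text \<open>The point is to understand how singular the kernel of a Koppelman operator is on the surface
  \<open>X\<close>, which has real dimension 4. A kernel of size \<open>|\<zeta> - z|\<close> to the power \<open>-s\<close> is integrable
  on compact parts of \<open>X\<close>, uniformly in \<open>z\<close>, for \<open>s < 4\<close>. This is \<open>integral_kernel_bound\<close>, and it rests on the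
  growth estimate \<open>\<mu> (X \<inter> L \<inter> ball z r) \<le> C r^4\<close> for compact \<open>L\<close> (\<open>local_growth\<close>, \<open>compact_growth\<close>), which has to hold
  up to the singular point. To prove it, project along complex lines. Near a given point the lines
  with directions close to a suitable \<open>v\<close> meet \<open>X\<close> in a bounded number of points, because a
  holomorphic function with too many zeros on a line is too small there. Finitely many of these
  directions suffice to have, at each regular point of \<open>X\<close>, one whose angle with the tangent
  plane is bounded below. The part of \<open>X\<close> belonging to one direction projects to a plane
  with bounded multiplicity and bounded inverse Jacobian, so its volume in a ball of radius \<open>r\<close> is
  at most a constant times \<open>r^4\<close>.

  The equation \<open>df \<and> \<omega> = 2\<pi>i d\<zeta>\<^sub>1 d\<zeta>\<^sub>2 d\<zeta>\<^sub>3\<close> says that the size of \<open>\<omega>\<close> on \<open>X\<close> is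
  \<open>2\<pi> / |df|\<close>. In the kernel \<open>\<omega> \<and> K\<close> the form \<open>K\<close> is the contraction of \<open>h \<and> (g \<and> B)\<^sub>2\<close>,
  and \<open>(g \<and> B)\<^sub>2\<close> has size \<open>|\<zeta> - z|^(-3)\<close>. The Hefer form \<open>h\<close> equals \<open>df / 2\<pi>i\<close> on the diagonal
  (\<open>hefer_diagonal\<close>). The part of \<open>h\<close> that is evaluated on the diagonal cancels the growth of \<open>\<omega>\<close>
  and contributes a kernel of size \<open>|\<zeta> - z|^(-3)\<close>; the difference between \<open>h\<close> and its value on the diagonal
  gains a factor \<open>|\<zeta> - z|\<close> and contributes a kernel of size \<open>|\<omega>| |\<zeta> - z|^(-2)\<close>.

  Each derivative in \<open>z\<close> costs one more power of \<open>|\<zeta> - z|\<close>, so by interpolation the difference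
  of the kernels at \<open>z\<close> and \<open>w\<close> is at most \<open>|z - w|^\<alpha>\<close> times kernels of size
  \<open>|\<zeta> - z|^(-3-\<alpha>)\<close> and \<open>|\<omega>| |\<zeta> - z|^(-2-\<alpha>)\<close>, plus the same with \<open>w\<close>. As \<open>\<omega>\<close> is in \<open>L^q\<close>,
  by Young's inequality these have bounded integrals if \<open>3 + \<alpha> < 4\<close> and \<open>(2 + \<alpha>) p < 4\<close>, where
  \<open>1/p + 1/q = 1\<close> (\<open>kernel_integral\<close>). When \<open>q\<close> tends to \<open>q(X)\<close>, this is the range \<open>\<alpha> < 4/p(X) - 2\<close>.

  Therefore a Koppelman operator maps continuous forms to locally Hoelder continuous ones
  (\<open>koppelman_Holder\<close>). Smooth forms are locally Hoelder continuous and products preserve this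
  property, so induction on the number of operators gives the theorem.\<close>

section \<open>Holomorphic functions on complex lines\<close>

lemma norm_scalar_mult_vec: "norm (c *s v) = cmod c * norm (v :: complex^'n)"
  by (simp add: norm_vec_def norm_mult L2_set_right_distrib)

lemma scalar_mult_vec_decomp: "c *s v = Re c *\<^sub>R v + Im c *\<^sub>R (\<i> *s v)"
  for v :: "complex^'n"
  unfolding vec_eq_iff by (simp add: complex_eq_iff)

lemma bounded_linear_scalar_mult: "bounded_linear (\<lambda>t. t *s (v :: complex^'n))"
proof (rule bounded_linear_intro)
  show "norm (x *s v) \<le> norm x * norm v" for x
    by (simp add: norm_scalar_mult_vec)
qed (simp_all add: vec_eq_iff distrib_right)

lemma complex_linear_scalar:
  fixes L :: "complex^'n \<Rightarrow> complex"
  assumes "linear L" "\<And>v. L (\<i> *s v) = \<i> * L v"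
  shows "L (c *s v) = c * L v"
proof -
  have "L (c *s v) = Re c *\<^sub>R L v + Im c *\<^sub>R (\<i> * L v)"
    by (subst scalar_mult_vec_decomp) (simp add: linear_add linear_scale assms)
  also have "\<dots> = (of_real (Re c) + \<i> * of_real (Im c)) * L v"
    by (simp add: scaleR_conv_of_real algebra_simps)
  also have "\<dots> = c * L v"
    using complex_eq[of c] by simp
  finally show ?thesis .
qed

lemma complex_linear_coordinates:
  fixes L :: "complex^'n \<Rightarrow> complex"
  assumes "linear L" "\<And>v. L (\<i> *s v) = \<i> * L v"
  shows "L h = (\<Sum>l\<in>UNIV. h $ l * L (axis l 1))"
proof -
  have "h = (\<Sum>l\<in>UNIV. h $ l *s axis l 1)"
    unfolding vec_eq_iff sum_component vector_smult_component axis_def vec_lambda_beta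
    by (simp add: if_distrib cong: if_cong)
  from arg_cong[OF this, of L] have "L h = (\<Sum>l\<in>UNIV. L (h $ l *s axis l 1))"
    by (simp only: linear_sum[OF assms(1)])
  then show ?thesis
    by (simp add: complex_linear_scalar[OF assms])
qed

lemma holo_on_frechet:
  assumes "holo_on S F" "p \<in> S"
  shows "(F has_derivative frechet_derivative F (at p)) (at p)"
    and "linear (frechet_derivative F (at p))"
    and "frechet_derivative F (at p) (c *s v) = c * frechet_derivative F (at p) v"
    and "frechet_derivative F (at p) h = (\<Sum>l\<in>UNIV. h $ l * frechet_derivative F (at p) (axis l 1))"
proof -
  obtain L where L: "(F has_derivative L) (at p)" "\<And>v. L (\<i> *s v) = \<i> * L v"
    using assms unfolding cholo_on_def by blast
  have LL: "L = frechet_derivative F (at p)"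
    using L(1) frechet_derivative_at by blast
  show 1: "(F has_derivative frechet_derivative F (at p)) (at p)"
    using L LL by simp
  show 2: "linear (frechet_derivative F (at p))"
    using 1 has_derivative_linear by blast
  have 3: "frechet_derivative F (at p) (\<i> *s v) = \<i> * frechet_derivative F (at p) v" for v
    using L(2)[of v] unfolding LL .
  show "frechet_derivative F (at p) (c *s v) = c * frechet_derivative F (at p) v"
    by (rule complex_linear_scalar[OF 2 3])
  show "frechet_derivative F (at p) h = (\<Sum>l\<in>UNIV. h $ l * frechet_derivative F (at p) (axis l 1))"
    by (rule complex_linear_coordinates[OF 2 3])
qed

lemma holo_on_subset: "cholo_on J S F \<Longrightarrow> T \<subseteq> S \<Longrightarrow> cholo_on J T F"
  unfolding cholo_on_def by blast

lemma holo_on_continuous: "cholo_on J S F \<Longrightarrow> continuous_on S F"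
  unfolding cholo_on_def
  by (meson continuous_at_imp_continuous_on has_derivative_continuous)

lemma holo_on_complex_line:
  fixes F :: "complex^'n \<Rightarrow> complex"
  assumes "holo_on S F" "p + t *s v \<in> S"
  shows "((\<lambda>t. F (p + t *s v)) has_field_derivative frechet_derivative F (at (p + t *s v)) v) (at t)"
proof -
  have "((\<lambda>t. p + t *s v) has_derivative (\<lambda>t. t *s v)) (at t)"
    using bounded_linear_imp_has_derivative[OF bounded_linear_scalar_mult]
    by (auto intro!: derivative_eq_intros)
  from has_derivative_compose[OF this holo_on_frechet(1)[OF assms]]
  have "((\<lambda>t. F (p + t *s v)) has_derivative (\<lambda>x. x * frechet_derivative F (at (p + t *s v)) v)) (at t)"
    by (simp add: holo_on_frechet(3)[OF assms])
  moreover have "(\<lambda>x. x * frechet_derivative F (at (p + t *s v)) v)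
      = (*) (frechet_derivative F (at (p + t *s v)) v)"
    by (simp add: fun_eq_iff mult.commute)
  ultimately show ?thesis
    unfolding has_field_derivative_def by simp
qed

lemma holo_on_complex_line_holomorphic:
  fixes F :: "complex^'n \<Rightarrow> complex"
  assumes "holo_on S F" "\<And>t. t \<in> T \<Longrightarrow> p + t *s v \<in> S"
  shows "(\<lambda>t. F (p + t *s v)) holomorphic_on T"
  unfolding holomorphic_on_def field_differentiable_def
  using holo_on_complex_line[OF assms(1)] assms(2)
  by (meson has_field_derivative_at_within)

text \<open>Cauchy's inequality on the complex line through \<open>p\<close> with direction \<open>v\<close>, on which the disc of
  radius \<open>r / (2 |v|)\<close> stays in the ball.\<close>

lemma holo_on_derivative_bound:
  fixes F :: "complex^'n \<Rightarrow> complex"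
  assumes F: "holo_on (ball p r) F" and M: "\<And>x. x \<in> ball p r \<Longrightarrow> cmod (F x) \<le> M"
    and "0 < r"
  shows "cmod (frechet_derivative F (at p) v) \<le> 2 * M / r * norm v"
proof (cases "v = 0")
  case True
  then show ?thesis
    using linear_0[OF holo_on_frechet(2)[OF F]] \<open>0 < r\<close> by simp
next
  case False
  define s where "s = r / (2 * norm v)"
  have s: "s > 0" using False \<open>0 < r\<close> by (simp add: s_def)
  have in_ball: "p + t *s v \<in> ball p r" if "cmod t \<le> s" for t
  proof -
    have "norm (t *s v) \<le> s * norm v"
      by (simp add: norm_scalar_mult_vec that mult_right_mono)
    also have "\<dots> = r / 2" using False by (simp add: s_def)
    also have "\<dots> < r" using \<open>0 < r\<close> by simp
    finally show ?thesis by (simp add: dist_norm)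
  qed
  have hol: "(\<lambda>t. F (p + t *s v)) holomorphic_on cball 0 s"
    by (rule holo_on_complex_line_holomorphic[OF F]) (auto intro: in_ball simp del: mem_ball)
  have "norm ((deriv ^^ 1) (\<lambda>t. F (p + t *s v)) 0) \<le> (fact 1) * M / s^1"
  proof (rule Cauchy_inequality)
    show "(\<lambda>t. F (p + t *s v)) holomorphic_on ball 0 s"
      using hol ball_subset_cball holomorphic_on_subset by blast
    show "continuous_on (cball 0 s) (\<lambda>t. F (p + t *s v))"
      using hol holomorphic_on_imp_continuous_on by blast
    show "cmod (F (p + x *s v)) \<le> M" if "cmod (0 - x) = s" for x
      using that by (intro M in_ball) simp
  qed (fact s)
  moreover have "deriv (\<lambda>t. F (p + t *s v)) 0 = frechet_derivative F (at p) v"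
    using holo_on_complex_line[OF F, of p 0 v] \<open>0 < r\<close>
    by (simp add: DERIV_imp_deriv)
  ultimately show ?thesis
    by (simp add: s_def field_simps)
qed

text \<open>Each point of the smaller ball is the centre of a ball of radius \<open>r\<close> in the larger one, so
  Cauchy's inequality bounds the derivative there.\<close>

lemma holo_on_Lipschitz:
  fixes F :: "complex^'n \<Rightarrow> complex"
  assumes F: "holo_on (ball p (2 * r)) F" and M: "\<And>x. x \<in> ball p (2 * r) \<Longrightarrow> cmod (F x) \<le> M"
    and "0 < r" "x \<in> ball p r" "y \<in> ball p r"
  shows "cmod (F x - F y) \<le> 2 * M / r * dist x y"
proof -
  have sub: "ball q r \<subseteq> ball p (2 * r)" if "q \<in> ball p r" for q
    using that by (auto simp: subset_iff) (smt (verit) dist_triangle)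
  have d: "cmod (frechet_derivative F (at q) v) \<le> 2 * M / r * norm v" if "q \<in> ball p r" for q v
    by (rule holo_on_derivative_bound)
       (use sub[OF that] F M \<open>0 < r\<close> in \<open>auto intro: holo_on_subset\<close>)
  have "norm (F x - F y) \<le> 2 * M / r * norm (x - y)"
  proof (rule differentiable_bound[where S = "ball p r"])
    fix q assume q: "q \<in> ball p r"
    then have "q \<in> ball p (2 * r)" using \<open>0 < r\<close> by auto
    then show "(F has_derivative frechet_derivative F (at q)) (at q within ball p r)"
      using holo_on_frechet(1)[OF F] has_derivative_at_withinI by blast
    show "onorm (frechet_derivative F (at q)) \<le> 2 * M / r"
      using d[OF q] by (intro onorm_le) auto
  qed (use assms in auto)
  then show ?thesis by (simp add: dist_norm)
qed

text \<open>The derivative of \<open>F\<close> at \<open>x\<close> minus that at \<open>p\<close> is the derivative at \<open>p\<close> of the difference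
  between a translate of \<open>F\<close> and \<open>F\<close> itself. This difference is holomorphic and of size
  \<open>O(|x - p|)\<close>, so Cauchy's inequality applies to it.\<close>

lemma continuous_on_frechet_holo:
  fixes F :: "complex^'n \<Rightarrow> complex"
  assumes "holo_on S F" "open S"
  shows "continuous_on S (\<lambda>x. frechet_derivative F (at x) v)"
proof (rule continuous_at_imp_continuous_on, rule ballI)
  fix p assume "p \<in> S"
  then obtain r0 where r0: "r0 > 0" "cball p r0 \<subseteq> S"
    using \<open>open S\<close> open_contains_cball by blast
  define r where "r = r0 / 4"
  have r: "r > 0" using r0 by (simp add: r_def)
  have sub: "ball p (4 * r) \<subseteq> S" "cball p (4 * r) \<subseteq> S" using r0 by (auto simp: r_def)
  have F: "holo_on (ball p (4 * r)) F" using assms(1) sub holo_on_subset by blast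
  obtain M where M: "\<And>x. x \<in> cball p (4 * r) \<Longrightarrow> cmod (F x) \<le> M"
    using compact_imp_bounded[OF compact_continuous_image[OF
        continuous_on_subset[OF holo_on_continuous[OF assms(1)] sub(2)] compact_cball]]
    unfolding bounded_iff by (meson imageI)
  have Lip: "cmod (F x - F y) \<le> M / r * dist x y" if "x \<in> ball p (2 * r)" "y \<in> ball p (2 * r)" for x y
    using holo_on_Lipschitz[of p "2 * r" F M x y] F M that r by simp
  have M0: "M \<ge> 0" using M[of p] r by (smt (verit) centre_in_cball norm_ge_zero)
  have est: "cmod (frechet_derivative F (at x) v - frechet_derivative F (at p) v)
      \<le> 2 * (M / r * dist x p) / r * norm v" if x: "x \<in> ball p r" for x
  proof -
    define G where "G = (\<lambda>u. F (u + (x - p)) - F u)"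
    have sh: "u + (x - p) \<in> ball p (2 * r)" if "u \<in> ball p r" for u
    proof -
      have "norm ((u - p) + (x - p)) < r + r"
        using that x by (intro norm_triangle_lt add_strict_mono) (auto simp: dist_norm norm_minus_commute)
      then show ?thesis by (simp add: dist_norm norm_minus_commute algebra_simps)
    qed
    have in4: "u \<in> ball p (4 * r)" if "u \<in> ball p (2 * r)" for u
      using that r by auto
    have der: "(G has_derivative (\<lambda>h. frechet_derivative F (at (u + (x - p))) h
        - frechet_derivative F (at u) h)) (at u)" if "u \<in> ball p r" for u
    proof -
      have u2: "u \<in> ball p (4 * r)" using that r by auto
      have "((\<lambda>u. u + (x - p)) has_derivative (\<lambda>h. h)) (at u)"
        by (auto intro!: derivative_eq_intros)
      from has_derivative_compose[OF this holo_on_frechet(1)[OF F in4[OF sh[OF that]]]]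
      show ?thesis unfolding G_def
        by (intro has_derivative_diff holo_on_frechet(1)[OF F u2])
    qed
    have G: "holo_on (ball p r) G"
      unfolding cholo_on_def
    proof (intro ballI exI conjI allI)
      fix u w assume u: "u \<in> ball p r"
      have u2: "u \<in> ball p (4 * r)" using u r by auto
      show "(G has_derivative (\<lambda>h. frechet_derivative F (at (u + (x - p))) h
        - frechet_derivative F (at u) h)) (at u)" using der u by blast
      show "frechet_derivative F (at (u + (x - p))) (\<i> *s w) - frechet_derivative F (at u) (\<i> *s w)
        = \<i> * (frechet_derivative F (at (u + (x - p))) w - frechet_derivative F (at u) w)"
        using holo_on_frechet(3)[OF F u2] holo_on_frechet(3)[OF F in4[OF sh[OF u]]]
        by (simp add: algebra_simps)
    qed
    have GM: "cmod (G u) \<le> M / r * dist x p" if "u \<in> ball p r" for u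
    proof -
      have "u \<in> ball p (2*r)" using that r by auto
      from Lip[OF sh[OF that] this] show ?thesis
        unfolding G_def by (simp add: dist_norm)
    qed
    have "frechet_derivative G (at p) = (\<lambda>h. frechet_derivative F (at (p + (x - p))) h
        - frechet_derivative F (at p) h)"
      using der[of p] r frechet_derivative_at by fastforce
    then have "frechet_derivative G (at p) v = frechet_derivative F (at x) v - frechet_derivative F (at p) v"
      by simp
    then show ?thesis
      using holo_on_derivative_bound[OF G GM r, of v] by simp
  qed
  have "((\<lambda>x. frechet_derivative F (at x) v - frechet_derivative F (at p) v) \<longlongrightarrow> 0) (at p)"
  proof (rule Lim_null_comparison)
    show "\<forall>\<^sub>F x in at p. cmod (frechet_derivative F (at x) v - frechet_derivative F (at p) v)
      \<le> 2 * (M / r * dist x p) / r * norm v"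
      unfolding eventually_at
    proof (intro exI conjI ballI impI)
      fix x assume "x \<noteq> p \<and> dist x p < r"
      then show "cmod (frechet_derivative F (at x) v - frechet_derivative F (at p) v)
          \<le> 2 * (M / r * dist x p) / r * norm v"
        by (intro est) (simp add: dist_commute)
    qed (fact r)
    have "((\<lambda>x. 2 * (M / r * dist x p) / r * norm v) \<longlongrightarrow> 2 * (M / r * dist p p) / r * norm v) (at p)"
      using r by (intro tendsto_intros) auto
    then show "((\<lambda>x. 2 * (M / r * dist x p) / r * norm v) \<longlongrightarrow> 0) (at p)" by simp
  qed
  then show "isCont (\<lambda>x. frechet_derivative F (at x) v) p"
    unfolding isCont_def using LIM_zero_iff by blast
qed

section \<open>Zeros on complex lines\<close>

text \<open>Dividing by \<open>t - b\<close> for a zero \<open>b\<close> in the disc of radius \<open>\<rho>\<close> costs a factor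
  \<open>1 / (R - \<rho>)\<close> in the maximum principle, and multiplying by it again at \<open>a\<close> costs at most
  \<open>|a| + \<rho>\<close>.\<close>

lemma holomorphic_many_zeros_small:
  fixes g :: "complex \<Rightarrow> complex"
  assumes "finite Z" and "g holomorphic_on ball 0 R" and "\<And>t. t \<in> ball 0 R \<Longrightarrow> cmod (g t) \<le> M"
    and "Z \<subseteq> cball 0 \<rho>" and "\<And>t. t \<in> Z \<Longrightarrow> g t = 0" and "0 \<le> \<rho>" "\<rho> < R" "a \<in> ball 0 R"
  shows "cmod (g a) \<le> M * ((cmod a + \<rho>) / (R - \<rho>)) ^ card Z"
  using assms
proof (induction Z arbitrary: g M rule: finite_induct)
  case empty
  then show ?case by simp
next
  case (insert b Z)
  have b: "cmod b \<le> \<rho>" using insert.prems by auto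
  define q where "q = (\<lambda>t. if t = b then deriv g b else (g t - g b) / (t - b))"
  have gb: "g b = 0" using insert.prems by auto
  have gq: "g t = (t - b) * q t" for t
    by (simp add: q_def gb)
  have q: "q holomorphic_on ball 0 R"
    unfolding q_def using insert.prems by (intro pole_lemma_open) auto
  have qM: "cmod (q t) \<le> M / (R - \<rho>)" if t: "t \<in> ball 0 R" for t
  proof -
    have le: "cmod (q t) * (r - \<rho>) \<le> M" if r: "max (cmod t) \<rho> < r" "r < R" for r
    proof -
      have r0: "r > 0" using r insert.prems by linarith
      have "cmod (q t) \<le> M / (r - \<rho>)"
      proof (rule maximum_modulus_frontier[where f = q and S = "ball 0 r"])
        show "q holomorphic_on interior (ball 0 r)"
          using r q by (auto intro: holomorphic_on_subset)
        have "closure (ball 0 r) \<subseteq> ball (0::complex) R" using r0 r by auto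
        then show "continuous_on (closure (ball 0 r)) q"
          using q holomorphic_on_imp_continuous_on holomorphic_on_subset by blast
        fix z :: complex assume "z \<in> frontier (ball 0 r)"
        then have z: "cmod z = r" using r0 by simp
        then have "r - \<rho> \<le> cmod (z - b)" using b norm_triangle_ineq2[of z b] by linarith
        moreover have "cmod (z - b) * cmod (q z) \<le> M"
          using gq[of z] insert.prems(2)[of z] z r by (simp add: norm_mult)
        ultimately have "(r - \<rho>) * cmod (q z) \<le> M"
          by (meson mult_right_mono norm_ge_zero order_trans)
        then show "cmod (q z) \<le> M / (r - \<rho>)"
          using r by (simp add: field_simps)
      qed (use r in auto)
      then show ?thesis using r by (simp add: field_simps)
    qed
    have "cmod (q t) * (R - \<rho>) \<le> M"
    proof (rule tendsto_upperbound)
      show "((\<lambda>r. cmod (q t) * (r - \<rho>)) \<longlongrightarrow> cmod (q t) * (R - \<rho>)) (at_left R)"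
        by (intro tendsto_intros)
      have "max (cmod t) \<rho> < R" using t insert.prems by auto
      then show "\<forall>\<^sub>F r in at_left R. cmod (q t) * (r - \<rho>) \<le> M"
        unfolding eventually_at_left_field using le by (intro exI[of _ "max (cmod t) \<rho>"]) auto
    qed auto
    then show ?thesis using insert.prems by (simp add: field_simps)
  qed
  have "cmod (q a) \<le> M / (R - \<rho>) * ((cmod a + \<rho>) / (R - \<rho>)) ^ card Z"
  proof (rule insert.IH)
    show "q t = 0" if "t \<in> Z" for t
      using that insert.hyps insert.prems(4)[of t] gq[of t] by auto
  qed (use insert.prems q qM in auto)
  then have "cmod (g a) \<le> (cmod a + \<rho>) * (M / (R - \<rho>) * ((cmod a + \<rho>) / (R - \<rho>)) ^ card Z)"
    unfolding gq norm_mult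
    using b norm_triangle_ineq4[of a b] norm_ge_zero[of a] insert.prems(5)
    by (intro mult_mono) auto
  then show ?case
    using insert.hyps by (simp add: field_simps)
qed

text \<open>Let \<open>v\<close> lead from \<open>x0\<close> to a nearby point where \<open>f\<close> does not vanish. A step \<open>w\<close> close to \<open>v\<close>
  from a point close to \<open>x0\<close> ends where \<open>|f| \<ge> m\<close> for a fixed \<open>m > 0\<close>. Many zeros on the line with
  direction \<open>w\<close> would make \<open>f\<close> smaller than \<open>m\<close> there. The sets \<open>Z\<close> are the
  subsets of fibres of the projection along \<open>w\<close>.\<close>

lemma holo_on_zeros_on_lines:
  fixes f :: "complex^'n \<Rightarrow> complex"
  assumes f: "holo_on S f" and "open S" "x0 \<in> S"
    and nz: "\<forall>e>0. \<exists>y\<in>ball x0 e. f y \<noteq> 0" and z0: "f x0 = 0"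
  obtains v \<epsilon> \<rho> n where "\<epsilon> > 0" "\<rho> > 0" "cball x0 \<rho> \<subseteq> S"
    "\<forall>w\<in>ball v \<epsilon>. w \<noteq> 0 \<and> (\<forall>Z. Z \<subseteq> ball x0 \<rho> \<longrightarrow> (\<forall>\<zeta>\<in>Z. f \<zeta> = 0) \<longrightarrow>
       (\<forall>\<zeta>\<in>Z. \<forall>\<zeta>'\<in>Z. \<exists>t. \<zeta>' = \<zeta> + t *s w) \<longrightarrow> finite Z \<and> card Z \<le> n)"
proof -
  obtain R where R: "R > 0" "cball x0 R \<subseteq> S"
    using assms open_contains_cball by blast
  obtain M0 where M0: "\<And>x. x \<in> cball x0 R \<Longrightarrow> cmod (f x) \<le> M0"
    using compact_imp_bounded[OF compact_continuous_image[OF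
        continuous_on_subset[OF holo_on_continuous[OF f] R(2)] compact_cball]]
    unfolding bounded_iff by (meson imageI)
  define M where "M = max M0 1"
  have M: "M > 0" "\<And>x. x \<in> cball x0 R \<Longrightarrow> cmod (f x) \<le> M"
    using M0 by (auto simp: M_def) (meson le_max_iff_disj mem_cball)
  \<comment> \<open>The step \<open>w\<close> will be shorter than \<open>R / 16\<close>. So the line \<open>\<zeta> + t w\<close> stays in the ball
    of radius \<open>R\<close> for \<open>|t| < 8\<close>, its zeros near \<open>x0\<close> have \<open>|t| \<le> 2\<close>, and at \<open>t = 1\<close> each zero gains
    the factor \<open>(1 + 2) / (8 - 2) = 1/2\<close>.\<close>
  obtain y where y: "y \<in> ball x0 (R / 32)" "f y \<noteq> 0"
    using nz[rule_format, of "R/32"] R by auto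
  define v where "v = y - x0"
  have v: "v \<noteq> 0" "norm v < R / 32"
    using y z0 by (auto simp: v_def dist_norm norm_minus_commute)
  define m where "m = cmod (f y) / 2"
  have m: "m > 0" using y by (simp add: m_def)
  have "y \<in> cball x0 R" using y R by auto
  then have "isCont f y"
    using R holo_on_continuous[OF f] \<open>open S\<close> by (auto simp: continuous_on_eq_continuous_at)
  then obtain d where d: "d > 0" "\<And>x. dist x y < d \<Longrightarrow> dist (f x) (f y) < m"
    using m unfolding continuous_at_eps_delta by blast
  have big: "cmod (f x) \<ge> m" if "dist x y < d" for x
  proof -
    have "cmod (f y) \<le> cmod (f x) + dist (f x) (f y)"
      by (metis dist_norm norm_minus_commute norm_triangle_sub)
    then show ?thesis using d(2)[OF that] by (simp add: m_def)
  qed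
  define \<epsilon> where "\<epsilon> = min (norm v / 2) (d / 2)"
  define \<rho> where "\<rho> = min (norm v / 2) (d / 2)"
  have \<epsilon>: "\<epsilon> > 0" "\<epsilon> \<le> norm v / 2" "\<epsilon> \<le> d / 2" using v d by (auto simp: \<epsilon>_def)
  have \<rho>: "\<rho> > 0" "\<rho> \<le> norm v / 2" "\<rho> \<le> d / 2" using v d by (auto simp: \<rho>_def)
  obtain n where n: "M * (1/2) ^ n < m"
  proof -
    obtain n where "(1/2::real) ^ n < m / M"
      using real_arch_pow_inv[of "m / M" "1/2"] m M by auto
    then show ?thesis using that M by (simp add: field_simps)
  qed
  have wn: "norm v / 2 \<le> norm w" "norm w < R / 16" if "w \<in> ball v \<epsilon>" for w
  proof -
    have "norm (v - w) \<le> norm v / 2" using that \<epsilon> by (simp add: dist_norm)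
    then show "norm v / 2 \<le> norm w" using norm_triangle_ineq2[of v w] by linarith
    have "norm w \<le> norm v + norm (v - w)"
      by (metis norm_minus_commute norm_triangle_sub)
    then show "norm w < R / 16" using \<open>norm (v - w) \<le> norm v / 2\<close> v R(1) by linarith
  qed
  have fin: "card Z \<le> n" if w: "w \<in> ball v \<epsilon>" and Z: "Z \<subseteq> ball x0 \<rho>" "\<And>\<zeta>. \<zeta> \<in> Z \<Longrightarrow> f \<zeta> = 0"
      "\<And>\<zeta> \<zeta>'. \<zeta> \<in> Z \<Longrightarrow> \<zeta>' \<in> Z \<Longrightarrow> \<exists>t. \<zeta>' = \<zeta> + t *s w" "finite Z" for w Z
  proof (cases "Z = {}")
    case False
    then obtain \<zeta> where \<zeta>: "\<zeta> \<in> Z" by blast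
    have \<zeta>x: "dist \<zeta> x0 < \<rho>" using \<zeta> Z(1) by (auto simp: dist_commute)
    define g where "g = (\<lambda>t. f (\<zeta> + t *s w))"
    have in_ball: "\<zeta> + t *s w \<in> cball x0 R" if "t \<in> ball 0 8" for t
    proof -
      have "norm (t *s w) \<le> 8 * (R / 16)" unfolding norm_scalar_mult_vec
        using that wn[OF w] by (intro mult_mono) auto
      moreover have "dist (\<zeta> + t *s w) x0 \<le> dist \<zeta> x0 + norm (t *s w)"
        by (metis add_diff_eq add.commute dist_norm norm_triangle_ineq)
      ultimately show ?thesis using \<zeta>x \<rho> v by (simp add: dist_commute)
    qed
    define T where "T = {t. \<zeta> + t *s w \<in> Z}"
    have w0: "w \<noteq> 0" using wn[OF w] v by auto
    have inj: "inj (\<lambda>t. \<zeta> + t *s w)"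
    proof (rule injI)
      fix t t' assume "\<zeta> + t *s w = \<zeta> + t' *s w"
      then have "(t - t') *s w = 0" by (simp add: vector_sub_rdistrib)
      then have "cmod (t - t') * norm w = 0" by (metis norm_scalar_mult_vec norm_zero)
      then show "t = t'" using w0 by simp
    qed
    have ZT: "Z = (\<lambda>t. \<zeta> + t *s w) ` T"
      using Z(3)[OF \<zeta>] by (auto simp: T_def)
    have cT: "card Z = card T" "finite T"
      using ZT inj Z(4) by (simp_all add: card_image[OF inj_on_subset[OF inj subset_UNIV]] finite_image_iff[OF inj_on_subset[OF inj subset_UNIV]])
    have "cmod (g 1) \<le> M * ((cmod 1 + 2) / (8 - 2)) ^ card T"
    proof (rule holomorphic_many_zeros_small)
      show "g holomorphic_on ball 0 8" unfolding g_def
        by (rule holo_on_complex_line_holomorphic[OF f]) (use in_ball R in blast)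
      show "cmod (g t) \<le> M" if "t \<in> ball 0 8" for t
        unfolding g_def by (rule M(2)[OF in_ball[OF that]])
      show "T \<subseteq> cball 0 2"
      proof
        fix t assume "t \<in> T"
        then have "dist (\<zeta> + t *s w) x0 < \<rho>" using Z(1) by (auto simp: T_def dist_commute)
        then have "norm (t *s w) < 2 * \<rho>"
          using \<zeta>x norm_triangle_ineq4[of "\<zeta> + t *s w - x0" "\<zeta> - x0"] by (simp add: dist_norm)
        then have "cmod t * norm w < 2 * norm w"
          using \<rho>(2) wn(1)[OF w] by (simp add: norm_scalar_mult_vec)
        then show "t \<in> cball 0 2" using w0 by simp
      qed
      show "g t = 0" if "t \<in> T" for t using that Z(2) by (simp add: T_def g_def)
    qed (use cT in auto)
    then have le: "cmod (g 1) \<le> M * (1/2) ^ card T" by simp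
    have "dist (\<zeta> + 1 *s w) y < d"
    proof -
      have "(\<zeta> + 1 *s w) - y = (\<zeta> - x0) + (w - v)" by (simp add: v_def)
      then have "dist (\<zeta> + 1 *s w) y \<le> norm (\<zeta> - x0) + norm (w - v)"
        by (metis dist_norm norm_triangle_ineq)
      also have "\<dots> < d / 2 + d / 2"
        using \<zeta>x \<rho> w \<epsilon> by (intro add_strict_mono) (auto simp: dist_norm norm_minus_commute)
      finally show ?thesis by simp
    qed
    then have "m \<le> M * (1/2) ^ card T" using big le unfolding g_def by fastforce
    then have "(1/2::real) ^ n < (1/2) ^ card T"
      using n M by (meson mult_left_less_imp_less less_le_trans less_imp_le)
    then have "card T < n" using power_decreasing[of n "card T" "1/2::real"] by force
    then show ?thesis using cT by simp
  qed simp
  show ?thesis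
  proof (rule that[of \<epsilon> \<rho> v n])
    show "cball x0 \<rho> \<subseteq> S" using \<rho> v R by (force simp: subset_iff)
    show "\<forall>w\<in>ball v \<epsilon>. w \<noteq> 0 \<and> (\<forall>Z. Z \<subseteq> ball x0 \<rho> \<longrightarrow> (\<forall>\<zeta>\<in>Z. f \<zeta> = 0) \<longrightarrow>
       (\<forall>\<zeta>\<in>Z. \<forall>\<zeta>'\<in>Z. \<exists>t. \<zeta>' = \<zeta> + t *s w) \<longrightarrow> finite Z \<and> card Z \<le> n)"
    proof (intro ballI conjI[OF _ allI] impI)
      fix w assume w: "w \<in> ball v \<epsilon>"
      show "w \<noteq> 0" using wn[OF w] v by auto
      fix Z assume Z: "Z \<subseteq> ball x0 \<rho>" "\<forall>\<zeta>\<in>Z. f \<zeta> = 0" "\<forall>\<zeta>\<in>Z. \<forall>\<zeta>'\<in>Z. \<exists>t. \<zeta>' = \<zeta> + t *s w"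
    show "finite Z \<and> card Z \<le> n"
    proof (rule finite_if_finite_subsets_card_bdd)
      fix G assume G: "G \<subseteq> Z" "finite G"
      show "card G \<le> n"
      proof (rule fin[OF w _ _ _ G(2)])
        show "G \<subseteq> ball x0 \<rho>" using G Z(1) by blast
        show "f \<zeta> = 0" if "\<zeta> \<in> G" for \<zeta> using that G Z(2) by blast
        show "\<exists>t. \<zeta>' = \<zeta> + t *s w" if "\<zeta> \<in> G" "\<zeta>' \<in> G" for \<zeta> \<zeta>'
          using that G Z(3) by blast
      qed
    qed
    qed
  qed (use \<epsilon> \<rho> in auto)
qed

section \<open>Coefficients of exterior products\<close>

text \<open>The index \<open>3\<close> of the third coordinate is \<open>0\<close> in the type \<open>3\<close>, so the coordinates come in the
  order \<open>0 < 1 < 2\<close> in the monomials. Signs below refer to this order.\<close>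

lemma less_3 [simp]: "(0::3) < 1" "(0::3) < 2" "(1::3) < 2"
  "\<not> (1::3) < 0" "\<not> (2::3) < 0" "\<not> (2::3) < 1"
  by (simp_all add: less_bit1_def bit1.Rep_0 bit1.Rep_1 bit1.Rep_numeral)

lemma less_2 [simp]: "(0::2) < 1" "\<not> (1::2) < 0"
  by (simp_all add: less_bit0_def bit0.Rep_0 bit0.Rep_1)

lemma three_eq_0: "(3::3) = 0" and two_eq_0: "(2::2) = 0"
  by simp_all

lemma UNIV_3': "(UNIV :: 3 set) = {0, 1, 2}"
  using UNIV_3 by auto

lemma UNIV_2': "(UNIV :: 2 set) = {0, 1}"
  using UNIV_2 by auto

lemma sum_3': "sum f (UNIV :: 3 set) = f 0 + f 1 + f 2"
  using sum_3[of f] unfolding three_eq_0 by (simp add: ac_simps)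

lemma sum_2': "sum f (UNIV :: 2 set) = f 0 + f 1"
  using sum_2[of f] unfolding two_eq_0 by (simp add: ac_simps)

lemma less_covec_simps [simp]:
  "D\<zeta> i < D\<zeta> j \<longleftrightarrow> i < j" "D\<zeta>b i < D\<zeta>b j \<longleftrightarrow> i < j" "Dzb i < Dzb j \<longleftrightarrow> i < j"
  "D\<zeta> i < D\<zeta>b j" "D\<zeta> i < Dzb j" "D\<zeta>b i < Dzb j"
  "\<not> D\<zeta>b i < D\<zeta> j" "\<not> Dzb i < D\<zeta> j" "\<not> Dzb i < D\<zeta>b j"
  by (simp_all add: less_covec_def)

lemma sum_ext_apply: "(sum f A) S = (\<Sum>i\<in>A. f i S)" for f :: "'b \<Rightarrow> 'i ext"
  by (induction A rule: infinite_finite_induct) simp_all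

definition wsign :: "'i::linorder set \<Rightarrow> 'i set \<Rightarrow> complex" where
  "wsign T S = (-1) ^ card {(i, j). i \<in> T \<and> j \<in> S - T \<and> j < i}"

lemma wedge_apply: "(a \<and>\<^sub>e b) S = (\<Sum>T\<in>Pow S. wsign T S * a T * b (S - T))"
  by (simp add: wedge_def wsign_def)

lemma cmod_wsign [simp]: "cmod (wsign T S) = 1"
  by (simp add: wsign_def norm_power)

lemma wsign_cross:
  assumes "\<And>i j. i \<in> T \<Longrightarrow> j \<in> S - T \<Longrightarrow> i < j"
  shows "wsign T S = 1"
proof -
  have "{(i, j). i \<in> T \<and> j \<in> S - T \<and> j < i} = {}"
    using assms by (auto dest: less_asym)
  then show ?thesis unfolding wsign_def by (simp only: card.empty power_0)
qed

lemma wedge_add_left: "(a + b) \<and>\<^sub>e c = a \<and>\<^sub>e c + b \<and>\<^sub>e c"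
  and wedge_add_right: "c \<and>\<^sub>e (a + b) = c \<and>\<^sub>e a + c \<and>\<^sub>e b"
  and wedge_diff_left: "(a - b) \<and>\<^sub>e c = a \<and>\<^sub>e c - b \<and>\<^sub>e c"
  and wedge_escale_left: "(k *\<^sub>e a) \<and>\<^sub>e b = k *\<^sub>e (a \<and>\<^sub>e b)"
  and wedge_zero_left: "0 \<and>\<^sub>e b = 0"
  by (auto simp: fun_eq_iff wedge_def escale_def algebra_simps sum.distrib sum_subtractf sum_distrib_left)

lemma wedge_sum_left: "(sum f A) \<and>\<^sub>e c = (\<Sum>i\<in>A. f i \<and>\<^sub>e c)"
  by (induction A rule: infinite_finite_induct)
     (simp_all only: simp_thms sum.infinite sum.empty sum.insert wedge_add_left wedge_zero_left)

text \<open>The number of factors that a generator has to pass when it is moved from the front to its place.\<close>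

definition below :: "'i::linorder \<Rightarrow> 'i set \<Rightarrow> nat" where
  "below c S = card {j \<in> S. j < c}"

lemma below_empty [simp]: "below c {} = 0"
  by (simp add: below_def)

lemma below_insert [simp]:
  assumes "finite S" "x \<notin> S"
  shows "below c (insert x S) = (if x < c then 1 else 0) + below c S"
proof -
  have "{j \<in> insert x S. j < c} = (if x < c then insert x {j \<in> S. j < c} else {j \<in> S. j < c})"
    by auto
  then show ?thesis using assms by (simp add: below_def)
qed

lemma wedge_gen_left:
  fixes a :: "'i::{linorder,finite} ext"
  shows "(gen c \<and>\<^sub>e a) S = (if c \<in> S then (-1) ^ below c (S - {c}) * a (S - {c}) else 0)"
proof -
  have "(gen c \<and>\<^sub>e a) S = (\<Sum>T\<in>Pow S. if T = {c} then wsign T S * a (S - T) else 0)"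
    unfolding wedge_apply gen_def by (intro sum.cong) auto
  also have "\<dots> = (if c \<in> S then wsign {c} S * a (S - {c}) else 0)"
    by (subst sum.delta) auto
  also have "c \<in> S \<Longrightarrow> wsign {c} S = (-1) ^ below c (S - {c})"
  proof -
    have "{(i, j). i \<in> {c} \<and> j \<in> S - {c} \<and> j < i} = Pair c ` {j \<in> S - {c}. j < c}" by auto
    moreover have "inj_on (Pair c) {j \<in> S - {c}. j < c}" by (simp add: inj_on_def)
    ultimately show ?thesis unfolding wsign_def below_def by (simp only: card_image)
  qed
  ultimately show ?thesis by auto
qed

lemma wedge_lin_left:
  fixes a :: "'i::{linorder,finite} ext"
  shows "((\<Sum>k\<in>A. c k *\<^sub>e gen (G k)) \<and>\<^sub>e a) S =
    (\<Sum>k\<in>A. if G k \<in> S then c k * (-1) ^ below (G k) (S - {G k}) * a (S - {G k}) else 0)"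
  unfolding wedge_sum_left wedge_escale_left sum_ext_apply
  by (intro sum.cong refl) (simp add: escale_def wedge_gen_left)

section \<open>Degree in the holomorphic differentials\<close>

definition graded :: "'i set \<Rightarrow> nat \<Rightarrow> 'i ext \<Rightarrow> bool" where
  "graded P k a \<longleftrightarrow> (\<forall>S. a S \<noteq> 0 \<longrightarrow> card (S \<inter> P) = k)"

lemma graded_wedge:
  fixes a :: "'i::{linorder,finite} ext"
  assumes "graded P k a" "graded P m b"
  shows "graded P (k + m) (a \<and>\<^sub>e b)"
  unfolding graded_def
proof (intro allI impI)
  fix S assume "(a \<and>\<^sub>e b) S \<noteq> 0"
  then obtain T where T: "T \<subseteq> S" "a T \<noteq> 0" "b (S - T) \<noteq> 0"
    unfolding wedge_apply by (metis (no_types, lifting) PowD mult_zero_left mult_zero_right sum.neutral)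
  have "S \<inter> P = (T \<inter> P) \<union> ((S - T) \<inter> P)" using T by auto
  then have "card (S \<inter> P) = card (T \<inter> P) + card ((S - T) \<inter> P)"
    by (metis Diff_disjoint Int_assoc Int_commute card_Un_disjoint finite inf_bot_right)
  then show "card (S \<inter> P) = k + m"
    using T assms by (simp add: graded_def)
qed

lemma graded_0 [simp]: "graded P k 0"
  by (simp add: graded_def)

lemma graded_add: "graded P k a \<Longrightarrow> graded P k b \<Longrightarrow> graded P k (a + b)"
  unfolding graded_def by (metis add.right_neutral plus_fun_apply)

lemma graded_sum: "(\<And>i. i \<in> A \<Longrightarrow> graded P k (f i)) \<Longrightarrow> graded P k (sum f A)"
  by (induction A rule: infinite_finite_induct) (auto intro: graded_add)

lemma graded_escale: "graded P k a \<Longrightarrow> graded P k (c *\<^sub>e a)"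
  by (auto simp: graded_def escale_def)

lemma graded_gen_in: "i \<in> P \<Longrightarrow> graded P 1 (gen i)"
  and graded_gen_notin: "i \<notin> P \<Longrightarrow> graded P 0 (gen i)"
  by (auto simp: graded_def gen_def)

lemma graded_eone: "graded P 0 eone"
  by (auto simp: graded_def eone_def)

lemma graded_one_form: "graded (range D\<zeta>) 1 (one_form c)"
  unfolding one_form_def
  by (intro graded_sum graded_escale graded_gen_in) simp

abbreviation "hol_deg \<equiv> graded (range D\<zeta>)"

lemma hol_part_graded: "hol_deg k a \<Longrightarrow> hol_part m a = (if m = k then a else 0)"
  by (auto simp: graded_def hol_part_def fun_eq_iff)

lemma hol_part_add: "hol_part k (a + b) = hol_part k a + hol_part k b"
  and hol_part_diff: "hol_part k (a - b) = hol_part k a - hol_part k b"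
  by (auto simp: hol_part_def fun_eq_iff)

lemma graded_hol_part: "hol_deg k (hol_part k a)"
  by (auto simp: graded_def hol_part_def)

text \<open>The degree in the differentials \<open>d\<zeta>\<^sub>l\<close> is additive, so only pairs of components with
  degrees adding up to 2 contribute.\<close>

lemma hol_part_wedge_2:
  "hol_part 2 (a \<and>\<^sub>e b) =
     hol_part 0 a \<and>\<^sub>e hol_part 2 b + hol_part 1 a \<and>\<^sub>e hol_part 1 b + hol_part 2 a \<and>\<^sub>e hol_part 0 b"
proof
  fix S :: "3 covec set"
  define w where "w i j = (hol_part i a \<and>\<^sub>e hol_part j b) S" for i j
  have w0: "w i j = 0" if "card (S \<inter> range D\<zeta>) \<noteq> i + j" for i j
  proof -
    have "hol_deg (i + j) (hol_part i a \<and>\<^sub>e hol_part j b)"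
      by (intro graded_wedge graded_hol_part)
    then show ?thesis using that by (auto simp: graded_def w_def)
  qed
  show "hol_part 2 (a \<and>\<^sub>e b) S = (hol_part 0 a \<and>\<^sub>e hol_part 2 b + hol_part 1 a \<and>\<^sub>e hol_part 1 b
      + hol_part 2 a \<and>\<^sub>e hol_part 0 b) S"
  proof (cases "card (S \<inter> range D\<zeta>) = 2")
    case False
    then show ?thesis
      using w0[of 0 2] w0[of 1 1] w0[of 2 0] by (simp add: w_def hol_part_def)
  next
    case True
    have "(a \<and>\<^sub>e b) S = w 0 2 + w 1 1 + w 2 0"
      unfolding w_def wedge_apply sum.distrib[symmetric]
    proof (rule sum.cong)
      fix T assume "T \<in> Pow S"
      then have "S \<inter> range D\<zeta> = (T \<inter> range D\<zeta>) \<union> ((S - T) \<inter> range D\<zeta>)" by auto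
      then have "card (T \<inter> range D\<zeta>) + card ((S - T) \<inter> range D\<zeta>) = 2"
        using True by (metis Diff_disjoint Int_assoc Int_commute card_Un_disjoint finite inf_bot_right)
      then consider "card (T \<inter> range D\<zeta>) = 0" "card ((S - T) \<inter> range D\<zeta>) = 2"
        | "card (T \<inter> range D\<zeta>) = 1" "card ((S - T) \<inter> range D\<zeta>) = 1"
        | "card (T \<inter> range D\<zeta>) = 2" "card ((S - T) \<inter> range D\<zeta>) = 0"
        by linarith
      then show "wsign T S * a T * b (S - T) =
          wsign T S * hol_part 0 a T * hol_part 2 b (S - T)
          + wsign T S * hol_part 1 a T * hol_part 1 b (S - T)
          + wsign T S * hol_part 2 a T * hol_part 0 b (S - T)"
        by cases (simp_all only: hol_part_def, simp_all)
    qed simp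
    then show ?thesis using True by (simp add: w_def hol_part_def)
  qed
qed

section \<open>Pullback of forms of top degree\<close>

text \<open>The sign with which \<open>d\<zeta>\<^sub>j\<close> times the product of the other two differentials equals the
  ordered product of all three.\<close>

definition esgn :: "3 \<Rightarrow> complex" where
  "esgn j = (if j = 1 then -1 else 1)"

lemma cmod_esgn [simp]: "cmod (esgn j) = 1"
  by (simp add: esgn_def)

lemma range_D_zeta_2: "range D\<zeta> = {D\<zeta> (0::2), D\<zeta> 1}"
  by (simp add: UNIV_2')

lemma range_D_zetab_2: "range D\<zeta>b = {D\<zeta>b (0::2), D\<zeta>b 1}"
  by (simp add: UNIV_2')

text \<open>Holomorphic differentials precede all others, and the degree of \<open>a\<close> leaves only one way of
  splitting the monomial. So there is one term, without a sign.\<close>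

lemma wedge_hol_nonhol:
  fixes a b :: "'n::{finite,linorder} covec ext"
  assumes a: "\<And>S. a S \<noteq> 0 \<Longrightarrow> \<exists>J'. S = D\<zeta> ` J' \<and> card J' = card J"
    and B: "B \<inter> range D\<zeta> = {}"
  shows "(a \<and>\<^sub>e b) (D\<zeta> ` J \<union> B) = a (D\<zeta> ` J) * b B"
proof -
  have "wsign T (D\<zeta> ` J \<union> B) * a T * b ((D\<zeta> ` J \<union> B) - T) = 0"
    if T: "T \<in> Pow (D\<zeta> ` J \<union> B)" "T \<noteq> D\<zeta> ` J" for T
  proof -
    have "a T = 0"
    proof (rule ccontr)
      assume "a T \<noteq> 0"
      then obtain J' where J': "T = D\<zeta> ` J'" "card J' = card J" using a by blast
      have "J' \<subseteq> J" using T(1) J'(1) B by auto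
      then have "J' = J" using J'(2) by (metis card_subset_eq finite)
      then show False using T J' by simp
    qed
    then show ?thesis by simp
  qed
  then have "(a \<and>\<^sub>e b) (D\<zeta> ` J \<union> B)
      = (\<Sum>T\<in>{D\<zeta> ` J}. wsign T (D\<zeta> ` J \<union> B) * a T * b ((D\<zeta> ` J \<union> B) - T))"
    unfolding wedge_apply by (intro sum.mono_neutral_right) auto
  also have "\<dots> = a (D\<zeta> ` J) * b B"
  proof -
    have "D\<zeta> ` J \<union> B - D\<zeta> ` J = B" using B by auto
    moreover have "wsign (D\<zeta> ` J) (D\<zeta> ` J \<union> B) = 1"
    proof (rule wsign_cross)
      fix i j assume "i \<in> D\<zeta> ` J" "j \<in> D\<zeta> ` J \<union> B - D\<zeta> ` J"
      then show "i < j" using B by (cases j) auto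
    qed
    ultimately show ?thesis by simp
  qed
  finally show ?thesis .
qed

lemma d_zeta_123: "d\<zeta>123 = (\<lambda>S. if S = range D\<zeta> then 1 else 0)"
proof
  fix S :: "3 covec set"
  have r: "range D\<zeta> = {D\<zeta> 1, D\<zeta> 2, D\<zeta> (0::3)}" by (auto simp: UNIV_3')
  have three: "(3::3) = 0" by simp
  show "d\<zeta>123 S = (if S = range D\<zeta> then 1 else 0)"
  proof (cases "S = range D\<zeta>")
    case True
    have e: "range D\<zeta> - {D\<zeta> 1} = {D\<zeta> 2, D\<zeta> (0::3)}" "{D\<zeta> 2, D\<zeta> (0::3)} - {D\<zeta> 2} = {D\<zeta> 0}"
      unfolding r by (simp_all add: insert_Diff_if)
    have "below (D\<zeta> 1) {D\<zeta> 2, D\<zeta> (0::3)} = 1" "below (D\<zeta> 2) {D\<zeta> (0::3)} = 1" by simp_all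
    then show ?thesis unfolding d\<zeta>123_def True three wedge_gen_left e
      by (simp add: gen_def)
  next
    case False
    have "gen (D\<zeta> 3) (S - {D\<zeta> 1} - {D\<zeta> 2}) = 0"
      if "D\<zeta> 1 \<in> S" "D\<zeta> 2 \<in> S - {D\<zeta> 1}"
    proof -
      have "S - {D\<zeta> 1} - {D\<zeta> 2} \<noteq> {D\<zeta> 0}"
      proof
        assume *: "S - {D\<zeta> 1} - {D\<zeta> 2} = {D\<zeta> 0}"
        have "S = insert (D\<zeta> 1) (insert (D\<zeta> 2) (S - {D\<zeta> 1} - {D\<zeta> 2}))"
          using that by auto
        then have "S = range D\<zeta>" unfolding * r .
        then show False using False by contradiction
      qed
      then show ?thesis unfolding gen_def three by simp
    qed
    then show ?thesis unfolding d\<zeta>123_def wedge_gen_left using False by auto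
  qed
qed

lemma wedge_d_zeta_123:
  assumes "B \<inter> range D\<zeta> = {}"
  shows "(d\<zeta>123 \<and>\<^sub>e b) (range D\<zeta> \<union> B) = b B"
proof -
  have "(d\<zeta>123 \<and>\<^sub>e b) (range D\<zeta> \<union> B) = d\<zeta>123 (range D\<zeta>) * b B"
  proof (rule wedge_hol_nonhol[OF _ assms])
    fix S assume "d\<zeta>123 S \<noteq> 0"
    then have "S = range D\<zeta>" by (simp add: d_zeta_123 split: if_splits)
    then show "\<exists>J'. S = D\<zeta> ` J' \<and> card J' = card (UNIV :: 3 set)" by blast
  qed
  then show ?thesis by (simp add: d_zeta_123)
qed

lemma one_form_wedge_top:
  "(one_form g \<and>\<^sub>e \<omega>) (range D\<zeta>) = (\<Sum>j\<in>UNIV. esgn j * g j * \<omega> (D\<zeta> ` (UNIV - {j})))"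
proof -
  have e: "D\<zeta> ` (UNIV - {0}) = {D\<zeta> 1, D\<zeta> (2::3)}" "D\<zeta> ` (UNIV - {1}) = {D\<zeta> 0, D\<zeta> (2::3)}"
    "D\<zeta> ` (UNIV - {2}) = {D\<zeta> 0, D\<zeta> (1::3)}"
    unfolding UNIV_3' by (simp_all add: insert_Diff_if)
  have d: "range D\<zeta> - {D\<zeta> k} = D\<zeta> ` (UNIV - {k})" for k :: 3 by auto
  have "below (D\<zeta> 0) {D\<zeta> 1, D\<zeta> (2::3)} = 0" "below (D\<zeta> 1) {D\<zeta> 0, D\<zeta> (2::3)} = 1"
    "below (D\<zeta> 2) {D\<zeta> 0, D\<zeta> (1::3)} = 2" by simp_all
  then show ?thesis
    unfolding one_form_def wedge_lin_left
    unfolding d sum_3' e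
    by (simp add: esgn_def)
qed

text \<open>The vector product, whose components are, up to sign, the minors of the \<open>2 \<times> 3\<close> matrix
  with rows \<open>a 0\<close> and \<open>a 1\<close>. These are the coefficients of the pullbacks of the forms
  \<open>d\<zeta>\<^sub>p d\<zeta>\<^sub>q\<close>.\<close>

definition cross :: "(2 \<Rightarrow> complex^3) \<Rightarrow> 3 \<Rightarrow> complex" where
  "cross a j = (if j = 0 then a 0 $ 1 * a 1 $ 2 - a 0 $ 2 * a 1 $ 1
     else if j = 1 then a 0 $ 2 * a 1 $ 0 - a 0 $ 0 * a 1 $ 2
     else a 0 $ 0 * a 1 $ 1 - a 0 $ 1 * a 1 $ 0)"

lemma cases_3: obtains "j = (0::3)" | "j = 1" | "j = 2"
  using UNIV_3' by auto

lemma cross_minor: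
  obtains p q where "UNIV - {j} = {p, q}" "p < q"
    "\<forall>a. a 0 $ p * a 1 $ q - a 1 $ p * a 0 $ q = esgn j * cross a j"
proof (cases j rule: cases_3)
  case 1
  have "UNIV - {0} = {1, 2::3}" unfolding UNIV_3' by (simp add: insert_Diff_if)
  then show ?thesis using 1 that[of 1 2] by (simp add: cross_def esgn_def mult.commute)
next
  case 2
  have "UNIV - {1} = {0, 2::3}" unfolding UNIV_3' by (simp add: insert_Diff_if)
  then show ?thesis using 2 that[of 0 2] by (simp add: cross_def esgn_def mult.commute)
next
  case 3
  have "UNIV - {2} = {0, 1::3}" unfolding UNIV_3' by (simp add: insert_Diff_if)
  then show ?thesis using 3 that[of 0 1] by (simp add: cross_def esgn_def mult.commute)
qed

lemma top_product_hol:
  "((\<Sum>k\<in>UNIV. \<alpha> k *\<^sub>e gen (D\<zeta> k)) \<and>\<^sub>e (\<Sum>k\<in>UNIV. \<beta> k *\<^sub>e gen (D\<zeta> k)) \<and>\<^sub>e c) ({D\<zeta> (0::2), D\<zeta> 1} \<union> B)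
    = (\<alpha> 0 * \<beta> 1 - \<alpha> 1 * \<beta> 0) * c B" if B: "B \<inter> range D\<zeta> = {}"
proof -
  have nB: "D\<zeta> k \<notin> B" for k using B by auto
  have e: "insert (D\<zeta> 0) (insert (D\<zeta> 1) B) - {D\<zeta> (0::2)} = insert (D\<zeta> 1) B"
    "insert (D\<zeta> 0) (insert (D\<zeta> 1) B) - {D\<zeta> (1::2)} = insert (D\<zeta> 0) B"
    "insert (D\<zeta> 1) B - {D\<zeta> (1::2)} = B" "insert (D\<zeta> 0) B - {D\<zeta> (0::2)} = B"
    using nB by (auto simp: insert_Diff_if)
  have z: "below (D\<zeta> k) B = 0" for k
  proof -
    have "\<not> j < D\<zeta> k" if "j \<in> B" for j using nB that by (cases j) auto
    then show ?thesis by (simp add: below_def card_eq_0_iff)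
  qed
  have b: "below (D\<zeta> 0) (insert (D\<zeta> (1::2)) B) = 0" "below (D\<zeta> 1) (insert (D\<zeta> (0::2)) B) = 1"
    using nB z by simp_all
  show ?thesis
    unfolding Un_insert_left Un_empty_left wedge_lin_left
    unfolding sum_2' e b z
    using nB by (simp add: algebra_simps)
qed

lemma top_product_antihol:
  "((\<Sum>k\<in>UNIV. \<alpha> k *\<^sub>e gen (D\<zeta>b k)) \<and>\<^sub>e (\<Sum>k\<in>UNIV. \<beta> k *\<^sub>e gen (D\<zeta>b k)) \<and>\<^sub>e eone) {D\<zeta>b (0::2), D\<zeta>b 1}
    = \<alpha> 0 * \<beta> 1 - \<alpha> 1 * \<beta> 0"
proof -
  have e: "{D\<zeta>b 0, D\<zeta>b 1} - {D\<zeta>b (0::2)} = {D\<zeta>b 1}" "{D\<zeta>b 0, D\<zeta>b 1} - {D\<zeta>b (1::2)} = {D\<zeta>b 0}"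
    "{D\<zeta>b 1} - {D\<zeta>b (1::2)} = {}" "{D\<zeta>b 0} - {D\<zeta>b (0::2)} = {}"
    by (simp_all add: insert_Diff_if)
  have b: "below (D\<zeta>b 0) {D\<zeta>b (1::2)} = 0" "below (D\<zeta>b 1) {D\<zeta>b (0::2)} = 1"
    by simp_all
  show ?thesis
    unfolding wedge_lin_left
    unfolding sum_2' e b by (simp add: eone_def algebra_simps)
qed

text \<open>Pullback of a generator and, below, of a monomial given as a list of generators; \<^const>\<open>pull\<close>
  is a linear combination of the latter.\<close>

definition pull_gen :: "('k::{finite,linorder} \<Rightarrow> complex^'n::{finite,linorder}) \<Rightarrow> 'n covec \<Rightarrow> 'k covec ext" where
  "pull_gen a i = (case i of
       D\<zeta> j \<Rightarrow> (\<Sum>k\<in>UNIV. (a k $ j) *\<^sub>e gen (D\<zeta> k))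
     | D\<zeta>b j \<Rightarrow> (\<Sum>k\<in>UNIV. cnj (a k $ j) *\<^sub>e gen (D\<zeta>b k))
     | Dzb j \<Rightarrow> 0)"

definition pull_mon :: "('k::{finite,linorder} \<Rightarrow> complex^'n::{finite,linorder}) \<Rightarrow> 'n covec list \<Rightarrow> 'k covec ext" where
  "pull_mon a xs = foldr (\<lambda>i. wedge (pull_gen a i)) xs eone"

lemma pull_apply: "pull a A S = (\<Sum>T\<in>UNIV. A T * pull_mon a (sorted_list_of_set T) S)"
  unfolding pull_def ext_map_def
  unfolding pull_gen_def[symmetric]
  unfolding pull_mon_def[symmetric] sum_ext_apply escale_def ..

lemma pull_mon_simps [simp]: "pull_mon a [] = eone" "pull_mon a (i # xs) = pull_gen a i \<and>\<^sub>e pull_mon a xs"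
  by (simp_all add: pull_mon_def)

lemma wedge_zero_right: "a \<and>\<^sub>e 0 = 0"
  by (auto simp: fun_eq_iff wedge_def)

lemma pull_mon_Dzb: "Dzb j \<in> set xs \<Longrightarrow> pull_mon a xs = 0"
proof (induction xs)
  case (Cons i xs)
  show ?case
  proof (cases "i = Dzb j")
    case True
    show ?thesis by (simp only: True pull_mon_simps pull_gen_def covec.case wedge_zero_left)
  next
    case False
    then have "Dzb j \<in> set xs" using Cons.prems by simp
    then have "pull_mon a xs = 0" by (rule Cons.IH)
    then show ?thesis by (simp only: pull_mon_simps wedge_zero_right)
  qed
qed simp

text \<open>The pullback by a complex linear map preserves the degrees in both kinds of differentials.
  Hence only the monomials of degree \<open>(2,2)\<close>, or \<open>(2,0)\<close>, contribute to the top coefficients in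
  \<open>pull_top\<close> and \<open>pull_hol_top\<close>.\<close>

lemma graded_pull_mon:
  fixes a :: "'k::{finite,linorder} \<Rightarrow> complex^'n::{finite,linorder}"
  shows "graded (range D\<zeta>) (length (filter (\<lambda>i. i \<in> range D\<zeta>) xs)) (pull_mon a xs)"
    and "graded (range D\<zeta>b) (length (filter (\<lambda>i. i \<in> range D\<zeta>b) xs)) (pull_mon a xs)"
proof -
  have h: "graded (range D\<zeta>) (if i \<in> range D\<zeta> then 1 else 0) (pull_gen a i)" for i
  proof (cases i)
    case (D\<zeta> j)
    have "graded (range D\<zeta>) 1 (pull_gen a i)"
      unfolding D\<zeta> pull_gen_def covec.case
      by (intro graded_sum graded_escale graded_gen_in) simp
    then show ?thesis using D\<zeta> by simp
  next
    case (D\<zeta>b j)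
    have n: "D\<zeta>b j \<notin> range D\<zeta>" for j :: 'k by auto
    have "graded (range D\<zeta>) 0 (pull_gen a i)"
      unfolding D\<zeta>b pull_gen_def covec.case
      by (intro graded_sum graded_escale graded_gen_notin n)
    then show ?thesis unfolding D\<zeta>b by auto
  next
    case (Dzb j)
    have n: "pull_gen a i = 0" by (simp only: Dzb pull_gen_def covec.case)
    show ?thesis unfolding n by simp
  qed
  have h': "graded (range D\<zeta>b) (if i \<in> range D\<zeta>b then 1 else 0) (pull_gen a i)" for i
  proof (cases i)
    case (D\<zeta>b j)
    have "graded (range D\<zeta>b) 1 (pull_gen a i)"
      unfolding D\<zeta>b pull_gen_def covec.case
      by (intro graded_sum graded_escale graded_gen_in) simp
    then show ?thesis using D\<zeta>b by simp
  next
    case (D\<zeta> j)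
    have n: "D\<zeta> j \<notin> range D\<zeta>b" for j :: 'k by auto
    have "graded (range D\<zeta>b) 0 (pull_gen a i)"
      unfolding D\<zeta> pull_gen_def covec.case
      by (intro graded_sum graded_escale graded_gen_notin n)
    then show ?thesis unfolding D\<zeta> by auto
  next
    case (Dzb j)
    have n: "pull_gen a i = 0" by (simp only: Dzb pull_gen_def covec.case)
    show ?thesis unfolding n by simp
  qed
  show "graded (range D\<zeta>) (length (filter (\<lambda>i. i \<in> range D\<zeta>) xs)) (pull_mon a xs)"
  proof (induction xs)
    case (Cons i xs)
    from graded_wedge[OF h[of i] Cons] show ?case by (simp split: if_splits)
  qed (simp add: graded_eone)
  show "graded (range D\<zeta>b) (length (filter (\<lambda>i. i \<in> range D\<zeta>b) xs)) (pull_mon a xs)"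
  proof (induction xs)
    case (Cons i xs)
    from graded_wedge[OF h'[of i] Cons] show ?case by (simp split: if_splits)
  qed (simp add: graded_eone)
qed

lemma pull_mon_nonzero:
  fixes a :: "'k::{finite,linorder} \<Rightarrow> complex^'n::{finite,linorder}"
  assumes "pull_mon a (sorted_list_of_set T) S \<noteq> 0"
  obtains J L where "T = D\<zeta> ` J \<union> D\<zeta>b ` L" "card J = card (S \<inter> range D\<zeta>)" "card L = card (S \<inter> range D\<zeta>b)"
proof -
  have len: "length (filter P (sorted_list_of_set T)) = card {x \<in> T. P x}" for P
    by (metis distinct_card distinct_filter distinct_sorted_list_of_set finite set_filter set_sorted_list_of_set)
  have "\<not> (\<exists>j. Dzb j \<in> T)"
    using pull_mon_Dzb[of _ "sorted_list_of_set T" a] assms by auto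
  then have T: "T = D\<zeta> ` (D\<zeta> -` T) \<union> D\<zeta>b ` (D\<zeta>b -` T)"
  proof -
    have "x \<in> D\<zeta> ` (D\<zeta> -` T) \<union> D\<zeta>b ` (D\<zeta>b -` T)" if "x \<in> T" for x
      using that \<open>\<not> (\<exists>j. Dzb j \<in> T)\<close> by (cases x) auto
    then show ?thesis by auto
  qed
  have "card {x \<in> T. x \<in> range D\<zeta>} = card (S \<inter> range D\<zeta>)" "card {x \<in> T. x \<in> range D\<zeta>b} = card (S \<inter> range D\<zeta>b)"
    using graded_pull_mon[of "sorted_list_of_set T" a] assms unfolding len graded_def by auto
  moreover have e: "{x \<in> T. x \<in> range D\<zeta>} = D\<zeta> ` (D\<zeta> -` T)" "{x \<in> T. x \<in> range D\<zeta>b} = D\<zeta>b ` (D\<zeta>b -` T)"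
    by auto
  have "card {x \<in> T. x \<in> range D\<zeta>} = card (D\<zeta> -` T)" "card {x \<in> T. x \<in> range D\<zeta>b} = card (D\<zeta>b -` T)"
    unfolding e by (intro card_image inj_onI; simp)+
  ultimately have "card (D\<zeta> -` T) = card (S \<inter> range D\<zeta>)" "card (D\<zeta>b -` T) = card (S \<inter> range D\<zeta>b)"
    by metis+
  then show ?thesis using that T by blast
qed

lemma card_2_of_3: "card (J :: 3 set) = 2 \<Longrightarrow> \<exists>j. J = UNIV - {j}"
proof -
  assume "card J = 2"
  then have "card (UNIV - J) = 1" by (simp add: card_Diff_subset)
  then obtain j where "UNIV - J = {j}" by (auto simp: card_1_singleton_iff)
  then have "J = UNIV - {j}" by auto
  then show ?thesis by blast
qed

lemma inj_minus_singleton: "UNIV - {j} = UNIV - {l} \<Longrightarrow> j = l"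
  by auto

lemma pull_mon_top:
  "pull_mon a (sorted_list_of_set (D\<zeta> ` (UNIV - {j}) \<union> D\<zeta>b ` (UNIV - {l}))) (range D\<zeta> \<union> range D\<zeta>b)
    = esgn j * esgn l * (cross a j * cnj (cross a l))" for a :: "2 \<Rightarrow> complex^3"
proof -
  obtain p q where pq: "UNIV - {j} = {p, q}" "p < q"
    "\<forall>a. a 0 $ p * a 1 $ q - a 1 $ p * a 0 $ q = esgn j * cross a j" by (rule cross_minor[of j])
  obtain r s where rs: "UNIV - {l} = {r, s}" "r < s"
    "\<forall>a. a 0 $ r * a 1 $ s - a 1 $ r * a 0 $ s = esgn l * cross a l" by (rule cross_minor[of l])
  have "sorted_list_of_set (set [D\<zeta> p, D\<zeta> q, D\<zeta>b r, D\<zeta>b s]) = [D\<zeta> p, D\<zeta> q, D\<zeta>b r, D\<zeta>b s]"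
    using pq(2) rs(2) by (intro sorted_list_of_set.idem_if_sorted_distinct) (auto simp: less_imp_le)
  moreover have "D\<zeta> ` (UNIV - {j}) \<union> D\<zeta>b ` (UNIV - {l}) = set [D\<zeta> p, D\<zeta> q, D\<zeta>b r, D\<zeta>b s]"
    unfolding pq(1) rs(1) by auto
  ultimately have e: "sorted_list_of_set (D\<zeta> ` (UNIV - {j}) \<union> D\<zeta>b ` (UNIV - {l})) = [D\<zeta> p, D\<zeta> q, D\<zeta>b r, D\<zeta>b s]"
    by simp
  have i: "{D\<zeta>b (0::2), D\<zeta>b 1} \<inter> range D\<zeta> = {}" by auto
  have "cnj (a 0 $ r) * cnj (a 1 $ s) - cnj (a 1 $ r) * cnj (a 0 $ s) = cnj (esgn l * cross a l)"
    unfolding rs(3)[rule_format, symmetric] by simp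
  moreover have "cnj (esgn l) = esgn l" by (simp add: esgn_def)
  ultimately show ?thesis
    unfolding e range_D_zeta_2 range_D_zetab_2 pull_mon_simps pull_gen_def covec.case
      top_product_hol[OF i] top_product_antihol pq(3)[rule_format] by simp
qed

lemma pull_mon_hol_top:
  "pull_mon a (sorted_list_of_set (D\<zeta> ` (UNIV - {j}))) (range D\<zeta>) = esgn j * cross a j"
  for a :: "2 \<Rightarrow> complex^3"
proof -
  obtain p q where pq: "UNIV - {j} = {p, q}" "p < q"
    "\<forall>a. a 0 $ p * a 1 $ q - a 1 $ p * a 0 $ q = esgn j * cross a j" by (rule cross_minor[of j])
  have "sorted_list_of_set (set [D\<zeta> p, D\<zeta> q]) = [D\<zeta> p, D\<zeta> q]"
    using pq(2) by (intro sorted_list_of_set.idem_if_sorted_distinct) (auto simp: less_imp_le)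
  moreover have "D\<zeta> ` (UNIV - {j}) = set [D\<zeta> p, D\<zeta> q]"
    unfolding pq(1) by auto
  ultimately have e: "sorted_list_of_set (D\<zeta> ` (UNIV - {j})) = [D\<zeta> p, D\<zeta> q]"
    by simp
  have r: "range D\<zeta> = {D\<zeta> (0::2), D\<zeta> 1} \<union> {}" unfolding range_D_zeta_2 by simp
  show ?thesis
    unfolding e r pull_mon_simps pull_gen_def covec.case top_product_hol[OF Int_empty_left] pq(3)[rule_format]
    by (simp add: eone_def)
qed

lemma pull_top:
  fixes a :: "2 \<Rightarrow> complex^3"
  shows "pull a A (range D\<zeta> \<union> range D\<zeta>b) = (\<Sum>j\<in>UNIV. \<Sum>l\<in>UNIV.
     esgn j * esgn l * (cross a j * cnj (cross a l)) * A (D\<zeta> ` (UNIV - {j}) \<union> D\<zeta>b ` (UNIV - {l})))"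
proof -
  define Q :: "3 \<times> 3 \<Rightarrow> 3 covec set" where "Q = (\<lambda>(j, l). D\<zeta> ` (UNIV - {j}) \<union> D\<zeta>b ` (UNIV - {l}))"
  have inj: "inj Q"
  proof (rule injI)
    fix u v assume *: "Q u = Q v"
    have "D\<zeta> -` Q u = UNIV - {fst u}" "D\<zeta>b -` Q u = UNIV - {snd u}" for u
      by (cases u; auto simp: Q_def)+
    then show "u = v" using * inj_minus_singleton by (metis prod_eqI)
  qed
  have "pull a A (range D\<zeta> \<union> range D\<zeta>b) =
    (\<Sum>T\<in>range Q. A T * pull_mon a (sorted_list_of_set T) (range D\<zeta> \<union> range D\<zeta>b))"
    unfolding pull_apply
  proof (rule sum.mono_neutral_right)
    have c: "card ((range D\<zeta> \<union> range D\<zeta>b) \<inter> range D\<zeta> :: 2 covec set) = 2"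
      "card ((range D\<zeta> \<union> range D\<zeta>b) \<inter> range D\<zeta>b :: 2 covec set) = 2"
    proof -
      have "(range D\<zeta> \<union> range D\<zeta>b) \<inter> range D\<zeta> = {D\<zeta> (0::2), D\<zeta> 1}"
        "(range D\<zeta> \<union> range D\<zeta>b) \<inter> range D\<zeta>b = {D\<zeta>b (0::2), D\<zeta>b 1}"
        unfolding range_D_zeta_2 range_D_zetab_2 by auto
      then show "card ((range D\<zeta> \<union> range D\<zeta>b) \<inter> range D\<zeta> :: 2 covec set) = 2"
        "card ((range D\<zeta> \<union> range D\<zeta>b) \<inter> range D\<zeta>b :: 2 covec set) = 2" by simp_all
    qed
    show "\<forall>T\<in>UNIV - range Q. A T * pull_mon a (sorted_list_of_set T) (range D\<zeta> \<union> range D\<zeta>b) = 0"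
    proof (rule ballI, rule ccontr)
      fix T assume T: "T \<in> UNIV - range Q" "A T * pull_mon a (sorted_list_of_set T) (range D\<zeta> \<union> range D\<zeta>b) \<noteq> 0"
      then have "pull_mon a (sorted_list_of_set T) (range D\<zeta> \<union> range D\<zeta>b) \<noteq> 0" by simp
      then obtain J L where "T = D\<zeta> ` J \<union> D\<zeta>b ` L" "card J = 2" "card L = 2"
        using c by (elim pull_mon_nonzero) metis
      then obtain j l where "T = Q (j, l)" using card_2_of_3 unfolding Q_def by (metis prod.case)
      then show False using T by blast
    qed
  qed auto
  also have "\<dots> = (\<Sum>(j, l)\<in>UNIV. A (Q (j, l)) * pull_mon a (sorted_list_of_set (Q (j, l))) (range D\<zeta> \<union> range D\<zeta>b))"
    by (subst sum.reindex[OF inj]) (auto intro!: sum.cong)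
  also have "\<dots> = (\<Sum>j\<in>UNIV. \<Sum>l\<in>UNIV. A (Q (j, l)) * pull_mon a (sorted_list_of_set (Q (j, l))) (range D\<zeta> \<union> range D\<zeta>b))"
    unfolding UNIV_Times_UNIV[symmetric] by (rule sum.cartesian_product[symmetric])
  finally show ?thesis
    unfolding Q_def prod.case pull_mon_top by (simp only: mult.commute)
qed

lemma pull_hol_top:
  fixes a :: "2 \<Rightarrow> complex^3"
  shows "pull a A (range D\<zeta>) = (\<Sum>j\<in>UNIV. esgn j * cross a j * A (D\<zeta> ` (UNIV - {j})))"
proof -
  define Q :: "3 \<Rightarrow> 3 covec set" where "Q = (\<lambda>j. D\<zeta> ` (UNIV - {j}))"
  have inj: "inj Q"
  proof (rule injI)
    fix u v assume *: "Q u = Q v"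
    have "D\<zeta> -` Q u = UNIV - {u}" for u by (auto simp: Q_def)
    then show "u = v" using * inj_minus_singleton by metis
  qed
  have "pull a A (range D\<zeta>) = (\<Sum>T\<in>range Q. A T * pull_mon a (sorted_list_of_set T) (range D\<zeta>))"
    unfolding pull_apply
  proof (rule sum.mono_neutral_right)
    have c: "card (range D\<zeta> \<inter> range D\<zeta> :: 2 covec set) = 2"
      "card (range D\<zeta> \<inter> range D\<zeta>b :: 2 covec set) = 0"
      by (simp_all add: card_image inj_on_def) (auto simp: card_eq_0_iff)
    show "\<forall>T\<in>UNIV - range Q. A T * pull_mon a (sorted_list_of_set T) (range D\<zeta>) = 0"
    proof (rule ballI, rule ccontr)
      fix T assume T: "T \<in> UNIV - range Q" "A T * pull_mon a (sorted_list_of_set T) (range D\<zeta>) \<noteq> 0"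
      then have "pull_mon a (sorted_list_of_set T) (range D\<zeta>) \<noteq> 0" by simp
      then obtain J L where JL: "T = D\<zeta> ` J \<union> D\<zeta>b ` L" "card J = 2" "card L = 0"
        using c by (elim pull_mon_nonzero) metis
      then have "L = {}" by simp
      then obtain j where "T = Q j" using JL card_2_of_3[of J] unfolding Q_def by auto
      then show False using T by blast
    qed
  qed auto
  also have "\<dots> = (\<Sum>j\<in>UNIV. A (Q j) * pull_mon a (sorted_list_of_set (Q j)) (range D\<zeta>))"
    by (subst sum.reindex[OF inj]) simp
  finally show ?thesis
    unfolding Q_def pull_mon_hol_top by (simp only: mult.commute)
qed

section \<open>The tangent frame and the structure form\<close>

definition gradsq :: "(complex^3 \<Rightarrow> complex) \<Rightarrow> complex^3 \<Rightarrow> real" where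
  "gradsq f x = (\<Sum>l\<in>UNIV. (cmod (df f x l))\<^sup>2)"

lemma gradsq_eq: "complex_of_real (gradsq f x) = (\<Sum>l\<in>UNIV. df f x l * cnj (df f x l))"
  by (simp only: gradsq_def of_real_sum complex_norm_square)

lemma gradsq_pos: "\<exists>l. df f x l \<noteq> 0 \<Longrightarrow> gradsq f x > 0"
  unfolding gradsq_def by (auto intro!: sum_pos2)

text \<open>The property defining \<^const>\<open>tangent_frame\<close>, in terms of the coefficients \<open>g\<close> of the
  differential.\<close>

definition is_frame :: "(3 \<Rightarrow> complex) \<Rightarrow> (2 \<Rightarrow> complex^3) \<Rightarrow> bool" where
  "is_frame g a \<longleftrightarrow> (\<forall>k. (\<Sum>j\<in>UNIV. a k $ j * g j) = 0) \<and> hgram a = mat 1"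

lemma forall_2': "(\<forall>k::2. P k) \<longleftrightarrow> P 0 \<and> P 1"
  by (metis exhaust_2 two_eq_0)

lemma is_frame_iff:
  "is_frame g a \<longleftrightarrow>
     a 0 $ 0 * g 0 + a 0 $ 1 * g 1 + a 0 $ 2 * g 2 = 0 \<and>
     a 1 $ 0 * g 0 + a 1 $ 1 * g 1 + a 1 $ 2 * g 2 = 0 \<and>
     a 0 $ 0 * cnj (a 0 $ 0) + a 0 $ 1 * cnj (a 0 $ 1) + a 0 $ 2 * cnj (a 0 $ 2) = 1 \<and>
     a 0 $ 0 * cnj (a 1 $ 0) + a 0 $ 1 * cnj (a 1 $ 1) + a 0 $ 2 * cnj (a 1 $ 2) = 0 \<and>
     a 1 $ 0 * cnj (a 0 $ 0) + a 1 $ 1 * cnj (a 0 $ 1) + a 1 $ 2 * cnj (a 0 $ 2) = 0 \<and>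
     a 1 $ 0 * cnj (a 1 $ 0) + a 1 $ 1 * cnj (a 1 $ 1) + a 1 $ 2 * cnj (a 1 $ 2) = 1"
  unfolding is_frame_def hgram_def vec_eq_iff mat_def vec_lambda_beta forall_2' sum_3'
  by simp

lemma is_frame_exists:
  assumes g: "\<exists>l. g l \<noteq> 0"
  shows "\<exists>a. is_frame g a"
proof -
  \<comment> \<open>\<open>p\<close> is any nonzero vector in the kernel of \<open>g\<close>; \<open>q\<close> is the vector product of \<open>g\<close> and the
    conjugate of \<open>p\<close>, which is in the kernel and orthogonal to \<open>p\<close>. Both are normalized below.\<close>
  define p :: "3 \<Rightarrow> complex" where
    "p = (if g 0 \<noteq> 0 \<or> g 1 \<noteq> 0 then (\<lambda>j. if j = 0 then g 1 else if j = 1 then - g 0 else 0)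
          else (\<lambda>j. if j = 0 then 1 else 0))"
  have pg: "p 0 * g 0 + p 1 * g 1 + p 2 * g 2 = 0" by (simp add: p_def)
  have p0: "p 0 \<noteq> 0 \<or> p 1 \<noteq> 0 \<or> p 2 \<noteq> 0" by (simp add: p_def)
  define nsq where "nsq u = (cmod (u 0))\<^sup>2 + (cmod (u 1))\<^sup>2 + (cmod (u 2))\<^sup>2" for u :: "3 \<Rightarrow> complex"
  have nsq: "complex_of_real (nsq u) = u 0 * cnj (u 0) + u 1 * cnj (u 1) + u 2 * cnj (u 2)" for u
    by (simp only: nsq_def of_real_add complex_norm_square)
  have nsq_pos: "nsq u > 0" if "u 0 \<noteq> 0 \<or> u 1 \<noteq> 0 \<or> u 2 \<noteq> 0" for u
  proof -
    have pos: "(cmod (u j))\<^sup>2 > 0" if "u j \<noteq> 0" for j using that by simp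
    have nn: "(cmod (u j))\<^sup>2 \<ge> 0" for j by simp
    show ?thesis using that unfolding nsq_def
      by (elim disjE; use pos nn in \<open>smt (verit)\<close>)
  qed
  define q :: "3 \<Rightarrow> complex" where
    "q = (\<lambda>j. if j = 0 then g 1 * cnj (p 2) - g 2 * cnj (p 1)
       else if j = 1 then g 2 * cnj (p 0) - g 0 * cnj (p 2) else g 0 * cnj (p 1) - g 1 * cnj (p 0))"
  have q: "q 0 = g 1 * cnj (p 2) - g 2 * cnj (p 1)" "q 1 = g 2 * cnj (p 0) - g 0 * cnj (p 2)"
     "q 2 = g 0 * cnj (p 1) - g 1 * cnj (p 0)" by (simp_all add: q_def)
  have qg: "q 0 * g 0 + q 1 * g 1 + q 2 * g 2 = 0" unfolding q by algebra
  have qp: "q 0 * cnj (p 0) + q 1 * cnj (p 1) + q 2 * cnj (p 2) = 0" unfolding q by algebra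
  have pq: "p 0 * cnj (q 0) + p 1 * cnj (q 1) + p 2 * cnj (q 2) = 0"
    using arg_cong[OF qp, of cnj] by (simp add: mult.commute)
  have "\<exists>l. g l \<noteq> 0 \<and> (l = 0 \<or> l = 1 \<or> l = 2)" using g UNIV_3' by auto
  then have g0: "g 0 \<noteq> 0 \<or> g 1 \<noteq> 0 \<or> g 2 \<noteq> 0" by metis
  \<comment> \<open>Lagrange's identity, in which the mixed term vanishes.\<close>
  have qq: "complex_of_real (nsq q) = complex_of_real (nsq g) * complex_of_real (nsq p)"
  proof -
    have "complex_of_real (nsq q) = complex_of_real (nsq g) * complex_of_real (nsq p)
       - (p 0 * g 0 + p 1 * g 1 + p 2 * g 2) * cnj (p 0 * g 0 + p 1 * g 1 + p 2 * g 2)"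
      unfolding nsq q by (simp add: algebra_simps)
    then show ?thesis using pg by simp
  qed
  then have "nsq q = nsq g * nsq p" by (metis of_real_eq_iff of_real_mult)
  then have qpos: "nsq q > 0" using nsq_pos[OF g0] nsq_pos[OF p0] by simp
  have ppos: "nsq p > 0" by (rule nsq_pos[OF p0])
  define P where "P = complex_of_real (1 / sqrt (nsq p))"
  define Q where "Q = complex_of_real (1 / sqrt (nsq q))"
  have P: "cnj P = P" "P * P * complex_of_real (nsq p) = 1"
    using ppos unfolding P_def of_real_mult[symmetric] by (simp_all add: real_sqrt_mult_self)
  have Q: "cnj Q = Q" "Q * Q * complex_of_real (nsq q) = 1"
    using qpos unfolding Q_def of_real_mult[symmetric] by (simp_all add: real_sqrt_mult_self)
  define a :: "2 \<Rightarrow> complex^3" where "a = (\<lambda>k. if k = 0 then (\<chi> j. P * p j) else (\<chi> j. Q * q j))"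
  have "is_frame g a"
    unfolding is_frame_iff
  proof (intro conjI)
    show "a 0 $ 0 * g 0 + a 0 $ 1 * g 1 + a 0 $ 2 * g 2 = 0"
      using pg unfolding a_def by simp algebra
    show "a 1 $ 0 * g 0 + a 1 $ 1 * g 1 + a 1 $ 2 * g 2 = 0"
      using qg unfolding a_def by simp algebra
    show "a 0 $ 0 * cnj (a 0 $ 0) + a 0 $ 1 * cnj (a 0 $ 1) + a 0 $ 2 * cnj (a 0 $ 2) = 1"
      using P(2) unfolding nsq a_def by (simp add: P(1) algebra_simps)
    show "a 0 $ 0 * cnj (a 1 $ 0) + a 0 $ 1 * cnj (a 1 $ 1) + a 0 $ 2 * cnj (a 1 $ 2) = 0"
      using pq unfolding a_def by (simp add: P(1) Q(1)) algebra
    show "a 1 $ 0 * cnj (a 0 $ 0) + a 1 $ 1 * cnj (a 0 $ 1) + a 1 $ 2 * cnj (a 0 $ 2) = 0"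
      using qp unfolding a_def by (simp add: P(1) Q(1)) algebra
    show "a 1 $ 0 * cnj (a 1 $ 0) + a 1 $ 1 * cnj (a 1 $ 1) + a 1 $ 2 * cnj (a 1 $ 2) = 1"
      using Q(2) unfolding nsq a_def by (simp add: Q(1) algebra_simps)
  qed
  then show ?thesis by blast
qed

text \<open>Both \<open>g\<close> and the vector product are annihilated by the two vectors of the frame, hence
  proportional.\<close>

lemma frame_parallel:
  assumes "is_frame g a"
  shows "g j * cross a l = g l * cross a j"
proof -
  note F = assms[unfolded is_frame_iff]
  have 1: "g 0 * cross a 1 = g 1 * cross a 0"
    using F unfolding cross_def by simp algebra
  have 2: "g 0 * cross a 2 = g 2 * cross a 0"
    using F unfolding cross_def by simp algebra
  have 3: "g 1 * cross a 2 = g 2 * cross a 1"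
    using F unfolding cross_def by simp algebra
  show ?thesis
    by (cases j rule: cases_3; cases l rule: cases_3; simp only: 1 2 3)
qed

text \<open>Lagrange's identity for an orthonormal pair.\<close>

lemma frame_cross_unit:
  assumes "is_frame g a"
  shows "(\<Sum>j\<in>UNIV. cross a j * cnj (cross a j)) = 1"
proof -
  note F = assms[unfolded is_frame_iff]
  define A B C D where
    "A = a 0 $ 0 * cnj (a 0 $ 0) + a 0 $ 1 * cnj (a 0 $ 1) + a 0 $ 2 * cnj (a 0 $ 2)"
    and "B = a 0 $ 0 * cnj (a 1 $ 0) + a 0 $ 1 * cnj (a 1 $ 1) + a 0 $ 2 * cnj (a 1 $ 2)"
    and "C = a 1 $ 0 * cnj (a 0 $ 0) + a 1 $ 1 * cnj (a 0 $ 1) + a 1 $ 2 * cnj (a 0 $ 2)"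
    and "D = a 1 $ 0 * cnj (a 1 $ 0) + a 1 $ 1 * cnj (a 1 $ 1) + a 1 $ 2 * cnj (a 1 $ 2)"
  have "(\<Sum>j\<in>UNIV. cross a j * cnj (cross a j)) = A * D - B * C"
    unfolding sum_3' cross_def A_def B_def C_def D_def by (simp add: algebra_simps)
  also have "\<dots> = 1" using F by (simp add: A_def B_def C_def D_def)
  finally show ?thesis .
qed

text \<open>The vector product of a frame is \<open>g / |g|\<close> up to a phase, which depends on the frame but drops out
  of the products that occur in forms of bidegree \<open>(2,2)\<close>.\<close>

lemma frame_cross_outer:
  assumes "is_frame g a"
  shows "(\<Sum>m\<in>UNIV. g m * cnj (g m)) * (cross a j * cnj (cross a l)) = g j * cnj (g l)"
proof -
  have "(\<Sum>m\<in>UNIV. g m * cnj (g m)) * (cross a j * cnj (cross a l))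
    = (\<Sum>m\<in>UNIV. (g m * cross a j) * cnj (g m * cross a l))"
    by (simp add: sum_distrib_right sum_distrib_left ac_simps)
  also have "\<dots> = (\<Sum>m\<in>UNIV. (g j * cross a m) * cnj (g l * cross a m))"
    by (simp only: frame_parallel[OF assms])
  also have "\<dots> = g j * cnj (g l) * (\<Sum>m\<in>UNIV. cross a m * cnj (cross a m))"
    by (simp add: sum_distrib_left ac_simps)
  finally show ?thesis using frame_cross_unit[OF assms] by simp
qed

lemma tangent_frame_is_frame:
  assumes "\<And>h. frechet_derivative f (at x) h = (\<Sum>l\<in>UNIV. h $ l * df f x l)"
    and "\<exists>l. df f x l \<noteq> 0"
  shows "is_frame (df f x) (tangent_frame f x)"
proof -
  have "\<exists>a :: 2 \<Rightarrow> complex^3. (\<forall>k. frechet_derivative f (at x) (a k) = 0) \<and> hgram a = mat 1"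
    using is_frame_exists[OF assms(2)] unfolding is_frame_def assms(1) .
  then have "(\<forall>k. frechet_derivative f (at x) (tangent_frame f x k) = 0) \<and> hgram (tangent_frame f x) = mat 1"
    unfolding tangent_frame_def by (rule someI_ex)
  then show ?thesis unfolding is_frame_def assms(1) .
qed

text \<open>The frame, given only by a choice operator, is eliminated in favour of the differential of \<open>f\<close>.\<close>

lemma density22_formula:
  assumes "\<And>h. frechet_derivative f (at x) h = (\<Sum>l\<in>UNIV. h $ l * df f x l)"
    and "\<exists>l. df f x l \<noteq> 0"
  shows "density22 f x A = 4 / gradsq f x * (\<Sum>j\<in>UNIV. \<Sum>l\<in>UNIV. esgn j * esgn l *
     (df f x j * cnj (df f x l)) * A (D\<zeta> ` (UNIV - {j}) \<union> D\<zeta>b ` (UNIV - {l})))"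
proof -
  define a where "a = tangent_frame f x"
  have fr: "is_frame (df f x) a"
    unfolding a_def by (rule tangent_frame_is_frame[OF assms])
  have G: "gradsq f x > 0" by (rule gradsq_pos[OF assms(2)])
  have c: "cross a j * cnj (cross a l) = df f x j * cnj (df f x l) / gradsq f x" for j l
    using frame_cross_outer[OF fr, of j l] G unfolding gradsq_eq[symmetric]
    by (simp add: field_simps)
  show ?thesis
    unfolding density22_def restr_def a_def[symmetric] pull_top c
    by (simp add: sum_distrib_left sum_divide_distrib ac_simps)
qed

lemma structure_form_top:
  assumes "one_form g \<and>\<^sub>e w = (2 * pi * \<i>) *\<^sub>e d\<zeta>123"
  shows "(\<Sum>j\<in>UNIV. esgn j * g j * w (D\<zeta> ` (UNIV - {j}))) = 2 * pi * \<i>"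
  using one_form_wedge_top[of g w] unfolding assms by (simp add: escale_def d_zeta_123)

text \<open>The coefficients of \<open>\<omega>\<close> enter only through the sum evaluated in \<open>structure_form_top\<close>. One of
  the two factors \<open>df\<close> in \<open>density22_formula\<close> is used up in this sum, which leaves a coefficient
  of size \<open>1 / |df|\<close>.\<close>

lemma density22_structure:
  assumes lin: "\<And>h. frechet_derivative f (at x) h = (\<Sum>l\<in>UNIV. h $ l * df f x l)"
    and g0: "\<exists>l. df f x l \<noteq> 0"
    and w: "bidegree 2 0 w" "one_form (df f x) \<and>\<^sub>e w = (2 * pi * \<i>) *\<^sub>e d\<zeta>123"
  shows "density22 f x (z_coeff I (w \<and>\<^sub>e \<beta>)) = 8 * pi * \<i> / gradsq f x *
     (\<Sum>l\<in>UNIV. esgn l * cnj (df f x l) * \<beta> (D\<zeta>b ` (UNIV - {l}) \<union> Dzb ` I))"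
proof -
  have co: "z_coeff I (w \<and>\<^sub>e \<beta>) (D\<zeta> ` (UNIV - {j}) \<union> D\<zeta>b ` (UNIV - {l}))
      = w (D\<zeta> ` (UNIV - {j})) * \<beta> (D\<zeta>b ` (UNIV - {l}) \<union> Dzb ` I)" for j l
  proof -
    have "(D\<zeta> ` (UNIV - {j}) \<union> D\<zeta>b ` (UNIV - {l})) \<inter> range Dzb = {}" by auto
    then have "z_coeff I (w \<and>\<^sub>e \<beta>) (D\<zeta> ` (UNIV - {j}) \<union> D\<zeta>b ` (UNIV - {l}))
       = (w \<and>\<^sub>e \<beta>) (D\<zeta> ` (UNIV - {j}) \<union> (D\<zeta>b ` (UNIV - {l}) \<union> Dzb ` I))"
      unfolding z_coeff_def by (simp add: Un_assoc)
    also have "\<dots> = w (D\<zeta> ` (UNIV - {j})) * \<beta> (D\<zeta>b ` (UNIV - {l}) \<union> Dzb ` I)"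
    proof (rule wedge_hol_nonhol)
      show "(D\<zeta>b ` (UNIV - {l}) \<union> Dzb ` I) \<inter> range D\<zeta> = {}" by auto
      fix S assume "w S \<noteq> 0"
      then obtain J L where "S = D\<zeta> ` J \<union> D\<zeta>b ` L" "card J = 2" "card L = 0"
        using w(1) unfolding bidegree_def by blast
      moreover have "card (UNIV - {j}) = 2" by (simp add: card_Diff_subset)
      ultimately show "\<exists>J'. S = D\<zeta> ` J' \<and> card J' = card (UNIV - {j})" by auto
    qed
    finally show ?thesis .
  qed
  have "(\<Sum>j\<in>UNIV. \<Sum>l\<in>UNIV. esgn j * esgn l * (df f x j * cnj (df f x l)) *
      (w (D\<zeta> ` (UNIV - {j})) * \<beta> (D\<zeta>b ` (UNIV - {l}) \<union> Dzb ` I)))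
    = (\<Sum>j\<in>UNIV. esgn j * df f x j * w (D\<zeta> ` (UNIV - {j}))) *
      (\<Sum>l\<in>UNIV. esgn l * cnj (df f x l) * \<beta> (D\<zeta>b ` (UNIV - {l}) \<union> Dzb ` I))"
    unfolding sum_product by (simp add: ac_simps)
  then show ?thesis
    unfolding density22_formula[OF lin g0] co structure_form_top[OF w(2)]
    by (simp add: field_simps)
qed

text \<open>The coefficient \<open>R\<close> of \<open>\<omega>\<close> in the frame satisfies \<open>df\<^sub>l R = 2\<pi>i cross\<^sub>l\<close>, where \<open>cross\<close> has
  norm 1; so \<open>|df| |R| = 2\<pi>\<close>. The inequality turns the assumption \<open>\<omega> \<in> L^q\<close> into integrability of
  \<open>|df|\<close> to the power \<open>-q\<close>.\<close>

lemma form_norm_structure: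
  assumes lin: "\<And>h. frechet_derivative f (at x) h = (\<Sum>l\<in>UNIV. h $ l * df f x l)"
    and g0: "\<exists>l. df f x l \<noteq> 0"
    and w: "one_form (df f x) \<and>\<^sub>e w = (2 * pi * \<i>) *\<^sub>e d\<zeta>123"
  shows "2 * pi \<le> form_norm f x w * sqrt (gradsq f x)"
proof -
  define a where "a = tangent_frame f x"
  have fr: "is_frame (df f x) a"
    unfolding a_def by (rule tangent_frame_is_frame[OF lin g0])
  define R where "R = restr f x w (range D\<zeta>)"
  have R: "R = (\<Sum>j\<in>UNIV. esgn j * cross a j * w (D\<zeta> ` (UNIV - {j})))"
    unfolding R_def restr_def a_def[symmetric] pull_hol_top ..
  have Rl: "df f x l * R = 2 * pi * \<i> * cross a l" for l
  proof -
    have "df f x l * R = (\<Sum>j\<in>UNIV. esgn j * (df f x l * cross a j) * w (D\<zeta> ` (UNIV - {j})))"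
      unfolding R by (simp add: sum_distrib_left ac_simps)
    also have "\<dots> = (\<Sum>j\<in>UNIV. esgn j * (df f x j * cross a l) * w (D\<zeta> ` (UNIV - {j})))"
      by (simp only: frame_parallel[OF fr, of l])
    also have "\<dots> = (\<Sum>j\<in>UNIV. esgn j * df f x j * w (D\<zeta> ` (UNIV - {j}))) * cross a l"
      unfolding sum_distrib_right by (intro sum.cong) (simp_all add: ac_simps)
    finally show ?thesis unfolding structure_form_top[OF w] .
  qed
  have "complex_of_real (gradsq f x * (cmod R)\<^sup>2) = (\<Sum>l\<in>UNIV. (df f x l * R) * cnj (df f x l * R))"
    unfolding of_real_mult gradsq_eq complex_norm_square sum_distrib_right by (simp add: ac_simps)
  also have "\<dots> = (\<Sum>l\<in>UNIV. (2 * pi * \<i>) * cnj (2 * pi * \<i>) * (cross a l * cnj (cross a l)))"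
    unfolding Rl by (simp add: ac_simps)
  also have "\<dots> = complex_of_real ((2 * pi)\<^sup>2)"
    unfolding sum_distrib_left[symmetric] frame_cross_unit[OF fr] by (simp add: power2_eq_square)
  finally have "gradsq f x * (cmod R)\<^sup>2 = (2 * pi)\<^sup>2" by (simp only: of_real_eq_iff)
  then have "sqrt (gradsq f x) * cmod R = 2 * pi"
    by (metis abs_of_nonneg norm_ge_zero pi_ge_zero real_sqrt_abs real_sqrt_mult mult_nonneg_nonneg zero_le_numeral)
  moreover have "cmod R \<le> form_norm f x w"
  proof -
    have "(cmod R)\<^sup>2 \<le> (\<Sum>S\<in>UNIV. (cmod (restr f x w S))\<^sup>2)"
      unfolding R_def by (rule member_le_sum) auto
    then show ?thesis unfolding form_norm_def using real_le_rsqrt by blast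
  qed
  moreover have "0 \<le> sqrt (gradsq f x)" using gradsq_pos[OF g0] by simp
  ultimately show ?thesis
    using mult_right_mono[of "cmod R" "form_norm f x w" "sqrt (gradsq f x)"] by (simp add: mult.commute)
qed

lemma norm_axis_complex: "norm (axis l c :: complex^'n) = cmod c"
  unfolding norm_vec_def L2_set_def axis_def vec_lambda_beta
  by (simp add: if_distrib[of norm] if_distrib[of "\<lambda>x. x\<^sup>2"] cong: if_cong)

section \<open>Graph charts transversal to a direction\<close>

text \<open>The decomposition of the space into the line spanned by \<open>w\<close> and a complementary plane,
  the image of \<open>A\<close>. The map \<open>P\<close> is the projection along \<open>w\<close> and \<open>\<tau>\<close> the coordinate in the
  direction \<open>w\<close>.\<close>

definition splitting ::
  "complex^3 \<Rightarrow> (complex^2 \<Rightarrow> complex^3) \<Rightarrow> (complex^3 \<Rightarrow> complex^2) \<Rightarrow> (complex^3 \<Rightarrow> complex) \<Rightarrow> bool" where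
  "splitting w A P \<tau> \<longleftrightarrow> bounded_linear A \<and> bounded_linear P \<and>
     (\<forall>c u. A (c *s u) = c *s A u) \<and> (\<forall>c \<zeta>. P (c *s \<zeta>) = c *s P \<zeta>) \<and>
     (\<forall>u. P (A u) = u) \<and> P w = 0 \<and> (\<forall>\<zeta>. \<zeta> = A (P \<zeta>) + \<tau> \<zeta> *s w)"

lemma splitting_exists:
  assumes "w \<noteq> 0"
  obtains A P \<tau> where "splitting w A P \<tau>"
proof -
  obtain m where m: "w $ m \<noteq> 0" using assms by (auto simp: vec_eq_iff)
  obtain i j where ij: "UNIV - {m} = {i, j}" "i \<noteq> j"
    using cross_minor[of m] by (metis less_irrefl)
  have d: "i \<noteq> m" "j \<noteq> m" "i \<noteq> j" and ex: "k = i \<or> k = j \<or> k = m" for k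
    using ij by auto
  define A :: "complex^2 \<Rightarrow> complex^3" where
    "A u = (\<chi> k. if k = i then u $ 0 else if k = j then u $ 1 else 0)" for u
  define P :: "complex^3 \<Rightarrow> complex^2" where
    "P \<zeta> = (\<chi> k. if k = 0 then \<zeta> $ i - \<zeta> $ m * (w $ i / w $ m) else \<zeta> $ j - \<zeta> $ m * (w $ j / w $ m))" for \<zeta>
  have "linear A"
    by (rule linearI) (simp_all add: A_def vec_eq_iff)
  moreover have "linear P"
    by (rule linearI) (simp_all add: P_def vec_eq_iff divide_inverse algebra_simps)
  moreover have "\<forall>c u. A (c *s u) = c *s A u"
    by (simp add: A_def vec_eq_iff)
  moreover have "\<forall>c \<zeta>. P (c *s \<zeta>) = c *s P \<zeta>"
    by (simp add: P_def vec_eq_iff algebra_simps)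
  moreover have "\<forall>u. P (A u) = u"
    using d unfolding vec_eq_iff forall_2' by (simp add: P_def A_def)
  moreover have "P w = 0"
    using m unfolding vec_eq_iff forall_2' by (simp add: P_def)
  moreover have "\<forall>\<zeta>. \<zeta> = A (P \<zeta>) + (\<zeta> $ m / w $ m) *s w"
  proof
    fix \<zeta>
    have "\<zeta> $ k = (A (P \<zeta>) + (\<zeta> $ m / w $ m) *s w) $ k" for k
      using ex[of k] d m by (elim disjE) (simp_all add: A_def P_def)
    then show "\<zeta> = A (P \<zeta>) + (\<zeta> $ m / w $ m) *s w" unfolding vec_eq_iff by blast
  qed
  ultimately have "splitting w A P (\<lambda>\<zeta>. \<zeta> $ m / w $ m)"
    unfolding splitting_def linear_conv_bounded_linear by blast
  then show ?thesis by (rule that)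
qed

text \<open>A holomorphic parametrization \<open>\<psi>\<close> of \<open>{f = 0}\<close> in \<open>U\<close> that is a section of the projection
  \<open>P\<close>.\<close>

definition graph_chart ::
  "(complex^3 \<Rightarrow> complex) \<Rightarrow> (complex^3 \<Rightarrow> complex^2) \<Rightarrow> (complex^3) set \<Rightarrow> (complex^2) set \<Rightarrow>
   (complex^2 \<Rightarrow> complex^3) \<Rightarrow> bool" where
  "graph_chart f P U V \<psi> \<longleftrightarrow> open U \<and> open V \<and> (\<forall>j. holo_on V (\<lambda>u. \<psi> u $ j)) \<and>
     (\<forall>u\<in>V. \<psi> differentiable (at u)) \<and> \<psi> ` V = {\<zeta>\<in>U. f \<zeta> = 0} \<and> (\<forall>u\<in>V. P (\<psi> u) = u)"

text \<open>The holomorphic implicit function theorem. The map \<open>\<Phi>\<close> replaces the coordinate in the direction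
  \<open>w\<close> by the value of \<open>f\<close>; it is a local diffeomorphism because \<open>df(w) \<noteq> 0\<close>, and the restriction of
  its inverse to the image of \<open>A\<close> is the chart. The inverse is holomorphic because the inverse of a
  complex linear map is complex linear.\<close>

lemma graph_chart_exists:
  assumes f: "holo_on S f" and "open S" "x \<in> S" and w: "frechet_derivative f (at x) w \<noteq> 0"
    and sp: "splitting w A P \<tau>"
  obtains U V \<psi> where "graph_chart f P U V \<psi>" "x \<in> U" "U \<subseteq> S"
proof -
  have A: "bounded_linear A" and P: "bounded_linear P"
    and Ac: "\<And>c u. A (c *s u) = c *s A u" and Pc: "\<And>c \<zeta>. P (c *s \<zeta>) = c *s P \<zeta>"
    and PA: "\<And>u. P (A u) = u" and Pw: "P w = 0" and spl: "\<And>\<zeta>. \<zeta> = A (P \<zeta>) + \<tau> \<zeta> *s w"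
    using sp unfolding splitting_def by blast+
  define F where "F = (\<lambda>\<zeta>. frechet_derivative f (at \<zeta>))"
  have F: "(f has_derivative F \<zeta>) (at \<zeta>)" "linear (F \<zeta>)" "\<And>c v. F \<zeta> (c *s v) = c * F \<zeta> v" if "\<zeta> \<in> S" for \<zeta>
    using holo_on_frechet(1-3)[OF f that] unfolding F_def by blast+
  have w0: "w \<noteq> 0" using w linear_0[OF F(2)[OF \<open>x \<in> S\<close>]] unfolding F_def by auto
  define \<Phi> where "\<Phi> = (\<lambda>\<zeta>. A (P \<zeta>) + f \<zeta> *s w)"
  define \<Phi>' where "\<Phi>' = (\<lambda>\<zeta> h. A (P h) + F \<zeta> h *s w)"
  have PPhi: "P (\<Phi> \<zeta>) = P \<zeta>" for \<zeta>
    unfolding \<Phi>_def by (simp add: linear_add[OF bounded_linear.linear[OF P]] PA Pc Pw)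
  have PPhi': "P (\<Phi>' \<zeta> h) = P h" for \<zeta> h
    unfolding \<Phi>'_def by (simp add: linear_add[OF bounded_linear.linear[OF P]] PA Pc Pw)
  have der: "(\<Phi> has_derivative \<Phi>' \<zeta>) (at \<zeta>)" if "\<zeta> \<in> S" for \<zeta>
  proof -
    have "((\<lambda>\<zeta>. A (P \<zeta>)) has_derivative (\<lambda>h. A (P h))) (at \<zeta>)"
      by (intro bounded_linear.has_derivative[OF A] bounded_linear_imp_has_derivative[OF P])
    moreover have "((\<lambda>\<zeta>. f \<zeta> *s w) has_derivative (\<lambda>h. F \<zeta> h *s w)) (at \<zeta>)"
      by (rule bounded_linear.has_derivative[OF bounded_linear_scalar_mult F(1)[OF that]])
    ultimately show ?thesis unfolding \<Phi>_def \<Phi>'_def by (rule has_derivative_add)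
  qed
  have bl: "bounded_linear (\<Phi>' \<zeta>)" if "\<zeta> \<in> S" for \<zeta>
    using der[OF that] has_derivative_bounded_linear by blast
  have \<Phi>'_inj: "inj (\<Phi>' x)"
  proof (subst linear_injective_0[OF bounded_linear.linear[OF bl[OF \<open>x \<in> S\<close>]]], intro allI impI)
    fix h assume h: "\<Phi>' x h = 0"
    have "P h = 0" using PPhi'[of x h] h linear_0[OF bounded_linear.linear[OF P]] by simp
    have "h = A (P h) + \<tau> h *s w" by (rule spl)
    also have "\<dots> = \<tau> h *s w" using \<open>P h = 0\<close> linear_0[OF bounded_linear.linear[OF A]] by simp
    finally have h2: "h = \<tau> h *s w" .
    have "F x h *s w = 0"
      using h \<open>P h = 0\<close> linear_0[OF bounded_linear.linear[OF A]] unfolding \<Phi>'_def by simp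
    then have "F x h = 0" using w0 by (auto simp: vec_eq_iff)
    moreover have "F x h = \<tau> h * F x w"
      using arg_cong[OF h2, of "F x"] unfolding F(3)[OF \<open>x \<in> S\<close>] .
    ultimately have "\<tau> h = 0" using w unfolding F_def by simp
    then have "\<tau> h *s w = 0" by simp
    with h2 show "h = 0" by (rule trans)
  qed
  define D where "D = (\<lambda>\<zeta>. Blinfun (\<Phi>' \<zeta>))"
  have D: "blinfun_apply (D \<zeta>) = \<Phi>' \<zeta>" if "\<zeta> \<in> S" for \<zeta>
    unfolding D_def using bounded_linear_Blinfun_apply[OF bl[OF that]] .
  have contD: "continuous_on S D"
  proof (rule continuous_on_blinfun_componentwise)
    fix i :: "complex^3" assume "i \<in> Basis"
    have "continuous_on S (\<lambda>\<zeta>. A (P i) + F \<zeta> i *s w)"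
      unfolding F_def
      by (intro continuous_on_add continuous_on_const
          bounded_linear.continuous_on[OF bounded_linear_scalar_mult]
          continuous_on_frechet_holo[OF f \<open>open S\<close>])
    then show "continuous_on S (\<lambda>\<zeta>. blinfun_apply (D \<zeta>) i)"
      by (rule continuous_on_eq) (simp add: D \<Phi>'_def)
  qed
  obtain G where G: "linear G" "G \<circ> \<Phi>' x = id"
    using linear_injective_left_inverse[OF bounded_linear.linear[OF bl[OF \<open>x \<in> S\<close>]] \<Phi>'_inj] by blast
  have inv: "Blinfun G o\<^sub>L D x = id_blinfun"
  proof (rule blinfun_eqI)
    fix h
    have "G (\<Phi>' x h) = h" using G(2) by (metis comp_apply id_apply)
    then show "blinfun_apply (Blinfun G o\<^sub>L D x) h = blinfun_apply id_blinfun h"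
      using G(1) by (simp add: D[OF \<open>x \<in> S\<close>] linear_conv_bounded_linear bounded_linear_Blinfun_apply)
  qed
  have derD: "(\<Phi> has_derivative blinfun_apply (D \<zeta>)) (at \<zeta>)" if "\<zeta> \<in> S" for \<zeta>
    using der[OF that] D[OF that] by simp
  obtain U W g g' where U: "open U" "U \<subseteq> S" "x \<in> U" "open W" "\<Phi> x \<in> W" "homeomorphism U W \<Phi> g"
    and g: "\<And>y. y \<in> W \<Longrightarrow> (g has_derivative g' y) (at y)"
    and g': "\<And>y. y \<in> W \<Longrightarrow> g' y = inv (blinfun_apply (D (g y)))"
    and bij: "\<And>y. y \<in> W \<Longrightarrow> bij (blinfun_apply (D (g y)))"
    using inverse_function_theorem[OF \<open>open S\<close> derD contD \<open>x \<in> S\<close> inv] by metis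
  have gU: "g y \<in> U" "\<Phi> (g y) = y" if "y \<in> W" for y
    using U(6) that unfolding homeomorphism_def by auto
  have Ug: "\<Phi> \<zeta> \<in> W" "g (\<Phi> \<zeta>) = \<zeta>" if "\<zeta> \<in> U" for \<zeta>
    using U(6) that unfolding homeomorphism_def by auto
  define V where "V = A -` W"
  define \<psi> where "\<psi> = (\<lambda>u. g (A u))"
  have "open V" unfolding V_def
    using U(4) linear_continuous_on[OF A] by (simp add: open_vimage)
  have f0: "f (\<psi> u) = 0" "P (\<psi> u) = u" "\<psi> u \<in> U" if "u \<in> V" for u
  proof -
    have Au: "A u \<in> W" using that by (simp add: V_def)
    show "\<psi> u \<in> U" using gU(1)[OF Au] by (simp add: \<psi>_def)
    have e: "\<Phi> (\<psi> u) = A u" using gU(2)[OF Au] by (simp add: \<psi>_def)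
    show Pu: "P (\<psi> u) = u" using PPhi[of "\<psi> u"] e PA by simp
    have "f (\<psi> u) *s w = 0" using e Pu unfolding \<Phi>_def by simp
    then show "f (\<psi> u) = 0" using w0 by (auto simp: vec_eq_iff)
  qed
  have img: "\<psi> ` V = {\<zeta>\<in>U. f \<zeta> = 0}"
  proof
    show "\<psi> ` V \<subseteq> {\<zeta>\<in>U. f \<zeta> = 0}" using f0 by auto
    show "{\<zeta>\<in>U. f \<zeta> = 0} \<subseteq> \<psi> ` V"
    proof
      fix \<zeta> assume z: "\<zeta> \<in> {\<zeta>\<in>U. f \<zeta> = 0}"
      then have "\<Phi> \<zeta> = A (P \<zeta>)" unfolding \<Phi>_def by simp
      then have "P \<zeta> \<in> V" "\<psi> (P \<zeta>) = \<zeta>" using Ug[of \<zeta>] z by (simp_all add: V_def \<psi>_def)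
      then show "\<zeta> \<in> \<psi> ` V" by force
    qed
  qed
  have der\<psi>: "(\<psi> has_derivative (\<lambda>v. g' (A u) (A v))) (at u)" if "u \<in> V" for u
  proof -
    have "A u \<in> W" using that by (simp add: V_def)
    from has_derivative_compose[OF bounded_linear_imp_has_derivative[OF A] g[OF this]]
    show ?thesis by (simp add: \<psi>_def)
  qed
  have "holo_on V (\<lambda>u. \<psi> u $ j)" for j
    unfolding cholo_on_def
  proof (intro ballI exI conjI allI)
    fix u v assume u: "u \<in> V"
    show "((\<lambda>u. \<psi> u $ j) has_derivative (\<lambda>v. g' (A u) (A v) $ j)) (at u)"
      by (rule bounded_linear.has_derivative[OF bounded_linear_vec_nth der\<psi>[OF u]])
    have Au: "A u \<in> W" using u by (simp add: V_def)
    define B where "B = \<Phi>' (g (A u))"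
    have S: "g (A u) \<in> S" using gU(1)[OF Au] U(2) by blast
    have B: "bij B" "g' (A u) = inv B" using bij[OF Au] g'[OF Au] D[OF S] unfolding B_def by simp_all
    have Bi: "B (\<i> *s h) = \<i> *s B h" for h
      unfolding B_def \<Phi>'_def
      by (simp only: Pc Ac F(3)[OF S]) (simp add: vec_eq_iff algebra_simps)
    have "inv B (\<i> *s y) = \<i> *s inv B y" for y
    proof -
      have "B (\<i> *s inv B y) = \<i> *s y"
        unfolding Bi using B(1) by (simp add: bij_is_surj surj_f_inv_f)
      then show ?thesis using B(1) by (metis bij_inv_eq_iff)
    qed
    then show "g' (A u) (A (\<i> *s v)) $ j = \<i> * g' (A u) (A v) $ j"
      unfolding B(2) Ac by simp
  qed
  moreover have "\<psi> differentiable (at u)" if "u \<in> V" for u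
    using der\<psi>[OF that] differentiableI by blast
  ultimately have "graph_chart f P U V \<psi>"
    unfolding graph_chart_def using U(1) \<open>open V\<close> img f0(2) by blast
  then show ?thesis using that U(2,3) by blast
qed

text \<open>Hadamard's inequality for the Gram determinant.\<close>

lemma Re_det_hgram_le:
  "Re (det (hgram a)) \<le> (norm (a 1))\<^sup>2 * (norm (a 2))\<^sup>2" for a :: "2 \<Rightarrow> complex^3"
proof -
  have diag: "hgram a $ k $ k = complex_of_real ((norm (a k))\<^sup>2)" for k
    unfolding hgram_def norm_vec_def L2_set_def
    by (simp add: sum_nonneg complex_norm_square[symmetric])
  have off: "hgram a $ 2 $ 1 = cnj (hgram a $ 1 $ 2)"
    unfolding hgram_def by (simp add: mult.commute)
  have "det (hgram a) = complex_of_real ((norm (a 1))\<^sup>2 * (norm (a 2))\<^sup>2 - (cmod (hgram a $ 1 $ 2))\<^sup>2)"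
    unfolding det_2 diag off by (simp only: of_real_diff of_real_mult complex_norm_square)
  then show ?thesis by simp
qed

text \<open>A tangent vector of the graph over \<open>e\<close> has the form \<open>A e + t w\<close> with \<open>df(A e) + t df(w) = 0\<close>,
  so \<open>|t|\<close> is controlled by \<open>|df| / |df(w)|\<close>.\<close>

lemma graph_chart_columns_bound:
  assumes f: "holo_on S f" and ch: "graph_chart f P U V \<psi>" "U \<subseteq> S" and sp: "splitting w A P \<tau>"
    and u: "u \<in> V" and c: "0 < c" and B: "norm (A (axis k 1)) \<le> B" "norm w \<le> B"
    and tr: "c * (\<Sum>l\<in>UNIV. cmod (df f (\<psi> u) l)) \<le> cmod (frechet_derivative f (at (\<psi> u)) w)"
    and nz: "\<exists>l. df f (\<psi> u) l \<noteq> 0"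
  shows "norm (columns_of \<psi> u k) \<le> B + B / c * B"
proof -
  have P: "bounded_linear P" and PA: "\<And>u. P (A u) = u" and spl: "\<And>\<zeta>. \<zeta> = A (P \<zeta>) + \<tau> \<zeta> *s w"
    using sp unfolding splitting_def by blast+
  have V: "open V" "\<psi> differentiable (at u)" "\<And>u. u \<in> V \<Longrightarrow> P (\<psi> u) = u" "\<And>u. u \<in> V \<Longrightarrow> \<psi> u \<in> U \<and> f (\<psi> u) = 0"
    using ch(1) u unfolding graph_chart_def by auto
  define D where "D = frechet_derivative \<psi> (at u)"
  have D: "(\<psi> has_derivative D) (at u)"
    unfolding D_def using V(2) frechet_derivative_works by blast
  have S: "\<psi> u \<in> S" using V(4)[OF u] ch(2) by blast
  define F where "F = frechet_derivative f (at (\<psi> u))"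
  have F: "(f has_derivative F) (at (\<psi> u))" "linear F" "\<And>c v. F (c *s v) = c * F v"
    "\<And>h. F h = (\<Sum>l\<in>UNIV. h $ l * df f (\<psi> u) l)"
    unfolding F_def df_def by (fact holo_on_frechet[OF f S])+
  define N where "N = (\<Sum>l\<in>UNIV. cmod (df f (\<psi> u) l))"
  have N: "N > 0" using nz unfolding N_def by (auto intro!: sum_pos2)
  have FN: "cmod (F h) \<le> norm h * N" for h
  proof -
    have "cmod (F h) \<le> (\<Sum>l\<in>UNIV. cmod (h $ l * df f (\<psi> u) l))" unfolding F(4) by (rule norm_sum)
    also have "\<dots> \<le> (\<Sum>l\<in>UNIV. norm h * cmod (df f (\<psi> u) l))"
      unfolding norm_mult by (intro sum_mono mult_right_mono Finite_Cartesian_Product.norm_nth_le) auto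
    finally show ?thesis by (simp add: N_def sum_distrib_left)
  qed
  define e where "e = (axis k 1 :: complex^2)"
  have PD: "P (D e) = e"
  proof -
    have "((\<lambda>u. P (\<psi> u)) has_derivative (\<lambda>h. P (D h))) (at u)"
      by (rule bounded_linear.has_derivative[OF P D])
    moreover have "((\<lambda>u. P (\<psi> u)) has_derivative (\<lambda>h. h)) (at u)"
      by (rule has_derivative_transform_within_open[OF _ V(1) u]) (auto simp: V(3) intro: has_derivative_ident)
    ultimately show ?thesis using has_derivative_unique by metis
  qed
  have FD: "F (D e) = 0"
  proof -
    have "((\<lambda>u. f (\<psi> u)) has_derivative (\<lambda>h. F (D h))) (at u)"
      by (rule has_derivative_compose[OF D F(1)])
    moreover have "((\<lambda>u. f (\<psi> u)) has_derivative (\<lambda>h. 0)) (at u)"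
      by (rule has_derivative_transform_within_open[OF _ V(1) u]) (auto simp: V(4) intro: has_derivative_const)
    ultimately show ?thesis using has_derivative_unique by metis
  qed
  define t where "t = \<tau> (D e)"
  have De: "D e = A e + t *s w" using spl[of "D e"] unfolding PD t_def .
  have "F (A e) + t * F w = 0" using FD unfolding De by (simp add: linear_add[OF F(2)] F(3))
  then have "cmod t * cmod (F w) = cmod (F (A e))"
    by (metis add_eq_0_iff norm_minus_cancel norm_mult)
  moreover have "cmod (F (A e)) \<le> B * N"
    using FN[of "A e"] B(1) N unfolding e_def by (meson less_imp_le mult_right_mono order_trans)
  moreover have "cmod t * (c * N) \<le> cmod t * cmod (F w)"
    using tr unfolding N_def F_def by (intro mult_left_mono) auto
  ultimately have "cmod t * c * N \<le> B * N" by (simp add: mult.assoc)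
  then have "cmod t \<le> B / c" using N c by (simp add: pos_le_divide_eq)
  then have "norm (t *s w) \<le> B / c * B"
    unfolding norm_scalar_mult_vec using B(2) c
    by (intro mult_mono) (auto intro: order_trans[OF norm_ge_zero])
  then have "norm (D e) \<le> B + B / c * B"
    unfolding De using B(1) norm_triangle_ineq[of "A e" "t *s w"] unfolding e_def by linarith
  then show ?thesis by (simp add: columns_of_def D_def e_def)
qed

section \<open>Volume growth of the surface\<close>

locale surface =
  fixes \<Omega>' :: "(complex^3) set" and f :: "complex^3 \<Rightarrow> complex" and \<mu> :: "(complex^3) measure"
  assumes open_\<Omega>': "open \<Omega>'" and holo: "holo_on \<Omega>' f"
    and regular: "\<And>\<zeta>. \<zeta> \<in> hypersurface \<Omega>' f - {0} \<Longrightarrow> \<exists>l. df f \<zeta> l \<noteq> 0"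
    and volume: "induced_volume (hypersurface \<Omega>' f - {0}) \<mu>"
begin

abbreviation "X \<equiv> hypersurface \<Omega>' f"

lemma X_iff: "\<zeta> \<in> X \<longleftrightarrow> \<zeta> \<in> \<Omega>' \<and> f \<zeta> = 0"
  by (auto simp: hypersurface_def)

lemma df_linear:
  assumes "x \<in> \<Omega>'"
  shows "frechet_derivative f (at x) h = (\<Sum>l\<in>UNIV. h $ l * df f x l)"
  unfolding df_def by (rule holo_on_frechet(4)[OF holo assms])

lemma continuous_on_df: "continuous_on \<Omega>' (\<lambda>x. df f x l)"
  unfolding df_def by (rule continuous_on_frechet_holo[OF holo open_\<Omega>'])

lemma borel_restrict:
  assumes "continuous_on \<Omega>' (g :: complex^3 \<Rightarrow> 'b::topological_space)" "A \<in> sets borel"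
  shows "{x\<in>\<Omega>'. g x \<in> A} \<in> sets borel"
proof -
  have "g -` A \<inter> space (restrict_space borel \<Omega>') \<in> sets (restrict_space borel \<Omega>')"
    by (rule measurable_sets[OF borel_measurable_continuous_on_restrict[OF assms(1)] assms(2)])
  moreover have "g -` A \<inter> space (restrict_space borel \<Omega>') = {x\<in>\<Omega>'. g x \<in> A}"
    by (auto simp: space_restrict_space)
  ultimately show ?thesis
    using open_\<Omega>' by (simp add: sets_restrict_space_iff)
qed

lemma X_borel: "X \<in> sets borel"
  using borel_restrict[OF holo_on_continuous[OF holo], of "{0}"] by (simp add: hypersurface_def)

lemma R_borel: "X - {0} \<in> sets borel"
  using X_borel by simp

lemma sets_mu: "sets \<mu> = sets (restrict_space borel (X - {0}))"
  using volume by (simp add: induced_volume_def)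

lemma space_mu: "space \<mu> = X - {0}"
  using sets_eq_imp_space_eq[OF sets_mu] by (simp add: space_restrict_space)

lemma in_sets_mu: "B \<in> sets \<mu> \<longleftrightarrow> B \<in> sets borel \<and> B \<subseteq> X - {0}"
  unfolding sets_mu using R_borel by (auto simp: sets_restrict_space_iff)

lemma measurable_mu: "g \<in> borel_measurable borel \<Longrightarrow> g \<in> borel_measurable \<mu>"
  unfolding measurable_cong_sets[OF sets_mu refl] by (rule measurable_restrict_space1)

lemma emeasure_chart:
  fixes V :: "(complex^2) set"
  assumes "open V" "\<And>j. holo_on V (\<lambda>u. \<psi> u $ j)" "inj_on \<psi> V" "\<psi> ` V \<subseteq> X - {0}" "D \<in> sets borel" "D \<subseteq> V"
  shows "emeasure \<mu> (\<psi> ` D) = (\<integral>\<^sup>+u\<in>D. ennreal (Re (det (hgram (columns_of \<psi> u)))) \<partial>lborel)"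
proof -
  have "open V \<and> (\<forall>j. holo_on V (\<lambda>u. \<psi> u $ j)) \<and> inj_on \<psi> V \<and> \<psi> ` V \<subseteq> X - {0}"
    using assms(1-4) by blast
  with volume[unfolded induced_volume_def, THEN conjunct2, THEN spec, THEN spec]
  have "\<forall>D\<in>sets borel. D \<subseteq> V \<longrightarrow> emeasure \<mu> (\<psi> ` D) =
      (\<integral>\<^sup>+u\<in>D. ennreal (Re (det (hgram (columns_of \<psi> u)))) \<partial>lborel)"
    by (rule mp)
  then show ?thesis using assms(5,6) by blast
qed

text \<open>Countably many graph charts cover \<open>B\<close>, and \<open>B\<close> is cut into disjoint pieces, each in one chart.
  The volume of a piece is at most a constant times the volume of its projection, since the columns
  of the charts are bounded. At most \<open>n\<close> projections overlap at any point because their preimages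
  are different points of a fibre.\<close>

lemma emeasure_transversal:
  assumes sp: "splitting w A P \<tau>" and c: "0 < c"
    and Bd: "\<And>k. norm (A (axis k 1)) \<le> M" "norm w \<le> M"
    and B: "B \<in> sets \<mu>"
    and tr: "\<And>x. x \<in> B \<Longrightarrow> c * (\<Sum>l\<in>UNIV. cmod (df f x l)) \<le> cmod (frechet_derivative f (at x) w)"
    and fib: "\<And>Z. Z \<subseteq> B \<Longrightarrow> (\<And>x y. x \<in> Z \<Longrightarrow> y \<in> Z \<Longrightarrow> P x = P y) \<Longrightarrow> finite Z \<and> card Z \<le> n"
    and G: "G \<in> sets borel" "P ` B \<subseteq> G"
  shows "emeasure \<mu> B \<le> ennreal ((M + M / c * M) ^ 4 * n) * emeasure lborel G"
proof (cases "B = {}")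
  case False
  have Bb: "B \<in> sets borel" "B \<subseteq> X - {0}" using B in_sets_mu by auto
  define S where "S = \<Omega>' - {0}"
  have S: "open S" "S \<subseteq> \<Omega>'" using open_\<Omega>' by (auto simp: S_def open_delete)
  have fS: "holo_on S f" using holo_on_subset[OF holo S(2)] .
  define C where "C = (M + M / c * M) ^ 4"
  have M: "M \<ge> 0" using Bd(2) norm_ge_zero order_trans by blast
  have C: "C \<ge> 0" by (simp add: C_def)
  define \<F> where "\<F> = {U. U \<subseteq> S \<and> (\<exists>V \<psi>. graph_chart f P U V \<psi>)}"
  have \<F>_open: "\<And>U. U \<in> \<F> \<Longrightarrow> open U" unfolding \<F>_def graph_chart_def by blast
  have cover: "B \<subseteq> \<Union>\<F>"
  proof
    fix x assume x: "x \<in> B"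
    then have xS: "x \<in> S" and xR: "x \<in> X - {0}" using Bb(2) by (auto simp: S_def X_iff)
    have "(\<Sum>l\<in>UNIV. cmod (df f x l)) > 0" using regular[OF xR] by (auto intro!: sum_pos2)
    then have "cmod (frechet_derivative f (at x) w) > 0" using tr[OF x] c
      by (meson less_le_trans mult_pos_pos)
    then have "frechet_derivative f (at x) w \<noteq> 0" by simp
    then obtain U V \<psi> where "graph_chart f P U V \<psi>" "x \<in> U" "U \<subseteq> S"
      using graph_chart_exists[OF fS S(1) xS _ sp] by metis
    then show "x \<in> \<Union>\<F>" unfolding \<F>_def by blast
  qed
  obtain \<F>' where \<F>': "\<F>' \<subseteq> \<F>" "countable \<F>'" "\<Union>\<F>' = \<Union>\<F>"
    using Lindelof[OF \<F>_open] by metis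
  have ne: "\<F>' \<noteq> {}" using cover False \<F>'(3) by auto
  define U where "U = from_nat_into \<F>'"
  have U: "U i \<in> \<F>" for i using from_nat_into[OF ne, of i] \<F>'(1) unfolding U_def by blast
  have UU: "(\<Union>i. U i) = \<Union>\<F>" unfolding U_def using range_from_nat_into[OF ne \<F>'(2)] \<F>'(3) by simp
  have "\<forall>i. \<exists>V \<psi>. graph_chart f P (U i) V \<psi>" using U unfolding \<F>_def by blast
  then obtain V \<psi> where ch: "\<And>i. graph_chart f P (U i) (V i) (\<psi> i)" by metis
  have US: "U i \<subseteq> S" for i using U[of i] unfolding \<F>_def by blast
  have oV: "open (V i)" and hol: "\<And>j. holo_on (V i) (\<lambda>u. \<psi> i u $ j)"
    and img: "\<psi> i ` V i = {\<zeta>\<in>U i. f \<zeta> = 0}" and P\<psi>: "\<And>u. u \<in> V i \<Longrightarrow> P (\<psi> i u) = u"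
    and dif: "\<And>u. u \<in> V i \<Longrightarrow> \<psi> i differentiable (at u)" for i
    using ch[of i] unfolding graph_chart_def by blast+
  have cont: "continuous_on (V i) (\<psi> i)" for i
    by (intro continuous_at_imp_continuous_on ballI differentiable_imp_continuous_within dif)
  define A' where "A' = disjointed (\<lambda>i. B \<inter> U i)"
  have A'_sub: "A' i \<subseteq> B \<inter> U i" for i unfolding A'_def by (rule disjointed_subset)
  have A'_dis: "disjoint_family A'" unfolding A'_def by (rule disjoint_family_disjointed)
  have A'_un: "(\<Union>i. A' i) = B"
    unfolding A'_def UN_disjointed_eq using cover UU by auto
  have BU: "range (\<lambda>i. B \<inter> U i) \<subseteq> sets borel"
    using Bb(1) \<F>_open[OF U] by (auto intro!: sets.Int)
  have A'_borel: "A' i \<in> sets borel" for i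
    unfolding A'_def using sets.range_disjointed_sets[OF BU] by blast
  have A'_mu: "A' i \<in> sets \<mu>" for i
    using A'_borel A'_sub Bb(2) unfolding in_sets_mu by blast
  define D where "D i = {u\<in>V i. \<psi> i u \<in> A' i}" for i
  have D_borel: "D i \<in> sets borel" for i
  proof -
    have "\<psi> i -` A' i \<inter> space (restrict_space borel (V i)) \<in> sets (restrict_space borel (V i))"
      by (rule measurable_sets[OF borel_measurable_continuous_on_restrict[OF cont] A'_borel])
    moreover have "\<psi> i -` A' i \<inter> space (restrict_space borel (V i)) = D i"
      by (auto simp: space_restrict_space D_def)
    ultimately show ?thesis using oV[of i] by (simp add: sets_restrict_space_iff)
  qed
  have \<psi>D: "\<psi> i ` D i = A' i" for i
  proof
    show "\<psi> i ` D i \<subseteq> A' i" by (auto simp: D_def)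
    show "A' i \<subseteq> \<psi> i ` D i"
    proof
      fix x assume x: "x \<in> A' i"
      then have "x \<in> {\<zeta>\<in>U i. f \<zeta> = 0}" using A'_sub[of i] Bb(2) by (auto simp: X_iff)
      then obtain u where "u \<in> V i" "x = \<psi> i u" unfolding img[symmetric] by blast
      then show "x \<in> \<psi> i ` D i" using x unfolding D_def by blast
    qed
  qed
  have piece: "emeasure \<mu> (A' i) \<le> ennreal C * emeasure lborel (D i)" for i
  proof -
    have "inj_on (\<psi> i) (V i)" using P\<psi>[of _ i] by (metis inj_onI)
    moreover have "\<psi> i ` V i \<subseteq> X - {0}" using img[of i] US[of i] by (auto simp: S_def X_iff)
    ultimately have "emeasure \<mu> (A' i) = (\<integral>\<^sup>+u\<in>D i. ennreal (Re (det (hgram (columns_of (\<psi> i) u)))) \<partial>lborel)"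
      unfolding \<psi>D[of i, symmetric]
      by (intro emeasure_chart[OF oV hol _ _ D_borel]) (auto simp: D_def)
    also have "\<dots> \<le> (\<integral>\<^sup>+u. ennreal C * indicator (D i) u \<partial>lborel)"
    proof (rule nn_integral_mono)
      fix u
      show "ennreal (Re (det (hgram (columns_of (\<psi> i) u)))) * indicator (D i) u \<le> ennreal C * indicator (D i) u"
      proof (cases "u \<in> D i")
        case True
        then have u: "u \<in> V i" "\<psi> i u \<in> B" using A'_sub[of i] by (auto simp: D_def)
        have nz: "\<exists>l. df f (\<psi> i u) l \<noteq> 0" using regular Bb(2) u(2) by blast
        have col: "norm (columns_of (\<psi> i) u k) \<le> M + M / c * M" for k
          by (rule graph_chart_columns_bound[OF fS ch US sp u(1) c Bd tr[OF u(2)] nz])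
        have "Re (det (hgram (columns_of (\<psi> i) u))) \<le> (M + M / c * M)\<^sup>2 * (M + M / c * M)\<^sup>2"
          by (rule order_trans[OF Re_det_hgram_le]) (intro mult_mono power_mono col; simp)
        also have "\<dots> = C" by (simp add: C_def power_add[symmetric])
        finally show ?thesis by (intro mult_right_mono ennreal_leI) auto
      qed simp
    qed
    also have "\<dots> = ennreal C * emeasure lborel (D i)"
      using D_borel by (simp add: nn_integral_cmult_indicator)
    finally show ?thesis .
  qed
  have count: "(\<Sum>i. indicator (D i) u) \<le> ennreal n * indicator G u" for u
  proof -
    define I where "I = {i. u \<in> D i}"
    define Z where "Z = (\<lambda>i. \<psi> i u) ` I"
    have inA: "\<psi> i u \<in> A' i" "P (\<psi> i u) = u" if "i \<in> I" for i
      using that P\<psi> unfolding I_def D_def by auto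
    have ZB: "Z \<subseteq> B" using inA(1) A'_sub unfolding Z_def by blast
    have "finite Z \<and> card Z \<le> n"
      by (rule fib[OF ZB]) (auto simp: Z_def inA(2))
    moreover have "inj_on (\<lambda>i. \<psi> i u) I"
    proof (rule inj_onI)
      fix i j assume ij: "i \<in> I" "j \<in> I" "\<psi> i u = \<psi> j u"
      then have "\<psi> i u \<in> A' i \<inter> A' j" using inA(1) by force
      then show "i = j" using A'_dis unfolding disjoint_family_on_def by blast
    qed
    ultimately have I: "finite I" "card I \<le> n"
      unfolding Z_def by (auto simp: finite_image_iff card_image)
    have "(\<Sum>i. indicator (D i) u) = (\<Sum>i\<in>I. indicator (D i) u :: ennreal)"
      by (rule suminf_finite[OF I(1)]) (auto simp: I_def)
    also have "\<dots> = (\<Sum>i\<in>I. 1)" by (rule sum.cong) (auto simp: I_def)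
    also have "\<dots> = of_nat (card I)" by simp
    finally have eq: "(\<Sum>i. indicator (D i) u) = (of_nat (card I) :: ennreal)" .
    show ?thesis
    proof (cases "I = {}")
      case True
      then show ?thesis using eq by simp
    next
      case False
      then obtain i where "i \<in> I" by blast
      then have "u \<in> G" using inA A'_sub[of i] G(2) by (metis Int_iff image_subset_iff subsetD)
      moreover have "(of_nat (card I) :: ennreal) \<le> of_nat n" using I(2) by simp
      ultimately show ?thesis using eq by (simp add: ennreal_of_nat_eq_real_of_nat)
    qed
  qed
  have "emeasure \<mu> B = (\<Sum>i. emeasure \<mu> (A' i))"
  proof -
    have "range A' \<subseteq> sets \<mu>" using A'_mu by blast
    from suminf_emeasure[OF this A'_dis] show ?thesis unfolding A'_un by simp
  qed
  also have "\<dots> \<le> (\<Sum>i. ennreal C * emeasure lborel (D i))"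
    by (intro suminf_le piece) auto
  also have "\<dots> = (\<Sum>i. \<integral>\<^sup>+u. ennreal C * indicator (D i) u \<partial>lborel)"
    using D_borel by (simp add: nn_integral_cmult_indicator)
  also have "\<dots> = (\<integral>\<^sup>+u. (\<Sum>i. ennreal C * indicator (D i) u) \<partial>lborel)"
    using D_borel by (intro nn_integral_suminf[symmetric]) auto
  also have "\<dots> \<le> (\<integral>\<^sup>+u. ennreal (C * n) * indicator G u \<partial>lborel)"
  proof (rule nn_integral_mono)
    fix u
    have "(\<Sum>i. ennreal C * indicator (D i) u) = ennreal C * (\<Sum>i. indicator (D i) u)"
      by (rule ennreal_suminf_cmult)
    also have "\<dots> \<le> ennreal C * (ennreal n * indicator G u)"
      by (rule mult_left_mono[OF count]) simp
    also have "\<dots> = ennreal (C * n) * indicator G u"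
      using C by (simp add: ennreal_mult mult.assoc)
    finally show "(\<Sum>i. ennreal C * indicator (D i) u) \<le> ennreal (C * n) * indicator G u" .
  qed
  also have "\<dots> = ennreal (C * n) * emeasure lborel G"
    using G(1) by (simp add: nn_integral_cmult_indicator)
  finally show ?thesis by (simp add: C_def)
qed simp

text \<open>Otherwise all points of the ball would be in \<open>X\<close>, with \<open>df = 0\<close>; but the origin is the only
  point of \<open>X\<close> where \<open>df\<close> may vanish.\<close>

lemma not_locally_zero:
  assumes "x0 \<in> \<Omega>'" "e > 0"
  shows "\<exists>y\<in>ball x0 e. f y \<noteq> 0"
proof (rule ccontr)
  assume "\<not> ?thesis"
  then have z: "f y = 0" if "y \<in> ball x0 e" for y using that by blast
  obtain d where d: "d > 0" "ball x0 d \<subseteq> \<Omega>'"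
    using open_\<Omega>' assms(1) open_contains_ball by blast
  define T where "T = ball x0 (min d e)"
  have T: "open T" "x0 \<in> T" "T \<subseteq> \<Omega>'" "T \<subseteq> ball x0 e"
    using d assms(2) by (auto simp: T_def)
  have "T \<noteq> {0}" using T(1) not_open_singleton by metis
  then obtain y where y: "y \<in> T" "y \<noteq> 0" using T(2) by blast
  have "(f has_derivative (\<lambda>h. 0)) (at y)"
    by (rule has_derivative_transform_within_open[OF has_derivative_const[where c = 0] T(1) y(1)])
       (use z T(4) in \<open>simp add: subset_iff\<close>)
  then have "frechet_derivative f (at y) = (\<lambda>h. 0)" using frechet_derivative_at by metis
  then have "df f y l = 0" for l by (simp add: df_def)
  moreover have "y \<in> X - {0}" using y T z by (auto simp: X_iff)
  ultimately show False using regular by blast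
qed

text \<open>The part of \<open>X\<close> where \<open>|df(w)| \<ge> c |df|\<close> is projected along \<open>w\<close>: its intersection with a ball of
  radius \<open>r\<close> goes to a ball of radius \<open>\<kappa> r\<close> in a space of real dimension 4. Finitely many directions
  \<open>w\<close> close to the direction \<open>v\<close> with bounded numbers of zeros are needed.\<close>

lemma local_growth:
  assumes x0: "x0 \<in> X"
  obtains \<rho> C where "\<rho> > 0" "C \<ge> 0" "ball x0 \<rho> \<subseteq> \<Omega>'"
    "\<forall>z r. r > 0 \<longrightarrow> emeasure \<mu> ((X - {0}) \<inter> ball x0 \<rho> \<inter> ball z r) \<le> ennreal (C * r ^ 4)"
proof -
  have x0': "x0 \<in> \<Omega>'" "f x0 = 0" using x0 by (auto simp: X_iff)
  obtain v \<epsilon> \<rho> n where \<epsilon>: "\<epsilon> > 0" and \<rho>: "\<rho> > 0" "cball x0 \<rho> \<subseteq> \<Omega>'"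
    and lines: "\<forall>w\<in>ball v \<epsilon>. w \<noteq> 0 \<and> (\<forall>Z. Z \<subseteq> ball x0 \<rho> \<longrightarrow> (\<forall>\<zeta>\<in>Z. f \<zeta> = 0) \<longrightarrow>
       (\<forall>\<zeta>\<in>Z. \<forall>\<zeta>'\<in>Z. \<exists>t. \<zeta>' = \<zeta> + t *s w) \<longrightarrow> finite Z \<and> card Z \<le> n)"
    by (rule holo_on_zeros_on_lines[OF holo open_\<Omega>' x0'(1) _ x0'(2)])
       (use not_locally_zero[OF x0'(1)] in blast)
  define c where "c = \<epsilon> / 12"
  have c: "c > 0" using \<epsilon> by (simp add: c_def)
  define N where "N x = (\<Sum>l\<in>UNIV. cmod (df f x l))" for x
  define T where "T w = {x \<in> \<Omega>'. c * N x \<le> cmod (frechet_derivative f (at x) w)}" for w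
  have T_borel: "T w \<in> sets borel" for w
  proof -
    have "continuous_on \<Omega>' (\<lambda>x. cmod (frechet_derivative f (at x) w) - c * N x)"
      unfolding N_def by (intro continuous_intros continuous_on_df continuous_on_frechet_holo[OF holo open_\<Omega>'])
    from borel_restrict[OF this, of "{0..}"] show ?thesis by (simp add: T_def)
  qed
  have single: "\<exists>C\<ge>0. \<forall>B z r. B \<in> sets \<mu> \<longrightarrow> B \<subseteq> ball x0 \<rho> \<longrightarrow> B \<subseteq> T w \<longrightarrow> r > 0 \<longrightarrow> B \<subseteq> ball z r \<longrightarrow>
      emeasure \<mu> B \<le> ennreal (C * r ^ 4)" if w: "w \<in> ball v \<epsilon>" for w
  proof -
    obtain A P \<tau> where sp: "splitting w A P \<tau>" using splitting_exists lines w by metis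
    have P: "bounded_linear P" and spl: "\<And>\<zeta>. \<zeta> = A (P \<zeta>) + \<tau> \<zeta> *s w"
      using sp unfolding splitting_def by blast+
    obtain \<kappa> where \<kappa>: "\<kappa> > 0" "\<And>h. norm (P h) \<le> norm h * \<kappa>"
      using bounded_linear.pos_bounded[OF P] by blast
    define M where "M = norm w + (\<Sum>k\<in>UNIV. norm (A (axis k 1)))"
    have M: "norm (A (axis k 1)) \<le> M" "norm w \<le> M" for k
      unfolding M_def using member_le_sum[of k UNIV "\<lambda>k. norm (A (axis k 1))"]
      by (auto intro: add_increasing sum_nonneg)
    define C where "C = (M + M / c * M) ^ 4 * n * (unit_ball_vol 4 * \<kappa> ^ 4)"
    have "C \<ge> 0" by (simp add: C_def)
    moreover have "emeasure \<mu> B \<le> ennreal (C * r ^ 4)"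
      if B: "B \<in> sets \<mu>" "B \<subseteq> ball x0 \<rho>" "B \<subseteq> T w" "r > 0" "B \<subseteq> ball z r" for B z r
    proof -
      have BX: "B \<subseteq> X - {0}" using B(1) in_sets_mu by blast
      have "emeasure \<mu> B \<le> ennreal ((M + M / c * M) ^ 4 * n) * emeasure lborel (cball (P z) (\<kappa> * r))"
      proof (rule emeasure_transversal[OF sp c M B(1)])
        show "c * (\<Sum>l\<in>UNIV. cmod (df f x l)) \<le> cmod (frechet_derivative f (at x) w)" if "x \<in> B" for x
          using that B(3) by (auto simp: T_def N_def)
        show "P ` B \<subseteq> cball (P z) (\<kappa> * r)"
        proof
          fix u assume "u \<in> P ` B"
          then obtain \<zeta> where \<zeta>: "\<zeta> \<in> B" "u = P \<zeta>" by blast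
          have "norm (P z - P \<zeta>) \<le> norm (z - \<zeta>) * \<kappa>"
            using \<kappa>(2)[of "z - \<zeta>"] linear_diff[OF bounded_linear.linear[OF P]] by simp
          also have "\<dots> \<le> r * \<kappa>"
            using \<zeta>(1) B(5) \<kappa>(1) by (intro mult_right_mono) (auto simp: dist_norm subset_iff less_imp_le)
          finally show "u \<in> cball (P z) (\<kappa> * r)" by (simp add: \<zeta>(2) dist_norm mult.commute)
        qed
        fix Z assume Z: "Z \<subseteq> B" "\<And>x y. x \<in> Z \<Longrightarrow> y \<in> Z \<Longrightarrow> P x = P y"
        show "finite Z \<and> card Z \<le> n"
        proof (rule lines[rule_format, OF w, THEN conjunct2, rule_format])
          show "Z \<subseteq> ball x0 \<rho>" using Z(1) B(2) by blast
          show "f \<zeta> = 0" if "\<zeta> \<in> Z" for \<zeta> using that Z(1) BX by (auto simp: X_iff)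
          fix \<zeta> \<zeta>' assume h: "\<zeta> \<in> Z" "\<zeta>' \<in> Z"
          have "\<zeta>' - \<zeta> = (A (P \<zeta>') + \<tau> \<zeta>' *s w) - (A (P \<zeta>) + \<tau> \<zeta> *s w)"
            using spl[of \<zeta>] spl[of \<zeta>'] by (rule arg_cong2[of \<zeta>' _ \<zeta> _ minus, rotated])
          also have "\<dots> = (\<tau> \<zeta>' - \<tau> \<zeta>) *s w"
            using Z(2)[OF h] by (simp add: vector_sub_rdistrib)
          finally have "\<zeta>' = \<zeta> + (\<tau> \<zeta>' - \<tau> \<zeta>) *s w" by (metis add_diff_cancel_left' diff_add_cancel add.commute)
          then show "\<exists>t. \<zeta>' = \<zeta> + t *s w" by blast
        qed
      qed simp
      also have "emeasure lborel (cball (P z) (\<kappa> * r)) = ennreal (unit_ball_vol 4 * (\<kappa> * r) ^ 4)"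
        using emeasure_cball[of "\<kappa> * r" "P z"] \<kappa>(1) B(4) by simp
      also have "ennreal ((M + M / c * M) ^ 4 * n) * ennreal (unit_ball_vol 4 * (\<kappa> * r) ^ 4)
          = ennreal ((M + M / c * M) ^ 4 * n * (unit_ball_vol 4 * (\<kappa> * r) ^ 4))"
        by (rule ennreal_mult[symmetric]) simp_all
      also have "(M + M / c * M) ^ 4 * n * (unit_ball_vol 4 * (\<kappa> * r) ^ 4) = C * r ^ 4"
        by (simp only: C_def power_mult_distrib ac_simps)
      finally show ?thesis .
    qed
    ultimately show ?thesis by blast
  qed
  \<comment> \<open>The differences of these directions span the whole space, so \<open>df\<close> cannot be small on all
    of them. With \<open>c = \<epsilon> / 12\<close>, failure for all of them would give \<open>|df\<^sub>l| < |df| / 3\<close> for the sum norm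
    and each of the three components.\<close>
  define W where "W = insert v ((\<lambda>l. v + (\<epsilon> / 2) *\<^sub>R axis l 1) ` (UNIV :: 3 set))"
  have W: "W \<subseteq> ball v \<epsilon>" using \<epsilon> by (auto simp: W_def dist_norm norm_axis_complex)
  have finW: "finite W" by (simp add: W_def)
  have cover: "\<exists>w\<in>W. x \<in> T w" if x: "x \<in> X - {0}" for x
  proof (rule ccontr)
    assume no: "\<not> ?thesis"
    have xO: "x \<in> \<Omega>'" using x by (auto simp: X_iff)
    define F where "F = frechet_derivative f (at x)"
    have F: "linear F" unfolding F_def by (rule holo_on_frechet(2)[OF holo xO])
    have small: "cmod (F w) < c * N x" if "w \<in> W" for w
      using no that xO unfolding T_def F_def by force
    have "cmod (df f x l) < N x / 3" for l
    proof -
      have "F (v + (\<epsilon> / 2) *\<^sub>R axis l 1) = F v + (\<epsilon> / 2) *\<^sub>R F (axis l 1)"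
        by (simp add: linear_add[OF F] linear_scale[OF F])
      then have "(\<epsilon> / 2) *\<^sub>R df f x l = F (v + (\<epsilon> / 2) *\<^sub>R axis l 1) - F v"
        by (simp add: df_def F_def)
      then have "(\<epsilon> / 2) * cmod (df f x l) = cmod (F (v + (\<epsilon> / 2) *\<^sub>R axis l 1) - F v)"
        using \<epsilon> by (metis abs_of_pos half_gt_zero norm_scaleR)
      also have "\<dots> \<le> cmod (F (v + (\<epsilon> / 2) *\<^sub>R axis l 1)) + cmod (F v)" by (rule norm_triangle_ineq4)
      also have "\<dots> < c * N x + c * N x" by (intro add_strict_mono small) (auto simp: W_def)
      finally show ?thesis using \<epsilon> by (simp add: c_def field_simps)
    qed
    then have "N x < (\<Sum>l\<in>(UNIV :: 3 set). N x / 3)" unfolding N_def by (intro sum_strict_mono) auto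
    then show False by simp
  qed
  have all: "\<forall>w\<in>W. \<exists>C\<ge>0. \<forall>B z r. B \<in> sets \<mu> \<longrightarrow> B \<subseteq> ball x0 \<rho> \<longrightarrow> B \<subseteq> T w \<longrightarrow> r > 0 \<longrightarrow> B \<subseteq> ball z r \<longrightarrow>
      emeasure \<mu> B \<le> ennreal (C * r ^ 4)" using single W by blast
  obtain C where C': "\<forall>w\<in>W. C w \<ge> 0 \<and> (\<forall>B z r. B \<in> sets \<mu> \<longrightarrow> B \<subseteq> ball x0 \<rho> \<longrightarrow> B \<subseteq> T w \<longrightarrow> r > 0 \<longrightarrow> B \<subseteq> ball z r \<longrightarrow>
      emeasure \<mu> B \<le> ennreal (C w * r ^ 4))"
    using bchoice[OF all] by (rule exE)
  have C: "C w \<ge> 0" "\<And>B z r. B \<in> sets \<mu> \<Longrightarrow> B \<subseteq> ball x0 \<rho> \<Longrightarrow> B \<subseteq> T w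
     \<Longrightarrow> r > 0 \<Longrightarrow> B \<subseteq> ball z r \<Longrightarrow> emeasure \<mu> B \<le> ennreal (C w * r ^ 4)" if "w \<in> W" for w
    using C'[rule_format, OF that] by simp_all
  show ?thesis
  proof (rule that[OF \<rho>(1)], safe)
    show "0 \<le> sum C W" using C(1) by (rule sum_nonneg)
    show "x \<in> \<Omega>'" if "x \<in> ball x0 \<rho>" for x using that \<rho>(2) ball_subset_cball by blast
    fix z r assume r: "r > (0::real)"
    define B where "B w = (X - {0}) \<inter> ball x0 \<rho> \<inter> ball z r \<inter> T w" for w
    have B: "B w \<in> sets \<mu>" for w
      unfolding in_sets_mu B_def using R_borel T_borel[of w] by auto
    have "(X - {0}) \<inter> ball x0 \<rho> \<inter> ball z r = (\<Union>w\<in>W. B w)" using cover unfolding B_def by blast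
    then have "emeasure \<mu> ((X - {0}) \<inter> ball x0 \<rho> \<inter> ball z r) \<le> (\<Sum>w\<in>W. emeasure \<mu> (B w))"
      using emeasure_subadditive_finite[OF finW, of B \<mu>] B by auto
    also have "\<dots> \<le> (\<Sum>w\<in>W. ennreal (C w * r ^ 4))"
      by (intro sum_mono C(2)[OF _ B _ _ r]) (auto simp: B_def)
    also have "\<dots> = ennreal (sum C W * r ^ 4)"
      using C(1) r by (subst sum_ennreal) (auto simp: sum_distrib_right)
    finally show "emeasure \<mu> ((X - {0}) \<inter> ball x0 \<rho> \<inter> ball z r) \<le> ennreal (sum C W * r ^ 4)" .
  qed
qed

lemma compact_growth:
  assumes "compact L" "L \<subseteq> \<Omega>'"
  obtains C where "C \<ge> 0"
    "\<forall>z r. r > 0 \<longrightarrow> emeasure \<mu> ((X - {0}) \<inter> L \<inter> ball z r) \<le> ennreal (C * r ^ 4)"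
proof -
  have "\<exists>\<rho> C. \<rho> > 0 \<and> C \<ge> 0 \<and> (\<forall>z r. r > 0 \<longrightarrow>
      emeasure \<mu> ((X - {0}) \<inter> ball x \<rho> \<inter> ball z r) \<le> ennreal (C * r ^ 4))" if x: "x \<in> L" for x
  proof (cases "x \<in> X")
    case True
    then show ?thesis by (rule local_growth) blast
  next
    case False
    have "open {\<zeta>\<in>\<Omega>'. f \<zeta> \<in> - {0}}"
    proof -
      have "{\<zeta>\<in>\<Omega>'. f \<zeta> \<in> - {0}} = \<Omega>' \<inter> f -` (- {0})" by auto
      then show ?thesis
        using continuous_open_preimage[OF holo_on_continuous[OF holo] open_\<Omega>', of "- {0}"]
        by (simp add: open_delete open_Compl)
    qed
    moreover have "x \<in> {\<zeta>\<in>\<Omega>'. f \<zeta> \<in> - {0}}" using False x assms by (auto simp: X_iff)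
    ultimately obtain \<rho> where \<rho>: "\<rho> > 0" "ball x \<rho> \<subseteq> {\<zeta>\<in>\<Omega>'. f \<zeta> \<in> - {0}}"
      using open_contains_ball by blast
    then have "(X - {0}) \<inter> ball x \<rho> \<inter> ball z r = {}" for z r by (auto simp: X_iff)
    then show ?thesis using \<rho>(1) by (intro exI[of _ \<rho>] exI[of _ 0]) auto
  qed
  then obtain \<rho> C where \<rho>: "\<And>x. x \<in> L \<Longrightarrow> \<rho> x > 0" and C: "\<And>x. x \<in> L \<Longrightarrow> C x \<ge> 0"
    "\<And>x z r. x \<in> L \<Longrightarrow> r > 0 \<Longrightarrow> emeasure \<mu> ((X - {0}) \<inter> ball x (\<rho> x) \<inter> ball z r) \<le> ennreal (C x * r ^ 4)"
    by metis
  obtain F where F: "F \<subseteq> L" "finite F" "L \<subseteq> (\<Union>x\<in>F. ball x (\<rho> x))"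
  proof (rule compactE_image[OF assms(1), of L "\<lambda>x. ball x (\<rho> x)"])
    show "L \<subseteq> (\<Union>x\<in>L. ball x (\<rho> x))" using \<rho> by auto
  qed auto
  show ?thesis
  proof (rule that[of "sum C F"], safe)
    show "0 \<le> sum C F" using C(1) F(1) by (intro sum_nonneg) auto
    fix z r assume r: "r > (0::real)"
    define B where "B x = (X - {0}) \<inter> ball x (\<rho> x) \<inter> ball z r" for x
    have B: "B x \<in> sets \<mu>" for x
      unfolding in_sets_mu B_def using R_borel by auto
    have "(X - {0}) \<inter> L \<inter> ball z r \<subseteq> (\<Union>x\<in>F. B x)" using F(3) unfolding B_def by blast
    then have "emeasure \<mu> ((X - {0}) \<inter> L \<inter> ball z r) \<le> emeasure \<mu> (\<Union>x\<in>F. B x)"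
      using B F(2) by (intro emeasure_mono) auto
    also have "\<dots> \<le> (\<Sum>x\<in>F. emeasure \<mu> (B x))"
      using emeasure_subadditive_finite[OF F(2), of B \<mu>] B by auto
    also have "\<dots> \<le> (\<Sum>x\<in>F. ennreal (C x * r ^ 4))"
      unfolding B_def using F(1) r by (intro sum_mono C(2)) auto
    also have "\<dots> = ennreal (sum C F * r ^ 4)"
      using C(1) F(1) r by (subst sum_ennreal) (auto simp: sum_distrib_right subset_iff)
    finally show "emeasure \<mu> ((X - {0}) \<inter> L \<inter> ball z r) \<le> ennreal (sum C F * r ^ 4)" .
  qed
qed

lemma compact_measurable: "compact L \<Longrightarrow> (X - {0}) \<inter> L \<in> sets \<mu>"
  unfolding in_sets_mu using R_borel borel_compact by blast

lemma compact_finite: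
  assumes "compact L" "L \<subseteq> \<Omega>'"
  shows "emeasure \<mu> ((X - {0}) \<inter> L) < \<infinity>"
proof -
  obtain C where C: "\<forall>z r. r > 0 \<longrightarrow> emeasure \<mu> ((X - {0}) \<inter> L \<inter> ball z r) \<le> ennreal (C * r ^ 4)"
    by (rule compact_growth[OF assms])
  obtain r where r: "r > 0" "L \<subseteq> ball 0 r"
    using compact_imp_bounded[OF assms(1)] bounded_subset_ballD by blast
  have "(X - {0}) \<inter> L \<inter> ball 0 r = (X - {0}) \<inter> L" using r by blast
  then show ?thesis using C[rule_format, OF r(1), of 0] by (simp add: order_le_less_trans ennreal_less_top)
qed

text \<open>Sum over dyadic shells: where the distance to \<open>z\<close> is about \<open>2^(-k)\<close>, the kernel is at most
  \<open>2^(s(k+1))\<close> and the volume at most \<open>C 16^(-k)\<close>.\<close>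

lemma integral_kernel_bound:
  assumes L: "compact L" "L \<subseteq> \<Omega>'" and s: "0 \<le> s" "s < 4"
  obtains C where "C \<ge> 0"
    "\<forall>z. (\<integral>\<^sup>+\<zeta>\<in>(X - {0}) \<inter> L. ennreal (norm (\<zeta> - z) powr (- s)) \<partial>\<mu>) \<le> ennreal C"
proof -
  obtain C where C0: "C \<ge> 0" and C: "\<forall>z r. r > 0 \<longrightarrow> emeasure \<mu> ((X - {0}) \<inter> L \<inter> ball z r) \<le> ennreal (C * r ^ 4)"
    by (rule compact_growth[OF L])
  obtain m where m: "m \<ge> 0" "emeasure \<mu> ((X - {0}) \<inter> L) = ennreal m"
    using compact_finite[OF L] by (cases "emeasure \<mu> ((X - {0}) \<inter> L)") auto
  define q where "q = (2::real) powr s"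
  have q: "q > 0" "q / 16 < 1"
  proof -
    have "2 powr s < 2 powr (4::real)" using s by (intro powr_less_mono) auto
    also have "2 powr (4::real) = 16" by (simp add: powr_numeral)
    finally show "q / 16 < 1" by (simp add: q_def)
  qed (simp add: q_def)
  define E where "E = (X - {0}) \<inter> L"
  have E: "E \<in> sets \<mu>" unfolding E_def by (rule compact_measurable[OF L(1)])
  define c where "c k = q * C * (q / 16) ^ k" for k
  have sum: "summable c"
    unfolding c_def using q by (intro summable_mult summable_geometric) simp
  have c0: "c k \<ge> 0" for k using q C0 by (simp add: c_def)
  show ?thesis
  proof (rule that[of "m + suminf c", OF _ allI])
    show "0 \<le> m + suminf c" using m(1) suminf_nonneg[OF sum c0] by simp
    fix z
    define Ek where "Ek k = E \<inter> ball z ((1/2) ^ k)" for k :: nat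
    have Ek: "Ek k \<in> sets \<mu>" for k
      unfolding in_sets_mu Ek_def using E[unfolded in_sets_mu] by auto
    have "(\<integral>\<^sup>+\<zeta>\<in>E. ennreal (norm (\<zeta> - z) powr (- s)) \<partial>\<mu>)
        \<le> (\<integral>\<^sup>+\<zeta>. indicator E \<zeta> + (\<Sum>k. ennreal (q ^ Suc k) * indicator (Ek k) \<zeta>) \<partial>\<mu>)"
    proof (rule nn_integral_mono)
      fix \<zeta>
      define d where "d = norm (\<zeta> - z)"
      show "ennreal (norm (\<zeta> - z) powr (- s)) * indicator E \<zeta>
        \<le> indicator E \<zeta> + (\<Sum>k. ennreal (q ^ Suc k) * indicator (Ek k) \<zeta>)"
      proof (cases "\<zeta> \<in> E")
        case True
        consider "d = 0" | "d \<ge> 1" | "0 < d" "d < 1" using norm_ge_zero[of "\<zeta> - z"] by (force simp: d_def)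
        then show ?thesis
        proof cases
          case 1
          then show ?thesis by (simp add: d_def)
        next
          case 2
          have "d powr (- s) \<le> 1 powr (- s)" using 2 s(1) by (intro powr_mono2') auto
          then have "ennreal (d powr (- s)) \<le> 1" by (simp add: ennreal_le_1)
          then show ?thesis using True by (simp add: d_def add_increasing2)
        next
          case 3
          have ex: "\<exists>n. (1/2) ^ n \<le> d" using real_arch_pow_inv[OF 3(1), of "1/2"] by (auto intro: less_imp_le)
          \<comment> \<open>The index of the shell that contains \<open>\<zeta>\<close>.\<close>
          define n where "n = (LEAST n. (1/2) ^ n \<le> d)"
          have n: "(1/2) ^ n \<le> d" unfolding n_def using ex by (rule LeastI_ex)
          have "n \<noteq> 0" using n 3 by (metis power_0 not_le)
          then obtain k where k: "n = Suc k" by (cases n) auto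
          have "\<not> (1/2) ^ k \<le> d" using not_less_Least[of k "\<lambda>n. (1/2) ^ n \<le> d"] k unfolding n_def by simp
          then have in_Ek: "\<zeta> \<in> Ek k" using True by (simp add: Ek_def d_def dist_norm norm_minus_commute)
          have "d powr (- s) \<le> ((1/2) ^ n) powr (- s)"
            using n s(1) by (intro powr_mono2') auto
          also have "((1/2::real) ^ n) powr (- s) = q ^ n"
          proof -
            have "(1/2::real) ^ n = 2 powr (- real n)"
              by (simp add: powr_minus powr_realpow power_one_over inverse_eq_divide)
            then have "((1/2::real) ^ n) powr (- s) = 2 powr (s * real n)"
              by (simp add: powr_powr mult.commute)
            also have "\<dots> = q ^ n" by (simp add: q_def powr_powr[symmetric] powr_realpow)
            finally show ?thesis .
          qed
          finally have "ennreal (d powr (- s)) \<le> ennreal (q ^ Suc k) * indicator (Ek k) \<zeta>"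
            using in_Ek by (simp add: k ennreal_leI)
          also have "\<dots> \<le> (\<Sum>k. ennreal (q ^ Suc k) * indicator (Ek k) \<zeta>)"
          proof -
            define F :: "nat \<Rightarrow> ennreal" where "F = (\<lambda>k. ennreal (q ^ Suc k) * indicator (Ek k) \<zeta>)"
            have "F k \<le> suminf F" using sum_le_suminf[of F "{k}"] by simp
            then show ?thesis by (simp add: F_def)
          qed
          finally show ?thesis using True by (simp add: d_def add_increasing)
        qed
      qed simp
    qed
    also have "\<dots> = emeasure \<mu> E + (\<Sum>k. ennreal (q ^ Suc k) * emeasure \<mu> (Ek k))"
      using E Ek by (simp add: nn_integral_add nn_integral_suminf nn_integral_cmult_indicator del: power_Suc)
    also have "\<dots> \<le> ennreal m + (\<Sum>k. ennreal (c k))"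
    proof (intro add_mono suminf_le)
      show "emeasure \<mu> E \<le> ennreal m" using m(2) by (simp add: E_def)
      fix k
      have "emeasure \<mu> (Ek k) \<le> ennreal (C * ((1/2) ^ k) ^ 4)"
        unfolding Ek_def E_def by (rule C[rule_format]) simp
      also have "((1/2::real) ^ k) ^ 4 = (1/16) ^ k"
      proof -
        have "((1/2::real) ^ k) ^ 4 = ((1/2) ^ 4) ^ k"
          by (simp only: power_mult[symmetric] mult.commute)
        also have "(1/2::real) ^ 4 = 1/16" by (simp add: power_one_over)
        finally show ?thesis .
      qed
      finally have "ennreal (q ^ Suc k) * emeasure \<mu> (Ek k) \<le> ennreal (q ^ Suc k) * ennreal (C * (1/16) ^ k)"
        by (rule mult_left_mono) simp
      also have "\<dots> = ennreal (q ^ Suc k * (C * (1/16) ^ k))"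
        using q C0 by (intro ennreal_mult[symmetric]) auto
      also have "q ^ Suc k * (C * (1/16) ^ k) = c k" by (simp add: c_def power_divide)
      finally show "ennreal (q ^ Suc k) * emeasure \<mu> (Ek k) \<le> ennreal (c k)" .
    qed auto
    also have "(\<Sum>k. ennreal (c k)) = ennreal (suminf c)" by (rule suminf_ennreal2[OF c0 sum])
    also have "ennreal m + ennreal (suminf c) = ennreal (m + suminf c)"
      using m(1) suminf_nonneg[OF sum c0] by simp
    finally show "(\<integral>\<^sup>+\<zeta>\<in>(X - {0}) \<inter> L. ennreal (norm (\<zeta> - z) powr (- s)) \<partial>\<mu>) \<le> ennreal (m + suminf c)"
      unfolding E_def .
  qed
qed

lemma emeasure_point: "z \<in> X - {0} \<Longrightarrow> emeasure \<mu> {z} = 0"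
proof -
  assume z: "z \<in> X - {0}"
  then obtain \<rho> C where *: "\<rho> > 0" "C \<ge> 0"
    "\<forall>w r. r > 0 \<longrightarrow> emeasure \<mu> ((X - {0}) \<inter> ball z \<rho> \<inter> ball w r) \<le> ennreal (C * r ^ 4)"
    using local_growth[of z] by (metis DiffD1)
  have "emeasure \<mu> {z} \<le> ennreal (C * r ^ 4)" if "r > 0" for r
  proof -
    have "emeasure \<mu> {z} \<le> emeasure \<mu> ((X - {0}) \<inter> ball z \<rho> \<inter> ball z r)"
      using z *(1) that R_borel by (intro emeasure_mono) (auto simp: in_sets_mu)
    then show ?thesis using *(3)[rule_format, OF that, of z] by (rule order_trans)
  qed
  moreover have "((\<lambda>r. ennreal (C * r ^ 4)) \<longlongrightarrow> ennreal (C * 0 ^ 4)) (at_right (0::real))"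
    by (intro tendsto_intros tendsto_ennrealI)
  ultimately have "emeasure \<mu> {z} \<le> ennreal (C * 0 ^ 4)"
    by (intro tendsto_lowerbound[where F = "at_right (0::real)"])
       (auto simp: eventually_at_filter trivial_limit_at_right_real)
  then show ?thesis by simp
qed

end

section \<open>Singular kernels\<close>

text \<open>The kernels behaving like \<open>|\<zeta> - z|\<close> to the power \<open>-k\<close>, with one derivative in \<open>z\<close> costing one
  power. The Lipschitz estimate is stated for the smaller of the two distances, where it is weakest;
  in this form it holds for \<open>z\<close> and \<open>w\<close> on opposite sides of the singularity, and it is stable
  under products.\<close>

definition kbound :: "(complex^3) set \<Rightarrow> (complex^3) set \<Rightarrow> real \<Rightarrow> ((complex^3) \<times> (complex^3) \<Rightarrow> complex) \<Rightarrow> real \<Rightarrow> bool" where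
  "kbound L N k F C \<longleftrightarrow> C \<ge> 0 \<and>
     (\<forall>\<zeta>\<in>L. \<forall>z\<in>N. \<zeta> \<noteq> z \<longrightarrow> cmod (F (\<zeta>, z)) \<le> C * norm (\<zeta> - z) powr (- k)) \<and>
     (\<forall>\<zeta>\<in>L. \<forall>z\<in>N. \<forall>w\<in>N. \<zeta> \<noteq> z \<longrightarrow> \<zeta> \<noteq> w \<longrightarrow> norm (\<zeta> - z) \<le> norm (\<zeta> - w) \<longrightarrow>
         cmod (F (\<zeta>, z) - F (\<zeta>, w)) \<le> C * norm (z - w) * norm (\<zeta> - z) powr (- k - 1))"

definition kcls :: "(complex^3) set \<Rightarrow> (complex^3) set \<Rightarrow> real \<Rightarrow> ((complex^3) \<times> (complex^3) \<Rightarrow> complex) \<Rightarrow> bool" where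
  "kcls L N k F \<longleftrightarrow>
     (\<forall>z\<in>N. (\<lambda>\<zeta>. indicator (L - {z}) \<zeta> * F (\<zeta>, z)) \<in> borel_measurable borel) \<and> (\<exists>C. kbound L N k F C)"

lemma kboundD:
  assumes "kbound L N k F C"
  shows "C \<ge> 0"
    and "\<And>\<zeta> z. \<zeta> \<in> L \<Longrightarrow> z \<in> N \<Longrightarrow> \<zeta> \<noteq> z \<Longrightarrow> cmod (F (\<zeta>, z)) \<le> C * norm (\<zeta> - z) powr (- k)"
    and "\<And>\<zeta> z w. \<zeta> \<in> L \<Longrightarrow> z \<in> N \<Longrightarrow> w \<in> N \<Longrightarrow> \<zeta> \<noteq> z \<Longrightarrow> \<zeta> \<noteq> w \<Longrightarrow> norm (\<zeta> - z) \<le> norm (\<zeta> - w) \<Longrightarrow>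
       cmod (F (\<zeta>, z) - F (\<zeta>, w)) \<le> C * norm (z - w) * norm (\<zeta> - z) powr (- k - 1)"
  using assms unfolding kbound_def by simp_all

lemma kclsE:
  assumes "kcls L N k F"
  obtains C where "kbound L N k F C"
  using assms unfolding kcls_def by blast

lemma kclsI:
  assumes "\<And>z. z \<in> N \<Longrightarrow> (\<lambda>\<zeta>. indicator (L - {z}) \<zeta> * F (\<zeta>, z)) \<in> borel_measurable borel"
    and "C \<ge> 0"
    and "\<And>\<zeta> z. \<zeta> \<in> L \<Longrightarrow> z \<in> N \<Longrightarrow> \<zeta> \<noteq> z \<Longrightarrow> cmod (F (\<zeta>, z)) \<le> C * norm (\<zeta> - z) powr (- k)"
    and "\<And>\<zeta> z w. \<zeta> \<in> L \<Longrightarrow> z \<in> N \<Longrightarrow> w \<in> N \<Longrightarrow> \<zeta> \<noteq> z \<Longrightarrow> \<zeta> \<noteq> w \<Longrightarrow> norm (\<zeta> - z) \<le> norm (\<zeta> - w) \<Longrightarrow>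
       cmod (F (\<zeta>, z) - F (\<zeta>, w)) \<le> C * norm (z - w) * norm (\<zeta> - z) powr (- k - 1)"
  shows "kcls L N k F"
proof -
  have "kbound L N k F C" unfolding kbound_def using assms(2-4) by simp
  then show ?thesis unfolding kcls_def using assms(1) by blast
qed

lemma kcls_measurable:
  "kcls L N k F \<Longrightarrow> z \<in> N \<Longrightarrow> (\<lambda>\<zeta>. indicator (L - {z}) \<zeta> * F (\<zeta>, z)) \<in> borel_measurable borel"
  unfolding kcls_def by blast

lemma kcls_cong:
  assumes "\<And>\<zeta> z. \<zeta> \<in> L \<Longrightarrow> z \<in> N \<Longrightarrow> \<zeta> \<noteq> z \<Longrightarrow> F (\<zeta>, z) = G (\<zeta>, z)" and F: "kcls L N k F"
  shows "kcls L N k G"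
proof -
  obtain C where C': "kbound L N k F C" by (rule kclsE[OF F])
  note C = kboundD[OF C']
  show ?thesis
  proof (rule kclsI[where C = C])
    fix z assume z: "z \<in> N"
    have "(\<lambda>\<zeta>. indicator (L - {z}) \<zeta> * F (\<zeta>, z)) = (\<lambda>\<zeta>. indicator (L - {z}) \<zeta> * G (\<zeta>, z))"
      using assms(1)[OF _ z] by (auto simp: fun_eq_iff indicator_def)
    then show "(\<lambda>\<zeta>. indicator (L - {z}) \<zeta> * G (\<zeta>, z)) \<in> borel_measurable borel"
      using kcls_measurable[OF F z] by simp
  next
    show "cmod (G (\<zeta>, z)) \<le> C * norm (\<zeta> - z) powr - k" if "\<zeta> \<in> L" "z \<in> N" "\<zeta> \<noteq> z" for \<zeta> z
      using C(2)[OF that] assms(1)[OF that] by simp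
    show "cmod (G (\<zeta>, z) - G (\<zeta>, w)) \<le> C * norm (z - w) * norm (\<zeta> - z) powr (- k - 1)"
      if h: "\<zeta> \<in> L" "z \<in> N" "w \<in> N" "\<zeta> \<noteq> z" "\<zeta> \<noteq> w" "norm (\<zeta> - z) \<le> norm (\<zeta> - w)" for \<zeta> z w
      using C(3)[OF h] assms(1)[OF h(1,2,4)] assms(1)[OF h(1,3,5)] by simp
  qed (fact C(1))
qed

lemma kcls_add:
  assumes "kcls L N k F" "kcls L N k G"
  shows "kcls L N k (\<lambda>p. F p + G p)"
proof -
  obtain C where C': "kbound L N k F C" by (rule kclsE[OF assms(1)])
  note C = kboundD[OF C']
  obtain D where D': "kbound L N k G D" by (rule kclsE[OF assms(2)])
  note D = kboundD[OF D']
  show ?thesis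
  proof (rule kclsI[where C = "C + D"])
    show "(\<lambda>\<zeta>. indicator (L - {z}) \<zeta> * (F (\<zeta>, z) + G (\<zeta>, z))) \<in> borel_measurable borel" if "z \<in> N" for z
      unfolding distrib_left
      by (intro borel_measurable_add kcls_measurable[OF assms(1) that] kcls_measurable[OF assms(2) that])
    show "cmod (F (\<zeta>, z) + G (\<zeta>, z)) \<le> (C + D) * norm (\<zeta> - z) powr (- k)"
      if "\<zeta> \<in> L" "z \<in> N" "\<zeta> \<noteq> z" for \<zeta> z
      unfolding distrib_right by (rule norm_triangle_mono[OF C(2) D(2)]) fact+
    show "cmod (F (\<zeta>, z) + G (\<zeta>, z) - (F (\<zeta>, w) + G (\<zeta>, w)))
        \<le> (C + D) * norm (z - w) * norm (\<zeta> - z) powr (- k - 1)"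
      if "\<zeta> \<in> L" "z \<in> N" "w \<in> N" "\<zeta> \<noteq> z" "\<zeta> \<noteq> w" "norm (\<zeta> - z) \<le> norm (\<zeta> - w)" for \<zeta> z w
      unfolding distrib_right add_diff_add by (rule norm_triangle_mono[OF C(3) D(3)]) fact+
  qed (use C D in simp)
qed

text \<open>In \<open>(F(z) - F(w)) G(z) + F(w) (G(z) - G(w))\<close> the factor \<open>F(w)\<close> is taken at the larger distance.
  It is estimated by the value at the smaller distance, which requires \<open>k \<ge> 0\<close>.\<close>

lemma kcls_mult:
  assumes "kcls L N k F" "kcls L N m G" "0 \<le> k"
  shows "kcls L N (k + m) (\<lambda>p. F p * G p)"
proof -
  obtain C where C': "kbound L N k F C" by (rule kclsE[OF assms(1)])
  note C = kboundD[OF C']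
  obtain D where D': "kbound L N m G D" by (rule kclsE[OF assms(2)])
  note D = kboundD[OF D']
  show ?thesis
  proof (rule kclsI[where C = "2 * C * D"])
    show "(\<lambda>\<zeta>. indicator (L - {z}) \<zeta> * (F (\<zeta>, z) * G (\<zeta>, z))) \<in> borel_measurable borel" if "z \<in> N" for z
    proof -
      have "(\<lambda>\<zeta>. indicator (L - {z}) \<zeta> * (F (\<zeta>, z) * G (\<zeta>, z)))
          = (\<lambda>\<zeta>. (indicator (L - {z}) \<zeta> * F (\<zeta>, z)) * (indicator (L - {z}) \<zeta> * G (\<zeta>, z)))"
        by (auto simp: fun_eq_iff indicator_def)
      then show ?thesis
        using borel_measurable_times[OF kcls_measurable[OF assms(1) that] kcls_measurable[OF assms(2) that]]
        by simp
    qed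
    show "cmod (F (\<zeta>, z) * G (\<zeta>, z)) \<le> 2 * C * D * norm (\<zeta> - z) powr (- (k + m))"
      if "\<zeta> \<in> L" "z \<in> N" "\<zeta> \<noteq> z" for \<zeta> z
    proof -
      have "cmod (F (\<zeta>, z) * G (\<zeta>, z)) \<le> (C * norm (\<zeta> - z) powr (- k)) * (D * norm (\<zeta> - z) powr (- m))"
        unfolding norm_mult using C(1) by (intro mult_mono C(2) D(2) that) auto
      also have "\<dots> = C * D * norm (\<zeta> - z) powr (- (k + m))"
        using powr_add[of "norm (\<zeta> - z)" "- k" "- m"] by (simp add: ac_simps)
      also have "\<dots> \<le> 2 * C * D * norm (\<zeta> - z) powr (- (k + m))"
        using C(1) D(1) by (intro mult_right_mono) auto
      finally show ?thesis .
    qed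
    show "cmod (F (\<zeta>, z) * G (\<zeta>, z) - F (\<zeta>, w) * G (\<zeta>, w))
        \<le> 2 * C * D * norm (z - w) * norm (\<zeta> - z) powr (- (k + m) - 1)"
      if h: "\<zeta> \<in> L" "z \<in> N" "w \<in> N" "\<zeta> \<noteq> z" "\<zeta> \<noteq> w" "norm (\<zeta> - z) \<le> norm (\<zeta> - w)" for \<zeta> z w
    proof -
      define a where "a = norm (\<zeta> - z)"
      have a: "a > 0" using h by (simp add: a_def)
      have "F (\<zeta>, z) * G (\<zeta>, z) - F (\<zeta>, w) * G (\<zeta>, w)
          = (F (\<zeta>, z) - F (\<zeta>, w)) * G (\<zeta>, z) + F (\<zeta>, w) * (G (\<zeta>, z) - G (\<zeta>, w))"
        by (simp add: algebra_simps)
      also have "cmod \<dots> \<le> (C * norm (z - w) * a powr (- k - 1)) * (D * a powr (- m))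
          + (C * a powr (- k)) * (D * norm (z - w) * a powr (- m - 1))"
      proof (rule norm_triangle_mono)
        show "cmod ((F (\<zeta>, z) - F (\<zeta>, w)) * G (\<zeta>, z)) \<le> (C * norm (z - w) * a powr (- k - 1)) * (D * a powr (- m))"
          unfolding norm_mult a_def using C(1) by (intro mult_mono C(3) D(2) h) auto
        have "cmod (F (\<zeta>, w)) \<le> C * norm (\<zeta> - w) powr (- k)" by (intro C(2) h)
        also have "\<dots> \<le> C * a powr (- k)"
          using C(1) assms(3) a h(6) unfolding a_def by (intro mult_left_mono powr_mono2') auto
        finally show "cmod (F (\<zeta>, w) * (G (\<zeta>, z) - G (\<zeta>, w))) \<le> (C * a powr (- k)) * (D * norm (z - w) * a powr (- m - 1))"
          unfolding norm_mult a_def using C(1) by (intro mult_mono D(3) h) auto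
      qed
      also have "\<dots> = 2 * C * D * norm (z - w) * a powr (- (k + m) - 1)"
        using powr_add[of a "- k - 1" "- m"] powr_add[of a "- k" "- m - 1"]
        by (simp add: algebra_simps)
      finally show ?thesis by (simp add: a_def)
    qed
  qed (use C D in simp)
qed

lemma kcls_indep:
  assumes "(\<lambda>\<zeta>. indicator L \<zeta> * g \<zeta>) \<in> borel_measurable borel" "\<And>\<zeta>. \<zeta> \<in> L \<Longrightarrow> cmod (g \<zeta>) \<le> C"
  shows "kcls L N 0 (\<lambda>p. g (fst p))"
proof (rule kclsI[where C = "max C 0"])
  fix z
  have "(\<lambda>\<zeta>. indicator (L - {z}) \<zeta> * g (fst (\<zeta>, z))) = (\<lambda>\<zeta>. indicator (- {z}) \<zeta> * (indicator L \<zeta> * g \<zeta>))"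
    by (auto simp: fun_eq_iff indicator_def)
  also have "\<dots> \<in> borel_measurable borel"
    by (intro borel_measurable_times borel_measurable_indicator assms) auto
  finally show "(\<lambda>\<zeta>. indicator (L - {z}) \<zeta> * g (fst (\<zeta>, z))) \<in> borel_measurable borel" .
next
  show "cmod (g (fst (\<zeta>, z))) \<le> max C 0 * norm (\<zeta> - z) powr - 0" if "\<zeta> \<in> L" "\<zeta> \<noteq> z" for \<zeta> z
    using assms(2)[OF that(1)] that by simp
qed simp_all

lemma kcls_const: "L \<in> sets borel \<Longrightarrow> kcls L N 0 (\<lambda>p. c)"
  using kcls_indep[of L "\<lambda>_. c" "cmod c" N] by simp

lemma kcls_cmult: "L \<in> sets borel \<Longrightarrow> kcls L N k F \<Longrightarrow> kcls L N k (\<lambda>p. c * F p)"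
  using kcls_mult[OF kcls_const[of L N c]] by fastforce

lemma kcls_zero: "L \<in> sets borel \<Longrightarrow> kcls L N k (\<lambda>p. 0)"
  by (rule kclsI[where C = 0]) simp_all

lemma kcls_sum:
  assumes "L \<in> sets borel" "\<And>i. i \<in> I \<Longrightarrow> kcls L N k (F i)"
  shows "kcls L N k (\<lambda>p. \<Sum>i\<in>I. F i p)"
  using assms(2) by (induction I rule: infinite_finite_induct) (auto intro: kcls_zero[OF assms(1)] kcls_add)

lemma kcls_mono:
  assumes F: "kcls L N k F" and "k \<le> m" and d: "\<And>\<zeta> z. \<zeta> \<in> L \<Longrightarrow> z \<in> N \<Longrightarrow> norm (\<zeta> - z) \<le> d"
  shows "kcls L N m F"
proof -
  obtain C where C': "kbound L N k F C" by (rule kclsE[OF F])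
  note C = kboundD[OF C']
  define M where "M = d powr (m - k)"
  have pw: "norm (\<zeta> - z) powr (- k) \<le> M * norm (\<zeta> - z) powr (- m)"
    "norm (\<zeta> - z) powr (- k - 1) \<le> M * norm (\<zeta> - z) powr (- m - 1)"
    if "\<zeta> \<in> L" "z \<in> N" "\<zeta> \<noteq> z" for \<zeta> z
  proof -
    have "norm (\<zeta> - z) powr (m - k) \<le> M"
      unfolding M_def using that \<open>k \<le> m\<close> by (intro powr_mono2 d) auto
    then have "norm (\<zeta> - z) powr (m - k) * norm (\<zeta> - z) powr (- m) \<le> M * norm (\<zeta> - z) powr (- m)"
      "norm (\<zeta> - z) powr (m - k) * norm (\<zeta> - z) powr (- m - 1) \<le> M * norm (\<zeta> - z) powr (- m - 1)"
      by (intro mult_right_mono; simp)+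
    then show "norm (\<zeta> - z) powr (- k) \<le> M * norm (\<zeta> - z) powr (- m)"
      "norm (\<zeta> - z) powr (- k - 1) \<le> M * norm (\<zeta> - z) powr (- m - 1)"
      by (simp_all add: powr_add[symmetric])
  qed
  show ?thesis
  proof (rule kclsI[where C = "C * M"])
    show "(\<lambda>\<zeta>. indicator (L - {z}) \<zeta> * F (\<zeta>, z)) \<in> borel_measurable borel" if "z \<in> N" for z
      by (rule kcls_measurable[OF F that])
    show "cmod (F (\<zeta>, z)) \<le> C * M * norm (\<zeta> - z) powr (- m)" if "\<zeta> \<in> L" "z \<in> N" "\<zeta> \<noteq> z" for \<zeta> z
      using order_trans[OF C(2)[OF that] mult_left_mono[OF pw(1)[OF that] C(1)]] by (simp add: mult.assoc)
    show "cmod (F (\<zeta>, z) - F (\<zeta>, w)) \<le> C * M * norm (z - w) * norm (\<zeta> - z) powr (- m - 1)"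
      if h: "\<zeta> \<in> L" "z \<in> N" "w \<in> N" "\<zeta> \<noteq> z" "\<zeta> \<noteq> w" "norm (\<zeta> - z) \<le> norm (\<zeta> - w)" for \<zeta> z w
      using order_trans[OF C(3)[OF h] mult_left_mono[OF pw(2)[OF h(1,2,4)], of "C * norm (z - w)"]] C(1)
      by (simp add: ac_simps)
  qed (use C(1) in \<open>simp add: M_def\<close>)
qed

lemma kcls_Lipschitz:
  assumes "\<And>z. z \<in> N \<Longrightarrow> (\<lambda>\<zeta>. indicator L \<zeta> * F (\<zeta>, z)) \<in> borel_measurable borel"
    and b: "\<And>\<zeta> z. \<zeta> \<in> L \<Longrightarrow> z \<in> N \<Longrightarrow> cmod (F (\<zeta>, z)) \<le> C"
    and l: "\<And>\<zeta> z w. \<zeta> \<in> L \<Longrightarrow> z \<in> N \<Longrightarrow> w \<in> N \<Longrightarrow> cmod (F (\<zeta>, z) - F (\<zeta>, w)) \<le> C * norm (z - w)"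
    and d: "\<And>\<zeta> z. \<zeta> \<in> L \<Longrightarrow> z \<in> N \<Longrightarrow> norm (\<zeta> - z) \<le> d"
  shows "kcls L N 0 F"
proof (rule kclsI[where C = "\<bar>C\<bar> * max d 1"])
  fix z assume z: "z \<in> N"
  have "(\<lambda>\<zeta>. indicator (L - {z}) \<zeta> * F (\<zeta>, z)) = (\<lambda>\<zeta>. indicator (- {z}) \<zeta> * (indicator L \<zeta> * F (\<zeta>, z)))"
    by (auto simp: fun_eq_iff indicator_def)
  also have "\<dots> \<in> borel_measurable borel"
    by (intro borel_measurable_times borel_measurable_indicator assms(1)[OF z]) auto
  finally show "(\<lambda>\<zeta>. indicator (L - {z}) \<zeta> * F (\<zeta>, z)) \<in> borel_measurable borel" .
next
  show "cmod (F (\<zeta>, z)) \<le> \<bar>C\<bar> * max d 1 * norm (\<zeta> - z) powr (- 0)" if "\<zeta> \<in> L" "z \<in> N" "\<zeta> \<noteq> z" for \<zeta> z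
  proof -
    have "cmod (F (\<zeta>, z)) \<le> \<bar>C\<bar> * 1" using b[OF that(1,2)] by simp
    also have "\<dots> \<le> \<bar>C\<bar> * max d 1" by (intro mult_left_mono) auto
    finally show ?thesis using that by simp
  qed
  show "cmod (F (\<zeta>, z) - F (\<zeta>, w)) \<le> \<bar>C\<bar> * max d 1 * norm (z - w) * norm (\<zeta> - z) powr (- 0 - 1)"
    if "\<zeta> \<in> L" "z \<in> N" "w \<in> N" "\<zeta> \<noteq> z" "\<zeta> \<noteq> w" "norm (\<zeta> - z) \<le> norm (\<zeta> - w)" for \<zeta> z w
  proof -
    have a: "norm (\<zeta> - z) > 0" "norm (\<zeta> - z) \<le> max d 1" using that d[OF that(1,2)] by auto
    then have "1 \<le> max d 1 * norm (\<zeta> - z) powr (- 1)" by (simp add: powr_minus field_simps)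
    then have "\<bar>C\<bar> * norm (z - w) * 1 \<le> \<bar>C\<bar> * norm (z - w) * (max d 1 * norm (\<zeta> - z) powr (- 1))"
      by (intro mult_left_mono) auto
    moreover have "cmod (F (\<zeta>, z) - F (\<zeta>, w)) \<le> \<bar>C\<bar> * norm (z - w)"
      using l[OF that(1-3)] by (meson abs_ge_self mult_right_mono norm_ge_zero order_trans)
    ultimately show ?thesis by (simp add: ac_simps)
  qed
qed simp

lemma kcls_inv_norm:
  assumes L: "L \<in> sets borel"
  shows "kcls L N 1 (\<lambda>p. complex_of_real (1 / norm (\<eta> p)))"
proof (rule kclsI[where C = 1])
  fix z
  show "(\<lambda>\<zeta>. indicator (L - {z}) \<zeta> * complex_of_real (1 / norm (\<eta> (\<zeta>, z)))) \<in> borel_measurable borel"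
    unfolding \<eta>_def fst_conv snd_conv using L
    by (intro borel_measurable_times borel_measurable_indicator borel_measurable_of_real
        borel_measurable_divide borel_measurable_const borel_measurable_norm borel_measurable_diff
        measurable_ident sets.Diff) (simp_all add: measurable_ident)
next
  show "cmod (complex_of_real (1 / norm (\<eta> (\<zeta>, z)))) \<le> 1 * norm (\<zeta> - z) powr - 1" if "\<zeta> \<noteq> z" for \<zeta> z
    using that by (simp add: \<eta>_def powr_minus inverse_eq_divide norm_divide)
  show "cmod (complex_of_real (1 / norm (\<eta> (\<zeta>, z))) - complex_of_real (1 / norm (\<eta> (\<zeta>, w))))
      \<le> 1 * norm (z - w) * norm (\<zeta> - z) powr (- 1 - 1)"
    if h: "\<zeta> \<noteq> z" "\<zeta> \<noteq> w" "norm (\<zeta> - z) \<le> norm (\<zeta> - w)" for \<zeta> z w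
  proof -
    define a b where "a = norm (\<zeta> - z)" and "b = norm (\<zeta> - w)"
    have ab: "0 < a" "0 < b" "a \<le> b" using h by (auto simp: a_def b_def)
    have "b - a \<le> norm (z - w)"
      unfolding a_def b_def using norm_triangle_ineq[of "\<zeta> - z" "z - w"] by simp
    moreover have "1 / a - 1 / b = (b - a) / (a * b)" using ab by (simp add: field_simps)
    moreover have "(b - a) / (a * b) \<le> (b - a) / (a * a)" using ab by (intro divide_left_mono) auto
    ultimately have "1 / a - 1 / b \<le> norm (z - w) / (a * a)"
      using ab by (smt (verit) divide_right_mono mult_pos_pos)
    moreover have "0 \<le> 1 / a - 1 / b" using ab by (simp add: field_simps)
    moreover have "a powr (- 1 - 1) = 1 / (a * a)"
      using ab by (simp add: powr_minus power2_eq_square inverse_eq_divide)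
    ultimately have "\<bar>1 / a - 1 / b\<bar> \<le> norm (z - w) * a powr (- 1 - 1)" by simp
    then show ?thesis
      unfolding of_real_diff[symmetric] norm_of_real by (simp add: \<eta>_def a_def b_def)
  qed
qed simp

lemma kcls_eta:
  assumes L: "L \<in> sets borel"
  shows "kcls L N (- 1) (\<lambda>p. \<eta> p $ l)" "kcls L N (- 1) (\<lambda>p. cnj (\<eta> p $ l))"
proof -
  have m: "(\<lambda>\<zeta>. indicator (L - {z}) \<zeta> * \<eta> (\<zeta>, z) $ l) \<in> borel_measurable borel"
    "(\<lambda>\<zeta>. indicator (L - {z}) \<zeta> * cnj (\<eta> (\<zeta>, z) $ l)) \<in> borel_measurable borel" for z
  proof -
    have c: "(\<lambda>\<zeta>. \<eta> (\<zeta>, z) $ l) \<in> borel_measurable borel" "(\<lambda>\<zeta>. cnj (\<eta> (\<zeta>, z) $ l)) \<in> borel_measurable borel"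
      unfolding \<eta>_def by (intro borel_measurable_continuous_onI continuous_intros; simp)+
    show "(\<lambda>\<zeta>. indicator (L - {z}) \<zeta> * \<eta> (\<zeta>, z) $ l) \<in> borel_measurable borel"
      "(\<lambda>\<zeta>. indicator (L - {z}) \<zeta> * cnj (\<eta> (\<zeta>, z) $ l)) \<in> borel_measurable borel"
      using L by (intro borel_measurable_times borel_measurable_indicator c sets.Diff; simp)+
  qed
  have b: "cmod (\<eta> (\<zeta>, z) $ l) \<le> 1 * norm (\<zeta> - z) powr - (- 1)" if "\<zeta> \<noteq> z" for \<zeta> z
    using Finite_Cartesian_Product.norm_nth_le[of "\<zeta> - z" l] that by (simp add: \<eta>_def)
  have d: "cmod (\<eta> (\<zeta>, z) $ l - \<eta> (\<zeta>, w) $ l) \<le> 1 * norm (z - w) * norm (\<zeta> - z) powr (- (- 1) - 1)"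
    if "\<zeta> \<noteq> z" for \<zeta> z w
    using Finite_Cartesian_Product.norm_nth_le[of "z - w" l] that by (simp add: \<eta>_def norm_minus_commute)
  show "kcls L N (- 1) (\<lambda>p. \<eta> p $ l)"
    by (rule kclsI[where C = 1, OF m(1) _ b d]) auto
  show "kcls L N (- 1) (\<lambda>p. cnj (\<eta> p $ l))"
  proof (rule kclsI[where C = 1, OF m(2)])
    show "cmod (cnj (\<eta> (\<zeta>, z) $ l)) \<le> 1 * norm (\<zeta> - z) powr - (- 1)" if "\<zeta> \<noteq> z" for \<zeta> z
      using b[OF that] by simp
    show "cmod (cnj (\<eta> (\<zeta>, z) $ l) - cnj (\<eta> (\<zeta>, w) $ l)) \<le> 1 * norm (z - w) * norm (\<zeta> - z) powr (- (- 1) - 1)"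
      if "\<zeta> \<noteq> z" for \<zeta> z w
      unfolding complex_cnj_diff[symmetric] complex_mod_cnj by (rule d[OF that])
  qed auto
qed

text \<open>The Lipschitz estimate is used if \<open>|z - w|\<close> is at most the distance to the singularity, and the
  size of both terms otherwise.\<close>

lemma kcls_Holder:
  assumes F: "kcls L N k F" and k: "0 \<le> k" and \<alpha>: "0 < \<alpha>" "\<alpha> \<le> 1"
  obtains C where "C \<ge> 0"
    "\<forall>\<zeta>\<in>L. \<forall>z\<in>N. \<forall>w\<in>N. \<zeta> \<noteq> z \<longrightarrow> \<zeta> \<noteq> w \<longrightarrow> cmod (F (\<zeta>, z) - F (\<zeta>, w))
       \<le> C * norm (z - w) powr \<alpha> * (norm (\<zeta> - z) powr (- (k + \<alpha>)) + norm (\<zeta> - w) powr (- (k + \<alpha>)))"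
proof -
  obtain C where C': "kbound L N k F C" by (rule kclsE[OF F])
  note C = kboundD[OF C']
  have ord: "cmod (F (\<zeta>, z) - F (\<zeta>, w)) \<le> 2 * C * norm (z - w) powr \<alpha> * norm (\<zeta> - z) powr (- (k + \<alpha>))"
    if h: "\<zeta> \<in> L" "z \<in> N" "w \<in> N" "\<zeta> \<noteq> z" "\<zeta> \<noteq> w" "norm (\<zeta> - z) \<le> norm (\<zeta> - w)" for \<zeta> z w
  proof (cases "z = w")
    case False
    define a t where "a = norm (\<zeta> - z)" and "t = norm (z - w)"
    have a: "a > 0" "t > 0" using h False by (auto simp: a_def t_def)
    show ?thesis
    proof (cases "t \<le> a")
      case True
      have "t = t powr \<alpha> * t powr (1 - \<alpha>)" using a by (simp add: powr_add[symmetric])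
      also have "\<dots> \<le> t powr \<alpha> * a powr (1 - \<alpha>)"
        using a True \<alpha> by (intro mult_left_mono powr_mono2) auto
      finally have "t * a powr (- k - 1) \<le> t powr \<alpha> * a powr (1 - \<alpha>) * a powr (- k - 1)"
        by (rule mult_right_mono) simp
      also have "\<dots> = t powr \<alpha> * a powr (- (k + \<alpha>))"
        using powr_add[of a "1 - \<alpha>" "- k - 1"] by (simp add: algebra_simps)
      finally have le: "t * a powr (- k - 1) \<le> t powr \<alpha> * a powr (- (k + \<alpha>))" .
      have "C * (t * a powr (- k - 1)) \<le> 2 * C * (t powr \<alpha> * a powr (- (k + \<alpha>)))"
        by (rule mult_mono[OF _ le]) (use C(1) a in auto)
      then show ?thesis using C(3)[OF h] by (simp add: a_def t_def mult.assoc)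
    next
      case False
      have "cmod (F (\<zeta>, z) - F (\<zeta>, w)) \<le> C * a powr (- k) + C * norm (\<zeta> - w) powr (- k)"
        unfolding a_def by (rule order_trans[OF norm_triangle_ineq4 add_mono]) (intro C(2) h)+
      also have "\<dots> \<le> C * a powr (- k) + C * a powr (- k)"
        using C(1) k a h(6) unfolding a_def by (intro add_left_mono mult_left_mono powr_mono2') auto
      also have "\<dots> = 2 * C * (a powr \<alpha> * a powr (- (k + \<alpha>)))"
        by (simp add: powr_add[symmetric])
      also have "\<dots> \<le> 2 * C * (t powr \<alpha> * a powr (- (k + \<alpha>)))"
        using C(1) False a \<alpha> by (intro mult_left_mono mult_right_mono powr_mono2) auto
      finally show ?thesis by (simp add: a_def t_def mult.assoc)
    qed
  qed simp
  show ?thesis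
  proof (rule that[of "2 * C"], goal_cases)
    case 1
    show ?case using C(1) by simp
  next
    case 2
    show ?case
    proof (intro ballI impI)
      fix \<zeta> z w assume h: "\<zeta> \<in> L" "z \<in> N" "w \<in> N" "\<zeta> \<noteq> z" "\<zeta> \<noteq> w"
      have e: "2 * C * norm (z - w) powr \<alpha> * (norm (\<zeta> - z) powr (- (k + \<alpha>)) + norm (\<zeta> - w) powr (- (k + \<alpha>)))
          = 2 * C * norm (z - w) powr \<alpha> * norm (\<zeta> - z) powr (- (k + \<alpha>))
          + 2 * C * norm (z - w) powr \<alpha> * norm (\<zeta> - w) powr (- (k + \<alpha>))" by (rule distrib_left)
      have nn: "0 \<le> 2 * C * norm (z - w) powr \<alpha> * norm (\<zeta> - u) powr (- (k + \<alpha>))" for u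
        using C(1) by simp
      show "cmod (F (\<zeta>, z) - F (\<zeta>, w)) \<le> 2 * C * norm (z - w) powr \<alpha>
          * (norm (\<zeta> - z) powr (- (k + \<alpha>)) + norm (\<zeta> - w) powr (- (k + \<alpha>)))"
      proof (cases "norm (\<zeta> - z) \<le> norm (\<zeta> - w)")
        case True
        show ?thesis unfolding e using ord[OF h True] nn[of w] by linarith
      next
        case False
        have "norm (\<zeta> - w) \<le> norm (\<zeta> - z)" using False by simp
        from ord[OF h(1,3,2,5,4) this] show ?thesis
          unfolding e using nn[of z] by (simp add: norm_minus_commute)
      qed
    qed
  qed
qed

section \<open>Integrals of singular kernels\<close>

text \<open>Young's inequality without the optimal constants: either \<open>v\<close> is at most \<open>u\<close> to the power
  \<open>q - 1\<close>, or \<open>u\<close> is at most \<open>v\<close> to the power \<open>1 / (q - 1)\<close>.\<close>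

lemma Young_crude:
  fixes u v q :: real
  assumes "0 \<le> u" "0 < v" "1 < q"
  shows "u * v \<le> u powr q + v powr (q / (q - 1))"
proof (cases "v \<le> u powr (q - 1)")
  case True
  show ?thesis
  proof (cases "u = 0")
    case False
    then have "u * v \<le> u * u powr (q - 1)" using True assms by (intro mult_left_mono) auto
    also have "\<dots> = u powr q" using False assms powr_mult_base[of u "q - 1"] by simp
    also have "\<dots> \<le> u powr q + v powr (q / (q - 1))" by simp
    finally show ?thesis .
  qed simp
next
  case False
  have "u = (u powr (q - 1)) powr (1 / (q - 1))" using assms by (simp add: powr_powr)
  also have "\<dots> \<le> v powr (1 / (q - 1))" using False assms by (intro powr_mono2) auto
  finally have "u * v \<le> v powr (1 / (q - 1)) * v" using assms by (intro mult_right_mono) auto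
  also have "\<dots> = v powr (1 / (q - 1) + 1)" using assms by (simp add: powr_add)
  also have "1 / (q - 1) + 1 = q / (q - 1)" using assms by (simp add: field_simps)
  also have "v powr (q / (q - 1)) \<le> u powr q + v powr (q / (q - 1))" by simp
  finally show ?thesis .
qed

text \<open>The kernels that occur in \<open>\<omega> \<and> K \<and> \<phi>\<close>: \<open>d\<close> is the differential of \<open>f\<close>, and \<open>p\<close> contains the
  factors \<open>\<omega>\<close> and \<open>\<phi>\<close>, of size \<open>1 / |df|\<close>. The sum stems from the Hefer form on the diagonal and
  \<open>B\<close> from the deviation from the diagonal.\<close>

definition kernel_combination ::
  "complex \<Rightarrow> (3 \<Rightarrow> complex) \<Rightarrow> (3 \<Rightarrow> 'a \<Rightarrow> complex) \<Rightarrow> ('a \<Rightarrow> complex) \<Rightarrow> 'a \<Rightarrow> complex" where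
  "kernel_combination p d A B x = p * ((\<Sum>m\<in>UNIV. d m * A m x) + B x)"

text \<open>In the following two lemmas \<open>g\<close> is the length of the differential. It cancels in the terms with
  \<open>A\<close>, and Young's inequality separates \<open>1 / g\<close> from the singularity of \<open>B\<close>.\<close>

lemma kernel_pointwise:
  assumes A: "\<And>m. kcls L N 3 (A m)" and B: "kcls L N 2 B" and q: "1 < q"
  obtains C where "C \<ge> 0"
    "\<forall>\<zeta>\<in>L. \<forall>z\<in>N. \<forall>p d. \<forall>g>0. \<zeta> \<noteq> z \<longrightarrow> cmod p \<le> C0 / g \<longrightarrow> (\<forall>m. cmod (d m) \<le> g) \<longrightarrow>
       cmod (kernel_combination p d A B (\<zeta>, z)) \<le> C * (norm (\<zeta> - z) powr (- 3)
         + (1 / g) powr q + norm (\<zeta> - z) powr (- (2 * (q / (q - 1)))))"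
proof -
  have "\<forall>m. \<exists>C. kbound L N 3 (A m) C" using A unfolding kcls_def by blast
  then obtain CA where CA: "\<And>m. kbound L N 3 (A m) (CA m)" by metis
  obtain CB where CB: "kbound L N 2 B CB" by (rule kclsE[OF B])
  define C where "C = \<bar>C0\<bar> * ((\<Sum>m\<in>UNIV. CA m) + CB)"
  have CA0: "CA m \<ge> 0" for m using kboundD(1)[OF CA] .
  have CB0: "CB \<ge> 0" using kboundD(1)[OF CB] .
  show ?thesis
  proof (rule that[of C], goal_cases)
    case 1
    show ?case unfolding C_def using CA0 CB0 by (intro mult_nonneg_nonneg add_nonneg_nonneg sum_nonneg) auto
  next
    case 2
    show ?case
    proof (intro ballI allI impI)
      fix \<zeta> z and p :: complex and d :: "3 \<Rightarrow> complex" and g :: real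
      assume h: "\<zeta> \<in> L" "z \<in> N" and g: "0 < g" and ne: "\<zeta> \<noteq> z"
        and p: "cmod p \<le> C0 / g" and d: "\<forall>m. cmod (d m) \<le> g"
      define a where "a = norm (\<zeta> - z)"
      have a: "a > 0" using ne by (simp add: a_def)
      have C0: "C0 \<ge> 0" using p g norm_ge_zero order_trans zero_le_divide_iff
        by (metis less_le_not_le)
      have "cmod (\<Sum>m\<in>UNIV. d m * A m (\<zeta>, z)) \<le> (\<Sum>m\<in>UNIV. g * (CA m * a powr (- 3)))"
      proof (rule order_trans[OF norm_sum sum_mono])
        fix m
        have "cmod (A m (\<zeta>, z)) \<le> CA m * a powr (- 3)"
          unfolding a_def using kboundD(2)[OF CA h ne] by simp
        then show "cmod (d m * A m (\<zeta>, z)) \<le> g * (CA m * a powr (- 3))"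
          unfolding norm_mult using d g by (intro mult_mono) auto
      qed
      then have 1: "cmod (\<Sum>m\<in>UNIV. d m * A m (\<zeta>, z)) \<le> g * sum CA UNIV * a powr (- 3)"
        by (simp add: sum_distrib_left sum_distrib_right ac_simps)
      have 2: "cmod (B (\<zeta>, z)) \<le> CB * a powr (- 2)"
        unfolding a_def using kboundD(2)[OF CB h ne] by simp
      have "cmod (kernel_combination p d A B (\<zeta>, z))
          \<le> C0 / g * (g * sum CA UNIV * a powr (- 3) + CB * a powr (- 2))"
        unfolding kernel_combination_def norm_mult
        using C0 g by (intro mult_mono p order_trans[OF norm_triangle_ineq add_mono[OF 1 2]]) auto
      also have "\<dots> = C0 * (sum CA UNIV * a powr (- 3) + CB * (1 / g * a powr (- 2)))"
        using g by (simp add: field_simps)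
      also have "1 / g * a powr (- 2) \<le> (1 / g) powr q + (a powr (- 2)) powr (q / (q - 1))"
        using g a q by (intro Young_crude) auto
      also have "(a powr (- 2)) powr (q / (q - 1)) = a powr (- (2 * (q / (q - 1))))"
        by (simp add: powr_powr)
      also have "C0 * (sum CA UNIV * a powr (- 3) + CB * ((1 / g) powr q + a powr (- (2 * (q / (q - 1))))))
          \<le> C0 * ((sum CA UNIV + CB) * (a powr (- 3) + (1 / g) powr q + a powr (- (2 * (q / (q - 1))))))"
      proof (rule mult_left_mono[OF _ C0])
        have "0 \<le> sum CA UNIV" using CA0 by (intro sum_nonneg) auto
        then have "sum CA UNIV * a powr (- 3) \<le> sum CA UNIV * (a powr (- 3) + ((1 / g) powr q + a powr (- (2 * (q / (q - 1))))))"
          by (intro mult_left_mono) auto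
        moreover have "CB * ((1 / g) powr q + a powr (- (2 * (q / (q - 1)))))
            \<le> CB * (a powr (- 3) + ((1 / g) powr q + a powr (- (2 * (q / (q - 1))))))"
          using CB0 by (intro mult_left_mono) auto
        ultimately show "sum CA UNIV * a powr (- 3) + CB * ((1 / g) powr q + a powr (- (2 * (q / (q - 1)))))
            \<le> (sum CA UNIV + CB) * (a powr (- 3) + (1 / g) powr q + a powr (- (2 * (q / (q - 1)))))"
          unfolding distrib_right[of "sum CA UNIV"] add.assoc by linarith
      qed
      finally show "cmod (kernel_combination p d A B (\<zeta>, z)) \<le> C * (norm (\<zeta> - z) powr (- 3)
         + (1 / g) powr q + norm (\<zeta> - z) powr (- (2 * (q / (q - 1)))))"
        using C0 CB0 by (simp add: C_def a_def mult.assoc mult_left_mono)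
    qed
  qed
qed

lemma kernel_Holder_pointwise:
  assumes A: "\<And>m. kcls L N 3 (A m)" and B: "kcls L N 2 B" and q: "1 < q" and \<alpha>: "0 < \<alpha>" "\<alpha> \<le> 1"
  obtains C where "C \<ge> 0"
    "\<forall>\<zeta>\<in>L. \<forall>z\<in>N. \<forall>w\<in>N. \<forall>p d. \<forall>g>0. \<zeta> \<noteq> z \<longrightarrow> \<zeta> \<noteq> w \<longrightarrow> cmod p \<le> C0 / g \<longrightarrow> (\<forall>m. cmod (d m) \<le> g) \<longrightarrow>
       cmod (kernel_combination p d A B (\<zeta>, z) - kernel_combination p d A B (\<zeta>, w))
       \<le> C * norm (z - w) powr \<alpha> *
         (norm (\<zeta> - z) powr (- (3 + \<alpha>)) + norm (\<zeta> - w) powr (- (3 + \<alpha>)) + 2 * (1 / g) powr q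
         + norm (\<zeta> - z) powr (- ((2 + \<alpha>) * (q / (q - 1)))) + norm (\<zeta> - w) powr (- ((2 + \<alpha>) * (q / (q - 1)))))"
proof -
  have "\<exists>C\<ge>0. \<forall>\<zeta>\<in>L. \<forall>z\<in>N. \<forall>w\<in>N. \<zeta> \<noteq> z \<longrightarrow> \<zeta> \<noteq> w \<longrightarrow> cmod (A m (\<zeta>, z) - A m (\<zeta>, w))
       \<le> C * norm (z - w) powr \<alpha> * (norm (\<zeta> - z) powr (- (3 + \<alpha>)) + norm (\<zeta> - w) powr (- (3 + \<alpha>)))" for m
    by (rule kcls_Holder[OF A _ \<alpha>]) auto
  then obtain CA where CA0: "\<And>m. CA m \<ge> 0" and CA: "\<And>m. \<forall>\<zeta>\<in>L. \<forall>z\<in>N. \<forall>w\<in>N. \<zeta> \<noteq> z \<longrightarrow> \<zeta> \<noteq> w \<longrightarrow> cmod (A m (\<zeta>, z) - A m (\<zeta>, w))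
       \<le> CA m * norm (z - w) powr \<alpha> * (norm (\<zeta> - z) powr (- (3 + \<alpha>)) + norm (\<zeta> - w) powr (- (3 + \<alpha>)))"
    by metis
  obtain CB where CB0: "CB \<ge> 0" and CB: "\<forall>\<zeta>\<in>L. \<forall>z\<in>N. \<forall>w\<in>N. \<zeta> \<noteq> z \<longrightarrow> \<zeta> \<noteq> w \<longrightarrow> cmod (B (\<zeta>, z) - B (\<zeta>, w))
       \<le> CB * norm (z - w) powr \<alpha> * (norm (\<zeta> - z) powr (- (2 + \<alpha>)) + norm (\<zeta> - w) powr (- (2 + \<alpha>)))"
    by (rule kcls_Holder[OF B _ \<alpha>]) auto
  define C where "C = \<bar>C0\<bar> * ((\<Sum>m\<in>UNIV. CA m) + CB)"
  have SA: "0 \<le> sum CA UNIV" using CA0 by (intro sum_nonneg) auto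
  show ?thesis
  proof (rule that[of C], goal_cases)
    case 1
    show ?case unfolding C_def using SA CB0 by (intro mult_nonneg_nonneg add_nonneg_nonneg) auto
  next
    case 2
    show ?case
    proof (intro ballI allI impI)
      fix \<zeta> z w and p :: complex and d :: "3 \<Rightarrow> complex" and g :: real
      assume h: "\<zeta> \<in> L" "z \<in> N" "w \<in> N" and g: "0 < g" and ne: "\<zeta> \<noteq> z" "\<zeta> \<noteq> w"
        and p: "cmod p \<le> C0 / g" and d: "\<forall>m. cmod (d m) \<le> g"
      define a b t where "a = norm (\<zeta> - z)" and "b = norm (\<zeta> - w)" and "t = norm (z - w) powr \<alpha>"
      define s where "s = (2 + \<alpha>) * (q / (q - 1))"
      have a: "a > 0" "b > 0" "t \<ge> 0" using ne by (simp_all add: a_def b_def t_def)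
      have C0: "C0 \<ge> 0" using p g norm_ge_zero order_trans zero_le_divide_iff
        by (metis less_le_not_le)
      define P where "P = a powr (- (3 + \<alpha>)) + b powr (- (3 + \<alpha>))"
      define Q where "Q = a powr (- (2 + \<alpha>)) + b powr (- (2 + \<alpha>))"
      have P0: "P \<ge> 0" "Q \<ge> 0" by (simp_all add: P_def Q_def)
      have "cmod (\<Sum>m\<in>UNIV. d m * (A m (\<zeta>, z) - A m (\<zeta>, w))) \<le> (\<Sum>m\<in>UNIV. g * (CA m * t * P))"
      proof (rule order_trans[OF norm_sum sum_mono])
        fix m
        have "cmod (A m (\<zeta>, z) - A m (\<zeta>, w)) \<le> CA m * t * P"
          unfolding a_def b_def t_def P_def using CA[of m] h ne by blast
        then show "cmod (d m * (A m (\<zeta>, z) - A m (\<zeta>, w))) \<le> g * (CA m * t * P)"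
          unfolding norm_mult using d g by (intro mult_mono) auto
      qed
      then have 1: "cmod (\<Sum>m\<in>UNIV. d m * (A m (\<zeta>, z) - A m (\<zeta>, w))) \<le> g * sum CA UNIV * t * P"
        by (simp add: sum_distrib_left sum_distrib_right ac_simps)
      have 2: "cmod (B (\<zeta>, z) - B (\<zeta>, w)) \<le> CB * t * Q"
        unfolding a_def b_def t_def Q_def using CB h ne by blast
      have "kernel_combination p d A B (\<zeta>, z) - kernel_combination p d A B (\<zeta>, w)
          = p * ((\<Sum>m\<in>UNIV. d m * (A m (\<zeta>, z) - A m (\<zeta>, w))) + (B (\<zeta>, z) - B (\<zeta>, w)))"
        by (simp add: kernel_combination_def sum_subtractf algebra_simps)
      also have "cmod \<dots> \<le> C0 / g * (g * sum CA UNIV * t * P + CB * t * Q)"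
        unfolding norm_mult
        using C0 g by (intro mult_mono p order_trans[OF norm_triangle_ineq add_mono[OF 1 2]]) auto
      also have "\<dots> = C0 * t * (sum CA UNIV * P + CB * (1 / g * Q))"
        using g by (simp add: field_simps)
      also have "1 / g * Q = 1 / g * a powr (- (2 + \<alpha>)) + 1 / g * b powr (- (2 + \<alpha>))"
        by (simp only: Q_def distrib_left)
      also have "C0 * t * (sum CA UNIV * P + CB * (1 / g * a powr (- (2 + \<alpha>)) + 1 / g * b powr (- (2 + \<alpha>))))
          \<le> C0 * t * (sum CA UNIV * P + CB * (((1 / g) powr q + a powr (- s)) + ((1 / g) powr q + b powr (- s))))"
      proof -
        have "1 / g * x powr (- (2 + \<alpha>)) \<le> (1 / g) powr q + x powr (- s)" if "x > 0" for x
        proof -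
          have "1 / g * x powr (- (2 + \<alpha>)) \<le> (1 / g) powr q + (x powr (- (2 + \<alpha>))) powr (q / (q - 1))"
            using g that q by (intro Young_crude) auto
          also have "(x powr (- (2 + \<alpha>))) powr (q / (q - 1)) = x powr (- s)"
            unfolding s_def powr_powr by (simp only: minus_mult_left)
          finally show ?thesis .
        qed
        then show ?thesis
          using C0 a CB0 by (intro mult_left_mono add_left_mono add_mono) auto
      qed
      also have "\<dots> \<le> C0 * t * ((sum CA UNIV + CB) * (P + (2 * (1 / g) powr q + a powr (- s) + b powr (- s))))"
      proof (rule mult_left_mono)
        define V where "V = 2 * (1 / g) powr q + a powr (- s) + b powr (- s)"
        have V: "V \<ge> 0" by (simp add: V_def)
        have "sum CA UNIV * P \<le> sum CA UNIV * (P + V)" using SA V by (intro mult_left_mono) auto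
        moreover have "CB * V \<le> CB * (P + V)" using CB0 P0 by (intro mult_left_mono) auto
        ultimately have "sum CA UNIV * P + CB * V \<le> (sum CA UNIV + CB) * (P + V)"
          unfolding distrib_right[of "sum CA UNIV"] by linarith
        then show "sum CA UNIV * P + CB * (((1 / g) powr q + a powr (- s)) + ((1 / g) powr q + b powr (- s)))
          \<le> (sum CA UNIV + CB) * (P + (2 * (1 / g) powr q + a powr (- s) + b powr (- s)))"
          by (simp add: V_def algebra_simps)
      qed (use C0 a in simp)
      also have "\<dots> = C * t * (a powr (- (3 + \<alpha>)) + b powr (- (3 + \<alpha>)) + 2 * (1 / g) powr q + a powr (- s) + b powr (- s))"
        using C0 by (simp add: C_def P_def algebra_simps)
      finally show "cmod (kernel_combination p d A B (\<zeta>, z) - kernel_combination p d A B (\<zeta>, w))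
       \<le> C * norm (z - w) powr \<alpha> *
         (norm (\<zeta> - z) powr (- (3 + \<alpha>)) + norm (\<zeta> - w) powr (- (3 + \<alpha>)) + 2 * (1 / g) powr q
         + norm (\<zeta> - z) powr (- ((2 + \<alpha>) * (q / (q - 1)))) + norm (\<zeta> - w) powr (- ((2 + \<alpha>) * (q / (q - 1)))))"
        unfolding a_def b_def t_def s_def .
    qed
  qed
qed

lemma ennreal_combine:
  fixes t a b c d e :: real
  assumes "0 \<le> t" "0 \<le> a" "0 \<le> b" "0 \<le> c" "0 \<le> d" "0 \<le> e"
  shows "ennreal (t * (a + b + 2 * c + d + e))
    = ennreal t * (ennreal a + ennreal b + 2 * ennreal c + ennreal d + ennreal e)"
  using assms ennreal_mult[of 2 c] by (simp add: ennreal_mult)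

context surface
begin

lemma AE_neq: "AE \<zeta> in \<mu>. \<zeta> \<noteq> z"
proof (cases "z \<in> X - {0}")
  case True
  have "{z} \<in> null_sets \<mu>"
    using emeasure_point[OF True] True by (auto simp: null_sets_def in_sets_mu)
  then show ?thesis by (rule AE_I') auto
next
  case False
  then show ?thesis by (intro AE_I2) (auto simp: space_mu)
qed

lemma continuous_measurable_mu:
  fixes g :: "complex^3 \<Rightarrow> 'b::real_normed_vector"
  assumes "continuous_on (X - {0}) g"
  shows "g \<in> borel_measurable \<mu>"
  using measurable_mu[OF borel_measurable_continuous_on_indicator[OF R_borel assms]]
  by (rule measurable_cong[THEN iffD1, rotated]) (simp add: space_mu)

lemma df_measurable_mu: "(\<lambda>\<zeta>. df f \<zeta> m) \<in> borel_measurable \<mu>"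
  by (intro continuous_measurable_mu continuous_on_subset[OF continuous_on_df]) (auto simp: X_iff)

lemma gradsq_measurable_mu: "gradsq f \<in> borel_measurable \<mu>"
  unfolding gradsq_def
  by (intro continuous_measurable_mu continuous_intros continuous_on_subset[OF continuous_on_df]) (auto simp: X_iff)

lemma sqrt_gradsq: "\<zeta> \<in> X - {0} \<Longrightarrow> sqrt (gradsq f \<zeta>) > 0" "cmod (df f \<zeta> m) \<le> sqrt (gradsq f \<zeta>)"
proof -
  show "\<zeta> \<in> X - {0} \<Longrightarrow> sqrt (gradsq f \<zeta>) > 0" using gradsq_pos[OF regular] by simp
  have "(cmod (df f \<zeta> m))\<^sup>2 \<le> gradsq f \<zeta>" unfolding gradsq_def by (rule member_le_sum) auto
  then show "cmod (df f \<zeta> m) \<le> sqrt (gradsq f \<zeta>)" by (rule real_le_rsqrt)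
qed

text \<open>Integration of the pointwise estimates. The assumption on \<open>U\<close> is that \<open>\<omega>\<close> is in \<open>L^q\<close>, and the
  bounds on \<open>\<alpha>\<close> say that the exponents \<open>3 + \<alpha>\<close> and \<open>(2 + \<alpha>) q / (q - 1)\<close> are less than 4.\<close>

lemma kernel_integral:
  assumes L: "compact L" "L \<subseteq> \<Omega>'" and q: "1 < q" and U: "U \<ge> 0"
    "(\<integral>\<^sup>+\<zeta>\<in>(X - {0}) \<inter> L. ennreal ((1 / sqrt (gradsq f \<zeta>)) powr q) \<partial>\<mu>) \<le> ennreal U"
    and \<alpha>: "0 < \<alpha>" "\<alpha> < 1" "(2 + \<alpha>) * (q / (q - 1)) < 4"
    and A: "\<And>m. kcls L N 3 (A m)" and B: "kcls L N 2 B"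
    and p: "p \<in> borel_measurable \<mu>" "\<And>\<zeta>. \<zeta> \<in> (X - {0}) \<inter> L \<Longrightarrow> cmod (p \<zeta>) \<le> C0 / sqrt (gradsq f \<zeta>)"
  defines "k \<equiv> \<lambda>z \<zeta>. indicator (L - {z}) \<zeta> * kernel_combination (p \<zeta>) (df f \<zeta>) A B (\<zeta>, z)"
  shows "\<forall>z\<in>N. integrable \<mu> (k z)"
    and "\<exists>C\<ge>0. \<forall>z\<in>N. \<forall>w\<in>N. cmod ((LINT \<zeta>|\<mu>. k z \<zeta>) - (LINT \<zeta>|\<mu>. k w \<zeta>)) \<le> C * dist z w powr \<alpha>"
proof -
  have Lb: "L \<in> sets borel" using L(1) by (rule borel_compact)
  have qq: "q / (q - 1) > 0" using q by simp
  define E where "E = (X - {0}) \<inter> L"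
  have E: "E \<in> sets \<mu>" unfolding E_def by (rule compact_measurable[OF L(1)])
  have k_meas: "k z \<in> borel_measurable \<mu>" if "z \<in> N" for z
  proof -
    have "k z = (\<lambda>\<zeta>. p \<zeta> * ((\<Sum>m\<in>UNIV. df f \<zeta> m * (indicator (L - {z}) \<zeta> * A m (\<zeta>, z)))
        + indicator (L - {z}) \<zeta> * B (\<zeta>, z)))"
      by (auto simp: fun_eq_iff k_def kernel_combination_def indicator_def)
    also have "\<dots> \<in> borel_measurable \<mu>"
      by (intro borel_measurable_times borel_measurable_add borel_measurable_sum p df_measurable_mu
          measurable_mu[OF kcls_measurable[OF A that]] measurable_mu[OF kcls_measurable[OF B that]])
    finally show ?thesis .
  qed
  have u_meas: "(\<lambda>\<zeta>. (1 / sqrt (gradsq f \<zeta>)) powr q) \<in> borel_measurable \<mu>"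
    using gradsq_measurable_mu by measurable
  have n_meas: "(\<lambda>\<zeta>. norm (\<zeta> - z) powr s) \<in> borel_measurable \<mu>" for z s
    by (rule measurable_mu) measurable
  have bound: "\<exists>I\<ge>0. \<forall>z. (\<integral>\<^sup>+\<zeta>\<in>E. ennreal (norm (\<zeta> - z) powr (- s)) \<partial>\<mu>) \<le> ennreal I" if "0 \<le> s" "s < 4" for s
    unfolding E_def by (rule integral_kernel_bound[OF L that]) auto
  have le4: "2 * (q / (q - 1)) < 4"
  proof -
    have "2 * (q / (q - 1)) \<le> (2 + \<alpha>) * (q / (q - 1))" using qq \<alpha> by (intro mult_right_mono) auto
    then show ?thesis using \<alpha>(3) by linarith
  qed
  obtain C1 where C1: "C1 \<ge> 0"
    "\<forall>\<zeta>\<in>L. \<forall>z\<in>N. \<forall>p d. \<forall>g>0. \<zeta> \<noteq> z \<longrightarrow> cmod p \<le> C0 / g \<longrightarrow> (\<forall>m. cmod (d m) \<le> g) \<longrightarrow>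
       cmod (kernel_combination p d A B (\<zeta>, z)) \<le> C1 * (norm (\<zeta> - z) powr (- 3)
         + (1 / g) powr q + norm (\<zeta> - z) powr (- (2 * (q / (q - 1)))))"
    by (rule kernel_pointwise[OF A B q])
  obtain C2 where C2: "C2 \<ge> 0"
    "\<forall>\<zeta>\<in>L. \<forall>z\<in>N. \<forall>w\<in>N. \<forall>p d. \<forall>g>0. \<zeta> \<noteq> z \<longrightarrow> \<zeta> \<noteq> w \<longrightarrow> cmod p \<le> C0 / g \<longrightarrow> (\<forall>m. cmod (d m) \<le> g) \<longrightarrow>
       cmod (kernel_combination p d A B (\<zeta>, z) - kernel_combination p d A B (\<zeta>, w))
       \<le> C2 * norm (z - w) powr \<alpha> *
         (norm (\<zeta> - z) powr (- (3 + \<alpha>)) + norm (\<zeta> - w) powr (- (3 + \<alpha>)) + 2 * (1 / g) powr q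
         + norm (\<zeta> - z) powr (- ((2 + \<alpha>) * (q / (q - 1)))) + norm (\<zeta> - w) powr (- ((2 + \<alpha>) * (q / (q - 1)))))"
    by (rule kernel_Holder_pointwise[OF A B q \<alpha>(1) less_imp_le[OF \<alpha>(2)]])
  show int: "\<forall>z\<in>N. integrable \<mu> (k z)"
  proof
    fix z assume z: "z \<in> N"
    obtain I3 where I3: "\<forall>z. (\<integral>\<^sup>+\<zeta>\<in>E. ennreal (norm (\<zeta> - z) powr (- 3)) \<partial>\<mu>) \<le> ennreal I3"
      using bound[of 3] by auto
    obtain I2 where I2: "\<forall>z. (\<integral>\<^sup>+\<zeta>\<in>E. ennreal (norm (\<zeta> - z) powr (- (2 * (q / (q - 1))))) \<partial>\<mu>) \<le> ennreal I2"
      using bound[of "2 * (q / (q - 1))"] qq le4 by auto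
    have "(\<integral>\<^sup>+\<zeta>. ennreal (cmod (k z \<zeta>)) \<partial>\<mu>) \<le> (\<integral>\<^sup>+\<zeta>. ennreal C1 * (ennreal (norm (\<zeta> - z) powr (- 3)) * indicator E \<zeta>
        + ennreal ((1 / sqrt (gradsq f \<zeta>)) powr q) * indicator E \<zeta>
        + ennreal (norm (\<zeta> - z) powr (- (2 * (q / (q - 1))))) * indicator E \<zeta>) \<partial>\<mu>)"
    proof (rule nn_integral_mono)
      fix \<zeta> assume "\<zeta> \<in> space \<mu>"
      then have R: "\<zeta> \<in> X - {0}" by (simp add: space_mu)
      show "ennreal (cmod (k z \<zeta>)) \<le> ennreal C1 * (ennreal (norm (\<zeta> - z) powr (- 3)) * indicator E \<zeta>
        + ennreal ((1 / sqrt (gradsq f \<zeta>)) powr q) * indicator E \<zeta>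
        + ennreal (norm (\<zeta> - z) powr (- (2 * (q / (q - 1))))) * indicator E \<zeta>)"
      proof (cases "\<zeta> \<in> L - {z}")
        case True
        then have \<zeta>: "\<zeta> \<in> L" "\<zeta> \<noteq> z" and EE: "\<zeta> \<in> E" using R by (auto simp: E_def)
        have "cmod (k z \<zeta>) \<le> C1 * (norm (\<zeta> - z) powr (- 3)
         + (1 / sqrt (gradsq f \<zeta>)) powr q + norm (\<zeta> - z) powr (- (2 * (q / (q - 1)))))"
          using C1(2)[rule_format, OF \<zeta>(1) z sqrt_gradsq(1)[OF R] \<zeta>(2) p(2) sqrt_gradsq(2)] EE True
          by (simp add: k_def E_def)
        then show ?thesis using EE C1(1)
          by (simp add: ennreal_mult[symmetric] ennreal_plus[symmetric] ennreal_leI del: ennreal_plus)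
      qed (simp add: k_def)
    qed
    also have "\<dots> = ennreal C1 * ((\<integral>\<^sup>+\<zeta>\<in>E. ennreal (norm (\<zeta> - z) powr (- 3)) \<partial>\<mu>)
        + (\<integral>\<^sup>+\<zeta>\<in>E. ennreal ((1 / sqrt (gradsq f \<zeta>)) powr q) \<partial>\<mu>)
        + (\<integral>\<^sup>+\<zeta>\<in>E. ennreal (norm (\<zeta> - z) powr (- (2 * (q / (q - 1))))) \<partial>\<mu>))"
      using E n_meas u_meas by (simp add: nn_integral_add nn_integral_cmult)
    also have "\<dots> \<le> ennreal C1 * (ennreal I3 + ennreal U + ennreal I2)"
      using I3 I2 U(2) unfolding E_def by (intro mult_left_mono add_mono) auto
    also have "\<dots> < \<infinity>" by (simp add: ennreal_mult_less_top)
    finally show "integrable \<mu> (k z)" by (intro integrableI_bounded k_meas[OF z])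
  qed
  obtain J1 where J1: "J1 \<ge> 0" "\<forall>z. (\<integral>\<^sup>+\<zeta>\<in>E. ennreal (norm (\<zeta> - z) powr (- (3 + \<alpha>))) \<partial>\<mu>) \<le> ennreal J1"
    using bound[of "3 + \<alpha>"] \<alpha> by auto
  obtain J2 where J2: "J2 \<ge> 0" "\<forall>z. (\<integral>\<^sup>+\<zeta>\<in>E. ennreal (norm (\<zeta> - z) powr (- ((2 + \<alpha>) * (q / (q - 1))))) \<partial>\<mu>) \<le> ennreal J2"
  proof -
    have "0 \<le> (2 + \<alpha>) * (q / (q - 1))" using qq \<alpha> by (intro mult_nonneg_nonneg) auto
    from bound[OF this \<alpha>(3)] show ?thesis using that by blast
  qed
  define C where "C = C2 * (J1 + J1 + 2 * U + J2 + J2)"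
  show "\<exists>C\<ge>0. \<forall>z\<in>N. \<forall>w\<in>N. cmod ((LINT \<zeta>|\<mu>. k z \<zeta>) - (LINT \<zeta>|\<mu>. k w \<zeta>)) \<le> C * dist z w powr \<alpha>"
  proof (intro exI[of _ C] conjI ballI)
    show "0 \<le> C" using C2(1) J1(1) J2(1) U(1) by (simp add: C_def)
    fix z w assume z: "z \<in> N" and w: "w \<in> N"
    define t where "t = C2 * norm (z - w) powr \<alpha>"
    have t: "t \<ge> 0" using C2(1) by (simp add: t_def)
    let ?s = "(2 + \<alpha>) * (q / (q - 1))"
    have ints: "integrable \<mu> (k z)" "integrable \<mu> (k w)" using int z w by auto
    have "ennreal (cmod ((LINT \<zeta>|\<mu>. k z \<zeta>) - (LINT \<zeta>|\<mu>. k w \<zeta>))) = ennreal (cmod (LINT \<zeta>|\<mu>. k z \<zeta> - k w \<zeta>))"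
      by (simp only: Bochner_Integration.integral_diff[OF ints])
    also have "\<dots> \<le> (\<integral>\<^sup>+\<zeta>. ennreal (cmod (k z \<zeta> - k w \<zeta>)) \<partial>\<mu>)"
      by (rule integral_norm_bound_ennreal[OF Bochner_Integration.integrable_diff[OF ints]])
    also have "\<dots> \<le> (\<integral>\<^sup>+\<zeta>. ennreal t * (ennreal (norm (\<zeta> - z) powr (- (3 + \<alpha>))) * indicator E \<zeta>
        + ennreal (norm (\<zeta> - w) powr (- (3 + \<alpha>))) * indicator E \<zeta>
        + 2 * (ennreal ((1 / sqrt (gradsq f \<zeta>)) powr q) * indicator E \<zeta>)
        + ennreal (norm (\<zeta> - z) powr (- ?s)) * indicator E \<zeta>
        + ennreal (norm (\<zeta> - w) powr (- ?s)) * indicator E \<zeta>) \<partial>\<mu>)"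
    proof (rule nn_integral_mono_AE)
      show "AE \<zeta> in \<mu>. ennreal (cmod (k z \<zeta> - k w \<zeta>)) \<le> ennreal t * (ennreal (norm (\<zeta> - z) powr (- (3 + \<alpha>))) * indicator E \<zeta>
        + ennreal (norm (\<zeta> - w) powr (- (3 + \<alpha>))) * indicator E \<zeta>
        + 2 * (ennreal ((1 / sqrt (gradsq f \<zeta>)) powr q) * indicator E \<zeta>)
        + ennreal (norm (\<zeta> - z) powr (- ?s)) * indicator E \<zeta>
        + ennreal (norm (\<zeta> - w) powr (- ?s)) * indicator E \<zeta>)"
        using AE_neq[of z] AE_neq[of w] AE_space
      proof eventually_elim
        case (elim \<zeta>)
        then have R: "\<zeta> \<in> X - {0}" by (simp add: space_mu)
        show ?case
        proof (cases "\<zeta> \<in> L")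
          case True
          then have EE: "\<zeta> \<in> E" using R by (auto simp: E_def)
          have "cmod (k z \<zeta> - k w \<zeta>) \<le> t *
             (norm (\<zeta> - z) powr (- (3 + \<alpha>)) + norm (\<zeta> - w) powr (- (3 + \<alpha>)) + 2 * (1 / sqrt (gradsq f \<zeta>)) powr q
              + norm (\<zeta> - z) powr (- ?s) + norm (\<zeta> - w) powr (- ?s))"
            using C2(2)[rule_format, OF True z w sqrt_gradsq(1)[OF R] elim(1,2) p(2) sqrt_gradsq(2)] EE elim True
            by (simp add: k_def E_def t_def)
          also have "ennreal \<dots> = ennreal t * (ennreal (norm (\<zeta> - z) powr (- (3 + \<alpha>)))
            + ennreal (norm (\<zeta> - w) powr (- (3 + \<alpha>)))
            + 2 * (ennreal ((1 / sqrt (gradsq f \<zeta>)) powr q))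
            + ennreal (norm (\<zeta> - z) powr (- ?s))
            + ennreal (norm (\<zeta> - w) powr (- ?s)))"
            by (rule ennreal_combine[OF t]) simp_all
          finally show ?thesis using EE by (simp add: ennreal_leI)
        qed (simp add: k_def)
      qed
    qed
    also have "\<dots> = ennreal t * ((\<integral>\<^sup>+\<zeta>\<in>E. ennreal (norm (\<zeta> - z) powr (- (3 + \<alpha>))) \<partial>\<mu>)
        + (\<integral>\<^sup>+\<zeta>\<in>E. ennreal (norm (\<zeta> - w) powr (- (3 + \<alpha>))) \<partial>\<mu>)
        + 2 * (\<integral>\<^sup>+\<zeta>\<in>E. ennreal ((1 / sqrt (gradsq f \<zeta>)) powr q) \<partial>\<mu>)
        + (\<integral>\<^sup>+\<zeta>\<in>E. ennreal (norm (\<zeta> - z) powr (- ?s)) \<partial>\<mu>)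
        + (\<integral>\<^sup>+\<zeta>\<in>E. ennreal (norm (\<zeta> - w) powr (- ?s)) \<partial>\<mu>))"
      using E n_meas u_meas by (simp add: nn_integral_add nn_integral_cmult)
    also have "\<dots> \<le> ennreal t * (ennreal J1 + ennreal J1 + 2 * ennreal U + ennreal J2 + ennreal J2)"
      using J1(2) J2(2) U(2) unfolding E_def by (intro mult_left_mono add_mono) auto
    also have "\<dots> = ennreal (t * (J1 + J1 + 2 * U + J2 + J2))"
      by (rule ennreal_combine[OF t J1(1) J1(1) U(1) J2(1) J2(1), symmetric])
    also have "t * (J1 + J1 + 2 * U + J2 + J2) = C * dist z w powr \<alpha>"
      by (simp add: t_def C_def dist_norm)
    finally show "cmod ((LINT \<zeta>|\<mu>. k z \<zeta>) - (LINT \<zeta>|\<mu>. k w \<zeta>)) \<le> C * dist z w powr \<alpha>"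
      using C2(1) J1(1) J2(1) U(1) by (subst (asm) ennreal_le_iff) (simp_all add: C_def)
  qed
qed

end

section \<open>The Bochner-Martinelli form\<close>

definition fcls :: "(complex^3) set \<Rightarrow> (complex^3) set \<Rightarrow> real \<Rightarrow> pform \<Rightarrow> bool" where
  "fcls L N k \<Phi> \<longleftrightarrow> (\<forall>S. kcls L N k (\<lambda>p. \<Phi> p S))"

lemma fcls_wedge:
  assumes L: "L \<in> sets borel" and "fcls L N k \<Phi>" "fcls L N m \<Psi>" "0 \<le> k"
  shows "fcls L N (k + m) (\<lambda>p. \<Phi> p \<and>\<^sub>e \<Psi> p)"
  unfolding fcls_def wedge_apply mult.assoc
  using assms(2,3) by (intro allI kcls_sum[OF L] kcls_cmult[OF L] kcls_mult[OF _ _ assms(4)]) (simp_all add: fcls_def)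

lemma one_form_apply: "one_form c S = (\<Sum>l\<in>UNIV. c l * gen (D\<zeta> l) S)"
  unfolding one_form_def sum_ext_apply escale_def ..

lemma wirt_bar_const: "wirt_bar (\<lambda>q. c) p v w = 0"
  by (simp add: wirt_bar_def)

lemma wirt_bar_cmult:
  assumes "F differentiable (at p)"
  shows "wirt_bar (\<lambda>q. c * F q) p v w = c * wirt_bar F p v w"
proof -
  have "(F has_derivative frechet_derivative F (at p)) (at p)"
    using assms frechet_derivative_works by blast
  then have "((\<lambda>q. c * F q) has_derivative (\<lambda>v. c * frechet_derivative F (at p) v)) (at p)"
    by (rule has_derivative_mult_right)
  then have "frechet_derivative (\<lambda>q. c * F q) (at p) = (\<lambda>v. c * frechet_derivative F (at p) v)"
    using frechet_derivative_at by metis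
  then show ?thesis by (simp add: wirt_bar_def algebra_simps)
qed

text \<open>The coefficients of \<^const>\<open>bform\<close> up to \<open>2\<pi>i\<close> and, in \<open>dbcoef\<close>, their derivatives with respect to
  the conjugates of \<open>\<zeta>\<^sub>j\<close>. As they depend on \<open>\<eta>\<close> only, those with respect to the conjugates of \<open>z\<^sub>j\<close>
  differ by the sign.\<close>

definition bcoef :: "3 \<Rightarrow> (complex^3) \<times> (complex^3) \<Rightarrow> complex" where
  "bcoef l q = cnj (\<eta> q $ l) / complex_of_real ((norm (\<eta> q))\<^sup>2)"

lemma bform_apply: "bform p S = 1 / (2 * pi * \<i>) * (\<Sum>l\<in>UNIV. bcoef l p * gen (D\<zeta> l) S)"
  unfolding bform_def escale_def one_form_apply bcoef_def by simp

lemma bform_single: "bform p {D\<zeta> l} = 1 / (2 * pi * \<i>) * bcoef l p"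
  unfolding bform_apply gen_def by (simp add: if_distrib cong: if_cong)

lemma bform_eq_0: "(\<And>l. S \<noteq> {D\<zeta> l}) \<Longrightarrow> bform p S = 0"
  unfolding bform_apply gen_def by simp

lemma bounded_linear_eta: "bounded_linear \<eta>"
  unfolding \<eta>_def[abs_def] by (intro bounded_linear_sub bounded_linear_fst bounded_linear_snd)

lemma bcoef_has_derivative:
  assumes "\<eta> p \<noteq> 0"
  shows "(bcoef l has_derivative (\<lambda>v. (cnj (\<eta> v $ l) * complex_of_real ((norm (\<eta> p))\<^sup>2)
      - cnj (\<eta> p $ l) * complex_of_real (2 * (\<eta> p \<bullet> \<eta> v)))
      / (complex_of_real ((norm (\<eta> p))\<^sup>2) * complex_of_real ((norm (\<eta> p))\<^sup>2)))) (at p)"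
proof -
  have e: "(\<eta> has_derivative \<eta>) (at p)"
    by (rule bounded_linear_imp_has_derivative[OF bounded_linear_eta])
  have c: "((\<lambda>q. cnj (\<eta> q $ l)) has_derivative (\<lambda>v. cnj (\<eta> v $ l))) (at p)"
    by (intro bounded_linear.has_derivative[OF bounded_linear_cnj]
        bounded_linear.has_derivative[OF bounded_linear_vec_nth] e)
  have "((\<lambda>q. \<eta> q \<bullet> \<eta> q) has_derivative (\<lambda>v. \<eta> p \<bullet> \<eta> v + \<eta> v \<bullet> \<eta> p)) (at p)"
    by (rule has_derivative_inner[OF e e])
  then have "((\<lambda>q. (norm (\<eta> q))\<^sup>2) has_derivative (\<lambda>v. 2 * (\<eta> p \<bullet> \<eta> v))) (at p)"
    by (simp add: power2_norm_eq_inner inner_commute)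
  then have n: "((\<lambda>q. complex_of_real ((norm (\<eta> q))\<^sup>2)) has_derivative (\<lambda>v. complex_of_real (2 * (\<eta> p \<bullet> \<eta> v)))) (at p)"
    by (rule bounded_linear.has_derivative[OF bounded_linear_of_real])
  show ?thesis
    unfolding bcoef_def[abs_def] by (rule has_derivative_divide'[OF c n]) (use assms in simp)
qed

lemma bcoef_differentiable: "\<eta> p \<noteq> 0 \<Longrightarrow> bcoef l differentiable (at p)"
  using bcoef_has_derivative differentiableI by blast

definition dbcoef :: "3 \<Rightarrow> 3 \<Rightarrow> (complex^3) \<times> (complex^3) \<Rightarrow> complex" where
  "dbcoef j l p = (if j = l then 1 else 0) / complex_of_real ((norm (\<eta> p))\<^sup>2)
     - cnj (\<eta> p $ l) * \<eta> p $ j / complex_of_real ((norm (\<eta> p)) ^ 4)"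

lemma wirt_bcoef:
  assumes "\<eta> p \<noteq> 0"
  shows "wirt_bar (bcoef l) p (axis j 1, 0) (axis j \<i>, 0) = dbcoef j l p"
    and "wirt_bar (bcoef l) p (0, axis j 1) (0, axis j \<i>) = - dbcoef j l p"
proof -
  define n where "n = complex_of_real ((norm (\<eta> p))\<^sup>2)"
  have n: "n \<noteq> 0" using assms by (simp add: n_def)
  have n4: "complex_of_real ((norm (\<eta> p)) ^ 4) = n * n"
    unfolding n_def of_real_mult[symmetric] by (simp add: power_add[symmetric])
  have fr: "frechet_derivative (bcoef l) (at p) = (\<lambda>v. (cnj (\<eta> v $ l) * n
      - cnj (\<eta> p $ l) * complex_of_real (2 * (\<eta> p \<bullet> \<eta> v))) / (n * n))"
    using frechet_derivative_at[OF bcoef_has_derivative[OF assms, of l]] unfolding n_def by simp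
  have ev: "\<eta> (axis j c, 0) = axis j c" "\<eta> (0, axis j c) = - axis j c" for c :: complex
    by (simp_all add: \<eta>_def)
  have inn: "\<eta> p \<bullet> axis j 1 = Re (\<eta> p $ j)" "\<eta> p \<bullet> axis j \<i> = Im (\<eta> p $ j)"
    by (simp_all add: inner_axis inner_complex_def)
  have ax: "axis j c $ l = (if j = l then c else 0)" for c :: complex
    by (simp add: axis_def)
  have eq: "complex_of_real (2 * Re (\<eta> p $ j)) + \<i> * complex_of_real (2 * Im (\<eta> p $ j)) = 2 * \<eta> p $ j"
    by (simp add: complex_eq_iff)
  have num: "((if j = l then 1 else 0) * n - cnj (\<eta> p $ l) * complex_of_real (2 * Re (\<eta> p $ j))) / (n * n)
      + \<i> * (((if j = l then - \<i> else 0) * n - cnj (\<eta> p $ l) * complex_of_real (2 * Im (\<eta> p $ j))) / (n * n))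
      = 2 * dbcoef j l p"
  proof -
    have "((if j = l then 1 else 0) * n - cnj (\<eta> p $ l) * complex_of_real (2 * Re (\<eta> p $ j))) / (n * n)
      + \<i> * (((if j = l then - \<i> else 0) * n - cnj (\<eta> p $ l) * complex_of_real (2 * Im (\<eta> p $ j))) / (n * n))
      = (2 * (if j = l then 1 else 0) * n - cnj (\<eta> p $ l) * (complex_of_real (2 * Re (\<eta> p $ j)) + \<i> * complex_of_real (2 * Im (\<eta> p $ j)))) / (n * n)"
      using n by (simp add: field_simps)
    also have "\<dots> = 2 * dbcoef j l p"
      unfolding eq dbcoef_def n4 n_def[symmetric] using n by (simp add: field_simps)
    finally show ?thesis .
  qed
  show "wirt_bar (bcoef l) p (axis j 1, 0) (axis j \<i>, 0) = dbcoef j l p"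
    unfolding wirt_bar_def fr ev inn ax using num by (auto split: if_splits)
  have "frechet_derivative (bcoef l) (at p) (0, axis j c) = - frechet_derivative (bcoef l) (at p) (axis j c, 0)" for c
    unfolding fr ev by (simp add: field_simps minus_divide_left)
  note neg = this
  have "wirt_bar (bcoef l) p (0, axis j 1) (0, axis j \<i>) = - wirt_bar (bcoef l) p (axis j 1, 0) (axis j \<i>, 0)"
    unfolding wirt_bar_def neg by (simp add: field_simps)
  then show "wirt_bar (bcoef l) p (0, axis j 1) (0, axis j \<i>) = - dbcoef j l p"
    using \<open>wirt_bar (bcoef l) p (axis j 1, 0) (axis j \<i>, 0) = dbcoef j l p\<close> by simp
qed

lemma kcls_inv_norm_sq:
  assumes L: "L \<in> sets borel"
  shows "kcls L N 2 (\<lambda>p. 1 / complex_of_real ((norm (\<eta> p))\<^sup>2))"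
    and "kcls L N 4 (\<lambda>p. 1 / complex_of_real ((norm (\<eta> p)) ^ 4))"
proof -
  have "kcls L N (1 + 1) (\<lambda>p. complex_of_real (1 / norm (\<eta> p)) * complex_of_real (1 / norm (\<eta> p)))"
    by (rule kcls_mult[OF kcls_inv_norm[OF L] kcls_inv_norm[OF L]]) simp
  then show 2: "kcls L N 2 (\<lambda>p. 1 / complex_of_real ((norm (\<eta> p))\<^sup>2))"
    by (simp add: power2_eq_square)
  have "kcls L N (2 + 2) (\<lambda>p. 1 / complex_of_real ((norm (\<eta> p))\<^sup>2) * (1 / complex_of_real ((norm (\<eta> p))\<^sup>2)))"
    by (rule kcls_mult[OF 2 2]) simp
  moreover have "1 / complex_of_real ((norm (\<eta> p))\<^sup>2) * (1 / complex_of_real ((norm (\<eta> p))\<^sup>2))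
      = 1 / complex_of_real ((norm (\<eta> p)) ^ 4)" for p
    by (simp add: power_add[symmetric])
  ultimately show "kcls L N 4 (\<lambda>p. 1 / complex_of_real ((norm (\<eta> p)) ^ 4))" by simp
qed

lemma kcls_bcoef: "L \<in> sets borel \<Longrightarrow> kcls L N 1 (bcoef l)"
  using kcls_mult[OF kcls_inv_norm_sq(1) kcls_eta(2), of L N l] unfolding bcoef_def[abs_def] by simp

lemma kcls_dbcoef:
  assumes L: "L \<in> sets borel"
  shows "kcls L N 2 (dbcoef j l)"
proof -
  have "kcls L N (4 + - 1) (\<lambda>p. 1 / complex_of_real ((norm (\<eta> p)) ^ 4) * cnj (\<eta> p $ l))"
    by (rule kcls_mult[OF kcls_inv_norm_sq(2)[OF L] kcls_eta(2)[OF L]]) simp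
  then have "kcls L N (4 + - 1 + - 1) (\<lambda>p. 1 / complex_of_real ((norm (\<eta> p)) ^ 4) * cnj (\<eta> p $ l) * \<eta> p $ j)"
    by (rule kcls_mult[OF _ kcls_eta(1)[OF L]]) simp
  from kcls_add[OF kcls_cmult[OF L kcls_inv_norm_sq(1)[OF L], of N "if j = l then 1 else 0"]
      kcls_cmult[OF L, of N 2 "\<lambda>p. 1 / complex_of_real ((norm (\<eta> p)) ^ 4) * cnj (\<eta> p $ l) * \<eta> p $ j" "-1"]] this
  have "kcls L N 2 (\<lambda>p. (if j = l then 1 else 0) * (1 / complex_of_real ((norm (\<eta> p))\<^sup>2))
      + - 1 * (1 / complex_of_real ((norm (\<eta> p)) ^ 4) * cnj (\<eta> p $ l) * \<eta> p $ j))" by simp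
  moreover have "(if j = l then 1 else 0) * (1 / complex_of_real ((norm (\<eta> p))\<^sup>2))
      + - 1 * (1 / complex_of_real ((norm (\<eta> p)) ^ 4) * cnj (\<eta> p $ l) * \<eta> p $ j) = dbcoef j l p" for p
    by (simp add: dbcoef_def)
  ultimately show ?thesis by simp
qed

lemma fcls_bform: "L \<in> sets borel \<Longrightarrow> fcls L N 1 bform"
  unfolding fcls_def bform_apply
  by (intro allI kcls_cmult kcls_sum; assumption?)
     (simp only: mult.commute[of "bcoef _ _"], intro kcls_cmult kcls_bcoef; assumption)

lemma kcls_wirt_bform:
  assumes L: "L \<in> sets borel"
  shows "kcls L N 2 (\<lambda>p. wirt_bar (\<lambda>q. bform q T) p (axis j 1, 0) (axis j \<i>, 0))"
    and "kcls L N 2 (\<lambda>p. wirt_bar (\<lambda>q. bform q T) p (0, axis j 1) (0, axis j \<i>))"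
proof -
  consider l where "T = {D\<zeta> l}" | "\<And>l. T \<noteq> {D\<zeta> l}" by blast
  then have "kcls L N 2 (\<lambda>p. wirt_bar (\<lambda>q. bform q T) p (axis j 1, 0) (axis j \<i>, 0)) \<and>
    kcls L N 2 (\<lambda>p. wirt_bar (\<lambda>q. bform q T) p (0, axis j 1) (0, axis j \<i>))"
  proof cases
    case 1
    have e: "wirt_bar (\<lambda>q. bform q T) (\<zeta>, z) (axis j 1, 0) (axis j \<i>, 0) = 1 / (2 * pi * \<i>) * dbcoef j l (\<zeta>, z)"
      "wirt_bar (\<lambda>q. bform q T) (\<zeta>, z) (0, axis j 1) (0, axis j \<i>) = - (1 / (2 * pi * \<i>)) * dbcoef j l (\<zeta>, z)"
      if "\<zeta> \<noteq> z" for \<zeta> z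
    proof -
      have nz: "\<eta> (\<zeta>, z) \<noteq> 0" using that by (simp add: \<eta>_def)
      show "wirt_bar (\<lambda>q. bform q T) (\<zeta>, z) (axis j 1, 0) (axis j \<i>, 0) = 1 / (2 * pi * \<i>) * dbcoef j l (\<zeta>, z)"
        "wirt_bar (\<lambda>q. bform q T) (\<zeta>, z) (0, axis j 1) (0, axis j \<i>) = - (1 / (2 * pi * \<i>)) * dbcoef j l (\<zeta>, z)"
        unfolding 1 bform_single wirt_bar_cmult[OF bcoef_differentiable[OF nz]] wirt_bcoef[OF nz] by simp_all
    qed
    show ?thesis
    proof
      show "kcls L N 2 (\<lambda>p. wirt_bar (\<lambda>q. bform q T) p (axis j 1, 0) (axis j \<i>, 0))"
        by (rule kcls_cong[OF e(1)[symmetric] kcls_cmult[OF L kcls_dbcoef[OF L]]])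
      show "kcls L N 2 (\<lambda>p. wirt_bar (\<lambda>q. bform q T) p (0, axis j 1) (0, axis j \<i>))"
        by (rule kcls_cong[OF e(2)[symmetric] kcls_cmult[OF L kcls_dbcoef[OF L]]])
    qed
  next
    case 2
    then show ?thesis by (simp only: bform_eq_0[OF 2] wirt_bar_const kcls_zero[OF L])
  qed
  then show "kcls L N 2 (\<lambda>p. wirt_bar (\<lambda>q. bform q T) p (axis j 1, 0) (axis j \<i>, 0))"
    "kcls L N 2 (\<lambda>p. wirt_bar (\<lambda>q. bform q T) p (0, axis j 1) (0, axis j \<i>))" by blast+
qed

lemma dbar_apply:
  "dbar \<Phi> p S =
     (\<Sum>j\<in>UNIV. if D\<zeta>b j \<in> S then (-1) ^ below (D\<zeta>b j) (S - {D\<zeta>b j}) *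
        wirt_bar (\<lambda>q. \<Phi> q (S - {D\<zeta>b j})) p (axis j 1, 0) (axis j \<i>, 0) else 0) +
     (\<Sum>j\<in>UNIV. if Dzb j \<in> S then (-1) ^ below (Dzb j) (S - {Dzb j}) *
        wirt_bar (\<lambda>q. \<Phi> q (S - {Dzb j})) p (0, axis j 1) (0, axis j \<i>) else 0)"
  unfolding dbar_def plus_fun_apply sum_ext_apply wedge_gen_left ..

lemma fcls_dbar_bform:
  assumes L: "L \<in> sets borel"
  shows "fcls L N 2 (dbar bform)"
  unfolding fcls_def dbar_apply
proof (intro allI kcls_add kcls_sum[OF L])
  fix S :: "3 covec set" and j :: 3
  show "kcls L N 2 (\<lambda>p. if D\<zeta>b j \<in> S then (-1) ^ below (D\<zeta>b j) (S - {D\<zeta>b j}) *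
        wirt_bar (\<lambda>q. bform q (S - {D\<zeta>b j})) p (axis j 1, 0) (axis j \<i>, 0) else 0)"
    by (cases "D\<zeta>b j \<in> S") (simp_all only: if_True if_False kcls_zero[OF L] kcls_cmult[OF L kcls_wirt_bform(1)[OF L]])
  show "kcls L N 2 (\<lambda>p. if Dzb j \<in> S then (-1) ^ below (Dzb j) (S - {Dzb j}) *
        wirt_bar (\<lambda>q. bform q (S - {Dzb j})) p (0, axis j 1) (0, axis j \<i>) else 0)"
    by (cases "Dzb j \<in> S") (simp_all only: if_True if_False kcls_zero[OF L] kcls_cmult[OF L kcls_wirt_bform(2)[OF L]])
qed

lemma hol_deg_dbar:
  assumes "\<And>q. hol_deg k (\<Phi> q)"
  shows "hol_deg k (dbar \<Phi> p)"
proof -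
  have z: "\<Phi> q S = 0" if "card (S \<inter> range D\<zeta>) \<noteq> k" for q S
    using assms[of q] that by (auto simp: graded_def)
  have w: "hol_deg k (\<lambda>S. wirt_bar (\<lambda>q. \<Phi> q S) p v w)" for v w
    unfolding graded_def
  proof (intro allI impI, rule ccontr)
    fix S assume S: "wirt_bar (\<lambda>q. \<Phi> q S) p v w \<noteq> 0" "card (S \<inter> range D\<zeta>) \<noteq> k"
    have "(\<lambda>q. \<Phi> q S) = (\<lambda>q. 0)" using z[OF S(2)] by blast
    then show False using S(1) wirt_bar_const[of 0 p v w] by metis
  qed
  have n: "D\<zeta>b j \<notin> range D\<zeta>" "Dzb j \<notin> range D\<zeta>" for j :: 3 by auto
  show ?thesis
    unfolding dbar_def
    using graded_wedge[OF graded_gen_notin[OF n(1)] w] graded_wedge[OF graded_gen_notin[OF n(2)] w]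
    by (intro graded_add graded_sum) simp_all
qed

text \<open>The summands of \<^const>\<open>cauchy_powers\<close> have the degrees 1, 2, 3 in the differentials \<open>d\<zeta>\<^sub>l\<close>, as \<open>b\<close>
  has degree 1 and \<open>dbar\<close> preserves this degree.\<close>

lemma hol_part_cauchy_powers:
  assumes "\<And>q. hol_deg 1 (b q)"
  shows "hol_part 0 (cauchy_powers b p) = 0" "hol_part 1 (cauchy_powers b p) = b p"
    "hol_part 2 (cauchy_powers b p) = b p \<and>\<^sub>e dbar b p"
    "hol_part 0 (a \<and>\<^sub>e cauchy_powers b p) = 0"
    "hol_deg 0 a \<Longrightarrow> hol_part 1 (a \<and>\<^sub>e cauchy_powers b p) = a \<and>\<^sub>e b p"
proof -
  have 1: "hol_deg 1 (b p)" using assms .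
  have d: "hol_deg 1 (dbar b p)" by (rule hol_deg_dbar[OF assms])
  have 2: "hol_deg 2 (b p \<and>\<^sub>e dbar b p)" using graded_wedge[OF 1 d] by (simp add: numeral_2_eq_2)
  have 3: "hol_deg 3 (b p \<and>\<^sub>e dbar b p \<and>\<^sub>e dbar b p)"
    using graded_wedge[OF 1 graded_wedge[OF d d]] by (simp add: numeral_3_eq_3)
  show "hol_part 0 (cauchy_powers b p) = 0" "hol_part 1 (cauchy_powers b p) = b p"
    "hol_part 2 (cauchy_powers b p) = b p \<and>\<^sub>e dbar b p"
    unfolding cauchy_powers_def hol_part_add hol_part_graded[OF 1] hol_part_graded[OF 2] hol_part_graded[OF 3]
    by simp_all
  show "hol_part 0 (a \<and>\<^sub>e cauchy_powers b p) = 0"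
  proof
    fix S
    have "wsign T S * a T * cauchy_powers b p (S - T) = 0" if "card (S \<inter> range D\<zeta>) = 0" for T
    proof -
      have "S \<inter> range D\<zeta> = {}" using that by simp
      then have "card ((S - T) \<inter> range D\<zeta>) = 0" by (metis Diff_Int_distrib2 card.empty empty_Diff)
      then have "cauchy_powers b p (S - T) = hol_part 0 (cauchy_powers b p) (S - T)"
        by (simp add: hol_part_def)
      then show ?thesis using \<open>hol_part 0 (cauchy_powers b p) = 0\<close> by simp
    qed
    note z = this
    show "hol_part 0 (a \<and>\<^sub>e cauchy_powers b p) S = 0 S"
    proof (cases "card (S \<inter> range D\<zeta>) = 0")
      case True
      have "(a \<and>\<^sub>e cauchy_powers b p) S = 0"
        unfolding wedge_apply by (rule sum.neutral) (use z[OF True] in blast)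
      then show ?thesis by (simp add: hol_part_def)
    qed (simp add: hol_part_def)
  qed
  show "hol_part 1 (a \<and>\<^sub>e cauchy_powers b p) = a \<and>\<^sub>e b p" if a: "hol_deg 0 a"
  proof -
    have "hol_deg 1 (a \<and>\<^sub>e b p)" "hol_deg 2 (a \<and>\<^sub>e b p \<and>\<^sub>e dbar b p)"
      "hol_deg 3 (a \<and>\<^sub>e b p \<and>\<^sub>e dbar b p \<and>\<^sub>e dbar b p)"
      using graded_wedge[OF a 1] graded_wedge[OF a 2] graded_wedge[OF a 3] by (simp_all only: add_0)
    then show ?thesis
      unfolding cauchy_powers_def wedge_add_right hol_part_add by (simp add: hol_part_graded)
  qed
qed

lemma hol_deg_bform: "hol_deg 1 (bform q)"
  unfolding bform_def by (intro graded_escale graded_one_form)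

section \<open>The form g and the product with the Bochner-Martinelli form\<close>

text \<open>The derivatives of the cut-off function with respect to the conjugates of \<open>\<zeta>\<^sub>j\<close>.\<close>

definition dchi :: "(complex^3 \<Rightarrow> real) \<Rightarrow> 3 \<Rightarrow> complex^3 \<Rightarrow> complex" where
  "dchi chi j \<zeta> = wirt_bar (\<lambda>x. complex_of_real (chi x)) \<zeta> (axis j 1) (axis j \<i>)"

lemma gen_wedge_eone: "gen c \<and>\<^sub>e (k *\<^sub>e eone) = k *\<^sub>e gen c" for c :: "'i::{linorder,finite}"
proof
  fix S
  show "(gen c \<and>\<^sub>e (k *\<^sub>e eone)) S = (k *\<^sub>e gen c) S"
    unfolding wedge_gen_left
  proof (cases "S = {c}")
    case False
    then have "c \<in> S \<Longrightarrow> S - {c} \<noteq> {}" by blast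
    then show "(if c \<in> S then (- 1) ^ below c (S - {c}) * (k *\<^sub>e eone) (S - {c}) else 0) = (k *\<^sub>e gen c) S"
      using False by (simp add: escale_def eone_def gen_def)
  qed (simp add: escale_def eone_def gen_def)
qed

lemma dbar_cutoff:
  assumes "chi differentiable (at (fst p))"
  shows "dbar (\<lambda>q. complex_of_real (chi (fst q)) *\<^sub>e eone) p = (\<Sum>j\<in>UNIV. dchi chi j (fst p) *\<^sub>e gen (D\<zeta>b j))"
proof -
  define F where "F = (\<lambda>x. complex_of_real (chi x))"
  define F' where "F' = frechet_derivative F (at (fst p))"
  have F: "(F has_derivative F') (at (fst p))"
    using assms bounded_linear.has_derivative[OF bounded_linear_of_real] frechet_derivative_works
    unfolding F_def F'_def by (metis differentiable_def)
  have "((\<lambda>q. F (fst q)) has_derivative (\<lambda>v. F' (fst v))) (at p)"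
    by (rule has_derivative_compose[OF bounded_linear_imp_has_derivative[OF bounded_linear_fst] F])
  then have d: "(\<lambda>q. F (fst q)) differentiable (at p)" "frechet_derivative (\<lambda>q. F (fst q)) (at p) = (\<lambda>v. F' (fst v))"
    using differentiableI frechet_derivative_at by (blast, metis)
  have F0: "F' 0 = 0" using linear_0[OF has_derivative_linear[OF F]] .
  have w: "wirt_bar (\<lambda>q. F (fst q)) p (axis j 1, 0) (axis j \<i>, 0) = dchi chi j (fst p)"
    "wirt_bar (\<lambda>q. F (fst q)) p (0, axis j 1) (0, axis j \<i>) = 0" for j
    unfolding wirt_bar_def d(2) dchi_def F'_def F_def[symmetric] using F0[unfolded F'_def] by simp_all
  have c: "wirt_bar (\<lambda>q. (F (fst q) *\<^sub>e eone) S) p v w = eone S * wirt_bar (\<lambda>q. F (fst q)) p v w" for S :: "3 covec set" and v w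
    using wirt_bar_cmult[OF d(1), of "eone S"] by (simp add: escale_def mult.commute)
  have c1: "(\<lambda>S. wirt_bar (\<lambda>q. (F (fst q) *\<^sub>e eone) S) p (axis j 1, 0) (axis j \<i>, 0)) = dchi chi j (fst p) *\<^sub>e (eone :: 3 covec ext)" for j
    unfolding c w by (simp add: escale_def mult.commute)
  have c2: "(\<lambda>S. wirt_bar (\<lambda>q. (F (fst q) *\<^sub>e eone) S) p (0, axis j 1) (0, axis j \<i>)) = 0 *\<^sub>e (eone :: 3 covec ext)" for j
    unfolding c w by (simp add: escale_def)
  show ?thesis
    unfolding dbar_def F_def[symmetric, THEN fun_cong, symmetric] 
    using c1 c2 by (simp only: F_def gen_wedge_eone) (simp add: escale_def fun_eq_iff sum_ext_apply)
qed

lemma smooth_on_continuous: "smooth_on S F \<Longrightarrow> continuous_on S F"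
  unfolding smooth_on_def using Ck_on.simps(1) by metis

lemma smooth_on_differentiable: "smooth_on S F \<Longrightarrow> x \<in> S \<Longrightarrow> F differentiable (at x)"
  unfolding smooth_on_def using Ck_on.simps(2)[of 0] by metis

lemma smooth_on_frechet: "smooth_on S F \<Longrightarrow> continuous_on S (\<lambda>x. frechet_derivative F (at x) v)"
  unfolding smooth_on_def using Ck_on.simps by metis

lemma dchi_eq:
  assumes "chi differentiable (at x)"
  shows "dchi chi j x = (complex_of_real (frechet_derivative chi (at x) (axis j 1))
    + \<i> * complex_of_real (frechet_derivative chi (at x) (axis j \<i>))) / 2"
proof -
  have "(chi has_derivative frechet_derivative chi (at x)) (at x)"
    using assms frechet_derivative_works by blast
  then have "((\<lambda>x. complex_of_real (chi x)) has_derivative (\<lambda>v. complex_of_real (frechet_derivative chi (at x) v))) (at x)"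
    by (rule bounded_linear.has_derivative[OF bounded_linear_of_real])
  then have "frechet_derivative (\<lambda>x. complex_of_real (chi x)) (at x) = (\<lambda>v. complex_of_real (frechet_derivative chi (at x) v))"
    using frechet_derivative_at by metis
  then show ?thesis by (simp add: dchi_def wirt_bar_def)
qed

lemma continuous_dchi: "smooth_on UNIV chi \<Longrightarrow> continuous_on UNIV (dchi chi j)"
proof -
  assume s: "smooth_on UNIV chi"
  have "continuous_on UNIV (\<lambda>x. (complex_of_real (frechet_derivative chi (at x) (axis j 1))
    + \<i> * complex_of_real (frechet_derivative chi (at x) (axis j \<i>))) / 2)"
    by (intro continuous_intros smooth_on_frechet[OF s]) auto
  then show ?thesis
    by (rule continuous_on_eq) (simp add: dchi_eq[OF smooth_on_differentiable[OF s UNIV_I]])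
qed

lemma outside_support: "x \<notin> closure {\<zeta>. chi \<zeta> \<noteq> (0::real)} \<Longrightarrow> chi x = 0"
proof (rule ccontr)
  assume x: "x \<notin> closure {\<zeta>. chi \<zeta> \<noteq> 0}" "chi x \<noteq> 0"
  then have "x \<in> {\<zeta>. chi \<zeta> \<noteq> 0}" by simp
  then have "x \<in> closure {\<zeta>. chi \<zeta> \<noteq> 0}" by (rule subsetD[OF closure_subset])
  then show False using x(1) by contradiction
qed

lemma dchi_outside: "x \<notin> closure {\<zeta>. chi \<zeta> \<noteq> 0} \<Longrightarrow> dchi chi j x = 0"
proof -
  assume x: "x \<notin> closure {\<zeta>. chi \<zeta> \<noteq> 0}"
  have z: "chi y = 0" if "y \<in> - closure {\<zeta>. chi \<zeta> \<noteq> 0}" for y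
    using that outside_support by blast
  have "(chi has_derivative (\<lambda>h. 0)) (at x)"
  proof (rule has_derivative_transform_within_open[OF has_derivative_const[where c = 0]])
    show "open (- closure {\<zeta>. chi \<zeta> \<noteq> 0})" "x \<in> - closure {\<zeta>. chi \<zeta> \<noteq> 0}" using x by auto
    show "0 = chi y" if "y \<in> - closure {\<zeta>. chi \<zeta> \<noteq> 0}" for y using z[OF that] by simp
  qed
  then have "chi differentiable (at x)" "frechet_derivative chi (at x) = (\<lambda>h. 0)"
    using differentiableI frechet_derivative_at by (blast, metis)
  then show ?thesis by (simp add: dchi_eq)
qed

lemma supp_dbar_eq: "supp_dbar chi = closure {\<zeta>. \<exists>j. dchi chi j \<zeta> \<noteq> 0}"
  unfolding supp_dbar_def dchi_def ..

lemma supp_dbar_subset: "supp_dbar chi \<subseteq> closure {\<zeta>. chi \<zeta> \<noteq> 0}"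
  unfolding supp_dbar_eq
proof (rule closure_minimal)
  show "{\<zeta>. \<exists>j. dchi chi j \<zeta> \<noteq> 0} \<subseteq> closure {\<zeta>. chi \<zeta> \<noteq> 0}"
    using dchi_outside by blast
qed simp

lemma wedge_eone_left: "eone \<and>\<^sub>e X = X" for X :: "'i::{linorder,finite} ext"
proof
  fix S :: "'i set"
  have "wsign {} S = 1" by (rule wsign_cross) auto
  have "(eone \<and>\<^sub>e X) S = (\<Sum>T\<in>Pow S. if T = {} then wsign T S * X (S - T) else 0)"
    unfolding wedge_apply eone_def by (intro sum.cong) auto
  also have "\<dots> = X S" using \<open>wsign {} S = 1\<close> by (subst sum.delta) auto
  finally show "(eone \<and>\<^sub>e X) S = X S" .
qed

text \<open>\<open>(g \<and> B)\<^sub>2\<close> and, in \<open>cutoff_form\<close>, the product of \<open>dbar chi\<close> and \<open>s\<close>, which is up to sign the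
  component of \<open>g\<close> of degree 1 in the differentials \<open>d\<zeta>\<^sub>l\<close>.\<close>

definition koppelman_form :: "(complex^3 \<Rightarrow> real) \<Rightarrow> ((complex^3) \<times> (complex^3) \<Rightarrow> 3 \<Rightarrow> complex) \<Rightarrow> pform" where
  "koppelman_form chi s p = hol_part 2 (gform chi s p \<and>\<^sub>e Bform p)"

definition cutoff_form :: "(complex^3 \<Rightarrow> real) \<Rightarrow> ((complex^3) \<times> (complex^3) \<Rightarrow> 3 \<Rightarrow> complex) \<Rightarrow> pform" where
  "cutoff_form chi s p = (\<Sum>j\<in>UNIV. dchi chi j (fst p) *\<^sub>e gen (D\<zeta>b j)) \<and>\<^sub>e one_form (s p)"

text \<open>As \<open>B\<close> has no component of degree 0, only the components of \<open>g\<close> of degrees 0 and 1 contribute.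
  The first term has the singularity of \<open>b \<and> dbar b\<close>, of order 3; the second one that of \<open>b\<close>, of
  order 1.\<close>

lemma koppelman_form_eq:
  assumes "chi differentiable (at (fst p))"
  shows "koppelman_form chi s p = complex_of_real (chi (fst p)) *\<^sub>e (bform p \<and>\<^sub>e dbar bform p)
     - cutoff_form chi s p \<and>\<^sub>e bform p"
proof -
  define c where "c = (\<Sum>j\<in>UNIV. dchi chi j (fst p) *\<^sub>e gen (D\<zeta>b j) :: 3 covec ext)"
  have "D\<zeta>b j \<notin> range D\<zeta>" for j :: 3 by auto
  then have c0: "hol_deg 0 c"
    unfolding c_def by (intro graded_sum graded_escale graded_gen_notin)
  have one: "hol_deg 1 (one_form (s q))" for q by (rule graded_one_form)
  have g: "gform chi s p = complex_of_real (chi (fst p)) *\<^sub>e eone - c \<and>\<^sub>e cauchy_powers (\<lambda>q. one_form (s q)) p"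
    unfolding gform_def dbar_cutoff[OF assms] c_def ..
  have e: "hol_deg 0 (complex_of_real (chi (fst p)) *\<^sub>e eone)"
    by (intro graded_escale graded_eone)
  have g0: "hol_part 0 (gform chi s p) = complex_of_real (chi (fst p)) *\<^sub>e eone"
    unfolding g hol_part_diff hol_part_graded[OF e] hol_part_cauchy_powers(4)[OF one] by simp
  have g1: "hol_part 1 (gform chi s p) = - (c \<and>\<^sub>e one_form (s p))"
    unfolding g hol_part_diff hol_part_graded[OF e] hol_part_cauchy_powers(5)[OF one c0] by simp
  have zr: "hol_part 2 (gform chi s p) \<and>\<^sub>e 0 = 0" by (rule wedge_zero_right)
  have neg: "(- x) \<and>\<^sub>e y = - (x \<and>\<^sub>e y)" for x y :: "3 covec ext"
    using wedge_diff_left[of 0 x y] by (simp add: wedge_zero_left)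
  show ?thesis
    unfolding koppelman_form_def hol_part_wedge_2 g0 g1 Bform_def hol_part_cauchy_powers(1-3)[OF hol_deg_bform] zr
      wedge_escale_left wedge_eone_left neg cutoff_form_def c_def[symmetric] by simp
qed

lemma koppelman_form_outside:
  assumes "smooth_on UNIV chi" "fst p \<notin> closure {\<zeta>. chi \<zeta> \<noteq> 0}"
  shows "koppelman_form chi s p S = 0"
proof -
  have "chi (fst p) = 0" using assms(2) by (rule outside_support)
  moreover have "cutoff_form chi s p = 0"
    unfolding cutoff_form_def dchi_outside[OF assms(2)]
    by (simp add: escale_def zero_fun_def[symmetric] wedge_zero_left)
  ultimately show ?thesis
    unfolding koppelman_form_eq[OF smooth_on_differentiable[OF assms(1) UNIV_I]]
    by (simp add: escale_def wedge_zero_left)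
qed

lemma fcls_cutoff_form:
  assumes L: "L \<in> sets borel" and s: "\<And>j l. kcls L N 0 (\<lambda>p. dchi chi j (fst p) * s p l)"
  shows "fcls L N 0 (cutoff_form chi s)"
  unfolding fcls_def cutoff_form_def wedge_lin_left
proof (intro allI kcls_sum[OF L])
  fix S :: "3 covec set" and j :: 3
  define c where "c = ((-1) ^ below (D\<zeta>b j) (S - {D\<zeta>b j}) :: complex)"
  have "kcls L N 0 (\<lambda>p. dchi chi j (fst p) * c * one_form (s p) (S - {D\<zeta>b j}))"
  proof -
    have "dchi chi j (fst p) * c * one_form (s p) (S - {D\<zeta>b j})
      = (\<Sum>l\<in>UNIV. (c * gen (D\<zeta> l) (S - {D\<zeta>b j})) * (dchi chi j (fst p) * s p l))" for p
      unfolding one_form_apply sum_distrib_left by (simp add: ac_simps)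
    then show ?thesis by (simp only:) (intro kcls_sum[OF L] kcls_cmult[OF L] s)
  qed
  then show "kcls L N 0 (\<lambda>p. if D\<zeta>b j \<in> S then dchi chi j (fst p) * (-1) ^ below (D\<zeta>b j) (S - {D\<zeta>b j})
      * one_form (s p) (S - {D\<zeta>b j}) else 0)"
    unfolding c_def by (cases "D\<zeta>b j \<in> S") (simp_all only: if_True if_False kcls_zero[OF L])
qed

lemma fcls_koppelman_form:
  assumes chi: "smooth_on UNIV chi" and L: "compact L"
    and s: "\<And>j l. kcls L N 0 (\<lambda>p. dchi chi j (fst p) * s p l)"
    and d: "\<And>\<zeta> z. \<zeta> \<in> L \<Longrightarrow> z \<in> N \<Longrightarrow> norm (\<zeta> - z) \<le> d"
  shows "fcls L N 3 (koppelman_form chi s)"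
proof -
  have Lb: "L \<in> sets borel" using L by (rule borel_compact)
  have chic: "continuous_on UNIV (\<lambda>\<zeta>. complex_of_real (chi \<zeta>))"
    by (intro continuous_intros smooth_on_continuous[OF chi])
  obtain M where M: "\<And>\<zeta>. \<zeta> \<in> L \<Longrightarrow> cmod (complex_of_real (chi \<zeta>)) \<le> M"
    using compact_imp_bounded[OF compact_continuous_image[OF continuous_on_subset[OF chic subset_UNIV] L]]
    unfolding bounded_iff by (metis imageI)
  have "kcls L N 0 (\<lambda>p. complex_of_real (chi (fst p)))"
    by (rule kcls_indep[OF _ M])
       (intro borel_measurable_times borel_measurable_indicator Lb borel_measurable_continuous_onI[OF chic])
  have 1: "kcls L N 3 (\<lambda>p. complex_of_real (chi (fst p)) * (bform p \<and>\<^sub>e dbar bform p) S)" for S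
    using kcls_mult[OF \<open>kcls L N 0 (\<lambda>p. complex_of_real (chi (fst p)))\<close>,
        of "1 + 2" "\<lambda>p. (bform p \<and>\<^sub>e dbar bform p) S"]
      fcls_wedge[OF Lb fcls_bform[OF Lb] fcls_dbar_bform[OF Lb], of N] unfolding fcls_def by simp
  have 2: "kcls L N 3 (\<lambda>p. - 1 * (cutoff_form chi s p \<and>\<^sub>e bform p) S)" for S
  proof -
    have "kcls L N 1 (\<lambda>p. (cutoff_form chi s p \<and>\<^sub>e bform p) S)"
      using fcls_wedge[OF Lb fcls_cutoff_form[of L N chi s, OF Lb s] fcls_bform[OF Lb]]
      unfolding fcls_def by simp
    then have "kcls L N 3 (\<lambda>p. (cutoff_form chi s p \<and>\<^sub>e bform p) S)"
      by (rule kcls_mono[OF _ _ d]) simp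
    then show ?thesis by (rule kcls_cmult[OF Lb])
  qed
  have eq: "koppelman_form chi s p S = complex_of_real (chi (fst p)) * (bform p \<and>\<^sub>e dbar bform p) S
      + - 1 * (cutoff_form chi s p \<and>\<^sub>e bform p) S" for p S
    unfolding koppelman_form_eq[OF smooth_on_differentiable[OF chi UNIV_I]] by (simp add: escale_def)
  show ?thesis unfolding fcls_def eq by (intro allI kcls_add 1 2)
qed

text \<open>For \<open>\<zeta>\<close> in the support of \<open>dbar chi\<close> the section \<open>s\<close> is holomorphic in \<open>z\<close>, so Cauchy's inequality
  provides the Lipschitz estimate. For other \<open>\<zeta>\<close> the product vanishes.\<close>

lemma kcls_cutoff_section:
  assumes chi: "smooth_on UNIV chi" and L: "L = closure {\<zeta>. chi \<zeta> \<noteq> 0}" "compact L"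
    and s: "admissible_s E chi s" and r: "0 < r" "cball z0 (2 * r) \<subseteq> E"
    and N: "N \<subseteq> ball z0 r" and d: "\<And>\<zeta> z. \<zeta> \<in> L \<Longrightarrow> z \<in> N \<Longrightarrow> norm (\<zeta> - z) \<le> d"
  shows "kcls L N 0 (\<lambda>p. dchi chi j (fst p) * s p l)"
proof -
  define T where "T = supp_dbar chi"
  obtain W where W: "open W" "T \<times> closure E \<subseteq> W" "smooth_on W (\<lambda>p. s p l)"
    "\<forall>\<zeta>\<in>T. holo_on {z. (\<zeta>, z) \<in> W} (\<lambda>z. s (\<zeta>, z) l)"
    using s unfolding admissible_s_def T_def by blast
  have TL: "T \<subseteq> L" "closed T" using supp_dbar_subset[of chi] unfolding T_def L(1) supp_dbar_def by auto
  have Tc: "compact T" using L(2) TL compact_Int_closed[of L T] by (simp add: Int_absorb1)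
  have dchi0: "dchi chi j \<zeta> = 0" if "\<zeta> \<notin> T" for \<zeta>
    using that closure_subset[of "{\<zeta>. \<exists>j. dchi chi j \<zeta> \<noteq> 0}"] unfolding T_def supp_dbar_eq by blast
  have cW: "continuous_on W (\<lambda>p. s p l)" by (rule smooth_on_continuous[OF W(3)])
  have sub: "T \<times> cball z0 (2 * r) \<subseteq> W" using W(2) r(2) closure_subset[of E] by blast
  obtain M where "\<forall>p\<in>T \<times> cball z0 (2 * r). cmod (s p l) \<le> M"
    using compact_imp_bounded[OF compact_continuous_image[OF continuous_on_subset[OF cW sub]
          compact_Times[OF Tc compact_cball]]] unfolding bounded_iff by (metis imageI)
  then have M: "cmod (s (\<zeta>, z) l) \<le> M" if "\<zeta> \<in> T" "z \<in> cball z0 (2 * r)" for \<zeta> z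
    using that by blast
  have cd: "continuous_on UNIV (dchi chi j)" by (rule continuous_dchi[OF chi])
  obtain M' where M': "\<And>\<zeta>. \<zeta> \<in> T \<Longrightarrow> cmod (dchi chi j \<zeta>) \<le> M'"
    using compact_imp_bounded[OF compact_continuous_image[OF continuous_on_subset[OF cd subset_UNIV] Tc]]
    unfolding bounded_iff by (metis imageI)
  have Nb: "z \<in> ball z0 (2 * r)" "z \<in> cball z0 (2 * r)" "z \<in> ball z0 r" if "z \<in> N" for z
    using that N r(1) by auto
  show ?thesis
  proof (rule kcls_Lipschitz[where C = "\<bar>M'\<bar> * (\<bar>M\<bar> + \<bar>2 * M / r\<bar>)", OF _ _ _ d])
    fix z assume z: "z \<in> N"
    have "continuous_on T (\<lambda>\<zeta>. dchi chi j \<zeta> * s (\<zeta>, z) l)"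
    proof (intro continuous_on_mult continuous_on_subset[OF cd subset_UNIV])
      have "continuous_on T ((\<lambda>p. s p l) \<circ> (\<lambda>\<zeta>. (\<zeta>, z)))"
        by (rule continuous_on_compose[OF _ continuous_on_subset[OF cW]])
           (use sub Nb[OF z] in \<open>auto intro!: continuous_intros\<close>)
      then show "continuous_on T (\<lambda>\<zeta>. s (\<zeta>, z) l)" by (simp add: o_def)
    qed
    from borel_measurable_continuous_on_indicator[OF borel_closed[OF TL(2)] this]
    have "(\<lambda>\<zeta>. indicator T \<zeta> *\<^sub>R (dchi chi j \<zeta> * s (\<zeta>, z) l)) \<in> borel_measurable borel" .
    moreover have "(\<lambda>\<zeta>. indicator T \<zeta> *\<^sub>R (dchi chi j \<zeta> * s (\<zeta>, z) l))
        = (\<lambda>\<zeta>. indicator L \<zeta> * (dchi chi j (fst (\<zeta>, z)) * s (\<zeta>, z) l))"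
    proof
      fix \<zeta>
      show "indicator T \<zeta> *\<^sub>R (dchi chi j \<zeta> * s (\<zeta>, z) l)
        = indicator L \<zeta> * (dchi chi j (fst (\<zeta>, z)) * s (\<zeta>, z) l)"
        using dchi0[of \<zeta>] TL(1) by (cases "\<zeta> \<in> T") auto
    qed
    ultimately show "(\<lambda>\<zeta>. indicator L \<zeta> * (dchi chi j (fst (\<zeta>, z)) * s (\<zeta>, z) l)) \<in> borel_measurable borel" by simp
  next
    fix \<zeta> z assume h: "\<zeta> \<in> L" "z \<in> N"
    show "cmod (dchi chi j (fst (\<zeta>, z)) * s (\<zeta>, z) l) \<le> \<bar>M'\<bar> * (\<bar>M\<bar> + \<bar>2 * M / r\<bar>)"
    proof (cases "\<zeta> \<in> T")
      case True
      have "cmod (dchi chi j \<zeta>) \<le> \<bar>M'\<bar>" "cmod (s (\<zeta>, z) l) \<le> \<bar>M\<bar> + \<bar>2 * M / r\<bar>"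
        using M'[OF True] M[OF True Nb(2)[OF h(2)]] abs_ge_self[of M'] abs_ge_self[of M] abs_ge_zero[of "2 * M / r"]
        by linarith+
      then show ?thesis by (simp add: norm_mult mult_mono)
    qed (simp add: dchi0)
  next
    fix \<zeta> z w assume h: "\<zeta> \<in> L" "z \<in> N" "w \<in> N"
    show "cmod (dchi chi j (fst (\<zeta>, z)) * s (\<zeta>, z) l - dchi chi j (fst (\<zeta>, w)) * s (\<zeta>, w) l)
        \<le> \<bar>M'\<bar> * (\<bar>M\<bar> + \<bar>2 * M / r\<bar>) * norm (z - w)"
    proof (cases "\<zeta> \<in> T")
      case True
      have "holo_on (ball z0 (2 * r)) (\<lambda>z. s (\<zeta>, z) l)"
      proof (rule holo_on_subset[OF bspec[OF W(4) True]])
        show "ball z0 (2 * r) \<subseteq> {z. (\<zeta>, z) \<in> W}" using sub True by auto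
      qed
      then have "cmod (s (\<zeta>, z) l - s (\<zeta>, w) l) \<le> 2 * M / r * dist z w"
        by (rule holo_on_Lipschitz) (use M[OF True] r(1) Nb h in auto)
      also have "\<dots> \<le> (\<bar>M\<bar> + \<bar>2 * M / r\<bar>) * norm (z - w)"
        unfolding dist_norm using abs_ge_self[of "2 * M / r"] abs_ge_zero[of M]
        by (intro mult_right_mono) (linarith, simp)
      finally have "cmod (s (\<zeta>, z) l - s (\<zeta>, w) l) \<le> (\<bar>M\<bar> + \<bar>2 * M / r\<bar>) * norm (z - w)" .
      moreover have "cmod (dchi chi j \<zeta>) \<le> \<bar>M'\<bar>" using M'[OF True] by linarith
      ultimately have "cmod (dchi chi j \<zeta>) * cmod (s (\<zeta>, z) l - s (\<zeta>, w) l)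
          \<le> \<bar>M'\<bar> * ((\<bar>M\<bar> + \<bar>2 * M / r\<bar>) * norm (z - w))"
        by (intro mult_mono) auto
      then show ?thesis by (simp add: norm_mult[symmetric] right_diff_distrib mult.assoc)
    qed (simp add: dchi0)
  qed
qed

section \<open>The Hefer form\<close>

text \<open>For \<open>z = \<zeta> - t e\<^sub>l\<close> the equation \<open>\<delta>\<^sub>\<eta> h = f(\<zeta>) - f(z)\<close> reads \<open>2\<pi>i t h\<^sub>l = f(\<zeta>) - f(z)\<close>. Divide by
  \<open>t\<close> and let \<open>t\<close> tend to 0.\<close>

lemma hefer_diagonal:
  assumes h: "admissible_h f D h" and D: "open D" "\<zeta> \<in> D" and f: "holo_on D f"
  shows "h (\<zeta>, \<zeta>) l = df f \<zeta> l / (2 * pi * \<i>)"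
proof -
  have hol: "holo2_on (D \<times> D) (\<lambda>p. h p l)" and dl: "\<And>p. p \<in> D \<times> D \<Longrightarrow> \<delta>\<eta> p (h p) = f (fst p) - f (snd p)"
    using h unfolding admissible_h_def by blast+
  have hc: "continuous_on (D \<times> D) (\<lambda>p. h p l)" by (rule holo_on_continuous[OF hol])
  define e where "e = (axis l 1 :: complex^3)"
  define z where "z = (\<lambda>t. \<zeta> + t *s (- e))"
  have zc: "isCont z 0"
    unfolding z_def by (intro continuous_intros linear_continuous_at[OF bounded_linear_scalar_mult])
  have z0: "z 0 = \<zeta>" by (simp add: z_def)
  have zlim: "(z \<longlongrightarrow> \<zeta>) (at 0)" using zc unfolding isCont_def z0 .
  have ev: "\<forall>\<^sub>F t in at 0. z t \<in> D" by (rule topological_tendstoD[OF zlim D])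
  have "((\<lambda>t. h (\<zeta>, z t) l) \<longlongrightarrow> h (\<zeta>, \<zeta>) l) (at 0)"
  proof -
    have "isCont (\<lambda>p. h p l) (\<zeta>, \<zeta>)"
      using hc D by (simp add: continuous_on_eq_continuous_at open_Times)
    moreover have "((\<lambda>t. (\<zeta>, z t)) \<longlongrightarrow> (\<zeta>, \<zeta>)) (at 0)"
      by (intro tendsto_intros zlim)
    ultimately show ?thesis by (rule isCont_tendsto_compose)
  qed
  then have lim1: "((\<lambda>t. 2 * pi * \<i> * h (\<zeta>, z t) l) \<longlongrightarrow> 2 * pi * \<i> * h (\<zeta>, \<zeta>) l) (at 0)"
    by (intro tendsto_intros)
  define F where "F = frechet_derivative f (at \<zeta>)"
  have "((\<lambda>t. f (\<zeta> + t *s (- e))) has_field_derivative F (- e)) (at 0)"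
    using holo_on_complex_line[OF f, of \<zeta> 0 "- e"] D(2) unfolding F_def by simp
  then have "((\<lambda>t. (f (z t) - f (z 0)) / (t - 0)) \<longlongrightarrow> F (- e)) (at 0)"
    unfolding has_field_derivative_iff z_def .
  moreover have "F (- e) = - F e"
    unfolding F_def by (rule linear_neg[OF holo_on_frechet(2)[OF f D(2)]])
  ultimately have "((\<lambda>t. - ((f (z t) - f \<zeta>) / t)) \<longlongrightarrow> - (- F e)) (at 0)"
    unfolding z0 by (intro tendsto_minus) simp
  then have lim2: "((\<lambda>t. (f \<zeta> - f (z t)) / t) \<longlongrightarrow> F e) (at 0)"
    by (simp add: minus_divide_left)
  have eq: "\<forall>\<^sub>F t in at 0. (f \<zeta> - f (z t)) / t = 2 * pi * \<i> * h (\<zeta>, z t) l"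
    using ev eventually_neq_at_within[of 0 0 UNIV]
  proof eventually_elim
    case (elim t)
    have "\<eta> (\<zeta>, z t) $ k = (if k = l then t else 0)" for k
      by (simp add: \<eta>_def z_def e_def axis_def)
    then have "\<delta>\<eta> (\<zeta>, z t) (h (\<zeta>, z t)) = 2 * pi * \<i> * (t * h (\<zeta>, z t) l)"
      unfolding \<delta>\<eta>_def by (simp add: if_distrib[of "\<lambda>x. x * _"] cong: if_cong)
    then have "f \<zeta> - f (z t) = 2 * pi * \<i> * (t * h (\<zeta>, z t) l)"
      using dl[of "(\<zeta>, z t)"] D(2) elim by simp
    then show ?case using elim by simp
  qed
  have "2 * pi * \<i> * h (\<zeta>, \<zeta>) l = F e"
    by (rule tendsto_unique[OF _ lim1 Lim_transform_eventually[OF lim2 eq]]) simp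
  then have "h (\<zeta>, \<zeta>) l = F e / (2 * pi * \<i>)" by (simp add: field_simps)
  then show ?thesis unfolding df_def F_def e_def .
qed

lemma holo2_slice:
  assumes "holo2_on (D \<times> D') H" "\<zeta> \<in> D"
  shows "holo_on D' (\<lambda>z. H (\<zeta>, z))"
  unfolding cholo_on_def
proof
  fix z assume z: "z \<in> D'"
  then obtain L where L: "(H has_derivative L) (at (\<zeta>, z))" "\<And>v. L (map_prod ((*s) \<i>) ((*s) \<i>) v) = \<i> * L v"
    using assms unfolding cholo_on_def by blast
  have "((\<lambda>z. (\<zeta>, z)) has_derivative (\<lambda>v. (0, v))) (at z)"
    by (auto intro!: derivative_eq_intros)
  from has_derivative_compose[OF this L(1)]
  have "((\<lambda>z. H (\<zeta>, z)) has_derivative (\<lambda>v. L (0, v))) (at z)" .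
  moreover have "L (0, \<i> *s v) = \<i> * L (0, v)" for v using L(2)[of "(0, v)"] by simp
  ultimately show "\<exists>L. ((\<lambda>z. H (\<zeta>, z)) has_derivative L) (at z) \<and> (\<forall>v. L (\<i> *s v) = \<i> * L v)"
    by blast
qed

text \<open>The exponent \<open>-1\<close> expresses that the difference vanishes to first order on the diagonal. If \<open>\<zeta>\<close>
  is close to \<open>z\<close>, this is the Lipschitz estimate for holomorphic functions. Otherwise \<open>h\<close> is
  bounded and \<open>|\<zeta> - z|\<close> is bounded below.\<close>

lemma kcls_hefer_difference:
  assumes hol: "holo2_on (D \<times> D) (\<lambda>p. h p l)" and D: "open D" and L: "compact L" "L \<subseteq> D"
    and r: "0 < r" "cball z0 (2 * r) \<subseteq> D" and N: "N \<subseteq> ball z0 (r / 2)"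
  shows "kcls L N (- 1) (\<lambda>p. h p l - h (fst p, fst p) l)"
proof -
  have hc: "continuous_on (D \<times> D) (\<lambda>p. h p l)" by (rule holo_on_continuous[OF hol])
  define K where "K = L \<times> (cball z0 (2 * r) \<union> L)"
  have K: "compact K" "K \<subseteq> D \<times> D" unfolding K_def using L r by (auto intro!: compact_Times compact_Un)
  obtain M where M: "\<And>p. p \<in> K \<Longrightarrow> cmod (h p l) \<le> M"
    using compact_imp_bounded[OF compact_continuous_image[OF continuous_on_subset[OF hc K(2)] K(1)]]
    unfolding bounded_iff by (metis imageI)
  have M0: "M \<ge> 0" if "\<zeta> \<in> L" for \<zeta>
    using order_trans[OF norm_ge_zero M[of "(\<zeta>, \<zeta>)"]] that by (simp add: K_def)
  have Lip: "cmod (h (\<zeta>, z) l - h (\<zeta>, w) l) \<le> 2 * M / r * dist z w"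
    if "\<zeta> \<in> L" "z \<in> ball z0 r" "w \<in> ball z0 r" for \<zeta> z w
  proof (rule holo_on_Lipschitz[OF _ _ r(1) that(2,3)])
    show "holo_on (ball z0 (2 * r)) (\<lambda>z. h (\<zeta>, z) l)"
      by (rule holo_on_subset[OF holo2_slice[OF hol]]) (use that(1) L(2) r(2) ball_subset_cball in blast)+
    show "cmod (h (\<zeta>, x) l) \<le> M" if "x \<in> ball z0 (2 * r)" for x
      using \<open>\<zeta> \<in> L\<close> that by (intro M) (auto simp: K_def)
  qed
  have Nr: "z \<in> ball z0 r" "dist z z0 < r / 2" "z \<in> cball z0 (2 * r)" if "z \<in> N" for z
    using that N r(1) by (auto simp: dist_commute subset_iff)
  define C where "C = \<bar>4 * M / r\<bar>"
  show ?thesis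
  proof (rule kclsI[where C = C])
    fix z assume z: "z \<in> N"
    have "continuous_on L (\<lambda>\<zeta>. h (\<zeta>, z) l)" "continuous_on L (\<lambda>\<zeta>. h (\<zeta>, \<zeta>) l)"
    proof -
      have "continuous_on L ((\<lambda>p. h p l) \<circ> (\<lambda>\<zeta>. (\<zeta>, z)))"
        by (rule continuous_on_compose[OF _ continuous_on_subset[OF hc]])
           (use L(2) r(2) Nr(3)[OF z] in \<open>auto intro!: continuous_intros\<close>)
      then show "continuous_on L (\<lambda>\<zeta>. h (\<zeta>, z) l)" by (simp add: o_def)
      have "continuous_on L ((\<lambda>p. h p l) \<circ> (\<lambda>\<zeta>. (\<zeta>, \<zeta>)))"
        by (rule continuous_on_compose[OF _ continuous_on_subset[OF hc]])
           (use L(2) in \<open>auto intro!: continuous_intros\<close>)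
      then show "continuous_on L (\<lambda>\<zeta>. h (\<zeta>, \<zeta>) l)" by (simp add: o_def)
    qed
    then have "continuous_on L (\<lambda>\<zeta>. h (\<zeta>, z) l - h (\<zeta>, \<zeta>) l)" by (intro continuous_on_diff)
    from borel_measurable_times[OF borel_measurable_indicator borel_measurable_continuous_on_indicator[OF borel_compact[OF L(1)] this], of "- {z}"]
    have "(\<lambda>\<zeta>. indicator (- {z}) \<zeta> * (indicator L \<zeta> *\<^sub>R (h (\<zeta>, z) l - h (\<zeta>, \<zeta>) l))) \<in> borel_measurable borel"
      by simp
    moreover have "(\<lambda>\<zeta>. indicator (- {z}) \<zeta> * (indicator L \<zeta> *\<^sub>R (h (\<zeta>, z) l - h (\<zeta>, \<zeta>) l)))
       = (\<lambda>\<zeta>. indicator (L - {z}) \<zeta> * (h (\<zeta>, z) l - h (fst (\<zeta>, z), fst (\<zeta>, z)) l))"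
      by (auto simp: fun_eq_iff indicator_def)
    ultimately show "(\<lambda>\<zeta>. indicator (L - {z}) \<zeta> * (h (\<zeta>, z) l - h (fst (\<zeta>, z), fst (\<zeta>, z)) l)) \<in> borel_measurable borel"
      by simp
  next
    show "0 \<le> C" by (simp add: C_def)
    show "cmod (h (\<zeta>, z) l - h (fst (\<zeta>, z), fst (\<zeta>, z)) l) \<le> C * norm (\<zeta> - z) powr - (- 1)"
      if h: "\<zeta> \<in> L" "z \<in> N" "\<zeta> \<noteq> z" for \<zeta> z
    proof (cases "\<zeta> \<in> ball z0 r")
      case True
      have "cmod (h (\<zeta>, z) l - h (\<zeta>, \<zeta>) l) \<le> 2 * M / r * dist z \<zeta>"
        by (rule Lip[OF h(1) Nr(1)[OF h(2)] True])
      also have "\<dots> \<le> C * dist z \<zeta>"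
      proof (intro mult_right_mono)
        show "2 * M / r \<le> C" using r(1) M0[OF h(1)] by (simp add: C_def field_simps)
      qed simp
      finally show ?thesis using h by (simp add: dist_norm norm_minus_commute)
    next
      case False
      have "r \<le> dist \<zeta> z0" using False by (simp add: dist_commute)
      also have "\<dots> \<le> dist \<zeta> z + dist z z0" by (rule dist_triangle)
      finally have far: "r / 2 \<le> norm (\<zeta> - z)" using Nr(2)[OF h(2)] by (simp add: dist_norm)
      have "cmod (h (\<zeta>, z) l - h (\<zeta>, \<zeta>) l) \<le> M + M"
        by (rule order_trans[OF norm_triangle_ineq4 add_mono]) (use h Nr(3)[OF h(2)] in \<open>auto intro!: M simp: K_def simp del: mem_cball\<close>)
      also have "\<dots> = 4 * M / r * (r / 2)" using r(1) by simp
      also have "\<dots> \<le> C * norm (\<zeta> - z)"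
        unfolding C_def using far r(1) M0[OF h(1)] by (intro mult_mono) auto
      finally show ?thesis using h by simp
    qed
    show "cmod (h (\<zeta>, z) l - h (fst (\<zeta>, z), fst (\<zeta>, z)) l - (h (\<zeta>, w) l - h (fst (\<zeta>, w), fst (\<zeta>, w)) l))
        \<le> C * norm (z - w) * norm (\<zeta> - z) powr (- (- 1) - 1)"
      if h: "\<zeta> \<in> L" "z \<in> N" "w \<in> N" "\<zeta> \<noteq> z" "\<zeta> \<noteq> w" for \<zeta> z w
    proof -
      have "cmod (h (\<zeta>, z) l - h (\<zeta>, w) l) \<le> 2 * M / r * dist z w"
        by (rule Lip[OF h(1) Nr(1)[OF h(2)] Nr(1)[OF h(3)]])
      also have "\<dots> \<le> C * dist z w"
      proof (intro mult_right_mono)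
        show "2 * M / r \<le> C" using r(1) M0[OF h(1)] by (simp add: C_def field_simps)
      qed simp
      finally show ?thesis using h by (simp add: dist_norm)
    qed
  qed
qed

section \<open>Koppelman operators are Hoelder continuous\<close>

lemma borel_measurable_cnj:
  "g \<in> borel_measurable M \<Longrightarrow> (\<lambda>x. cnj (g x)) \<in> borel_measurable M"
proof (rule measurable_compose[of g M borel cnj borel])
  show "cnj \<in> borel_measurable borel"
    by (intro borel_measurable_continuous_onI continuous_on_cnj continuous_on_id)
qed

context surface
begin

lemma of_real_gradsq_measurable_mu: "(\<lambda>x. complex_of_real (gradsq f x)) \<in> borel_measurable \<mu>"
  using gradsq_measurable_mu by measurable

lemma structure_at:
  assumes st: "structure_form f (X - {0}) \<omega>" and x: "x \<in> X - {0}"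
  shows "density22 f x (z_coeff I (\<omega> x \<and>\<^sub>e \<beta>)) = 8 * pi * \<i> / gradsq f x *
      (\<Sum>l\<in>UNIV. esgn l * cnj (df f x l) * \<beta> (D\<zeta>b ` (UNIV - {l}) \<union> Dzb ` I))"
    and "1 / sqrt (gradsq f x) \<le> form_norm f x (\<omega> x)"
proof -
  have w: "bidegree 2 0 (\<omega> x)" "one_form (df f x) \<and>\<^sub>e \<omega> x = (2 * pi * \<i>) *\<^sub>e d\<zeta>123"
    using st x unfolding structure_form_def by blast+
  have xO: "x \<in> \<Omega>'" using x by (auto simp: X_iff)
  show "density22 f x (z_coeff I (\<omega> x \<and>\<^sub>e \<beta>)) = 8 * pi * \<i> / gradsq f x *
      (\<Sum>l\<in>UNIV. esgn l * cnj (df f x l) * \<beta> (D\<zeta>b ` (UNIV - {l}) \<union> Dzb ` I))"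
    by (rule density22_structure[OF df_linear[OF xO] regular[OF x] w])
  have g: "sqrt (gradsq f x) > 0" by (rule sqrt_gradsq(1)[OF x])
  have "1 \<le> 2 * pi" using pi_gt3 by linarith
  also have "2 * pi \<le> form_norm f x (\<omega> x) * sqrt (gradsq f x)"
    by (rule form_norm_structure[OF df_linear[OF xO] regular[OF x] w(2)])
  finally show "1 / sqrt (gradsq f x) \<le> form_norm f x (\<omega> x)"
    using g by (simp add: field_simps)
qed

lemma structure_integral:
  assumes st: "structure_form f (X - {0}) \<omega>" and int: "in_Lq f \<mu> q \<omega>" and q: "1 < q"
  obtains U where "U \<ge> 0"
    "(\<integral>\<^sup>+\<zeta>\<in>(X - {0}) \<inter> L. ennreal ((1 / sqrt (gradsq f \<zeta>)) powr q) \<partial>\<mu>) \<le> ennreal U"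
proof -
  have "(\<integral>\<^sup>+\<zeta>\<in>(X - {0}) \<inter> L. ennreal ((1 / sqrt (gradsq f \<zeta>)) powr q) \<partial>\<mu>)
      \<le> (\<integral>\<^sup>+\<zeta>. ennreal (norm (form_norm f \<zeta> (\<omega> \<zeta>) powr q)) \<partial>\<mu>)"
  proof (rule nn_integral_mono)
    fix x assume "x \<in> space \<mu>"
    then have x: "x \<in> X - {0}" by (simp add: space_mu)
    have "0 \<le> 1 / sqrt (gradsq f x)" using sqrt_gradsq(1)[OF x] by simp
    then have "(1 / sqrt (gradsq f x)) powr q \<le> form_norm f x (\<omega> x) powr q"
      using structure_at(2)[OF st x] q by (intro powr_mono2) auto
    then have "ennreal ((1 / sqrt (gradsq f x)) powr q) \<le> ennreal (norm (form_norm f x (\<omega> x) powr q))"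
      by (intro ennreal_leI) simp
    then show "ennreal ((1 / sqrt (gradsq f x)) powr q) * indicator ((X - {0}) \<inter> L) x
        \<le> ennreal (norm (form_norm f x (\<omega> x) powr q))"
      by (auto simp: indicator_def)
  qed
  also have "\<dots> < \<infinity>" using int unfolding in_Lq_def integrable_iff_bounded by blast
  finally have "(\<integral>\<^sup>+\<zeta>\<in>(X - {0}) \<inter> L. ennreal ((1 / sqrt (gradsq f \<zeta>)) powr q) \<partial>\<mu>) < \<infinity>" .
  then obtain U where "U \<ge> 0"
      "(\<integral>\<^sup>+\<zeta>\<in>(X - {0}) \<inter> L. ennreal ((1 / sqrt (gradsq f \<zeta>)) powr q) \<partial>\<mu>) = ennreal U"
    by (cases "\<integral>\<^sup>+\<zeta>\<in>(X - {0}) \<inter> L. ennreal ((1 / sqrt (gradsq f \<zeta>)) powr q) \<partial>\<mu>") auto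
  then show ?thesis by (intro that[of U]) simp_all
qed

lemma compact_X:
  assumes "compact L" "L \<subseteq> \<Omega>'"
  shows "compact (X \<inter> L)"
proof -
  have "closed {x \<in> L. f x = 0}"
    by (rule continuous_closed_preimage_constant[OF continuous_on_subset[OF holo_on_continuous[OF holo] assms(2)]
          compact_imp_closed[OF assms(1)]])
  moreover have "X \<inter> L = L \<inter> {x \<in> L. f x = 0}" using assms(2) by (auto simp: X_iff)
  ultimately show ?thesis using assms(1) by (simp add: compact_Int_closed)
qed

lemma continuous_on_compact_mu:
  fixes g :: "complex^3 \<Rightarrow> complex"
  assumes L: "compact L" "L \<subseteq> \<Omega>'" and g: "continuous_on (X \<inter> L) g"
  shows "(\<lambda>x. indicator L x * g x) \<in> borel_measurable \<mu>" and "\<exists>M\<ge>0. \<forall>x\<in>X \<inter> L. cmod (g x) \<le> M"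
proof -
  note c = compact_X[OF L]
  show "(\<lambda>x. indicator L x * g x) \<in> borel_measurable \<mu>"
    using measurable_mu[OF borel_measurable_continuous_on_indicator[OF borel_compact[OF c] g]]
    by (rule measurable_cong[THEN iffD1, rotated]) (auto simp: space_mu indicator_def)
  obtain M where "\<forall>x\<in>X \<inter> L. cmod (g x) \<le> M"
    using compact_imp_bounded[OF compact_continuous_image[OF g c]] unfolding bounded_iff by (metis imageI)
  then have "\<forall>x\<in>X \<inter> L. cmod (g x) \<le> \<bar>M\<bar>" using abs_ge_self[of M] order_trans by blast
  then show "\<exists>M\<ge>0. \<forall>x\<in>X \<inter> L. cmod (g x) \<le> M" by (intro exI[of _ "\<bar>M\<bar>"]) simp
qed

text \<open>The Hefer form is split into its value on the diagonal, which is \<open>df / 2\<pi>i\<close>, and the rest. Taking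
  the coefficient of \<open>d\<zeta>\<^sub>1 d\<zeta>\<^sub>2 d\<zeta>\<^sub>3\<close> solves the equation for the kernel \<open>k\<close>.\<close>

lemma koppelman_kernel_eq:
  assumes h: "admissible_h f D h" and D: "open D" "D \<subseteq> \<Omega>'" "\<zeta> \<in> D"
    and K: "d\<zeta>123 \<and>\<^sub>e k = one_form (h (\<zeta>, z)) \<and>\<^sub>e hol_part 2 (gform chi s (\<zeta>, z) \<and>\<^sub>e Bform (\<zeta>, z))"
    and T: "T \<inter> range D\<zeta> = {}"
  shows "k T = (\<Sum>m\<in>UNIV. df f \<zeta> m * (1 / (2 * pi * \<i>) * (-1) ^ below (D\<zeta> m) (range D\<zeta> \<union> T - {D\<zeta> m})
        * koppelman_form chi s (\<zeta>, z) (range D\<zeta> \<union> T - {D\<zeta> m})))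
    + (\<Sum>m\<in>UNIV. (-1) ^ below (D\<zeta> m) (range D\<zeta> \<union> T - {D\<zeta> m})
        * (koppelman_form chi s (\<zeta>, z) (range D\<zeta> \<union> T - {D\<zeta> m}) * (h (\<zeta>, z) m - h (\<zeta>, \<zeta>) m)))"
proof -
  have "k T = (one_form (h (\<zeta>, z)) \<and>\<^sub>e koppelman_form chi s (\<zeta>, z)) (range D\<zeta> \<union> T)"
    using wedge_d_zeta_123[OF T, of k] K unfolding koppelman_form_def by simp
  also have "\<dots> = (\<Sum>m\<in>UNIV. h (\<zeta>, z) m * (-1) ^ below (D\<zeta> m) (range D\<zeta> \<union> T - {D\<zeta> m})
      * koppelman_form chi s (\<zeta>, z) (range D\<zeta> \<union> T - {D\<zeta> m}))"
    unfolding one_form_def wedge_lin_left by simp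
  also have "\<dots> = (\<Sum>m\<in>UNIV. df f \<zeta> m * (1 / (2 * pi * \<i>) * (-1) ^ below (D\<zeta> m) (range D\<zeta> \<union> T - {D\<zeta> m})
        * koppelman_form chi s (\<zeta>, z) (range D\<zeta> \<union> T - {D\<zeta> m}))
      + (-1) ^ below (D\<zeta> m) (range D\<zeta> \<union> T - {D\<zeta> m})
        * (koppelman_form chi s (\<zeta>, z) (range D\<zeta> \<union> T - {D\<zeta> m}) * (h (\<zeta>, z) m - h (\<zeta>, \<zeta>) m)))"
  proof (rule sum.cong)
    fix m :: 3
    have d: "h (\<zeta>, \<zeta>) m = df f \<zeta> m / (2 * pi * \<i>)"
      by (rule hefer_diagonal[OF h D(1,3) holo_on_subset[OF holo D(2)]])
    show "h (\<zeta>, z) m * (-1) ^ below (D\<zeta> m) (range D\<zeta> \<union> T - {D\<zeta> m})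
        * koppelman_form chi s (\<zeta>, z) (range D\<zeta> \<union> T - {D\<zeta> m})
      = df f \<zeta> m * (1 / (2 * pi * \<i>) * (-1) ^ below (D\<zeta> m) (range D\<zeta> \<union> T - {D\<zeta> m})
        * koppelman_form chi s (\<zeta>, z) (range D\<zeta> \<union> T - {D\<zeta> m}))
      + (-1) ^ below (D\<zeta> m) (range D\<zeta> \<union> T - {D\<zeta> m})
        * (koppelman_form chi s (\<zeta>, z) (range D\<zeta> \<union> T - {D\<zeta> m}) * (h (\<zeta>, z) m - h (\<zeta>, \<zeta>) m))"
      unfolding d by (simp add: algebra_simps)
  qed simp
  finally show ?thesis unfolding sum.distrib .
qed

text \<open>After insertion of \<open>density22_structure\<close> and \<open>koppelman_kernel_eq\<close>, the integrand is a finite sum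
  of kernels as in \<open>kernel_integral\<close>: the form \<open>(g \<and> B)\<^sub>2\<close> has order 3, and its product with the
  deviation of the Hefer form from the diagonal has order 2.\<close>

lemma koppelman_Holder:
  assumes st: "structure_form f (X - {0}) \<omega>" and int: "in_Lq f \<mu> q \<omega>" and q: "1 < q"
    and \<alpha>: "0 < \<alpha>" "\<alpha> < 1" "(2 + \<alpha>) * (q / (q - 1)) < 4"
    and D: "open D" "D \<subseteq> \<Omega>'" and E: "open E" "relcompact E D"
    and kop: "koppelman f \<omega> \<mu> D E \<K>"
    and \<phi>: "\<And>I. continuous_on (X \<inter> D) (\<lambda>z. \<phi> z I)" and z0: "z0 \<in> E"
  shows "\<exists>r>0. \<exists>C\<ge>0. \<forall>z\<in>ball z0 r. \<forall>w\<in>ball z0 r. cmod (\<K> \<phi> z I - \<K> \<phi> w I) \<le> C * dist z w powr \<alpha>"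
proof -
  obtain h chi s K where h: "admissible_h f D h" and chi: "admissible_chi D E chi" and s: "admissible_s E chi s"
    and K: "\<And>\<zeta> z. \<zeta> \<in> D \<Longrightarrow> z \<in> E \<Longrightarrow> \<zeta> \<noteq> z \<Longrightarrow> d\<zeta>123 \<and>\<^sub>e K (\<zeta>, z) =
          one_form (h (\<zeta>, z)) \<and>\<^sub>e hol_part 2 (gform chi s (\<zeta>, z) \<and>\<^sub>e Bform (\<zeta>, z))"
    and Kdef: "\<K> = (\<lambda>\<phi> z I. LINT \<zeta>:D|\<mu>. density22 f \<zeta> (z_coeff I (\<omega> \<zeta> \<and>\<^sub>e K (\<zeta>, z) \<and>\<^sub>e emb (\<phi> \<zeta>))))"
    using kop unfolding koppelman_def by blast
  have chis: "smooth_on UNIV chi" using chi unfolding admissible_chi_def by blast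
  define L where "L = closure {\<zeta>. chi \<zeta> \<noteq> 0}"
  have L: "compact L" "L \<subseteq> D" using chi unfolding admissible_chi_def relcompact_def L_def by blast+
  have LO: "L \<subseteq> \<Omega>'" using L(2) D(2) by blast
  have Lb: "L \<in> sets borel" using L(1) by (rule borel_compact)
  have ED: "E \<subseteq> D" using E(2) closure_subset unfolding relcompact_def by blast
  obtain r0 where r0: "r0 > 0" "cball z0 r0 \<subseteq> E" using E(1) z0 open_contains_cball by blast
  define r where "r = r0 / 2"
  have r: "0 < r" "cball z0 (2 * r) \<subseteq> E" using r0 by (simp_all add: r_def)
  define N where "N = ball z0 (r / 2)"
  have NE: "N \<subseteq> E" "N \<subseteq> ball z0 r" using r by (auto simp: N_def subset_iff)
  obtain d where d: "\<And>\<zeta> z. \<zeta> \<in> L \<Longrightarrow> z \<in> N \<Longrightarrow> norm (\<zeta> - z) \<le> d"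
  proof -
    have "bounded (L \<union> N)" using compact_imp_bounded[OF L(1)] by (simp add: N_def)
    then obtain e where "\<forall>x\<in>L \<union> N. \<forall>y\<in>L \<union> N. dist x y \<le> e" unfolding bounded_two_points by blast
    then show ?thesis using that[of e] by (auto simp: dist_norm)
  qed
  have fQ: "fcls L N 3 (koppelman_form chi s)"
    by (rule fcls_koppelman_form[OF chis L(1) kcls_cutoff_section[OF chis L_def L(1) s r NE(2) d] d])
  have hol: "holo2_on (D \<times> D) (\<lambda>p. h p m)" for m using h unfolding admissible_h_def by blast
  have hG: "kcls L N (- 1) (\<lambda>p. h p m - h (fst p, fst p) m)" for m
    by (rule kcls_hefer_difference[OF hol D(1) L r(1)]) (use r(2) ED in \<open>auto simp: N_def\<close>)
  define c where "c T m = ((-1) ^ below (D\<zeta> m) (range D\<zeta> \<union> T - {D\<zeta> m}) :: complex)" for T and m :: 3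
  define S where "S T m = range D\<zeta> \<union> T - {D\<zeta> m}" for T and m :: 3
  define A where "A T m p = 1 / (2 * pi * \<i>) * c T m * koppelman_form chi s p (S T m)" for T m p
  define B where "B T p = (\<Sum>m\<in>UNIV. c T m * (koppelman_form chi s p (S T m) * (h p m - h (fst p, fst p) m)))" for T p
  have A: "kcls L N 3 (A T m)" for T m
    using fQ unfolding A_def[abs_def] fcls_def by (intro kcls_cmult[OF Lb]) blast
  have B: "kcls L N 2 (B T)" for T
    unfolding B_def[abs_def]
  proof (intro kcls_sum[OF Lb] kcls_cmult[OF Lb])
    fix m
    have "kcls L N 3 (\<lambda>p. koppelman_form chi s p (S T m))" using fQ unfolding fcls_def by blast
    from kcls_mult[OF this hG[of m]] show "kcls L N 2 (\<lambda>p. koppelman_form chi s p (S T m) * (h p m - h (fst p, fst p) m))"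
      by simp
  qed
  \<comment> \<open>\<open>J l\<close> are the monomials in which \<open>K \<and> \<phi>\<close> is evaluated by \<open>density22_structure\<close>, and \<open>T\<close>
    is the part of such a monomial that comes from \<open>K\<close>.\<close>
  define J where "J l = (D\<zeta>b ` (UNIV - {l}) \<union> Dzb ` I :: 3 covec set)" for l
  have JD: "T \<inter> range D\<zeta> = {}" if "T \<subseteq> J l" for T l using that unfolding J_def by auto
  define p where "p l T \<zeta> = indicator L \<zeta> * (8 * pi * \<i> / gradsq f \<zeta> * (esgn l * cnj (df f \<zeta> l)
      * (wsign T (J l) * emb (\<phi> \<zeta>) (J l - T))))" for l T \<zeta>
  define k where "k l T z \<zeta> = indicator (L - {z}) \<zeta> * kernel_combination (p l T \<zeta>) (df f \<zeta>) (A T) (B T) (\<zeta>, z)" for l T z \<zeta>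
  have KT: "K (\<zeta>, z) T = (\<Sum>m\<in>UNIV. df f \<zeta> m * A T m (\<zeta>, z)) + B T (\<zeta>, z)"
    if "\<zeta> \<in> D" "z \<in> E" "\<zeta> \<noteq> z" "T \<subseteq> J l" for \<zeta> z T l
    using koppelman_kernel_eq[OF h D that(1) K[OF that(1-3)] JD[OF that(4)]]
    unfolding A_def B_def c_def S_def by simp
  have K0: "K (\<zeta>, z) T = 0" if "\<zeta> \<in> D" "z \<in> E" "\<zeta> \<noteq> z" "T \<subseteq> J l" "\<zeta> \<notin> L" for \<zeta> z T l
    unfolding KT[OF that(1-4)] A_def B_def
    using koppelman_form_outside[OF chis, of "(\<zeta>, z)" s] that(5) unfolding L_def by simp
  obtain U where U: "U \<ge> 0"
    "(\<integral>\<^sup>+\<zeta>\<in>(X - {0}) \<inter> L. ennreal ((1 / sqrt (gradsq f \<zeta>)) powr q) \<partial>\<mu>) \<le> ennreal U"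
    by (rule structure_integral[OF st int q])
  have \<phi>c: "continuous_on (X \<inter> L) (\<lambda>\<zeta>. emb (\<phi> \<zeta>) S)" for S
    unfolding emb_def using continuous_on_subset[OF \<phi>, of "X \<inter> L"] L(2) by (cases "S \<subseteq> range D\<zeta>b") auto
  have p_meas: "p l T \<in> borel_measurable \<mu>" for l T
  proof -
    have "p l T = (\<lambda>\<zeta>. 8 * pi * \<i> / gradsq f \<zeta> * (esgn l * cnj (df f \<zeta> l)
      * (wsign T (J l) * (indicator L \<zeta> * emb (\<phi> \<zeta>) (J l - T)))))"
      by (simp add: p_def fun_eq_iff)
    also have "\<dots> \<in> borel_measurable \<mu>"
      by (rule borel_measurable_times[OF borel_measurable_divide[OF borel_measurable_const of_real_gradsq_measurable_mu]
            borel_measurable_times[OF borel_measurable_times[OF borel_measurable_const borel_measurable_cnj[OF df_measurable_mu]]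
              borel_measurable_times[OF borel_measurable_const continuous_on_compact_mu(1)[OF L(1) LO \<phi>c]]]])
    finally show ?thesis .
  qed
  have p_bound: "\<exists>C0. \<forall>\<zeta>\<in>(X - {0}) \<inter> L. cmod (p l T \<zeta>) \<le> C0 / sqrt (gradsq f \<zeta>)" for l T
  proof -
    obtain M where M: "M \<ge> 0" "\<forall>x\<in>X \<inter> L. cmod (emb (\<phi> x) (J l - T)) \<le> M"
      using continuous_on_compact_mu(2)[OF L(1) LO \<phi>c] by blast
    have "cmod (p l T \<zeta>) \<le> 8 * pi * M / sqrt (gradsq f \<zeta>)" if \<zeta>: "\<zeta> \<in> (X - {0}) \<inter> L" for \<zeta>
    proof -
      define g where "g = sqrt (gradsq f \<zeta>)"
      have g: "g > 0" "cmod (df f \<zeta> l) \<le> g" "gradsq f \<zeta> = g * g"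
        using sqrt_gradsq[of \<zeta>] \<zeta> gradsq_pos[OF regular, of \<zeta>] unfolding g_def by auto
      have "cmod (p l T \<zeta>) = 8 * pi / (g * g) * (cmod (df f \<zeta> l) * cmod (emb (\<phi> \<zeta>) (J l - T)))"
        using \<zeta> g(1) by (simp add: p_def g(3) norm_mult norm_divide)
      also have "\<dots> \<le> 8 * pi / (g * g) * (g * M)"
        using g M \<zeta> by (intro mult_left_mono mult_mono) auto
      also have "\<dots> = 8 * pi * M / g" using g(1) by simp
      finally show ?thesis unfolding g_def .
    qed
    then show ?thesis by blast
  qed
  have k_int: "\<forall>z\<in>N. integrable \<mu> (k l T z)"
    and k_Hol: "\<exists>C\<ge>0. \<forall>z\<in>N. \<forall>w\<in>N. cmod ((LINT \<zeta>|\<mu>. k l T z \<zeta>) - (LINT \<zeta>|\<mu>. k l T w \<zeta>)) \<le> C * dist z w powr \<alpha>" for l T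
  proof -
    obtain C0 where C0: "\<forall>\<zeta>\<in>(X - {0}) \<inter> L. cmod (p l T \<zeta>) \<le> C0 / sqrt (gradsq f \<zeta>)" using p_bound by blast
    note ki = kernel_integral[OF L(1) LO q U \<alpha> A B p_meas bspec[OF C0]]
    show "\<forall>z\<in>N. integrable \<mu> (k l T z)"
      unfolding k_def[abs_def] by (rule ki(1))
    show "\<exists>C\<ge>0. \<forall>z\<in>N. \<forall>w\<in>N. cmod ((LINT \<zeta>|\<mu>. k l T z \<zeta>) - (LINT \<zeta>|\<mu>. k l T w \<zeta>)) \<le> C * dist z w powr \<alpha>"
      unfolding k_def[abs_def] by (rule ki(2))
  qed
  have pointwise: "indicator D \<zeta> *\<^sub>R density22 f \<zeta> (z_coeff I (\<omega> \<zeta> \<and>\<^sub>e K (\<zeta>, z) \<and>\<^sub>e emb (\<phi> \<zeta>)))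
      = (\<Sum>l\<in>UNIV. \<Sum>T\<in>Pow (J l). k l T z \<zeta>)" if \<zeta>: "\<zeta> \<in> X - {0}" "\<zeta> \<noteq> z" and z: "z \<in> N" for \<zeta> z
  proof (cases "\<zeta> \<in> D")
    case True
    have zE: "z \<in> E" using z NE by blast
    have "density22 f \<zeta> (z_coeff I (\<omega> \<zeta> \<and>\<^sub>e K (\<zeta>, z) \<and>\<^sub>e emb (\<phi> \<zeta>)))
      = 8 * pi * \<i> / gradsq f \<zeta> * (\<Sum>l\<in>UNIV. esgn l * cnj (df f \<zeta> l) * (K (\<zeta>, z) \<and>\<^sub>e emb (\<phi> \<zeta>)) (J l))"
      unfolding J_def by (rule structure_at(1)[OF st \<zeta>(1)])
    also have "\<dots> = (\<Sum>l\<in>UNIV. \<Sum>T\<in>Pow (J l). 8 * pi * \<i> / gradsq f \<zeta> * (esgn l * cnj (df f \<zeta> l)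
        * (wsign T (J l) * emb (\<phi> \<zeta>) (J l - T))) * K (\<zeta>, z) T)"
      unfolding wedge_apply sum_distrib_left by (simp add: ac_simps)
    also have "\<dots> = (\<Sum>l\<in>UNIV. \<Sum>T\<in>Pow (J l). k l T z \<zeta>)"
    proof (intro sum.cong refl)
      fix l :: 3 and T assume "T \<in> Pow (J l)"
      then have T: "T \<subseteq> J l" by blast
      show "8 * pi * \<i> / gradsq f \<zeta> * (esgn l * cnj (df f \<zeta> l)
        * (wsign T (J l) * emb (\<phi> \<zeta>) (J l - T))) * K (\<zeta>, z) T = k l T z \<zeta>"
      proof (cases "\<zeta> \<in> L")
        case L: True
        then show ?thesis
          unfolding KT[OF True zE \<zeta>(2) T] k_def p_def kernel_combination_def using \<zeta>(2) by simp
      next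
        case False
        then show ?thesis unfolding K0[OF True zE \<zeta>(2) T False] k_def by simp
      qed
    qed
    finally show ?thesis using True by simp
  next
    case False
    then have "\<zeta> \<notin> L" using L(2) by blast
    then show ?thesis using False by (simp add: k_def)
  qed
  have Kint: "\<K> \<phi> z I = (\<Sum>l\<in>UNIV. \<Sum>T\<in>Pow (J l). LINT \<zeta>|\<mu>. k l T z \<zeta>)" if z: "z \<in> N" for z
  proof -
    have "\<K> \<phi> z I = (LINT \<zeta>|\<mu>. indicator D \<zeta> *\<^sub>R density22 f \<zeta> (z_coeff I (\<omega> \<zeta> \<and>\<^sub>e K (\<zeta>, z) \<and>\<^sub>e emb (\<phi> \<zeta>))))"
      unfolding Kdef set_lebesgue_integral_def ..
    also have "\<dots> = (LINT \<zeta>|\<mu>. (\<Sum>l\<in>UNIV. \<Sum>T\<in>Pow (J l). k l T z \<zeta>))"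
    \<comment> \<open>The kernel is given only for \<open>\<zeta> \<noteq> z\<close>, but points have measure zero.\<close>
    proof (rule integral_discrete_difference[where X = "{z} \<inter> (X - {0})"])
      show "countable ({z} \<inter> (X - {0}))" by (rule countable_finite) simp
      show "emeasure \<mu> {x} = 0" if "x \<in> {z} \<inter> (X - {0})" for x using that emeasure_point by blast
      show "{x} \<in> sets \<mu>" if "x \<in> {z} \<inter> (X - {0})" for x using that in_sets_mu by auto
      fix x assume "x \<in> space \<mu>" "x \<notin> {z} \<inter> (X - {0})"
      then show "indicator D x *\<^sub>R density22 f x (z_coeff I (\<omega> x \<and>\<^sub>e K (x, z) \<and>\<^sub>e emb (\<phi> x)))
        = (\<Sum>l\<in>UNIV. \<Sum>T\<in>Pow (J l). k l T z x)"
        using pointwise[OF _ _ z, of x] by (auto simp: space_mu)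
    qed
    also have "\<dots> = (\<Sum>l\<in>UNIV. \<Sum>T\<in>Pow (J l). LINT \<zeta>|\<mu>. k l T z \<zeta>)"
      using k_int z by (simp add: Bochner_Integration.integral_sum Bochner_Integration.integrable_sum)
    finally show ?thesis .
  qed
  obtain C where C0: "\<And>l T. C l T \<ge> 0" and C: "\<And>l T. \<forall>z\<in>N. \<forall>w\<in>N. cmod ((LINT \<zeta>|\<mu>. k l T z \<zeta>) - (LINT \<zeta>|\<mu>. k l T w \<zeta>)) \<le> C l T * dist z w powr \<alpha>"
    using k_Hol by metis
  show ?thesis
  proof (intro exI conjI ballI)
    show "0 < r / 2" using r(1) by simp
    show "0 \<le> (\<Sum>l\<in>UNIV. \<Sum>T\<in>Pow (J l). C l T)" by (intro sum_nonneg C0)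
    fix z w assume "z \<in> ball z0 (r / 2)" "w \<in> ball z0 (r / 2)"
    then have zw: "z \<in> N" "w \<in> N" by (auto simp: N_def)
    have "cmod (\<K> \<phi> z I - \<K> \<phi> w I) \<le> (\<Sum>l\<in>UNIV. \<Sum>T\<in>Pow (J l). C l T * dist z w powr \<alpha>)"
      unfolding Kint[OF zw(1)] Kint[OF zw(2)] sum_subtractf[symmetric]
      by (intro order_trans[OF norm_sum] sum_mono) (use C zw in blast)
    then show "cmod (\<K> \<phi> z I - \<K> \<phi> w I) \<le> (\<Sum>l\<in>UNIV. \<Sum>T\<in>Pow (J l). C l T) * dist z w powr \<alpha>"
      by (simp add: sum_distrib_right)
  qed
qed

end

section \<open>Local Hoelder continuity\<close>

definition loc_Holder :: "real \<Rightarrow> (complex^3) set \<Rightarrow> (complex^3 \<Rightarrow> complex) \<Rightarrow> bool" where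
  "loc_Holder \<alpha> S g \<longleftrightarrow> (\<forall>z0\<in>S. \<exists>r>0. \<exists>C\<ge>0. \<forall>z\<in>S \<inter> ball z0 r. \<forall>w\<in>S \<inter> ball z0 r.
     cmod (g z - g w) \<le> C * dist z w powr \<alpha>)"

lemma Holder_imp_continuous:
  assumes "0 < \<alpha>" "\<forall>z\<in>S. \<forall>w\<in>S. cmod (g z - g w) \<le> C * dist z w powr \<alpha>"
  shows "continuous_on S (g :: complex^3 \<Rightarrow> complex)"
  unfolding continuous_on_def
proof
  fix x assume x: "x \<in> S"
  have "((\<lambda>z. C * dist z x powr \<alpha>) \<longlongrightarrow> C * 0) (at x within S)"
  proof (intro tendsto_mult tendsto_const)
    have "((\<lambda>z. dist z x) \<longlongrightarrow> 0) (at x within S)"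
      using tendsto_dist[OF tendsto_ident_at tendsto_const, of x x S] by simp
    then show "((\<lambda>z. dist z x powr \<alpha>) \<longlongrightarrow> 0) (at x within S)"
      using assms(1) by (intro tendsto_zero_powrI) auto
  qed
  then have lim: "((\<lambda>z. C * dist z x powr \<alpha>) \<longlongrightarrow> 0) (at x within S)" by simp
  have "\<forall>\<^sub>F z in at x within S. norm (g z - g x) \<le> C * dist z x powr \<alpha>"
    unfolding eventually_at_filter by (rule always_eventually) (use assms(2) x in blast)
  then have "((\<lambda>z. g z - g x) \<longlongrightarrow> 0) (at x within S)"
    using lim by (rule Lim_null_comparison)
  then show "(g \<longlongrightarrow> g x) (at x within S)" by (rule LIM_zero_cancel)
qed

lemma loc_Holder_continuous:
  assumes "0 < \<alpha>" "loc_Holder \<alpha> S g"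
  shows "continuous_on S g"
  unfolding continuous_on_eq_continuous_within
proof
  fix z0 assume z0: "z0 \<in> S"
  obtain r C where r: "r > 0" "\<forall>z\<in>S \<inter> ball z0 r. \<forall>w\<in>S \<inter> ball z0 r. cmod (g z - g w) \<le> C * dist z w powr \<alpha>"
    using assms(2) z0 unfolding loc_Holder_def by blast
  have "continuous (at z0 within S \<inter> ball z0 r) g"
    using Holder_imp_continuous[OF assms(1) r(2)] z0 r(1) by (simp add: continuous_on_eq_continuous_within)
  moreover have "at z0 within S \<inter> ball z0 r = at z0 within S"
    by (rule at_within_nhd[of _ "ball z0 r"]) (use r(1) in auto)
  ultimately show "continuous (at z0 within S) g" by simp
qed

lemma loc_Holder_subset: "loc_Holder \<alpha> S g \<Longrightarrow> T \<subseteq> S \<Longrightarrow> loc_Holder \<alpha> T g"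
proof -
  assume H: "loc_Holder \<alpha> S g" and TS: "T \<subseteq> S"
  show ?thesis
    unfolding loc_Holder_def
  proof
    fix z0 assume "z0 \<in> T"
    then have "z0 \<in> S" using TS by blast
    then obtain r C where r: "r > 0" "C \<ge> 0" "\<forall>z\<in>S \<inter> ball z0 r. \<forall>w\<in>S \<inter> ball z0 r. cmod (g z - g w) \<le> C * dist z w powr \<alpha>"
      using H unfolding loc_Holder_def by blast
    have "z \<in> S \<inter> ball z0 r" if "z \<in> T \<inter> ball z0 r" for z using that TS by blast
    then have "\<forall>z\<in>T \<inter> ball z0 r. \<forall>w\<in>T \<inter> ball z0 r. cmod (g z - g w) \<le> C * dist z w powr \<alpha>"
      using r(3) by simp
    then show "\<exists>r>0. \<exists>C\<ge>0. \<forall>z\<in>T \<inter> ball z0 r. \<forall>w\<in>T \<inter> ball z0 r. cmod (g z - g w) \<le> C * dist z w powr \<alpha>"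
      using r(1,2) by blast
  qed
qed

lemma loc_Holder_add:
  assumes "loc_Holder \<alpha> S g" "loc_Holder \<alpha> S h"
  shows "loc_Holder \<alpha> S (\<lambda>z. g z + h z)"
  unfolding loc_Holder_def
proof
  fix z0 assume z0: "z0 \<in> S"
  obtain r C where r: "r > 0" "C \<ge> 0" "\<forall>z\<in>S \<inter> ball z0 r. \<forall>w\<in>S \<inter> ball z0 r. cmod (g z - g w) \<le> C * dist z w powr \<alpha>"
    using assms(1) z0 unfolding loc_Holder_def by blast
  obtain t D where t: "t > 0" "D \<ge> 0" "\<forall>z\<in>S \<inter> ball z0 t. \<forall>w\<in>S \<inter> ball z0 t. cmod (h z - h w) \<le> D * dist z w powr \<alpha>"
    using assms(2) z0 unfolding loc_Holder_def by blast
  show "\<exists>r>0. \<exists>C\<ge>0. \<forall>z\<in>S \<inter> ball z0 r. \<forall>w\<in>S \<inter> ball z0 r. cmod (g z + h z - (g w + h w)) \<le> C * dist z w powr \<alpha>"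
  proof (intro exI conjI ballI)
    show "0 < min r t" "0 \<le> C + D" using r t by auto
    fix z w assume "z \<in> S \<inter> ball z0 (min r t)" "w \<in> S \<inter> ball z0 (min r t)"
    then have "cmod (g z - g w) \<le> C * dist z w powr \<alpha>" "cmod (h z - h w) \<le> D * dist z w powr \<alpha>"
      using r(3) t(3) by auto
    then show "cmod (g z + h z - (g w + h w)) \<le> (C + D) * dist z w powr \<alpha>"
      unfolding add_diff_add distrib_right by (rule norm_triangle_mono)
  qed
qed

lemma loc_Holder_const: "loc_Holder \<alpha> S (\<lambda>z. c)"
  unfolding loc_Holder_def by (intro ballI exI[of _ 1] conjI exI[of _ 0]) auto

lemma loc_Holder_sum: "(\<And>i. i \<in> I \<Longrightarrow> loc_Holder \<alpha> S (g i)) \<Longrightarrow> loc_Holder \<alpha> S (\<lambda>z. \<Sum>i\<in>I. g i z)"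
  by (induction I rule: infinite_finite_induct) (auto intro: loc_Holder_add loc_Holder_const)

lemma loc_Holder_mult:
  assumes \<alpha>: "0 < \<alpha>" and "loc_Holder \<alpha> S g" "loc_Holder \<alpha> S h"
  shows "loc_Holder \<alpha> S (\<lambda>z. g z * h z)"
  unfolding loc_Holder_def
proof
  fix z0 assume z0: "z0 \<in> S"
  obtain r C where r: "r > 0" "C \<ge> 0" "\<forall>z\<in>S \<inter> ball z0 r. \<forall>w\<in>S \<inter> ball z0 r. cmod (g z - g w) \<le> C * dist z w powr \<alpha>"
    using assms(2) z0 unfolding loc_Holder_def by blast
  obtain t D where t: "t > 0" "D \<ge> 0" "\<forall>z\<in>S \<inter> ball z0 t. \<forall>w\<in>S \<inter> ball z0 t. cmod (h z - h w) \<le> D * dist z w powr \<alpha>"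
    using assms(3) z0 unfolding loc_Holder_def by blast
  define \<rho> where "\<rho> = min 1 (min r t)"
  define G H where "G = cmod (g z0) + C" and "H = cmod (h z0) + D"
  have b: "cmod (g z) \<le> G" "cmod (h z) \<le> H" if "z \<in> S \<inter> ball z0 \<rho>" for z
  proof -
    have zz: "z \<in> S \<inter> ball z0 r" "z0 \<in> S \<inter> ball z0 r" "z \<in> S \<inter> ball z0 t" "z0 \<in> S \<inter> ball z0 t" "dist z z0 \<le> 1"
      using that z0 r(1) t(1) by (auto simp: \<rho>_def dist_commute)
    have p: "dist z z0 powr \<alpha> \<le> 1" using zz(5) \<alpha> by (simp add: powr_le1)
    have "cmod (g z - g z0) \<le> C * 1" "cmod (h z - h z0) \<le> D * 1"
      using r(2,3) t(2,3) zz p by (meson mult_left_mono order_trans)+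
    then show "cmod (g z) \<le> G" "cmod (h z) \<le> H"
      using norm_triangle_sub[of "g z" "g z0"] norm_triangle_sub[of "h z" "h z0"] by (simp_all add: G_def H_def)
  qed
  show "\<exists>r>0. \<exists>C\<ge>0. \<forall>z\<in>S \<inter> ball z0 r. \<forall>w\<in>S \<inter> ball z0 r. cmod (g z * h z - g w * h w) \<le> C * dist z w powr \<alpha>"
  proof (intro exI conjI ballI)
    show "0 < \<rho>" using r t by (simp add: \<rho>_def)
    show "0 \<le> C * H + G * D" using r t by (simp add: G_def H_def)
    fix z w assume zw: "z \<in> S \<inter> ball z0 \<rho>" "w \<in> S \<inter> ball z0 \<rho>"
    have d: "cmod (g z - g w) \<le> C * dist z w powr \<alpha>" "cmod (h z - h w) \<le> D * dist z w powr \<alpha>"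
      using zw r(3) t(3) by (auto simp: \<rho>_def)
    have "g z * h z - g w * h w = (g z - g w) * h z + g w * (h z - h w)" by (simp add: algebra_simps)
    also have "cmod \<dots> \<le> C * dist z w powr \<alpha> * H + G * (D * dist z w powr \<alpha>)"
      by (rule norm_triangle_mono; unfold norm_mult)
         (use b[OF zw(1)] b[OF zw(2)] d r t in \<open>auto intro!: mult_mono simp: G_def\<close>)
    finally show "cmod (g z * h z - g w * h w) \<le> (C * H + G * D) * dist z w powr \<alpha>"
      by (simp add: algebra_simps)
  qed
qed

lemma smooth_on_loc_Holder:
  assumes g: "smooth_on D g" and D: "open D" and \<alpha>: "\<alpha> \<le> 1"
  shows "loc_Holder \<alpha> D g"
  unfolding loc_Holder_def
proof
  fix z0 assume z0: "z0 \<in> D"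
  obtain e where e: "e > 0" "cball z0 e \<subseteq> D" using D z0 open_contains_cball by blast
  define r where "r = min e (1/2)"
  have r: "r > 0" "cball z0 r \<subseteq> D" "r \<le> 1/2" using e by (auto simp: r_def subset_iff)
  have "\<exists>M. \<forall>x\<in>cball z0 r. cmod (frechet_derivative g (at x) b) \<le> M" for b
    using compact_imp_bounded[OF compact_continuous_image[OF
        continuous_on_subset[OF smooth_on_frechet[OF g] r(2)] compact_cball]]
    unfolding bounded_iff by (metis imageI)
  then obtain M where M: "\<And>b. \<forall>x\<in>cball z0 r. cmod (frechet_derivative g (at x) b) \<le> M b" by metis
  define C where "C = (\<Sum>b\<in>Basis. \<bar>M b\<bar>)"
  have der: "(g has_derivative frechet_derivative g (at x)) (at x)" if "x \<in> cball z0 r" for x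
    using smooth_on_differentiable[OF g] that r(2) frechet_derivative_works by blast
  have on: "norm (frechet_derivative g (at x) h) \<le> C * norm h" if x: "x \<in> cball z0 r" for x h
  proof -
    have lin: "linear (frechet_derivative g (at x))" using has_derivative_linear[OF der[OF x]] .
    have "frechet_derivative g (at x) h = frechet_derivative g (at x) (\<Sum>b\<in>Basis. (h \<bullet> b) *\<^sub>R b)"
      by (simp add: euclidean_representation)
    also have "\<dots> = (\<Sum>b\<in>Basis. (h \<bullet> b) *\<^sub>R frechet_derivative g (at x) b)"
      by (simp add: linear_sum[OF lin] linear_scale[OF lin])
    also have "norm \<dots> \<le> (\<Sum>b\<in>Basis. \<bar>M b\<bar> * norm h)"
    proof (rule order_trans[OF norm_sum sum_mono])
      fix b :: "complex^3" assume b: "b \<in> Basis"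
      have "cmod (frechet_derivative g (at x) b) \<le> \<bar>M b\<bar>" using M x abs_ge_self order_trans by blast
      moreover have "\<bar>h \<bullet> b\<bar> \<le> norm h" using b by (rule Basis_le_norm)
      ultimately have "\<bar>h \<bullet> b\<bar> * cmod (frechet_derivative g (at x) b) \<le> norm h * \<bar>M b\<bar>" by (intro mult_mono) auto
      then show "norm ((h \<bullet> b) *\<^sub>R frechet_derivative g (at x) b) \<le> \<bar>M b\<bar> * norm h" by (simp add: mult.commute)
    qed
    finally show ?thesis by (simp add: C_def sum_distrib_right)
  qed
  show "\<exists>r>0. \<exists>C\<ge>0. \<forall>z\<in>D \<inter> ball z0 r. \<forall>w\<in>D \<inter> ball z0 r. cmod (g z - g w) \<le> C * dist z w powr \<alpha>"
  proof (intro exI conjI ballI)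
    show "0 < r" by (fact r(1))
    show C0: "0 \<le> C" unfolding C_def by (intro sum_nonneg) auto
    fix z w assume zw: "z \<in> D \<inter> ball z0 r" "w \<in> D \<inter> ball z0 r"
    have "norm (g z - g w) \<le> C * norm (z - w)"
    proof (rule differentiable_bound[where S = "cball z0 r"])
      show "(g has_derivative frechet_derivative g (at x)) (at x within cball z0 r)" if "x \<in> cball z0 r" for x
        using der[OF that] has_derivative_at_withinI by blast
      show "onorm (frechet_derivative g (at x)) \<le> C" if "x \<in> cball z0 r" for x
        by (rule onorm_le) (rule on[OF that])
    qed (use zw in auto)
    also have "\<dots> \<le> C * dist z w powr \<alpha>"
    proof (rule mult_left_mono[OF _ C0])
      have "dist z w < r + r" using zw dist_triangle_less_add[of z z0 r w r] by (auto simp: dist_commute)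
      then have "dist z w \<le> 1" using r(3) by linarith
      then have "dist z w powr 1 \<le> dist z w powr \<alpha>" if "z \<noteq> w" using \<alpha> that by (intro powr_mono') auto
      then show "norm (z - w) \<le> dist z w powr \<alpha>" by (cases "z = w") (auto simp: dist_norm)
    qed
    finally show "cmod (g z - g w) \<le> C * dist z w powr \<alpha>" .
  qed
qed

lemma loc_Holder_uniform:
  assumes S: "z0 \<in> S" and g: "\<And>i. i \<in> I \<Longrightarrow> loc_Holder \<alpha> S (g i)" and "finite I"
  obtains r where "r > 0" "\<forall>i\<in>I. \<exists>C\<ge>0. \<forall>z\<in>S \<inter> ball z0 r. \<forall>w\<in>S \<inter> ball z0 r. cmod (g i z - g i w) \<le> C * dist z w powr \<alpha>"
proof -
  have "\<forall>i\<in>I. \<exists>r>0. \<exists>C\<ge>0. \<forall>z\<in>S \<inter> ball z0 r. \<forall>w\<in>S \<inter> ball z0 r. cmod (g i z - g i w) \<le> C * dist z w powr \<alpha>"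
    using g S unfolding loc_Holder_def by blast
  from bchoice[OF this] obtain r where r: "\<forall>i\<in>I. r i > 0 \<and> (\<exists>C\<ge>0. \<forall>z\<in>S \<inter> ball z0 (r i). \<forall>w\<in>S \<inter> ball z0 (r i). cmod (g i z - g i w) \<le> C * dist z w powr \<alpha>)"
    by blast
  define \<rho> where "\<rho> = Min (insert 1 (r ` I))"
  have \<rho>: "\<rho> > 0" "\<And>i. i \<in> I \<Longrightarrow> \<rho> \<le> r i" using r \<open>finite I\<close> by (auto simp: \<rho>_def)
  show ?thesis
  proof (rule that[OF \<rho>(1)], intro ballI)
    fix i assume i: "i \<in> I"
    then obtain C where C: "C \<ge> 0" "\<forall>z\<in>S \<inter> ball z0 (r i). \<forall>w\<in>S \<inter> ball z0 (r i). cmod (g i z - g i w) \<le> C * dist z w powr \<alpha>"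
      using r by blast
    have "S \<inter> ball z0 \<rho> \<subseteq> S \<inter> ball z0 (r i)" using \<rho>(2)[OF i] by (auto simp: subset_iff)
    then have "\<forall>z\<in>S \<inter> ball z0 \<rho>. \<forall>w\<in>S \<inter> ball z0 \<rho>. cmod (g i z - g i w) \<le> C * dist z w powr \<alpha>"
      using C(2) by (meson subsetD)
    then show "\<exists>C\<ge>0. \<forall>z\<in>S \<inter> ball z0 \<rho>. \<forall>w\<in>S \<inter> ball z0 \<rho>. cmod (g i z - g i w) \<le> C * dist z w powr \<alpha>"
      using C(1) by blast
  qed
qed

lemma holder_on_of_bound:
  assumes "0 < \<beta>" "\<alpha> = \<beta> \<or> \<alpha> = 0" "\<forall>z\<in>S. \<forall>w\<in>S. cmod (g z - g w) \<le> C * dist z w powr \<beta>"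
  shows "holder_on \<alpha> S g"
  using assms Holder_imp_continuous[OF assms(1,3)] unfolding holder_on_def by auto

lemma pc_domain_open: "pc_domain \<Omega>' D \<Longrightarrow> open D"
  unfolding pc_domain_def pseudoconvex_def by blast

lemma test_forms_mono: "N' \<subseteq> N \<Longrightarrow> test_forms r N' \<subseteq> test_forms r N"
  unfolding test_forms_def relcompact_def by blast

context surface
begin

lemma iterated_loc_Holder:
  assumes st: "structure_form f (X - {0}) \<omega>" and int: "in_Lq f \<mu> q \<omega>" and q: "1 < q"
    and \<alpha>: "0 < \<alpha>" "\<alpha> < 1" "(2 + \<alpha>) * (q / (q - 1)) < 4"
    and it: "iterated \<Omega>' f \<omega> \<mu> D \<phi>"
  shows "pc_domain \<Omega>' D \<and> (\<forall>I. loc_Holder \<alpha> (X \<inter> D) (\<lambda>z. \<phi> z I))"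
  using it
proof (induction rule: iterated.induct)
  case (base D \<xi>)
  have "loc_Holder \<alpha> D (\<lambda>z. \<xi> z I)" for I
    using smooth_on_loc_Holder[OF _ pc_domain_open[OF base(1)] less_imp_le[OF \<alpha>(2)]] base(2)
    unfolding smooth_form_def by blast
  then show ?case using base(1) loc_Holder_subset[of \<alpha> D _ "X \<inter> D"] by blast
next
  case (step D \<phi> E \<K> \<xi>)
  have D: "open D" "D \<subseteq> \<Omega>'" using step.IH pc_domain_open unfolding pc_domain_def by blast+
  have E: "open E" using pc_domain_open[OF step.hyps(2)] .
  have \<phi>: "continuous_on (X \<inter> D) (\<lambda>z. \<phi> z I)" for I
    using step.IH loc_Holder_continuous[OF \<alpha>(1)] by blast
  have K: "loc_Holder \<alpha> (X \<inter> E) (\<lambda>z. \<K> \<phi> z I)" for I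
    unfolding loc_Holder_def
  proof
    fix z0 assume z0: "z0 \<in> X \<inter> E"
    then have "z0 \<in> E" by blast
    from koppelman_Holder[where I = I and \<phi> = \<phi>, OF st int q \<alpha> D E step.hyps(3,4) \<phi> this]
    obtain r C where "r > 0" "C \<ge> 0"
      and bd: "\<forall>z\<in>ball z0 r. \<forall>w\<in>ball z0 r. cmod (\<K> \<phi> z I - \<K> \<phi> w I) \<le> C * dist z w powr \<alpha>"
      by (elim exE conjE) (rule that)
    then show "\<exists>r>0. \<exists>C\<ge>0. \<forall>z\<in>X \<inter> E \<inter> ball z0 r. \<forall>w\<in>X \<inter> E \<inter> ball z0 r. cmod (\<K> \<phi> z I - \<K> \<phi> w I) \<le> C * dist z w powr \<alpha>"
      by (intro exI[of _ r] exI[of _ C] conjI ballI) (auto intro: bd[rule_format])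
  qed
  have "loc_Holder \<alpha> E (\<lambda>z. \<xi> z I)" for I
    using smooth_on_loc_Holder[OF _ E less_imp_le[OF \<alpha>(2)]] step.hyps(5) unfolding smooth_form_def by blast
  then have \<xi>: "loc_Holder \<alpha> (X \<inter> E) (\<lambda>z. \<xi> z I)" for I by (rule loc_Holder_subset) auto
  have "loc_Holder \<alpha> (X \<inter> E) (\<lambda>z. (\<xi> z \<and>\<^sub>e \<K> \<phi> z) I)" for I
    unfolding wedge_apply
    by (intro loc_Holder_sum loc_Holder_mult[OF \<alpha>(1)] loc_Holder_const K \<xi>)
  then show ?case using step.hyps(2) by blast
qed

section \<open>Currents defined by continuous forms\<close>

text \<open>By \<open>density22_formula\<close> the coefficients of the restriction to the surface are bounded by those of
  the ambient form, even near the singular point, and the support of the test form meets \<open>X\<close> in a set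
  of finite volume. Integrability is what makes the current of a sum of forms the sum of the
  currents.\<close>

lemma density_pairing_integrable:
  assumes N: "N \<subseteq> \<Omega>'" and \<theta>: "\<theta> \<in> test_forms r N"
    and \<phi>: "\<And>I. continuous_on (X \<inter> N) (\<lambda>z. \<phi> z I)"
  shows "integrable \<mu> (\<lambda>x. density22 f x (emb (\<phi> x) \<and>\<^sub>e \<theta> x))"
proof -
  define K where "K = closure {x. \<theta> x \<noteq> 0}"
  have K: "compact K" "K \<subseteq> N" "K \<subseteq> \<Omega>'" using \<theta> N unfolding test_forms_def relcompact_def K_def by blast+
  have \<theta>0: "\<theta> x = 0" if "x \<notin> K" for x using that closure_subset[of "{x. \<theta> x \<noteq> 0}"] unfolding K_def by blast
  have \<theta>c: "continuous_on UNIV (\<lambda>x. \<theta> x S)" for S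
    using \<theta> smooth_on_continuous unfolding test_forms_def by blast
  define a where "a S T x = emb (\<phi> x) T * \<theta> x (S - T)" for S T x
  have a_cont: "continuous_on (X \<inter> K) (a S T)" for S T
  proof -
    have "continuous_on (X \<inter> K) (\<lambda>x. emb (\<phi> x) T)"
      unfolding emb_def using continuous_on_subset[OF \<phi>, of "X \<inter> K"] K(2) by (cases "T \<subseteq> range D\<zeta>b") auto
    then show ?thesis unfolding a_def[abs_def]
      by (intro continuous_on_mult continuous_on_subset[OF \<theta>c subset_UNIV])
  qed
  have a0: "a S T x = indicator K x * a S T x" for S T x
    using \<theta>0[of x] by (cases "x \<in> K") (auto simp: a_def)
  have a_int: "integrable \<mu> (\<lambda>x. df f x j * cnj (df f x l) / gradsq f x * a S T x)" for j l S T
  proof -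
    obtain M where M: "M \<ge> 0" "\<forall>x\<in>X \<inter> K. cmod (a S T x) \<le> M"
      using continuous_on_compact_mu(2)[OF K(1,3) a_cont] by blast
    show ?thesis
    proof (rule integrableI_bounded_set[where B = M])
    show "(X - {0}) \<inter> K \<in> sets \<mu>" by (rule compact_measurable[OF K(1)])
    show "emeasure \<mu> ((X - {0}) \<inter> K) < \<infinity>" by (rule compact_finite[OF K(1,3)])
    have "(\<lambda>x. indicator K x * a S T x) \<in> borel_measurable \<mu>"
      by (rule continuous_on_compact_mu(1)[OF K(1,3) a_cont])
    then show "(\<lambda>x. df f x j * cnj (df f x l) / gradsq f x * a S T x) \<in> borel_measurable \<mu>"
      unfolding a0[symmetric]
      by (rule borel_measurable_times[OF borel_measurable_divide[OF borel_measurable_times[OF df_measurable_mu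
              borel_measurable_cnj[OF df_measurable_mu]] of_real_gradsq_measurable_mu]])
    show "AE x in \<mu>. x \<in> (X - {0}) \<inter> K \<longrightarrow> norm (df f x j * cnj (df f x l) / gradsq f x * a S T x) \<le> M"
    proof (intro AE_I2 impI)
      fix x assume x: "x \<in> (X - {0}) \<inter> K"
      define g where "g = sqrt (gradsq f x)"
      have g: "g > 0" "cmod (df f x j) \<le> g" "cmod (df f x l) \<le> g" "gradsq f x = g * g"
        using sqrt_gradsq[of x] x gradsq_pos[OF regular, of x] unfolding g_def by auto
      have "cmod (df f x j) * cmod (df f x l) / (g * g) * cmod (a S T x) \<le> 1 * M"
      proof (intro mult_mono)
        have "cmod (df f x j) * cmod (df f x l) \<le> g * g" using g by (intro mult_mono) auto
        then show "cmod (df f x j) * cmod (df f x l) / (g * g) \<le> 1" using g(1) by simp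
      qed (use M x in auto)
      then show "norm (df f x j * cnj (df f x l) / gradsq f x * a S T x) \<le> M"
        using g(1) by (simp add: norm_mult norm_divide g(4))
    qed
    show "AE x in \<mu>. x \<notin> (X - {0}) \<inter> K \<longrightarrow> df f x j * cnj (df f x l) / gradsq f x * a S T x = 0"
    proof (intro AE_I2 impI)
      fix x assume "x \<in> space \<mu>" "x \<notin> (X - {0}) \<inter> K"
      then have "x \<notin> K" by (simp add: space_mu)
      then show "df f x j * cnj (df f x l) / gradsq f x * a S T x = 0" using a0[of S T x] by simp
    qed
    qed
  qed
  define Q where "Q j l = (D\<zeta> ` (UNIV - {j}) \<union> D\<zeta>b ` (UNIV - {l}) :: 3 covec set)" for j l :: 3
  have "integrable \<mu> (\<lambda>x. \<Sum>j\<in>UNIV. \<Sum>l\<in>UNIV. \<Sum>T\<in>Pow (Q j l). 4 * (esgn j * esgn l * wsign T (Q j l)) *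
      (df f x j * cnj (df f x l) / gradsq f x * a (Q j l) T x))"
    by (intro Bochner_Integration.integrable_sum integrable_mult_right impI a_int)
  then show ?thesis
  proof (rule Bochner_Integration.integrable_cong[THEN iffD1, rotated 2])
    fix x assume "x \<in> space \<mu>"
    then have x: "x \<in> X - {0}" by (simp add: space_mu)
    then have xO: "x \<in> \<Omega>'" by (auto simp: X_iff)
    show "(\<Sum>j\<in>UNIV. \<Sum>l\<in>UNIV. \<Sum>T\<in>Pow (Q j l). 4 * (esgn j * esgn l * wsign T (Q j l)) *
      (df f x j * cnj (df f x l) / gradsq f x * a (Q j l) T x)) = density22 f x (emb (\<phi> x) \<and>\<^sub>e \<theta> x)"
      unfolding density22_formula[OF df_linear[OF xO] regular[OF x]] Q_def[symmetric] wedge_apply a_def sum_distrib_left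
      by (simp add: ac_simps)
  qed simp
qed

lemma form_current_add:
  assumes N: "N \<subseteq> \<Omega>'" and \<theta>: "\<theta> \<in> test_forms r N"
    and \<phi>: "\<And>I. continuous_on (X \<inter> N) (\<lambda>z. \<phi> z I)" and \<psi>: "\<And>I. continuous_on (X \<inter> N) (\<lambda>z. \<psi> z I)"
  shows "form_current f \<mu> (\<lambda>z I. \<phi> z I + \<psi> z I) \<theta> = form_current f \<mu> \<phi> \<theta> + form_current f \<mu> \<psi> \<theta>"
proof -
  have "form_current f \<mu> (\<lambda>z I. \<phi> z I + \<psi> z I) \<theta>
    = (LINT x|\<mu>. density22 f x (emb (\<phi> x) \<and>\<^sub>e \<theta> x) + density22 f x (emb (\<psi> x) \<and>\<^sub>e \<theta> x))"
    unfolding form_current_def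
  proof (rule Bochner_Integration.integral_cong[OF refl])
    fix x assume "x \<in> space \<mu>"
    then have x: "x \<in> X - {0}" by (simp add: space_mu)
    then have xO: "x \<in> \<Omega>'" by (auto simp: X_iff)
    have "emb (\<lambda>I. \<phi> x I + \<psi> x I) = emb (\<phi> x) + emb (\<psi> x)" by (auto simp: emb_def fun_eq_iff)
    then show "density22 f x (emb (\<lambda>I. \<phi> x I + \<psi> x I) \<and>\<^sub>e \<theta> x)
        = density22 f x (emb (\<phi> x) \<and>\<^sub>e \<theta> x) + density22 f x (emb (\<psi> x) \<and>\<^sub>e \<theta> x)"
      unfolding density22_formula[OF df_linear[OF xO] regular[OF x]]
      by (simp only: wedge_add_left plus_fun_apply distrib_left sum.distrib)
  qed
  also have "\<dots> = form_current f \<mu> \<phi> \<theta> + form_current f \<mu> \<psi> \<theta>"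
    unfolding form_current_def
    by (rule Bochner_Integration.integral_add[OF density_pairing_integrable[OF N \<theta> \<phi>] density_pairing_integrable[OF N \<theta> \<psi>]])
  finally show ?thesis .
qed

lemma form_current_zero: "form_current f \<mu> (\<lambda>z I. 0) \<theta> = 0"
proof -
  have "form_current f \<mu> (\<lambda>z I. 0) \<theta> = (LINT x|\<mu>. 0)"
    unfolding form_current_def
  proof (rule Bochner_Integration.integral_cong[OF refl])
    fix x assume "x \<in> space \<mu>"
    then have x: "x \<in> X - {0}" by (simp add: space_mu)
    then have xO: "x \<in> \<Omega>'" by (auto simp: X_iff)
    have "emb (\<lambda>I. 0) = 0" by (auto simp: emb_def fun_eq_iff)
    then show "density22 f x (emb (\<lambda>I. 0) \<and>\<^sub>e \<theta> x) = 0"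
      unfolding density22_formula[OF df_linear[OF xO] regular[OF x]] by (simp add: wedge_zero_left)
  qed
  then show ?thesis by simp
qed

lemma form_current_sum_list:
  assumes N: "N \<subseteq> \<Omega>'" and \<theta>: "\<theta> \<in> test_forms r N"
    and \<phi>: "\<forall>\<phi>\<in>set \<phi>s. \<forall>I. continuous_on (X \<inter> N) (\<lambda>z. \<phi> z I)"
  shows "form_current f \<mu> (\<lambda>z I. \<Sum>\<phi>\<leftarrow>\<phi>s. \<phi> z I) \<theta> = (\<Sum>\<phi>\<leftarrow>\<phi>s. form_current f \<mu> \<phi> \<theta>)"
  using \<phi>
proof (induction \<phi>s)
  case Nil
  then show ?case using form_current_zero by simp
next
  case (Cons \<phi> \<phi>s)
  have c: "continuous_on (X \<inter> N) (\<lambda>z. \<Sum>\<phi>\<leftarrow>\<phi>s. \<phi> z I)" for I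
    using Cons.prems by (induction \<phi>s) (auto intro!: continuous_intros)
  have "form_current f \<mu> (\<lambda>z I. \<phi> z I + (\<Sum>\<phi>\<leftarrow>\<phi>s. \<phi> z I)) \<theta>
      = form_current f \<mu> \<phi> \<theta> + form_current f \<mu> (\<lambda>z I. \<Sum>\<phi>\<leftarrow>\<phi>s. \<phi> z I) \<theta>"
    using Cons.prems by (intro form_current_add[OF N \<theta>] c) auto
  then show ?case using Cons by simp
qed

lemma loc_Holder_sum_list:
  "\<forall>\<phi>\<in>set \<phi>s. loc_Holder \<alpha> S (\<lambda>z. \<phi> z I) \<Longrightarrow> loc_Holder \<alpha> S (\<lambda>z. \<Sum>\<phi>\<leftarrow>\<phi>s. \<phi> z I)"
  by (induction \<phi>s) (auto intro: loc_Holder_add loc_Holder_const)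

section \<open>Hoelder continuity of the sections\<close>

text \<open>The exponent \<open>\<beta> > 0\<close> is the one obtained for the kernels. The case \<open>\<alpha> = 0\<close> is that of continuous
  forms, which follows from any positive exponent. At the origin, the finitely many iterated
  expressions are added to a single form representing the current.\<close>

lemma A_sections_subset:
  assumes st: "structure_form f (X - {0}) \<omega>" and int: "in_Lq f \<mu> q \<omega>" and q: "1 < q"
    and \<beta>: "0 < \<beta>" "\<beta> < 1" "(2 + \<beta>) * (q / (q - 1)) < 4" and \<alpha>: "\<alpha> = \<beta> \<or> \<alpha> = 0"
    and U: "open U" "U \<subseteq> \<Omega>'"
  shows "A_sections \<Omega>' f \<omega> \<mu> r U \<subseteq> C_sections \<Omega>' f \<mu> \<alpha> r U"
proof
  fix T assume T: "T \<in> A_sections \<Omega>' f \<omega> \<mu> r U"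
  note T' = T[unfolded A_sections_def mem_Collect_eq]
  have cur: "is_current f (X - {0}) r U T" using T' by (rule conjunct1)
  have local: "\<exists>N' \<phi>'. open N' \<and> x \<in> N' \<and> N' \<subseteq> U \<and> (\<forall>I. holder_on \<alpha> (X \<inter> N') (\<lambda>z. \<phi>' z I)) \<and>
        degree_form r (X \<inter> N') \<phi>' \<and> (\<forall>\<theta>\<in>test_forms r N'. T \<theta> = form_current f \<mu> \<phi>' \<theta>)"
    if x: "x \<in> X \<inter> U" and N: "open N" "x \<in> N" "N \<subseteq> U" and \<phi>: "\<And>I. loc_Holder \<beta> (X \<inter> N) (\<lambda>z. \<phi> z I)"
      and deg: "degree_form r (X \<inter> N) \<phi>" and rep: "\<forall>\<theta>\<in>test_forms r N. T \<theta> = form_current f \<mu> \<phi> \<theta>" for x N \<phi>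
  proof -
    have "x \<in> X \<inter> N" using x N by blast
    from loc_Holder_uniform[OF this, of UNIV \<beta> "\<lambda>I z. \<phi> z I"] \<phi>
    obtain e where e: "e > 0" "\<forall>I\<in>UNIV. \<exists>C\<ge>0. \<forall>z\<in>X \<inter> N \<inter> ball x e. \<forall>w\<in>X \<inter> N \<inter> ball x e. cmod (\<phi> z I - \<phi> w I) \<le> C * dist z w powr \<beta>"
      by (metis finite)
    have S: "X \<inter> (N \<inter> ball x e) = X \<inter> N \<inter> ball x e" by blast
    show ?thesis
    proof (intro exI[of _ "N \<inter> ball x e"] exI[of _ \<phi>] conjI allI)
      show "holder_on \<alpha> (X \<inter> (N \<inter> ball x e)) (\<lambda>z. \<phi> z I)" for I
        unfolding S using e(2) by (metis UNIV_I holder_on_of_bound[OF \<beta>(1) \<alpha>])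
      show "degree_form r (X \<inter> (N \<inter> ball x e)) \<phi>" using deg unfolding degree_form_def by blast
      show "\<forall>\<theta>\<in>test_forms r (N \<inter> ball x e). T \<theta> = form_current f \<mu> \<phi> \<theta>"
        using rep test_forms_mono[of "N \<inter> ball x e" N r] by blast
    qed (use N e(1) in auto)
  qed
  have "\<exists>N' \<phi>'. open N' \<and> x \<in> N' \<and> N' \<subseteq> U \<and> (\<forall>I. holder_on \<alpha> (X \<inter> N') (\<lambda>z. \<phi>' z I)) \<and>
        degree_form r (X \<inter> N') \<phi>' \<and> (\<forall>\<theta>\<in>test_forms r N'. T \<theta> = form_current f \<mu> \<phi>' \<theta>)" if x: "x \<in> X \<inter> U" for x
  proof (cases "x = 0")
    case False
    then have "x \<in> X \<inter> U - {0}" using x by blast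
    from bspec[OF T'[THEN conjunct2, THEN conjunct1] this]
    obtain N \<xi> where N: "open N" "x \<in> N" "N \<subseteq> U" "smooth_form N \<xi>" "degree_form r N \<xi>"
      "\<forall>\<theta>\<in>test_forms r N. T \<theta> = form_current f \<mu> \<xi> \<theta>"
      by (elim exE conjE) (rule that)
    show ?thesis
    proof (rule local[OF x N(1-3) _ _ N(6)])
      have "loc_Holder \<beta> N (\<lambda>z. \<xi> z I)" for I
        using smooth_on_loc_Holder[OF _ N(1) less_imp_le[OF \<beta>(2)]] N(4) unfolding smooth_form_def by blast
      then show "loc_Holder \<beta> (X \<inter> N) (\<lambda>z. \<xi> z I)" for I by (rule loc_Holder_subset) auto
      show "degree_form r (X \<inter> N) \<xi>" using N(5) unfolding degree_form_def by blast
    qed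
  next
    case True
    then have "0 \<in> U" using x by blast
    from mp[OF T'[THEN conjunct2, THEN conjunct2] this] obtain N \<phi>s where N: "open N" "0 \<in> N" "N \<subseteq> U"
      and \<phi>s: "\<forall>\<phi>\<in>set \<phi>s. \<exists>D. iterated \<Omega>' f \<omega> \<mu> D \<phi> \<and> degree_form r (X \<inter> D) \<phi> \<and> N \<subseteq> D"
      and rep: "\<forall>\<theta>\<in>test_forms r N. T \<theta> = (\<Sum>\<phi>\<leftarrow>\<phi>s. form_current f \<mu> \<phi> \<theta>)"
      by (elim exE conjE) (rule that)
    have H: "\<forall>\<phi>\<in>set \<phi>s. loc_Holder \<beta> (X \<inter> N) (\<lambda>z. \<phi> z I)" for I
    proof
      fix \<phi> assume "\<phi> \<in> set \<phi>s"
      then obtain D where D: "iterated \<Omega>' f \<omega> \<mu> D \<phi>" "N \<subseteq> D" using \<phi>s by blast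
      then have "loc_Holder \<beta> (X \<inter> D) (\<lambda>z. \<phi> z I)" using iterated_loc_Holder[OF st int q \<beta>] by blast
      then show "loc_Holder \<beta> (X \<inter> N) (\<lambda>z. \<phi> z I)" by (rule loc_Holder_subset) (use D(2) in blast)
    qed
    show ?thesis
    proof (rule local[OF x N(1) _ N(3)])
      show "x \<in> N" using N(2) True by simp
      show "loc_Holder \<beta> (X \<inter> N) (\<lambda>z. \<Sum>\<phi>\<leftarrow>\<phi>s. \<phi> z I)" for I by (rule loc_Holder_sum_list[OF H])
      show "degree_form r (X \<inter> N) (\<lambda>z I. \<Sum>\<phi>\<leftarrow>\<phi>s. \<phi> z I)"
        unfolding degree_form_def
      proof (intro ballI allI impI)
        fix y and I :: "3 set" assume y: "y \<in> X \<inter> N" "card I \<noteq> r"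
        have "\<phi> y I = 0" if "\<phi> \<in> set \<phi>s" for \<phi>
          using \<phi>s that y unfolding degree_form_def by blast
        then show "(\<Sum>\<phi>\<leftarrow>\<phi>s. \<phi> y I) = 0" by (induction \<phi>s) auto
      qed
      have NO: "N \<subseteq> \<Omega>'" using N(3) U(2) by blast
      have "\<forall>\<phi>\<in>set \<phi>s. \<forall>I. continuous_on (X \<inter> N) (\<lambda>z. \<phi> z I)"
        using H loc_Holder_continuous[OF \<beta>(1)] by blast
      then show "\<forall>\<theta>\<in>test_forms r N. T \<theta> = form_current f \<mu> (\<lambda>z I. \<Sum>\<phi>\<leftarrow>\<phi>s. \<phi> z I) \<theta>"
        using rep form_current_sum_list[OF NO] by metis
    qed
  qed
  then show "T \<in> C_sections \<Omega>' f \<mu> \<alpha> r U" unfolding C_sections_def using cur by blast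
qed

end

theorem corollary1p3:
  fixes \<Omega>' \<Omega>\<^sub>0 :: "(complex^3) set" and f :: "complex^3 \<Rightarrow> complex"
    and \<mu> :: "(complex^3) measure" and \<omega> :: "complex^3 \<Rightarrow> 3 covec ext"
    and M :: "'m topology" and \<A> :: "((complex^2) set \<times> (complex^2 \<Rightarrow> 'm)) set"
    and \<pi> :: "'m \<Rightarrow> complex^3"
    and qX pX \<alpha> :: real and r :: nat
  assumes "pseudoconvex \<Omega>'" and "bounded \<Omega>'"
    and "open \<Omega>\<^sub>0" and "\<Omega>' \<subseteq> \<Omega>\<^sub>0" and "holo_on \<Omega>\<^sub>0 f"
    and "0 \<in> hypersurface \<Omega>' f"
    and "\<And>l. df f 0 l = 0"
    and "\<And>\<zeta>. \<zeta> \<in> \<Omega>\<^sub>0 \<Longrightarrow> f \<zeta> = 0 \<Longrightarrow> \<zeta> \<noteq> 0 \<Longrightarrow> \<exists>l. df f \<zeta> l \<noteq> 0"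
    and "structure_form f (hypersurface \<Omega>' f - {0}) \<omega>"
    and "canonical_resolution (hypersurface \<Omega>' f) \<omega> M \<A> \<pi>"
    and "induced_volume (hypersurface \<Omega>' f - {0}) \<mu>"
    and "2 < qX" and "qX \<le> 4"
    and "\<And>q. 1 \<le> q \<Longrightarrow> q < qX \<Longrightarrow> in_Lq f \<mu> q \<omega>"
    and "pX = qX / (qX - 1)"
    and "0 \<le> \<alpha>" and "\<alpha> < 4 / pX - 2"
  shows "\<forall>U. open U \<and> U \<subseteq> \<Omega>' \<longrightarrow>
           A_sections \<Omega>' f \<omega> \<mu> r U \<subseteq> C_sections \<Omega>' f \<mu> \<alpha> r U"
proof -
  have bound: "4 / pX - 2 = 2 - 4 / qX"
    using assms(12) unfolding assms(15) by (simp add: field_simps)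
  \<comment> \<open>For \<open>\<alpha> = 0\<close> any exponent in the admissible interval will do, for instance its midpoint.\<close>
  define \<beta> where "\<beta> = (if \<alpha> = 0 then (2 - 4 / qX) / 2 else \<alpha>)"
  have pos: "0 < 2 - 4 / qX" "2 - 4 / qX \<le> 1" using assms(12,13) by (simp_all add: field_simps)
  have \<beta>: "0 < \<beta>" "\<beta> < 2 - 4 / qX" "\<alpha> = \<beta> \<or> \<alpha> = 0"
    using assms(16,17) pos unfolding bound \<beta>_def by (auto split: if_splits simp del: field_simps)
  have \<beta>1: "\<beta> < 1" using \<beta>(2) pos(2) by linarith
  \<comment> \<open>The condition \<open>(2 + \<beta>) q / (q - 1) < 4\<close> is equivalent to \<open>q > 4 / (2 - \<beta>)\<close>.\<close>
  have "4 / (2 - \<beta>) < qX" using \<beta> \<beta>1 assms(12) by (simp add: field_simps)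
  then obtain q where q: "4 / (2 - \<beta>) < q" "q < qX" using dense by blast
  have "2 < 4 / (2 - \<beta>)" using \<beta> \<beta>1 by (simp add: field_simps)
  then have q1: "1 < q" using q by linarith
  have exp: "(2 + \<beta>) * (q / (q - 1)) < 4" using q(1) q1 \<beta>1 by (simp add: field_simps)
  interpret surface \<Omega>' f \<mu>
  proof unfold_locales
    show "open \<Omega>'" using assms(1) unfolding pseudoconvex_def by blast
    show "holo_on \<Omega>' f" using assms(5,4) by (rule holo_on_subset)
    show "\<exists>l. df f \<zeta> l \<noteq> 0" if "\<zeta> \<in> hypersurface \<Omega>' f - {0}" for \<zeta>
      using assms(4) assms(8)[of \<zeta>] that unfolding hypersurface_def by blast
  qed (fact assms(11))
  show ?thesis
    using A_sections_subset[OF assms(9) assms(14)[OF less_imp_le[OF q1] q(2)] q1 \<beta>(1) \<beta>1 exp \<beta>(3)] by blast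
qed

end
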